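(* Let the polynomial $P(z)=\sum_{j=0}^n p_jz^j$ with $p_n\ne0$ be real and even, and assume that $P$ has exactly one critical point $z_1$ with critical value $P(z_1)\notin[-1,1]$ and that $z_1$ is a simple zero of $P'$; that is, $z_1\notin E:=P^{-1}([-1,1])$ while the other $n-2$ critical points are in $E$. Then the following assertions hold: (i) The set $E$ consists of two components, $E=E_1\cup E_2$, where $E_1,E_2$ are simply connected disjoint infinite compact sets with $E_1=-E_2$, and $E=-E$, $E^*=E$, and $0\notin E$. In particular, only the following two cases can occur: $E_1^*=E_1$, $E_2^*=E_2$ (case 1), and $E_1^*=E_2$ (case 2). (ii) If $E_1^*=E_1$, $E_2^*=E_2$ (with $E_1,E_2$ labeled from left to right), then $$a_2=\left(\frac{(-1)^{n/2}}{2p_n}\Big(p_0+\sqrt{p_0^2-1}\Big)\right)^{1/n}>0,$$ and if $E_1^*=E_2$ (labeled such that $E_2$ is the component in the upper half-plane), then $$a_2=\mathrm{i}\left(\frac{1}{2p_n}\Big(p_0+\sqrt{p_0^2-1}\Big)\right)^{1/n},$$ with the positive real $n$-th root in both cases. For $\sqrt{p_0^2-1}$, the positive branch is taken if $p_0>1$ and the negative branch if $p_0<-1$. Moreover, in both cases, $a_1=-a_2$ and $$L=\{w\in\mathbb{C}: |w^2-a_2^2|^{1/2}\le \operatorname{cap}(E)=(2|p_n|)^{-1/n}\}.$$ (iii) The Walsh map of $E$ is $\Phi:E^c\to L^c$, $$\Phi(z)=\sqrt{a_2^2+\left(\frac{P(z)}{2p_n}+\sqrt{\left(\frac{P(z)}{2p_n}\right)^2-\frac{1}{4p_n^2}}\right)^{2/n}}$$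 with that branch of the $n$-th root and of the outer square root which yields positive real values of $\Phi(z)$ for sufficiently large $z$ on the positive real line.
   Context: Notation: $\widehat{\mathbb{C}}=\mathbb{C}\cup\{\infty\}$; $K^{c}=\widehat{\mathbb{C}}\setminus K$; $K^*=\{\overline z: z\in K\}$; $-K=\{-z:z\in K\}$; $\operatorname{cap}$ is logarithmic capacity. Walsh's theorem (known; defines $a_j$, $L$, $\Phi$): Let $E_1,\dots,E_\ell\subseteq\mathbb{C}$ be disjoint, simply connected (i.e. connected with connected complement in $\widehat{\mathbb C}$), infinite compact sets and $E=\bigcup_{j=1}^\ell E_j$, so that $E^c$ is an $\ell$-connected domain. Then there exist a unique compact set of the form $L=\{w\in\mathbb{C}: |U(w)|\le \operatorname{cap}(E)\}$, $U(w)=\prod_{j=1}^\ell (w-a_j)^{m_j}$, with distinct $a_1,\dots,a_\ell\in\mathbb{C}$ (the centers) and real $m_1,\dots,m_\ell>0$ (the exponents), $\sum_j m_j=1$, and a unique conformal map $\Phi:E^c\to L^c$ with $\Phi(z)=z+O(1/z)$ at $\infty$ (the Walsh map of $E$). The set $L$ has $\ell$ disjoint compact components $L_1,\dots,L_\ell$ with $a_j\in L_j$, labeled such that $\Phi$ maps a Jordan curve surrounding $E_j$ onto a Jordan curve surrounding $L_j$. Conventions: When all components satisfy $E_j^*=E_j$, each $E_j\cap\mathbb{R}$ is a point or an interval, and labeling from left to right means that $x\in E_j\cap\mathbb{R}$, $y\in E_{j+1}\cap\mathbb{R}$ implies $x<y$. The roots in the formula for $\Phi$ are understood as branches analytic on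 $\mathbb{C}\setminus E$; the inner square root is the branch with branch cut along $E$ which behaves as $P(z)/(2p_n)$ at $\infty$. *)

theory Defs
  imports
    "HOL-Complex_Analysis.Complex_Analysis"
    "HOL-Probability.Probability"
    "HOL-Library.Landau_Symbols"
begin

text \<open>
  Logarithmic capacity of a compact set \<open>K\<close>, \<open>cap K = sup exp (I M)\<close> with
  \<open>I M\<close> the double integral of \<open>ln \<bar>z - w\<bar>\<close> over the Borel probability measures \<open>M\<close> on \<open>K\<close>.
  The kernel is bounded above on \<open>K \<times> K\<close>, so a measure with an atom or with a non-integrable
  kernel has \<open>I M = -\<infinity>\<close> and contributes \<open>exp (-\<infinity>) = 0\<close>, which is the inserted \<open>0\<close>.
  Atoms have to be excluded explicitly because of the HOL convention \<open>ln 0 = 0\<close>.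
\<close>

definition log_capacity :: "complex set \<Rightarrow> real" where
  "log_capacity K = Sup (insert 0
     {exp (\<integral>x. ln (dist (fst x) (snd x)) \<partial>(M \<Otimes>\<^sub>M M)) | M :: complex measure.
        prob_space M \<and> sets M = sets borel \<and> emeasure M K = 1 \<and>
        (\<forall>z. emeasure M {z} = 0) \<and>
        integrable (M \<Otimes>\<^sub>M M) (\<lambda>x. ln (dist (fst x) (snd x)))})"

text \<open>
  Compact sets that are connected with connected complement in the Riemann sphere (this differs
  from the path-based \<^const>\<open>simply_connected\<close>).  For compact \<open>K\<close> the point at infinity is interior
  to the complement in the sphere and removing it does not affect connectedness, so the complement
  in the plane can be used.
\<close>

definition simply_connected_compact :: "complex set \<Rightarrow> bool" where
  "simply_connected_compact K \<longleftrightarrow> compact K \<and> connected K \<and> connected (- K)"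

text \<open>
  \<open>{w. \<bar>U w\<bar> \<le> r}\<close> for \<open>U w = (w - a\<^sub>1)\<^bsup>m\<^sub>1\<^esup> \<cdots> (w - a\<^sub>l)\<^bsup>m\<^sub>l\<^esup>\<close>.  For real exponents \<open>U\<close> is
  multivalued, but its modulus is not.
\<close>

definition lemniscatic_set ::
  "nat \<Rightarrow> (nat \<Rightarrow> complex) \<Rightarrow> (nat \<Rightarrow> real) \<Rightarrow> real \<Rightarrow> complex set" where
  "lemniscatic_set l a m r = {w. (\<Prod>j\<in>{1..l}. cmod (w - a j) powr m j) \<le> r}"

text \<open>A Jordan curve surrounding \<open>F j\<close> but none of the other sets \<open>F i\<close>.\<close>

definition jordan_surrounds ::
  "(real \<Rightarrow> complex) \<Rightarrow> nat \<Rightarrow> (nat \<Rightarrow> complex set) \<Rightarrow> nat \<Rightarrow> bool" where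
  "jordan_surrounds \<gamma> l F j \<longleftrightarrow>
     simple_path \<gamma> \<and> pathfinish \<gamma> = pathstart \<gamma> \<and>
     F j \<subseteq> inside (path_image \<gamma>) \<and>
     (\<forall>i\<in>{1..l} - {j}. F i \<subseteq> outside (path_image \<gamma>))"

text \<open>
  \<open>\<Phi>\<close> is a Walsh map of \<open>E = F 1 \<union> \<dots> \<union> F l\<close> with centers \<open>a j\<close> and exponents \<open>m j\<close>,
  where \<open>j\<close> ranges over \<open>{1..l}\<close>.
  A conformal map of the complements in the Riemann sphere that fixes infinity is given by its
  restriction to the plane: \<open>\<Phi>\<close> is holomorphic and injective on \<open>- E\<close> with image \<open>- L\<close>, and the
  normalization at infinity provides the extension by \<open>\<infinity> \<mapsto> \<infinity>\<close>.
\<close>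

definition is_walsh_map ::
  "nat \<Rightarrow> (nat \<Rightarrow> complex set) \<Rightarrow> (nat \<Rightarrow> complex) \<Rightarrow> (nat \<Rightarrow> real) \<Rightarrow> (complex \<Rightarrow> complex) \<Rightarrow> bool"
where
  "is_walsh_map l F a m \<Phi> \<longleftrightarrow>
     (let E = (\<Union>j\<in>{1..l}. F j);
          L = lemniscatic_set l a m (log_capacity E);
          Lc = (\<lambda>j. connected_component_set L (a j))
      in inj_on a {1..l} \<and> (\<forall>j\<in>{1..l}. m j > 0) \<and> (\<Sum>j\<in>{1..l}. m j) = 1 \<and>
         \<Phi> holomorphic_on (- E) \<and> inj_on \<Phi> (- E) \<and> \<Phi> ` (- E) = - L \<and>
         (\<lambda>z. \<Phi> z - z) \<in> O[at_infinity](\<lambda>z. 1 / z) \<and>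
         bij_betw Lc {1..l} (components L) \<and>
         (\<forall>j\<in>{1..l}. compact (Lc j) \<and> a j \<in> Lc j \<and>
            (\<exists>\<gamma>. path_image \<gamma> \<subseteq> - E \<and> jordan_surrounds \<gamma> l F j \<and>
                 jordan_surrounds (\<Phi> \<circ> \<gamma>) l Lc j)))"

text \<open>
  The two cases for a set with components \<open>F 1\<close>, \<open>F 2\<close>, including the labeling: from left to right
  if both components are symmetric with respect to the real line, and with \<open>F 2\<close> in the upper
  half-plane if conjugation exchanges them.
\<close>

definition labeled_case1 :: "(nat \<Rightarrow> complex set) \<Rightarrow> bool" where
  "labeled_case1 F \<longleftrightarrow> cnj ` F 1 = F 1 \<and> cnj ` F 2 = F 2 \<and>
     (\<forall>x y. complex_of_real x \<in> F 1 \<longrightarrow> complex_of_real y \<in> F 2 \<longrightarrow> x < y)"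

definition labeled_case2 :: "(nat \<Rightarrow> complex set) \<Rightarrow> bool" where
  "labeled_case2 F \<longleftrightarrow> cnj ` F 1 = F 2 \<and> F 2 \<subseteq> {z. Im z > 0}"

text \<open>
  The branch of \<open>sqrt (x\<^sup>2 - 1)\<close> that is positive for \<open>x > 1\<close> and negative for \<open>x < -1\<close>.
\<close>

definition signed_sqrt :: "real \<Rightarrow> real" where
  "signed_sqrt x = (if x > 1 then sqrt (x\<^sup>2 - 1) else - sqrt (x\<^sup>2 - 1))"

text \<open>
  \<open>\<Phi> = sqrt (c + (Q + sqrt (Q\<^sup>2 - 1 / (4 b\<^sup>2)))\<^bsup>2/n\<^esup>)\<close> on \<open>- E\<close>, where \<open>Q = P / (2 b)\<close> and \<open>b\<close> is the
  leading coefficient of \<open>P\<close>, all roots being branches analytic on \<open>- E\<close>.  \<open>S\<close> is the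
  inner square root, with \<open>S z \<sim> Q z\<close> at infinity.  \<open>G\<close> is the power with exponent \<open>2/n\<close> (\<open>n\<close> even):
  only the power \<open>2/n\<close>, not the \<open>n\<close>-th root itself, is single-valued on \<open>- E\<close>.  Positivity of \<open>\<Phi>\<close> on the
  positive real line near infinity selects the branches of \<open>G\<close> and of the outer root.
\<close>

definition walsh_root_formula ::
  "complex set \<Rightarrow> nat \<Rightarrow> (complex \<Rightarrow> complex) \<Rightarrow> real \<Rightarrow> complex \<Rightarrow> (complex \<Rightarrow> complex) \<Rightarrow> bool"
where
  "walsh_root_formula E n P b c \<Phi> \<longleftrightarrow>
     (let Q = (\<lambda>z. P z / (2 * complex_of_real b)) in
      \<exists>S G. S holomorphic_on (- E) \<and> G holomorphic_on (- E) \<and> \<Phi> holomorphic_on (- E) \<and>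
        (\<forall>z\<in>- E. (S z)\<^sup>2 = (Q z)\<^sup>2 - 1 / (4 * (complex_of_real b)\<^sup>2)) \<and>
        ((\<lambda>z. S z / Q z) \<longlongrightarrow> 1) at_infinity \<and>
        (\<forall>z\<in>- E. G z ^ (n div 2) = Q z + S z) \<and>
        (\<forall>z\<in>- E. (\<Phi> z)\<^sup>2 = c + G z) \<and>
        (\<forall>\<^sub>F x in at_top. \<Phi> (complex_of_real x) \<in> \<real> \<and> Re (\<Phi> (complex_of_real x)) > 0))"

end

theory Submission
  imports Defs "HOL-Computational_Algebra.Fundamental_Theorem_Algebra" "HOL-Real_Asymp.Real_Asymp"
begin

text \<open>
  Critical points of an even polynomial come in pairs, so the exceptional one is \<open>0\<close>. Writing
  \<open>P z = R (z\<^sup>2)\<close>, the polynomial \<open>R\<close> of degree \<open>k = n / 2\<close> has no critical point outside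
  \<open>K = {u. R u \<in> [-1, 1]}\<close>. Hence \<open>R + sqrt (R\<^sup>2 - 1)\<close> is a proper map of \<open>- K\<close> onto the exterior of the unit
  disc that is ramified only at infinity, and there totally; it therefore has a \<open>k\<close>-th root, and this
  root, scaled to \<open>f u = u + O(1)\<close>, maps \<open>- K\<close> conformally onto the exterior of a disc. So \<open>K\<close> is
  connected, and as \<open>0 \<notin> K\<close>, its preimage \<open>E\<close> under squaring falls into two components \<open>\<plusminus>s ` K\<close> for a branch
  \<open>s\<close> of the square root. The Walsh map is \<open>sqrt (f (z\<^sup>2) - f 0)\<close>.

  The capacity of \<open>E\<close> is bounded above by the size of the monic polynomials built from \<open>P\<close> and Chebyshev
  polynomials, and below by the energy of the measure on \<open>E\<close> that lifts the image of the uniform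
  measure on the circle under the boundary values of the inverse of \<open>f\<close>.

  For an arbitrary Walsh map \<open>\<Phi>\<close> with centers \<open>a\<close> and exponents \<open>m\<close>, the maximum principle gives
  \<open>\<bar>U (\<Phi> z)\<bar> = \<bar>f (z\<^sup>2)\<bar>\<^bsup>1/2\<^esup>\<close>. Comparing winding numbers along the curves around the components yields
  \<open>m\<^sub>1 = m\<^sub>2 = 1/2\<close>, so \<open>(\<Phi> z - a\<^sub>1) (\<Phi> z - a\<^sub>2) = f (z\<^sup>2)\<close>, and the normalization at infinity gives
  \<open>a\<^sub>1 = - a\<^sub>2\<close> and \<open>a\<^sub>2\<^sup>2 = - f 0\<close>. The sign of \<open>a\<^sub>2\<close> is found by following \<open>\<Phi>\<close> along the symmetry axis of
  \<open>F 2\<close> from infinity to the boundary of \<open>E\<close>.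
\<close>

section \<open>Roots of totally ramified proper maps\<close>

text \<open>Why \<open>\<alpha> = - f 0\<close> is the right shift: f is injective, so f u - f 0 is
  u times a zero-free function, and this factor has a square root because - K with infinity added is
  simply connected. Hence f(z^2) - f 0 has an odd holomorphic square root on - E, and it is
  injective. Its image is the set of w with |w^2 - \<alpha>| > \<rho>; since |\<alpha>| = |f 0| >
  \<rho>, the closed disc around \<alpha> misses 0, and L splits in two just as E does. The radius:
  with h = R + sqrt(R^2 - 1) and b the leading coefficient of R, the normalization f u = u + O(1)
  forces f^k = h / (2 b), so |h| > 1 becomes |f| > \<rho> = (2|b|)^(-1/k). Squaring doubles the
  degree, which gives the capacity sqrt \<rho> = (2|b|)^(-1/n). f commutes with conjugation, so
  \<alpha> is real and nonzero; its sign decides between the two cases, since (a 2)^2 = \<alpha>.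
  For real exponents U is multivalued, so the study of an arbitrary Walsh map has to work with |U|
  and with logarithmic derivatives until both exponents are known to be 1/2.\<close>

lemma proper_local_biholomorphism_covering_space:
  fixes g :: "complex \<Rightarrow> complex"
  assumes N: "open N" "N \<noteq> {}" and B: "open B" "connected B"
    and hol: "g holomorphic_on N" and im: "\<And>z. z \<in> N \<Longrightarrow> g z \<in> B"
    and der: "\<And>z. z \<in> N \<Longrightarrow> deriv g z \<noteq> 0"
    and proper: "\<And>C. compact C \<Longrightarrow> C \<subseteq> B \<Longrightarrow> compact {z \<in> N. g z \<in> C}"
  shows "covering_space N g B"
proof
  show cont: "continuous_on N g"
    by (simp add: hol holomorphic_on_imp_continuous_on)
  have inv: "\<exists>r>0. ball z r \<subseteq> N \<and> inj_on g (ball z r)" if "z \<in> N" for z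
    using has_complex_derivative_locally_invertible[OF hol that \<open>open N\<close> der[OF that]] by metis
  have cpt_im: "compact (g ` {z \<in> N. g z \<in> C})" if "compact C" "C \<subseteq> B" for C
    using proper[OF that] cont by (intro compact_continuous_image) (auto elim: continuous_on_subset)
  \<comment> \<open>The image is open by local injectivity and closed in B by properness, so
    connectedness of B makes it all of B.\<close>
  show surj: "g ` N = B"
  proof -
    have "open (g ` N)"
    proof (subst open_subopen, clarify)
      fix z assume "z \<in> N"
      then obtain r where r: "r > 0" "ball z r \<subseteq> N" "inj_on g (ball z r)" using inv by blast
      have "open (g ` ball z r)"
        by (rule open_mapping_thm3) (use r hol holomorphic_on_subset in auto)
      then show "\<exists>T. open T \<and> g z \<in> T \<and> T \<subseteq> g ` N" using r by (metis centre_in_ball image_eqI image_mono)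
    qed
    moreover have "open (B - g ` N)"
    proof (subst open_subopen, clarify)
      fix y assume y: "y \<in> B" "y \<notin> g ` N"
      obtain e where e: "e > 0" "cball y e \<subseteq> B" using y B open_contains_cball by metis
      let ?X = "g ` {z \<in> N. g z \<in> cball y e}"
      have "closed ?X" using cpt_im[of "cball y e"] e by (simp add: compact_imp_closed)
      then have "open (ball y e - ?X)" by blast
      moreover have "ball y e - ?X \<subseteq> B - g ` N"
        using e by (auto simp: subset_iff)
      moreover have "y \<in> ball y e - ?X" using y e by auto
      ultimately show "\<exists>T. open T \<and> y \<in> T \<and> T \<subseteq> B - g ` N" by blast
    qed
    moreover have "g ` N \<subseteq> B" using im by auto
    ultimately have "B - g ` N = {} \<or> g ` N = {}"
      using \<open>connected B\<close> connectedD[of B "g ` N" "B - g ` N"] by blast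
    then show ?thesis using \<open>g ` N \<subseteq> B\<close> N by blast
  qed
  fix y assume y: "y \<in> B"
  define F where "F = {z \<in> N. g z \<in> {y}}"
  have "compact F" unfolding F_def using y by (intro proper) auto
  obtain r where r: "\<And>z. z \<in> N \<Longrightarrow> r z > 0 \<and> ball z (r z) \<subseteq> N \<and> inj_on g (ball z (r z))"
    using inv by metis
  \<comment> \<open>Each injectivity ball around a fibre point contains no other fibre point, so a
    finite subcover of the compact fibre lists all of it.\<close>
  have "finite F"
  proof -
    have "F \<subseteq> (\<Union>z\<in>F. ball z (r z))" using r by (force simp: F_def)
    then obtain F' where F': "F' \<subseteq> F" "finite F'" "F \<subseteq> (\<Union>z\<in>F'. ball z (r z))"
      using compactE_image[OF \<open>compact F\<close>, of F "\<lambda>z. ball z (r z)"] by auto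
    have "F \<subseteq> F'"
    proof
      fix x assume x: "x \<in> F"
      then obtain z where z: "z \<in> F'" "x \<in> ball z (r z)" using F' by auto
      then have "z \<in> N" "g z = g x" using x F' by (auto simp: F_def)
      then have "x = z" using r[of z] z by (metis centre_in_ball inj_onD)
      then show "x \<in> F'" using z by simp
    qed
    then show ?thesis using F' finite_subset by blast
  qed
  have "\<exists>e>0. \<forall>x\<in>F. e \<le> r x \<and> (\<forall>x'\<in>F. x' \<noteq> x \<longrightarrow> 2 * e \<le> dist x x')"
  proof -
    \<comment> \<open>The element 1 keeps the set nonempty, so that \<open>Min\<close> is
      meaningful.\<close>
    define S where "S = r ` F \<union> (\<lambda>(x,x'). dist x x' / 2) ` {p \<in> F \<times> F. fst p \<noteq> snd p} \<union> {1}"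
    have S: "finite S" "\<And>s. s \<in> S \<Longrightarrow> s > 0"
      using \<open>finite F\<close> r by (auto simp: S_def F_def)
    have "Min S > 0" using S by (subst Min_gr_iff) (auto simp: S_def)
    moreover have "Min S \<le> r x" if "x \<in> F" for x
      using S that by (intro Min_le) (auto simp: S_def)
    moreover have "Min S \<le> dist x x' / 2" if "x \<in> F" "x' \<in> F" "x' \<noteq> x" for x x'
    proof (intro Min_le)
      show "dist x x' / 2 \<in> S" unfolding S_def
        using that by (intro UnI1 UnI2 image_eqI[of _ _ "(x, x')"]) auto
    qed (rule S(1))
    ultimately show ?thesis by (intro exI[of _ "Min S"]) force
  qed
  then obtain e where e: "e > 0" "\<And>x. x \<in> F \<Longrightarrow> e \<le> r x"
    "\<And>x x'. x \<in> F \<Longrightarrow> x' \<in> F \<Longrightarrow> x' \<noteq> x \<Longrightarrow> 2 * e \<le> dist x x'" by auto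
  have U: "ball x e \<subseteq> N" "inj_on g (ball x e)" "open (g ` ball x e)" if "x \<in> F" for x
  proof -
    have "x \<in> N" "ball x e \<subseteq> ball x (r x)" using that e(2)[OF that] by (auto simp: F_def)
    then show *: "ball x e \<subseteq> N" "inj_on g (ball x e)" using r[of x] by (auto intro: inj_on_subset)
    show "open (g ` ball x e)"
      by (rule open_mapping_thm3) (use * hol holomorphic_on_subset in auto)
  qed
  obtain d where d: "d > 0" "cball y d \<subseteq> B" using y B open_contains_cball by metis
  \<comment> \<open>Points over the closed disc that lie in none of the fibre balls form a compact
    set. Removing its image from the neighbourhood \<open>T\<close> of y forces every preimage of
    \<open>T\<close> into one of the balls.\<close>
  define X where "X = {z \<in> N. g z \<in> cball y d} - (\<Union>x\<in>F. ball x e)"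
  have "compact X" unfolding X_def by (intro compact_diff proper) (use d in auto)
  then have "compact (g ` X)"
    by (intro compact_continuous_image continuous_on_subset[OF cont]) (auto simp: X_def)
  have "y \<notin> g ` X" using e(1) by (force simp: X_def F_def)
  define T where "T = ball y d \<inter> (\<Inter>x\<in>F. g ` ball x e) - g ` X"
  have opT: "open T"
    unfolding T_def using \<open>compact (g ` X)\<close> \<open>finite F\<close> U
    by (intro open_Diff open_Int open_INT) (auto simp: compact_imp_closed)
  have yT: "y \<in> T" using \<open>y \<notin> g ` X\<close> d e(1) by (force simp: T_def F_def)
  have TB: "T \<subseteq> B" using d by (force simp: T_def)
  let ?v = "(\<lambda>x. ball x e \<inter> g -` T) ` F"
  have v1: "\<Union>?v = N \<inter> g -` T"
  proof
    show "\<Union>?v \<subseteq> N \<inter> g -` T" using U by auto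
    show "N \<inter> g -` T \<subseteq> \<Union>?v"
    proof
      fix z assume "z \<in> N \<inter> g -` T"
      then have "z \<in> N" "g z \<in> T" by auto
      then have "z \<notin> X" "g z \<in> cball y d" by (auto simp: T_def)
      then show "z \<in> \<Union>?v" using \<open>z \<in> N\<close> \<open>g z \<in> T\<close> by (auto simp: X_def)
    qed
  qed
  have v2: "openin (top_of_set N) (ball x e \<inter> g -` T)" if "x \<in> F" for x
  proof -
    have "open (N \<inter> g -` T)" using continuous_open_preimage[OF cont N(1) opT] .
    moreover have "ball x e \<inter> g -` T = ball x e \<inter> (N \<inter> g -` T)" using U(1)[OF that] by blast
    ultimately have "open (ball x e \<inter> g -` T)" by (metis open_Int open_ball)
    then show ?thesis using U(1)[OF that] by (intro open_subset) auto
  qed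
  have v3: "pairwise disjnt ?v"
  proof -
    have "disjnt (ball x e \<inter> g -` T) (ball x' e \<inter> g -` T)" if "x \<in> F" "x' \<in> F" "x \<noteq> x'" for x x'
    proof -
      have "ball x e \<inter> ball x' e = {}"
        using e(3)[of x x'] that by (intro disjoint_ballI) auto
      then show ?thesis by (auto simp: disjnt_def)
    qed
    then show ?thesis unfolding pairwise_image by (auto simp: pairwise_def)
  qed
  have v4: "\<exists>q. homeomorphism (ball x e \<inter> g -` T) T g q" if x: "x \<in> F" for x
  proof -
    have "g holomorphic_on ball x e" using U[OF x] hol holomorphic_on_subset by blast
    then obtain q where q: "q holomorphic_on (g ` ball x e)" "\<And>z. z \<in> ball x e \<Longrightarrow> q (g z) = z"
      using holomorphic_has_inverse[OF _ open_ball U(2)[OF x]] by metis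
    have "T \<subseteq> g ` ball x e" using x by (auto simp: T_def)
    then have "homeomorphism (ball x e \<inter> g -` T) T g q"
    proof (intro homeomorphismI)
      show "continuous_on (ball x e \<inter> g -` T) g" using cont U[OF x] by (auto elim: continuous_on_subset)
      show "continuous_on T q"
        using holomorphic_on_imp_continuous_on[OF q(1)] \<open>T \<subseteq> g ` ball x e\<close> continuous_on_subset by blast
      show "q ` T \<subseteq> ball x e \<inter> g -` T" using q(2) \<open>T \<subseteq> g ` ball x e\<close> by (auto simp: subset_iff image_iff)
    qed (use q(2) \<open>T \<subseteq> g ` ball x e\<close> in \<open>auto simp: subset_iff image_iff\<close>)
    then show "\<exists>q. homeomorphism (ball x e \<inter> g -` T) T g q" by blast
  qed
  have "openin (top_of_set B) T" using opT TB by (simp add: open_subset)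
  with yT v1 v3 show "\<exists>T. y \<in> T \<and> openin (top_of_set B) T \<and>
    (\<exists>v. \<Union>v = N \<inter> g -` T \<and> (\<forall>u\<in>v. openin (top_of_set N) u) \<and> pairwise disjnt v \<and>
         (\<forall>u\<in>v. \<exists>q. homeomorphism u T g q))"
    by (intro exI[of _ T] conjI exI[of _ ?v] ballI) (auto simp: v2 v4 )
qed

text \<open>In a logarithmic coordinate the punctured disc becomes the half-plane H and w^k becomes
  exp(k z). Lifting this map through the covering g gives a map inverse to the wanted root. Since g
  has order exactly k at 0, the lift near the puncture is a local inverse of an explicit k-th root;
  this fixes its periodicity and its injectivity.\<close>

lemma root_of_totally_ramified_proper_map:
  fixes g q :: "complex \<Rightarrow> complex"
  assumes D: "open D" "0 \<in> D" and k: "k > 0"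
    and q: "q holomorphic_on D" "\<And>v. v \<in> D \<Longrightarrow> q v \<noteq> 0"
    and g: "\<And>v. v \<in> D \<Longrightarrow> g v = v ^ k * q v"
    and im: "\<And>v. v \<in> D \<Longrightarrow> norm (g v) < 1"
    and der: "\<And>v. v \<in> D - {0} \<Longrightarrow> deriv g v \<noteq> 0"
    and proper: "\<And>t. t < 1 \<Longrightarrow> compact {v \<in> D. norm (g v) \<le> t}"
  obtains \<phi> where "\<phi> holomorphic_on D" "inj_on \<phi> D" "\<phi> ` D = ball 0 1" "\<phi> 0 = 0"
    "\<And>v. v \<in> D \<Longrightarrow> \<phi> v ^ k = g v"
proof -
  define N where "N = D - {0}"
  define B :: "complex set" where "B = ball 0 1 - {0}"
  define H :: "complex set" where "H = {z. Re z < 0}"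
  have holg: "g holomorphic_on D"
    by (rule holomorphic_transform[of "\<lambda>v. v ^ k * q v"]) (use q g in \<open>auto intro!: holomorphic_intros\<close>)
  have contg: "continuous_on D g" by (rule holomorphic_on_imp_continuous_on[OF holg])
  have openN: "open N" and openB: "open B" and openH: "open H"
    by (auto simp: N_def B_def H_def D open_delete open_halfspace_Re_lt)
  have g0: "g v \<noteq> 0" if "v \<in> N" for v using that g q by (simp add: N_def)
  have gB: "g v \<in> B" if "v \<in> N" for v using that g0 im by (simp add: N_def B_def)
  have cov: "covering_space N g B"
  proof (rule proper_local_biholomorphism_covering_space)
    obtain r where "r > 0" "ball 0 r \<subseteq> D" using D open_contains_ball by blast
    then have "complex_of_real (r/2) \<in> N" by (auto simp: N_def)
    then show "N \<noteq> {}" by blast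
    show "connected B" unfolding B_def by (rule connected_open_delete) auto
    show "g holomorphic_on N" using holg by (rule holomorphic_on_subset) (auto simp: N_def)
    fix C :: "complex set" assume C: "compact C" "C \<subseteq> B"
    show "compact {z \<in> N. g z \<in> C}"
    proof (cases "C = {}")
      case False
      obtain c where c: "c \<in> C" "\<And>z. z \<in> C \<Longrightarrow> norm z \<le> norm c"
        using continuous_attains_sup[OF C(1) False continuous_on_norm_id] by auto
      let ?Z = "{v \<in> D. norm (g v) \<le> norm c}"
      have "compact ?Z" using c(1) C by (intro proper) (auto simp: B_def)
      have "0 \<notin> C" using C by (auto simp: B_def)
      moreover have "g 0 = 0" using g[OF D(2)] k by simp
      ultimately have "{z \<in> N. g z \<in> C} = ?Z \<inter> g -` C" using c by (auto simp: N_def)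
      also have "closed \<dots>"
        using \<open>compact ?Z\<close> C contg
        by (intro continuous_closed_preimage) (auto simp: compact_imp_closed elim: continuous_on_subset)
      finally show ?thesis using \<open>compact ?Z\<close>
        by (metis (no_types, lifting) \<open>{z \<in> N. g z \<in> C} = ?Z \<inter> g -` C\<close> closed_Int_compact compact_Int_closed inf.right_idem inf_commute)
    qed auto
  qed (use openN openB gB der N_def in auto)
  obtain \<delta> where \<delta>: "\<delta> > 0" "ball 0 \<delta> \<subseteq> D" using D open_contains_ball by blast
  obtain l where l: "l holomorphic_on ball 0 \<delta>" "\<And>z. z \<in> ball 0 \<delta> \<Longrightarrow> q z = exp (l z)"
  proof -
    have "q holomorphic_on ball 0 \<delta>" using q(1) \<delta>(2) by (rule holomorphic_on_subset)
    moreover have "contractible (ball (0::complex) \<delta>)" by (rule convex_imp_contractible) auto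
    moreover have "\<And>z. z \<in> ball 0 \<delta> \<Longrightarrow> q z \<noteq> 0" using q(2) \<delta>(2) by blast
    ultimately show ?thesis using that contractible_imp_holomorphic_log by blast
  qed
  define \<beta> where "\<beta> = (\<lambda>v. v * exp (l v / of_nat k))"
  have hol\<beta>: "\<beta> holomorphic_on ball 0 \<delta>" unfolding \<beta>_def by (intro holomorphic_intros l) (use k in auto)
  have \<beta>k: "\<beta> v ^ k = g v" if "v \<in> ball 0 \<delta>" for v
    using that \<delta> g l(2) k by (auto simp: \<beta>_def power_mult_distrib exp_of_nat_mult[symmetric])
  have "deriv \<beta> 0 \<noteq> 0"
  proof -
    have "l field_differentiable at 0"
      using l(1) \<delta> by (intro holomorphic_on_imp_differentiable_at[of _ "ball 0 \<delta>"]) auto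
    then have "(l has_field_derivative deriv l 0) (at 0)" by (simp add: DERIV_deriv_iff_field_differentiable)
    then have "(\<beta> has_field_derivative exp (l 0 / of_nat k)) (at 0)"
      unfolding \<beta>_def by (auto intro!: derivative_eq_intros simp: k[THEN gr_implies_not0])
    then show ?thesis by (simp add: DERIV_imp_deriv)
  qed
  obtain r where r: "r > 0" "ball (0::complex) r \<subseteq> ball 0 \<delta>" "open (\<beta> ` ball 0 r)" "inj_on \<beta> (ball 0 r)"
    by (rule has_complex_derivative_locally_invertible[OF hol\<beta> _ open_ball \<open>deriv \<beta> 0 \<noteq> 0\<close>])
       (use \<delta> in auto)
  obtain \<xi> where \<xi>: "\<xi> holomorphic_on (\<beta> ` ball 0 r)" "\<And>z. z \<in> ball 0 r \<Longrightarrow> \<xi> (\<beta> z) = z"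
    by (rule holomorphic_has_inverse[OF holomorphic_on_subset[OF hol\<beta> r(2)] open_ball r(4)]) (rule that)
  have \<beta>0: "\<beta> 0 = 0" by (simp add: \<beta>_def)
  then have "0 \<in> \<beta> ` ball 0 r" using r(1) by (metis centre_in_ball image_eqI)
  then obtain \<epsilon>' where \<epsilon>': "\<epsilon>' > 0" "ball 0 \<epsilon>' \<subseteq> \<beta> ` ball 0 r" using r(3) open_contains_ball by blast
  define \<epsilon> where "\<epsilon> = min \<epsilon>' (1/2)"
  have \<epsilon>: "\<epsilon> > 0" "\<epsilon> < 1" "ball 0 \<epsilon> \<subseteq> \<beta> ` ball 0 r" using \<epsilon>' by (auto simp: \<epsilon>_def)
  have \<xi>\<epsilon>: "\<xi> w \<in> ball 0 r" "\<beta> (\<xi> w) = w" if "w \<in> ball 0 \<epsilon>" for w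
    using that \<epsilon>(3) \<xi>(2) by (auto simp: subset_iff image_iff)
  have \<xi>0: "\<xi> 0 = 0" using \<xi>(2)[of 0] \<beta>0 r by simp
  have \<xi>g: "g (\<xi> w) = w ^ k" if "w \<in> ball 0 \<epsilon>" for w
    using \<xi>\<epsilon>[OF that] \<beta>k[of "\<xi> w"] r(2) by (metis subsetD)
  have \<xi>N: "\<xi> w \<in> N" if "w \<in> ball 0 \<epsilon>" "w \<noteq> 0" for w
  proof -
    have "\<xi> w \<in> D" using \<xi>\<epsilon>(1)[OF that(1)] r(2) \<delta>(2) by blast
    then show ?thesis using \<xi>\<epsilon>(2)[OF that(1)] that(2) \<beta>0 by (auto simp: N_def)
  qed
  have \<xi>hol: "\<xi> holomorphic_on ball 0 \<epsilon>" using \<xi>(1) \<epsilon>(3) holomorphic_on_subset by blast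
  define F :: "complex \<Rightarrow> complex" where "F = (\<lambda>z. exp (of_nat k * z))"
  have contF: "continuous_on T F" for T unfolding F_def by (intro continuous_intros)
  have FB: "F \<in> H \<rightarrow> B" using k by (auto simp: F_def H_def B_def mult_less_0_iff)
  \<comment> \<open>\<open>exp \<zeta>0 = \<epsilon> / 2\<close> lies in the disc where
    \<open>\<xi>\<close> is defined, so the lift can start on the local inverse.\<close>
  define \<zeta>0 where "\<zeta>0 = complex_of_real (ln (\<epsilon>/2))"
  have \<zeta>0: "Re \<zeta>0 < ln \<epsilon>" "ln \<epsilon> < 0" using \<epsilon> by (auto simp: \<zeta>0_def)
  then have \<zeta>0H: "\<zeta>0 \<in> H" by (simp add: H_def)
  have exp_ball: "exp z \<in> ball 0 \<epsilon>" if "Re z < ln \<epsilon>" for z :: complex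
    using that \<epsilon>(1) by (simp add: ln_less_cancel_iff[symmetric] del: ln_less_cancel_iff)
  have convH: "convex H" unfolding H_def by (rule convex_halfspace_Re_lt)
  obtain \<psi>' where \<psi>': "continuous_on H \<psi>'" "\<psi>' \<in> H \<rightarrow> N" "\<psi>' \<zeta>0 = \<xi> (exp \<zeta>0)"
      "\<And>y. y \<in> H \<Longrightarrow> g (\<psi>' y) = F y"
  proof (rule covering_space_lift_strong[OF cov, of "\<xi> (exp \<zeta>0)" \<zeta>0 H F])
    show "\<xi> (exp \<zeta>0) \<in> N" using exp_ball[OF \<zeta>0(1)] by (intro \<xi>N) auto
    show "simply_connected H" "locally path_connected H"
      using convH by (auto simp: convex_imp_simply_connected convex_imp_locally_path_connected)
    show "F \<zeta>0 = g (\<xi> (exp \<zeta>0))" using exp_ball[OF \<zeta>0(1)] \<xi>g by (simp add: F_def exp_of_nat_mult)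
  qed (use \<zeta>0H contF FB in auto)
  have uniq: "hx z = hy z"
    if "continuous_on T hx" "hx \<in> T \<rightarrow> N" "\<And>x. x \<in> T \<Longrightarrow> g (hx x) = F x"
       "continuous_on T hy" "hy \<in> T \<rightarrow> N" "\<And>x. x \<in> T \<Longrightarrow> g (hy x) = F x"
       "hx a = hy a" "a \<in> T" "z \<in> T" "convex T" "T \<subseteq> H" for hx hy a z T
    by (rule covering_space_lift_unique[OF cov, of hx a hy T F])
       (use that contF FB in \<open>auto intro: convex_connected\<close>)
  have near0: "\<psi>' z = \<xi> (exp z)" if "Re z < ln \<epsilon>" for z
  proof (rule uniq[where T="{z. Re z < ln \<epsilon>}" and hx=\<psi>' and hy="\<lambda>z. \<xi> (exp z)" and a=\<zeta>0])
    have sub: "{z. Re z < ln \<epsilon>} \<subseteq> H" using \<zeta>0 by (auto simp: H_def)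
    show "{z. Re z < ln \<epsilon>} \<subseteq> H" by (rule sub)
    show "continuous_on {z. Re z < ln \<epsilon>} \<psi>'" using \<psi>'(1) sub continuous_on_subset by blast
    show "\<psi>' \<in> {z. Re z < ln \<epsilon>} \<rightarrow> N" using \<psi>'(2) sub by blast
    show "continuous_on {z. Re z < ln \<epsilon>} (\<lambda>z. \<xi> (exp z))"
      by (rule continuous_on_compose2[OF holomorphic_on_imp_continuous_on[OF \<xi>hol]])
         (use exp_ball in \<open>auto intro!: continuous_intros\<close>)
    show "(\<lambda>z. \<xi> (exp z)) \<in> {z. Re z < ln \<epsilon>} \<rightarrow> N" using exp_ball \<xi>N by auto
    show "g (\<xi> (exp x)) = F x" if "x \<in> {z. Re z < ln \<epsilon>}" for x
      using \<xi>g[OF exp_ball] that by (simp add: F_def exp_of_nat_mult)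
    show "g (\<psi>' x) = F x" if "x \<in> {z. Re z < ln \<epsilon>}" for x
      using \<psi>'(4) sub that by blast
    show "convex {z. Re z < ln \<epsilon>}" by (rule convex_halfspace_Re_lt)
  qed (use \<psi>' \<zeta>0 that in auto)
  text \<open>Adding a logarithm of a root of unity to the argument gives another lift; near the
    puncture all of them are given by \<open>\<xi>\<close>.\<close>
  have shift: "\<psi>' (z + c) = \<psi>' (z + d)"
    if z: "z \<in> H" and cd: "Re c = 0" "Re d = 0" "exp (of_nat k * c) = 1" "exp (of_nat k * d) = 1"
      and eq: "\<psi>' (\<zeta> + c) = \<psi>' (\<zeta> + d)" "\<zeta> \<in> H" for z c d \<zeta>
  proof (rule uniq[where T=H and hx="\<lambda>z. \<psi>' (z + c)" and hy="\<lambda>z. \<psi>' (z + d)" and a=\<zeta>])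
    have "F (x + a) = F x" if "exp (of_nat k * a) = 1" for x a
      using that by (simp add: F_def distrib_left exp_add)
    then show "\<And>x. x \<in> H \<Longrightarrow> g (\<psi>' (x + c)) = F x" "\<And>x. x \<in> H \<Longrightarrow> g (\<psi>' (x + d)) = F x"
      using \<psi>'(4) cd by (simp_all add: H_def)
    show "continuous_on H (\<lambda>z. \<psi>' (z + c))" "continuous_on H (\<lambda>z. \<psi>' (z + d))"
      by (rule continuous_on_compose2[OF \<psi>'(1)]; use cd in \<open>auto intro!: continuous_intros simp: H_def\<close>)+
    show "(\<lambda>z. \<psi>' (z + c)) \<in> H \<rightarrow> N" "(\<lambda>z. \<psi>' (z + d)) \<in> H \<rightarrow> N"
      using \<psi>'(2) cd by (auto simp: H_def Pi_iff)
  qed (use z eq convH in auto)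
  \<comment> \<open>The period of exp is checked at the base point, where the lift is
    \<open>\<xi>\<close> of exp. By uniqueness of lifts it holds on all of H, so the lift descends
    to the disc.\<close>
  have same: "\<psi>' z = \<psi>' z'" if zH: "z \<in> H" "exp z = exp z'" for z z'
  proof -
    obtain n :: int where n: "z' = z + (of_int (2 * n) * pi) * \<i>"
      using zH(2) exp_eq[of z' z] by metis
    have 1: "Re ((of_int (2 * n) * pi) * \<i>) = 0" by simp
    have 2: "exp (of_nat k * ((of_int (2 * n) * pi) * \<i>)) = 1"
    proof -
      have "exp ((of_int (2 * (int k * n)) * pi) * \<i>) = exp (0::complex)"
        unfolding exp_eq by (intro exI[of _ "int k * n"]) simp
      then show ?thesis by (simp add: algebra_simps)
    qed
    have 3: "exp (\<zeta>0 + (of_int (2 * n) * pi) * \<i>) = exp (\<zeta>0 + 0)" unfolding exp_eq by auto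
    have "\<psi>' (\<zeta>0 + (of_int (2 * n) * pi) * \<i>) = \<psi>' (\<zeta>0 + 0)"
      using near0[of "\<zeta>0 + (of_int (2 * n) * pi) * \<i>"] near0[of "\<zeta>0 + 0"] 3 \<zeta>0(1) by simp
    from shift[OF zH(1) 1 _ 2 _ this \<zeta>0H] show ?thesis using n by simp
  qed
  define \<psi> where "\<psi> = (\<lambda>w. if w = 0 then 0 else \<psi>' (Ln w))"
  have LnH: "Ln w \<in> H" if "w \<in> B" for w using that by (simp add: B_def H_def)
  have \<psi>exp: "\<psi> (exp z) = \<psi>' z" if "z \<in> H" for z
    using same[OF that, of "Ln (exp z)"] by (simp add: \<psi>_def)
  have contB: "continuous_on B \<psi>"
  proof (rule continuous_at_imp_continuous_on, rule ballI)
    fix w0 assume w0: "w0 \<in> B"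
    \<comment> \<open>\<open>Ln\<close> jumps on the negative axis; near w0 the continuous logarithm
      \<open>?L\<close> may replace it because \<open>\<psi>'\<close> is periodic.\<close>
    let ?L = "\<lambda>w. Ln (w / w0) + Ln w0"
    have w00: "w0 \<noteq> 0" using w0 by (simp add: B_def)
    have "isCont \<psi>' (?L w0)" using \<psi>'(1) openH LnH[OF w0] w00
      by (auto simp: continuous_on_eq_continuous_at)
    moreover have "isCont ?L w0"
    proof (rule isCont_add)
      show "isCont (\<lambda>w. Ln (w / w0)) w0"
        using w00 by (intro isCont_Ln' continuous_intros) auto
    qed simp
    ultimately have c: "isCont (\<lambda>w. \<psi>' (?L w)) w0" by (rule isCont_o2[rotated])
    have "\<forall>\<^sub>F w in nhds w0. w \<in> B" using openB w0 by (simp add: eventually_nhds_in_open)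
    then have "\<forall>\<^sub>F w in nhds w0. \<psi>' (?L w) = \<psi> w"
    proof eventually_elim
      case (elim w)
      then have "exp (?L w) = w" using w00 by (simp add: B_def exp_add)
      moreover have "Re (?L w) = ln (norm w)" using elim w00 by (simp add: B_def norm_divide ln_div)
      then have "?L w \<in> H" using elim by (simp add: H_def B_def)
      ultimately show ?case using \<psi>exp by metis
    qed
    with c show "isCont \<psi> w0" using isCont_cong by fast
  qed
  have gN: "\<psi> \<in> B \<rightarrow> N" using \<psi>'(2) LnH by (simp add: \<psi>_def B_def Pi_iff)
  have g\<psi>: "g (\<psi> w) = w ^ k" if "w \<in> ball 0 1" for w
  proof (cases "w = 0")
    case True then show ?thesis using g[OF D(2)] k by (simp add: \<psi>_def)
  next
    case False
    then show ?thesis using \<psi>'(4)[OF LnH, of w] that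
      by (simp add: \<psi>_def B_def F_def exp_of_nat_mult)
  qed
  have holB: "\<psi> holomorphic_on B"
    by (rule covering_space_lift_is_holomorphic[OF cov openN _ _ _ gN contB])
       (use holg g\<psi> k in \<open>auto simp: N_def B_def intro!: holomorphic_intros elim: holomorphic_on_subset
         simp: power_less_one_iff norm_power\<close>)
  have \<psi>\<xi>: "\<psi> w = \<xi> w" if "w \<in> ball 0 \<epsilon>" for w
  proof (cases "w = 0")
    case False
    then have "Re (Ln w) < ln \<epsilon>" using that \<epsilon>(1) by simp
    then show ?thesis using near0[of "Ln w"] False by (simp add: \<psi>_def)
  qed (simp add: \<psi>_def \<xi>0)
  have hol\<psi>: "\<psi> holomorphic_on ball 0 1"
  proof -
    have "\<psi> holomorphic_on ball 0 \<epsilon>" using \<xi>hol \<psi>\<xi> holomorphic_transform by metis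
    then have "\<psi> holomorphic_on (B \<union> ball 0 \<epsilon>)" using holB openB by (intro holomorphic_on_Un) auto
    moreover have "B \<union> ball 0 \<epsilon> = ball 0 1" using \<epsilon> by (auto simp: B_def)
    ultimately show ?thesis by simp
  qed
  have \<psi>D: "\<psi> w \<in> D" if "w \<in> ball 0 1" for w
    using gN that D by (cases "w = 0") (auto simp: \<psi>_def B_def N_def Pi_iff)
  have \<psi>N: "\<psi> w \<noteq> 0" if "w \<in> ball 0 1" "w \<noteq> 0" for w
    using gN that by (auto simp: B_def N_def Pi_iff)
  have inj: "inj_on \<psi> (ball 0 1)"
  proof (rule inj_onI)
    fix w w' assume w: "w \<in> ball 0 1" "w' \<in> ball 0 1" "\<psi> w = \<psi> w'"
    show "w = w'"
    proof (cases "w = 0 \<or> w' = 0")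
      case True
      then show ?thesis using w \<psi>N by (metis \<psi>_def)
    next
      case False
      let ?c = "\<i> * of_real (Im (Ln (w' / w)))"
      have pw: "w' ^ k = w ^ k" using g\<psi> w by metis
      then have "norm w' ^ k = norm w ^ k" by (metis norm_power)
      then have nw: "norm w' = norm w" using power_eq_imp_eq_base[of "norm w'" k "norm w"] k by simp
      have "exp ?c = exp (Ln (w'/w))"
      proof -
        have "w' / w \<noteq> 0" "norm (w' / w) = 1" using nw False by (auto simp: norm_divide)
        then have "Re (Ln (w' / w)) = 0" by (metis Re_Ln ln_one)
        then show ?thesis by (intro arg_cong[of _ _ exp]) (simp add: complex_eq_iff)
      qed
      then have ec: "exp ?c = w' / w" using False by simp
      have "exp (of_nat k * ?c) = 1"
        unfolding exp_of_nat_mult ec using pw False by (simp add: power_divide)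
      moreover have "\<psi>' (Ln w + ?c) = \<psi>' (Ln w + 0)"
      proof -
        have "\<psi>' (Ln w + ?c) = \<psi> (exp (Ln w + ?c))"
          using LnH[of w] w False by (intro \<psi>exp[symmetric]) (simp add: H_def B_def)
        also have "exp (Ln w + ?c) = w'" using False ec by (simp add: exp_add)
        finally show ?thesis using w False by (simp add: \<psi>_def)
      qed
      ultimately have "\<psi>' (\<zeta>0 + ?c) = \<psi>' (\<zeta>0 + 0)"
        using LnH[of w] w False by (intro shift[OF \<zeta>0H]) (auto simp: B_def)
      then have "\<xi> (exp (\<zeta>0 + ?c)) = \<xi> (exp \<zeta>0)" using near0[of "\<zeta>0 + ?c"] near0[of \<zeta>0] \<zeta>0(1) by simp
      moreover have "exp (\<zeta>0 + ?c) \<in> ball 0 \<epsilon>" "exp \<zeta>0 \<in> ball 0 \<epsilon>"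
        using \<zeta>0(1) by (intro exp_ball; simp)+
      ultimately have "exp (\<zeta>0 + ?c) = exp \<zeta>0" using \<xi>\<epsilon>(2) by metis
      then have "exp ?c = 1" by (simp add: exp_add)
      then show ?thesis using ec False by (simp add: divide_eq_eq)
    qed
  qed
  have opim: "open (\<psi> ` ball 0 1)" by (rule open_mapping_thm3[OF hol\<psi> _ inj]) auto
  have clim: "open (D - \<psi> ` ball 0 1)"
  proof (subst open_subopen, clarify)
    fix v assume v: "v \<in> D" "v \<notin> \<psi> ` ball 0 1"
    obtain t where t: "norm (g v) < t" "t < 1" using dense im[OF v(1)] by blast
    \<comment> \<open>Since g(\<psi> w) = w^k, points of the image with |g| < t come from |w| < s;
      so only a compact piece of the image has to be removed.\<close>
    define s where "s = root k t"
    have t0: "t > 0" using t(1) by (meson le_less_trans norm_ge_zero)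
    have s: "0 < s" "s < 1" "s ^ k = t" using t t0 k by (auto simp: s_def)
    have "compact (\<psi> ` cball 0 s)"
      using s by (intro compact_continuous_image continuous_on_subset[OF holomorphic_on_imp_continuous_on[OF hol\<psi>]]) auto
    moreover have "open (D \<inter> (\<lambda>v. norm (g v)) -` {..<t})"
      using contg D by (intro continuous_open_preimage continuous_intros) auto
    ultimately have "open ((D \<inter> (\<lambda>v. norm (g v)) -` {..<t}) - \<psi> ` cball 0 s)" (is "open ?T")
      by (simp add: compact_imp_closed open_Diff)
    moreover have "v \<in> ?T" using v t s by auto
    moreover have "?T \<subseteq> D - \<psi> ` ball 0 1"
    proof clarsimp
      fix w assume w: "norm (g (\<psi> w)) < t" "\<psi> w \<notin> \<psi> ` cball 0 s" "norm w < 1"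
      then have "norm w ^ k < s ^ k" using g\<psi>[of w] s by (simp add: norm_power)
      then have "norm w < s" using s by (meson less_eq_real_def power_less_imp_less_base)
      then show False using w by auto
    qed
    ultimately show "\<exists>T. open T \<and> v \<in> T \<and> T \<subseteq> D - \<psi> ` ball 0 1" by blast
  qed
  \<comment> \<open>A part of D missed by \<psi> cannot contain 0. On it |g| would attain a nonzero
    minimum by properness, although g is open there and therefore takes smaller values too.\<close>
  have surj: "\<psi> ` ball 0 1 = D"
  proof (rule ccontr)
    assume "\<psi> ` ball 0 1 \<noteq> D"
    then obtain v1 where v1: "v1 \<in> D - \<psi> ` ball 0 1" using \<psi>D by blast
    define Z where "Z = {v \<in> D. norm (g v) \<le> norm (g v1)} - \<psi> ` ball 0 1"
    have "compact Z" unfolding Z_def using proper[of "norm (g v1)"] im v1 opim by (intro compact_diff) auto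
    moreover have "v1 \<in> Z" using v1 by (simp add: Z_def)
    moreover have "continuous_on Z (\<lambda>v. norm (g v))"
      using contg by (intro continuous_intros) (auto simp: Z_def elim: continuous_on_subset)
    ultimately obtain v2 where v2: "v2 \<in> Z" "\<And>v. v \<in> Z \<Longrightarrow> norm (g v2) \<le> norm (g v)"
      using continuous_attains_inf[of Z] by blast
    have "0 \<in> \<psi> ` ball 0 1" by (rule image_eqI[of _ _ 0]) (auto simp: \<psi>_def)
    then have v2N: "v2 \<in> N" using v2(1) by (auto simp: Z_def N_def)
    have v2': "v2 \<in> D - \<psi> ` ball 0 1" using v2(1) by (simp add: Z_def)
    have "g holomorphic_on (D - \<psi> ` ball 0 1)" using holg by (rule holomorphic_on_subset) auto
    then obtain r where r: "r > 0" "ball v2 r \<subseteq> D - \<psi> ` ball 0 1" "open (g ` ball v2 r)"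
      using has_complex_derivative_locally_invertible[OF _ v2' clim] der v2N by (metis N_def)
    then obtain e where e: "e > 0" "ball (g v2) e \<subseteq> g ` ball v2 r"
      by (metis centre_in_ball image_eqI open_contains_ball)
    define m where "m = min (1/2) (e / (2 * norm (g v2)))"
    have gv2: "g v2 \<noteq> 0" using g0 v2N by blast
    have m: "m > 0" "m \<le> 1/2" "m * norm (g v2) < e"
    proof -
      show "m > 0" "m \<le> 1/2" using e gv2 by (auto simp: m_def)
      have "m * norm (g v2) \<le> e / (2 * norm (g v2)) * norm (g v2)"
        by (intro mult_right_mono) (auto simp: m_def)
      then show "m * norm (g v2) < e" using gv2 e by simp
    qed
    have "(1 - of_real m) * g v2 \<in> ball (g v2) e"
      using m by (simp add: dist_norm algebra_simps norm_mult)
    then obtain v where v: "v \<in> ball v2 r" "g v = (1 - of_real m) * g v2" using e by auto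
    have "1 - complex_of_real m = of_real (1 - m)" by simp
    then have "norm (1 - complex_of_real m) = 1 - m" using m by (simp only: norm_of_real)
    then have "norm (g v) = (1 - m) * norm (g v2)" using v by (simp add: norm_mult)
    also have "\<dots> < 1 * norm (g v2)" using m gv2 by (intro mult_strict_right_mono) auto
    finally have lt: "norm (g v) < norm (g v2)" by simp
    moreover have "norm (g v2) \<le> norm (g v1)" using v2(1) by (simp add: Z_def)
    ultimately have "v \<in> Z" using v r(2) by (auto simp: Z_def)
    then show False using v2(2)[of v] lt by simp
  qed
  obtain \<phi> where \<phi>: "\<phi> holomorphic_on (\<psi> ` ball 0 1)" "\<And>z. z \<in> ball 0 1 \<Longrightarrow> \<phi> (\<psi> z) = z"
    by (rule holomorphic_has_inverse[OF hol\<psi> open_ball inj]) (rule that)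
  show ?thesis
  proof (rule that[of \<phi>])
    show "\<phi> holomorphic_on D" using \<phi>(1) surj by simp
    have eq: "\<psi> (\<phi> v) = v" "\<phi> v \<in> ball 0 1" if "v \<in> D" for v
      using that \<phi>(2) unfolding surj[symmetric] by auto
    show "inj_on \<phi> D" using eq by (metis inj_onI)
    show "\<phi> ` D = ball 0 1"
    proof
      show "ball 0 1 \<subseteq> \<phi> ` D" using \<phi>(2) \<psi>D by (metis image_eqI subsetI)
    qed (use eq in auto)
    show "\<phi> 0 = 0" using \<phi>(2)[of 0] by (simp add: \<psi>_def)
    show "\<phi> v ^ k = g v" if "v \<in> D" for v using g\<psi>[of "\<phi> v"] eq[OF that] by simp
  qed
qed

section \<open>The exterior map of a polynomial preimage\<close>

text \<open>The branch of sqrt(x^2 - 1) that is analytic off [-1, 1] and behaves like x at infinity.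
  \<open>csqrt (x\<^sup>2 - 1)\<close> would be cut along the imaginary axis as well.\<close>

definition joukowski_sqrt :: "complex \<Rightarrow> complex" where
  "joukowski_sqrt x = x * csqrt (1 - 1 / x\<^sup>2)"

abbreviation unit_segment :: "complex set" where
  "unit_segment \<equiv> complex_of_real ` {-1..1}"

lemma csqrt_arg_notin_nonpos_Reals:
  assumes "x \<notin> unit_segment"
  shows "1 - 1 / x\<^sup>2 \<notin> \<real>\<^sub>\<le>\<^sub>0" "x \<noteq> 0"
proof -
  show x0: "x \<noteq> 0" using assms by (auto intro: rev_image_eqI[of 0])
  show "1 - 1 / x\<^sup>2 \<notin> \<real>\<^sub>\<le>\<^sub>0"
  proof
    assume "1 - 1 / x\<^sup>2 \<in> \<real>\<^sub>\<le>\<^sub>0"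
    then obtain r where r: "r \<le> 0" "1 - 1 / x\<^sup>2 = of_real r" by (auto simp: nonpos_Reals_def)
    then have "1 / x\<^sup>2 = of_real (1 - r)" by (simp add: algebra_simps)
    moreover have "complex_of_real (1 - r) \<noteq> 0" using r by (simp del: of_real_diff)
    ultimately have "x\<^sup>2 = of_real (1 / (1 - r))" using x0 by (simp add: field_simps del: of_real_diff)
    also have "\<dots> = (of_real (sqrt (1 / (1 - r))))\<^sup>2"
      using r by (metis of_real_power real_sqrt_pow2 divide_nonneg_nonneg zero_le_one diff_ge_0_iff_ge order.trans)
    finally have "x = of_real (sqrt (1 / (1 - r))) \<or> x = of_real (- sqrt (1 / (1 - r)))"
      by (simp add: power2_eq_iff)
    moreover have "0 \<le> sqrt (1 / (1 - r))" "sqrt (1 / (1 - r)) \<le> 1" using r by auto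
    ultimately have "x = of_real (sqrt (1 / (1 - r))) \<and> sqrt (1 / (1 - r)) \<in> {-1..1} \<or>
        x = of_real (- sqrt (1 / (1 - r))) \<and> - sqrt (1 / (1 - r)) \<in> {-1..1}"
      unfolding atLeastAtMost_iff by linarith
    then show False using assms by blast
  qed
qed

text \<open>The sum and the difference of x and the root are reciprocal. The sum is the larger one
  in modulus because the principal root c of 1 - 1/x^2 has positive real part, which gives |1 - c| <
  |1 + c|.\<close>

lemma joukowski_sqrt:
  assumes "x \<notin> unit_segment"
  shows joukowski_sqrt_sq: "(joukowski_sqrt x)\<^sup>2 = x\<^sup>2 - 1"
    and joukowski_sqrt_mult: "(x + joukowski_sqrt x) * (x - joukowski_sqrt x) = 1"
    and norm_joukowski_sqrt_gt_1: "norm (x + joukowski_sqrt x) > 1"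
proof -
  note x = csqrt_arg_notin_nonpos_Reals[OF assms]
  let ?c = "csqrt (1 - 1 / x\<^sup>2)"
  have "x\<^sup>2 * (1 - 1 / x\<^sup>2) = x\<^sup>2 - 1" using x(2) by (simp add: field_simps)
  then show 1: "(joukowski_sqrt x)\<^sup>2 = x\<^sup>2 - 1" by (simp add: joukowski_sqrt_def power_mult_distrib)
  show 2: "(x + joukowski_sqrt x) * (x - joukowski_sqrt x) = 1"
    using 1 by (simp add: algebra_simps power2_eq_square)
  have "Re ?c > 0"
  proof (rule ccontr)
    assume "\<not> Re ?c > 0"
    then have "Re ?c = 0" using csqrt_principal[of "1 - 1 / x\<^sup>2"] by linarith
    then have "?c\<^sup>2 = of_real (- ((Im ?c)\<^sup>2))" by (simp add: complex_eq_iff power2_eq_square)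
    then have "1 - 1 / x\<^sup>2 = of_real (- ((Im ?c)\<^sup>2))" by simp
    then show False using x(1) by (metis neg_le_0_iff_le nonpos_Reals_of_real_iff zero_le_power2)
  qed
  moreover have "(norm (1 + z))\<^sup>2 = (norm (1 - z))\<^sup>2 + 4 * Re z" for z :: complex
    unfolding cmod_power2 by (simp add: power2_eq_square algebra_simps)
  ultimately have "(norm (1 - ?c))\<^sup>2 < (norm (1 + ?c))\<^sup>2" by (metis less_add_same_cancel1 zero_less_mult_iff zero_less_numeral)
  then have "norm (1 - ?c) < norm (1 + ?c)" by (rule power_less_imp_less_base) simp
  then have "norm x * norm (1 - ?c) < norm x * norm (1 + ?c)" using x(2) by simp
  moreover have "x - joukowski_sqrt x = x * (1 - ?c)" "x + joukowski_sqrt x = x * (1 + ?c)"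
    by (simp_all add: joukowski_sqrt_def algebra_simps)
  ultimately have less: "norm (x - joukowski_sqrt x) < norm (x + joukowski_sqrt x)"
    by (simp add: norm_mult)
  have eq: "norm (x + joukowski_sqrt x) * norm (x - joukowski_sqrt x) = 1"
    by (metis 2 norm_mult norm_one)
  show "norm (x + joukowski_sqrt x) > 1"
  proof (rule ccontr)
    assume le: "\<not> norm (x + joukowski_sqrt x) > 1"
    then have "norm (x + joukowski_sqrt x) * norm (x - joukowski_sqrt x) \<le> 1 * norm (x - joukowski_sqrt x)"
      by (intro mult_right_mono) auto
    then show False using eq less le by linarith
  qed
qed

lemma holomorphic_on_joukowski_sqrt [holomorphic_intros]:
  assumes "f holomorphic_on S" "\<And>z. z \<in> S \<Longrightarrow> f z \<notin> unit_segment"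
  shows "(\<lambda>z. joukowski_sqrt (f z)) holomorphic_on S"
  unfolding joukowski_sqrt_def
  using csqrt_arg_notin_nonpos_Reals[OF assms(2)]
  by (intro holomorphic_intros assms) auto

lemma joukowski_sqrt_asymp: "((\<lambda>x. joukowski_sqrt x / x) \<longlongrightarrow> 1) at_infinity"
proof -
  have "((\<lambda>x::complex. 1 - inverse x * inverse x) \<longlongrightarrow> 1 - 0 * 0) at_infinity"
    by (intro tendsto_intros tendsto_inverse_0)
  then have "((\<lambda>x::complex. 1 - 1 / x\<^sup>2) \<longlongrightarrow> 1) at_infinity"
    by (simp add: field_simps power2_eq_square)
  moreover have "isCont csqrt 1" by (intro continuous_at_csqrt) auto
  ultimately have "((\<lambda>x. csqrt (1 - 1 / x\<^sup>2)) \<longlongrightarrow> csqrt 1) at_infinity"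
    by (rule isCont_tendsto_compose[rotated])
  moreover have "\<forall>\<^sub>F x in at_infinity. csqrt (1 - 1 / x\<^sup>2) = joukowski_sqrt x / x"
    using eventually_not_equal_at_infinity[of 0] by eventually_elim (simp add: joukowski_sqrt_def)
  ultimately show ?thesis using tendsto_cong by force
qed

lemma polynomial_preimage_compact:
  fixes R :: "complex poly"
  assumes "degree R > 0" "compact C"
  shows "compact {u. poly R u \<in> C}"
proof -
  have "compact {z. (\<Sum>i\<le>degree R. coeff R i * z ^ i) \<in> C}"
    by (rule proper_map_polyfun_univ[where i="degree R"]) (use assms in auto)
  then show ?thesis by (simp add: poly_altdef)
qed

text \<open>The level sets of |h| are ellipses with foci \<plusminus>1. The left side makes sense
  for every x, also on the segment, so the size of h can be controlled without a branch.\<close>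

lemma norm_joukowski_ellipse:
  fixes h :: complex
  assumes "h \<noteq> 0" "x = (h + 1 / h) / 2"
  shows "norm (x - 1) + norm (x + 1) = norm h + 1 / norm h"
proof -
  have 1: "x - 1 = (h - 1)\<^sup>2 / (2 * h)" "x + 1 = (h + 1)\<^sup>2 / (2 * h)"
    using assms by (simp_all add: field_simps power2_eq_square)
  have "(norm (h - 1))\<^sup>2 + (norm (h + 1))\<^sup>2 = 2 * (norm h)\<^sup>2 + 2"
    by (simp add: cmod_power2) (simp add: power2_eq_square algebra_simps)
  then have "((norm (h - 1))\<^sup>2 + (norm (h + 1))\<^sup>2) / (2 * norm h) = norm h + 1 / norm h"
    using assms(1) by (simp add: field_simps power2_eq_square)
  then show ?thesis unfolding 1
    by (simp add: norm_divide norm_mult norm_power add_divide_distrib)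
qed

text \<open>The root theorem is applied at infinity in the coordinate v = 1 / (u - c), to g = 1 / (R
  + sqrt(R^2 - 1)), which vanishes to order k at v = 0.\<close>

lemma polynomial_preimage_exterior_map:
  fixes R :: "complex poly"
  defines "b \<equiv> lead_coeff R" and "k \<equiv> degree R"
  defines "K \<equiv> {u. poly R u \<in> unit_segment}"
  assumes k: "k > 0" and crit: "\<And>u. u \<notin> K \<Longrightarrow> poly (pderiv R) u \<noteq> 0"
  obtains f \<gamma> where "f holomorphic_on - K" "inj_on f (- K)"
    "f ` (- K) = {w. (2 * norm b) powr (- 1 / real k) < norm w}"
    "\<And>u. u \<notin> K \<Longrightarrow> f u ^ k = (poly R u + joukowski_sqrt (poly R u)) / (2 * b)"
    "((\<lambda>u. f u - u) \<longlongrightarrow> \<gamma>) at_infinity"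
proof -
  have b0: "b \<noteq> 0" using k by (auto simp: b_def k_def)
  have cptK: "compact K"
    unfolding K_def using k
    by (intro polynomial_preimage_compact compact_continuous_image continuous_intros) (auto simp: k_def)
  \<comment> \<open>A root c of R lies in K, since 0 is in the segment; hence 1 / (u - c) is finite
    on all of - K.\<close>
  obtain c where c: "poly R c = 0" 
    using k alg_closed_imp_poly_has_root[of R] by (auto simp: k_def)
  have cK: "c \<in> K" unfolding K_def using c by (auto intro: rev_image_eqI[of 0])
  define D where "D = {v. v = 0 \<or> c + 1 / v \<notin> K}"
  \<comment> \<open>v^k R(c + 1/v) is a polynomial in v with value b at 0; through it g becomes v^k
    q with q holomorphic at v = 0 too.\<close>
  define r where "r = reflect_poly (R \<circ>\<^sub>p [:c, 1:])"
  have rv: "poly r v = v ^ k * poly R (c + 1 / v)" if "v \<noteq> 0" for v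
    using that by (simp add: r_def poly_reflect_poly_nz poly_pcompose k_def inverse_eq_divide degree_pcompose)
  have r0: "poly r 0 = b"
    using lead_coeff_comp[of "[:c, 1:]" R] by (simp add: r_def b_def)
  define q where "q = (\<lambda>v. 1 / (poly r v * (1 + csqrt (1 - (v ^ k / poly r v)\<^sup>2))))"
  define g where "g = (\<lambda>v. v ^ k * q v)"
  have D0: "0 \<in> D" by (simp add: D_def)
  have Dx: "poly R (c + 1 / v) \<notin> unit_segment" if "v \<in> D" "v \<noteq> 0" for v
    using that by (auto simp: D_def K_def)
  have Dr: "poly r v \<noteq> 0" "1 - (v ^ k / poly r v)\<^sup>2 \<notin> \<real>\<^sub>\<le>\<^sub>0" if "v \<in> D" for v
  proof -
    have "poly r v \<noteq> 0 \<and> 1 - (v ^ k / poly r v)\<^sup>2 \<notin> \<real>\<^sub>\<le>\<^sub>0"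
    proof (cases "v = 0")
      case False
      let ?x = "poly R (c + 1 / v)"
      have "(v ^ k / poly r v)\<^sup>2 = 1 / ?x\<^sup>2" using False by (simp add: rv power_divide power_mult_distrib)
      then show ?thesis using csqrt_arg_notin_nonpos_Reals[OF Dx[OF that False]] rv[OF False] False by simp
    qed (use r0 b0 k in \<open>auto simp: power_0_left\<close>)
    then show "poly r v \<noteq> 0" "1 - (v ^ k / poly r v)\<^sup>2 \<notin> \<real>\<^sub>\<le>\<^sub>0" by auto
  qed
  have csq: "1 + csqrt z \<noteq> 0" for z
  proof
    assume "1 + csqrt z = 0"
    then have "csqrt z = -1" by (simp add: add_eq_0_iff)
    then show False using Re_csqrt[of z] by simp
  qed
  have openD: "open D"
  proof -
    obtain M where M: "M > 0" "\<And>u. u \<in> K \<Longrightarrow> norm u \<le> M"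
      using compact_imp_bounded[OF cptK] bounded_pos by metis
    have "D = ((- {0}) \<inter> (\<lambda>v. c + 1 / v) -` (- K)) \<union> ball 0 (1 / (M + norm c))"
    proof -
      have "c + 1 / v \<notin> K" if "v \<noteq> 0" "norm v < 1 / (M + norm c)" for v
      proof
        assume "c + 1 / v \<in> K"
        then have "norm (1 / v) \<le> M + norm c"
          using M(2)[of "c + 1 / v"] norm_triangle_ineq4[of "c + 1 / v" c] by simp
        moreover have "norm (1 / v) > M + norm c"
          using that M(1) by (simp add: norm_divide field_simps add_pos_nonneg)
        ultimately show False by simp
      qed
      moreover have "M + norm c > 0" using M(1) by (simp add: add_pos_nonneg)
      ultimately show ?thesis by (auto simp: D_def)
    qed
    moreover have "open ((- {0}) \<inter> (\<lambda>v. c + 1 / v) -` (- K))"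
      using cptK by (intro continuous_open_preimage continuous_intros) (auto simp: compact_imp_closed open_Compl)
    ultimately show ?thesis by auto
  qed
  have qhol: "q holomorphic_on D"
    unfolding q_def using Dr csq by (intro holomorphic_intros) auto
  have q0: "q v \<noteq> 0" if "v \<in> D" for v using Dr[OF that] csq by (simp add: q_def)
  have gx: "g v = 1 / (poly R (c + 1 / v) + joukowski_sqrt (poly R (c + 1 / v)))"
    if "v \<in> D" "v \<noteq> 0" for v
  proof -
    let ?x = "poly R (c + 1 / v)"
    have sq: "(v ^ k / poly r v)\<^sup>2 = 1 / ?x\<^sup>2" using that by (simp add: rv power_divide power_mult_distrib)
    then have "g v = v ^ k * (1 / (v ^ k * ?x * (1 + csqrt (1 - 1 / ?x\<^sup>2))))"
      unfolding g_def q_def sq unfolding rv[OF that(2)] by simp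
    also have "\<dots> = 1 / (?x * (1 + csqrt (1 - 1 / ?x\<^sup>2)))" using that by simp
    finally show ?thesis by (simp add: joukowski_sqrt_def distrib_left)
  qed
  have ge: "norm (poly R (c + 1 / v) - 1) + norm (poly R (c + 1 / v) + 1) = norm (g v) + 1 / norm (g v)"
    and gJ: "2 * poly R (c + 1 / v) = g v + 1 / g v" and g1: "norm (g v) < 1" and gn0: "g v \<noteq> 0"
    if "v \<in> D" "v \<noteq> 0" for v
  proof -
    let ?x = "poly R (c + 1 / v)"
    note j = joukowski_sqrt[OF Dx[OF that]]
    have "?x + joukowski_sqrt ?x \<noteq> 0" using j(2) by auto
    then show "g v \<noteq> 0" using gx[OF that] by simp
    have "?x - joukowski_sqrt ?x = g v"
      unfolding gx[OF that] using j(2) \<open>?x + joukowski_sqrt ?x \<noteq> 0\<close>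
      by (metis nonzero_mult_div_cancel_left)
    then show J: "2 * ?x = g v + 1 / g v" using gx[OF that] by (simp add: algebra_simps)
    show "norm (?x - 1) + norm (?x + 1) = norm (g v) + 1 / norm (g v)"
      by (rule norm_joukowski_ellipse[OF \<open>g v \<noteq> 0\<close>]) (use J in \<open>simp add: field_simps\<close>)
    show "norm (g v) < 1" unfolding gx[OF that] norm_divide using j(3) by (simp add: divide_less_eq)
  qed
  have g0: "g 0 = 0" using k by (simp add: g_def)
  have holg: "g holomorphic_on D" unfolding g_def by (intro holomorphic_intros qhol)
  obtain \<phi> where \<phi>: "\<phi> holomorphic_on D" "inj_on \<phi> D" "\<phi> ` D = ball 0 1" "\<phi> 0 = 0"
    "\<And>v. v \<in> D \<Longrightarrow> \<phi> v ^ k = g v"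
  proof (rule root_of_totally_ramified_proper_map[OF openD D0 k qhol q0])
    show "norm (g v) < 1" if "v \<in> D" for v using g1[OF that] g0 by (cases "v = 0") auto
    \<comment> \<open>Differentiating 2 R = g + 1/g turns a zero of g' into a zero of R' outside
      K.\<close>
    show "deriv g v \<noteq> 0" if v: "v \<in> D - {0}" for v
    proof
      assume d0: "deriv g v = 0"
      have "(g has_field_derivative deriv g v) (at v)"
        using holg openD v holomorphic_derivI by blast
      then have "((\<lambda>v. g v + 1 / g v) has_field_derivative 0) (at v)"
        using gn0[of v] v d0 by (auto intro!: derivative_eq_intros)
      moreover have "\<forall>\<^sub>F z in nhds v. z \<in> D - {0}"
        using v openD by (intro eventually_nhds_in_open) auto
      then have "\<forall>\<^sub>F z in nhds v. 2 * poly R (c + 1 / z) = g z + 1 / g z"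
        by eventually_elim (use gJ in auto)
      ultimately have "((\<lambda>z. 2 * poly R (c + 1 / z)) has_field_derivative 0) (at v)"
        by (subst DERIV_cong_ev[OF refl _ refl])
      moreover have "((\<lambda>z. 2 * poly R (c + 1 / z)) has_field_derivative
          2 * (poly (pderiv R) (c + 1 / v) * (- 1 / v\<^sup>2))) (at v)"
        using v by (auto intro!: derivative_eq_intros poly_DERIV[THEN DERIV_chain2] simp: power2_eq_square)
      ultimately have "2 * (poly (pderiv R) (c + 1 / v) * (- 1 / v\<^sup>2)) = 0"
        using DERIV_unique by blast
      then show False using crit[of "c + 1 / v"] v by (auto simp: D_def)
    qed
    show "compact {v \<in> D. norm (g v) \<le> t}" if t: "t < 1" for t
    proof (cases "t \<le> 0")
      case True
      have "{v \<in> D. norm (g v) \<le> t} \<subseteq> {0}"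
      proof
        fix v assume "v \<in> {v \<in> D. norm (g v) \<le> t}"
        then have "v \<in> D" "norm (g v) \<le> 0" using True by (auto simp del: norm_le_zero_iff)
        then show "v \<in> {0}" using gn0 by auto
      qed
      then show ?thesis by (meson finite.emptyI finite_imp_compact finite_insert finite_subset)
    next
      case False
      \<comment> \<open>|g| \<le> t is the same as |R - 1| + |R + 1| \<ge> \<tau>, because s + 1/s
        decreases on (0, 1). On the segment the sum of distances is 2 < \<tau>, so points of K drop
        out by themselves.\<close>
      define \<tau> where "\<tau> = t + 1 / t"
      have \<tau>: "\<tau> > 2"
      proof -
        have "(1 - t)\<^sup>2 > 0" using t by simp
        then show ?thesis using False by (simp add: \<tau>_def field_simps power2_eq_square)
      qed
      have mono: "s \<le> t \<longleftrightarrow> \<tau> \<le> s + 1 / s" if "0 < s" "s < 1" for s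
      proof -
        have "s + 1 / s - \<tau> = (t - s) * (1 - s * t) / (s * t)"
          using that False by (simp add: \<tau>_def field_simps)
        moreover have "s * t < 1" using that False t by (metis mult_less_cancel_right2 mult.commute mult_strict_mono' less_eq_real_def linorder_not_le mult_1)
        ultimately show ?thesis using that False
          by (smt (verit) divide_nonneg_pos divide_neg_pos mult_nonneg_nonneg mult_neg_pos mult_pos_pos)
      qed
      \<comment> \<open>Multiplying by |v|^k clears the pole at v = 0, so the condition is closed in
        the whole plane.\<close>
      let ?Z = "{v. \<tau> * norm v ^ k \<le> norm (poly r v - v ^ k) + norm (poly r v + v ^ k)}"
      have Z: "v \<in> ?Z \<longleftrightarrow> \<tau> \<le> norm (poly R (c + 1 / v) - 1) + norm (poly R (c + 1 / v) + 1)" if "v \<noteq> 0" for v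
      proof -
        have "norm (poly r v - v ^ k) + norm (poly r v + v ^ k) =
          norm v ^ k * (norm (poly R (c + 1 / v) - 1) + norm (poly R (c + 1 / v) + 1))"
          unfolding rv[OF that] distrib_left norm_power[symmetric] norm_mult[symmetric]
          by (simp add: algebra_simps)
        then show ?thesis using that by (simp add: mult.commute[of \<tau>])
      qed
      have "{v \<in> D. norm (g v) \<le> t} = ?Z"
      proof (intro set_eqI iffI)
        fix v assume v: "v \<in> {v \<in> D. norm (g v) \<le> t}"
        show "v \<in> ?Z"
        proof (cases "v = 0")
          case False
          then show ?thesis using v Z[OF False] ge[of v] g1[of v] gn0[of v] mono[of "norm (g v)"] by simp
        qed (use k in \<open>simp add: power_0_left\<close>)
      next
        fix v assume v: "v \<in> ?Z"
        show "v \<in> {v \<in> D. norm (g v) \<le> t}"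
        proof (cases "v = 0")
          case False
          have "v \<in> D"
          proof (rule ccontr)
            assume "v \<notin> D"
            then obtain s :: real where "s \<in> {-1..1}" "poly R (c + 1 / v) = of_real s"
              using False by (auto simp: D_def K_def)
            then have "norm (poly R (c + 1 / v) - 1) + norm (poly R (c + 1 / v) + 1) = 2"
              by (metis (no_types, lifting) of_real_1 of_real_add of_real_diff norm_of_real
                  abs_of_nonneg abs_of_nonpos add.commute add_diff_cancel atLeastAtMost_iff
                  diff_le_0_iff_le le_add_same_cancel1 minus_diff_eq neg_le_iff_le one_add_one
                  add_diff_eq diff_add_cancel diff_minus_eq_add diff_ge_0_iff_ge)
            then show False using Z[OF False] v \<tau> by simp
          qed
          then show ?thesis using v False Z[OF False] ge[of v] g1[of v] gn0[of v] mono[of "norm (g v)"] by simp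
        qed (use D0 g0 \<open>\<not> t \<le> 0\<close> in auto)
      qed
      moreover have "closed ?Z" by (intro closed_Collect_le continuous_intros)
      moreover have "bounded ?Z"
      proof -
        \<comment> \<open>Large v means u near c, where R is near 0 and the sum of distances is near
          2, below \<tau>.\<close>
        have "isCont (\<lambda>s. norm (poly R (c + s) - 1) + norm (poly R (c + s) + 1)) 0"
          by (intro continuous_intros)
        then have "((\<lambda>s. norm (poly R (c + s) - 1) + norm (poly R (c + s) + 1)) \<longlongrightarrow> 2) (at 0)"
          using c by (simp add: isCont_def)
        then have "\<forall>\<^sub>F s in at 0. norm (poly R (c + s) - 1) + norm (poly R (c + s) + 1) < \<tau>"
          using \<tau> by (rule order_tendstoD)
        then obtain d where d: "d > 0" "\<And>s. s \<noteq> 0 \<Longrightarrow> norm s < d \<Longrightarrow>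
            norm (poly R (c + s) - 1) + norm (poly R (c + s) + 1) < \<tau>"
          by (auto simp: eventually_at)
        have "norm v \<le> 1 / d" if "v \<in> ?Z" for v
        proof (cases "v = 0")
          case False
          then have "\<not> norm (1 / v) < d" using d(2)[of "1 / v"] Z[OF False] that by auto
          then show ?thesis using False d(1) by (simp add: norm_divide field_simps)
        qed (use d in auto)
        then show ?thesis by (meson boundedI)
      qed
      ultimately show ?thesis by (simp add: compact_eq_bounded_closed)
    qed
  qed (auto simp: g_def)
  \<comment> \<open>With this derivative in the numerator, \<kappa> / \<phi> behaves like 1/v, that
    is, like u; the modulus of \<kappa> will be the radius.\<close>
  define \<kappa> where "\<kappa> = deriv \<phi> 0"
  define m where "m = (\<lambda>v. if v = 0 then \<kappa> else \<phi> v / v)"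
  have mhol: "m holomorphic_on D"
    using pole_lemma[OF \<phi>(1), of 0] D0 openD by (simp add: m_def \<kappa>_def \<phi>(4) interior_open cong: if_cong)
  have \<phi>n0: "\<phi> v \<noteq> 0" if "v \<in> D" "v \<noteq> 0" for v
    using \<phi>(2,4) that D0 by (metis inj_onD)
  have mq: "m v ^ k = q v" if "v \<in> D" "v \<noteq> 0" for v
    using \<phi>(5)[OF that(1)] that by (simp add: m_def g_def power_divide)
  have \<kappa>k: "\<kappa> ^ k = 1 / (2 * b)"
  proof -
    have c1: "isCont m 0" "isCont q 0"
      using mhol qhol openD D0 by (auto dest!: holomorphic_on_imp_continuous_on simp: continuous_on_eq_continuous_at)
    have "((\<lambda>v. m v ^ k) \<longlongrightarrow> m 0 ^ k) (at 0)" using c1 by (intro tendsto_intros) (simp add: isCont_def)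
    moreover have "\<forall>\<^sub>F v in at 0. m v ^ k = q v"
    proof -
      have "\<forall>\<^sub>F v in at 0. v \<in> D" using openD D0 by (intro eventually_at_in_open') auto
      then show ?thesis using eventually_neq_at_within[of 0] by eventually_elim (use mq in auto)
    qed
    ultimately have "(q \<longlongrightarrow> m 0 ^ k) (at 0)" using tendsto_cong by fast
    moreover have "(q \<longlongrightarrow> q 0) (at 0)" using c1 by (simp add: isCont_def)
    ultimately have "m 0 ^ k = q 0" using tendsto_unique by (metis at_neq_bot)
    then show ?thesis using k by (simp add: m_def q_def r0)
  qed
  define \<rho> where "\<rho> = (2 * norm b) powr (- 1 / real k)"
  have \<rho>0: "\<rho> > 0" using b0 by (simp add: \<rho>_def)
  have \<kappa>0: "\<kappa> \<noteq> 0" using \<kappa>k b0 k by (auto simp: power_0_left)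
  have \<kappa>\<rho>: "norm \<kappa> = \<rho>"
  proof (rule power_eq_imp_eq_base[of _ k])
    have "\<rho> ^ k = (2 * norm b) powr (- 1 / real k * real k)"
      unfolding \<rho>_def powr_powr[symmetric] using b0 by (subst powr_realpow) auto
    also have "\<dots> = (2 * norm b) powr (-1)" using k by simp
    also have "\<dots> = 1 / (2 * norm b)" using b0 by (simp add: powr_minus inverse_eq_divide)
    finally show "norm \<kappa> ^ k = \<rho> ^ k" using \<kappa>k by (simp add: norm_power[symmetric] norm_divide norm_mult)
  qed (use \<rho>0 k in auto)
  define f where "f = (\<lambda>u. \<kappa> / \<phi> (1 / (u - c)))"
  have inD: "1 / (u - c) \<in> D" "1 / (u - c) \<noteq> 0" "u \<noteq> c" if "u \<notin> K" for u
    using that cK by (auto simp: D_def)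
  have outD: "c + 1 / v \<notin> K" "f (c + 1 / v) = \<kappa> / \<phi> v" if "v \<in> D" "v \<noteq> 0" for v
    using that by (auto simp: D_def f_def)
  show ?thesis
  proof (rule that[of f])
    have "(\<lambda>u. \<phi> (1 / (u - c))) holomorphic_on - K"
      by (rule holomorphic_on_compose_gen[of "\<lambda>u. 1 / (u - c)" _ \<phi> D, unfolded o_def])
         (use inD \<phi>(1) in \<open>auto intro!: holomorphic_intros\<close>)
    then show "f holomorphic_on - K"
      unfolding f_def using inD \<phi>n0 by (intro holomorphic_intros) auto
    show "inj_on f (- K)"
    proof (rule inj_onI)
      fix x y assume xy: "x \<in> - K" "y \<in> - K" "f x = f y"
      then have "\<phi> (1 / (x - c)) = \<phi> (1 / (y - c))"
        using \<kappa>0 \<phi>n0 inD by (simp add: f_def)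
      then have "1 / (x - c) = 1 / (y - c)" using \<phi>(2) inD xy by (metis ComplD inj_onD)
      then show "x = y" using inD xy by (auto simp: field_simps)
    qed
    show "f ` (- K) = {w. (2 * norm b) powr (- 1 / real k) < norm w}"
    proof (intro equalityI subsetI)
      fix w :: complex assume "w \<in> f ` (- K)"
      then obtain u where u: "u \<notin> K" "w = f u" by auto
      then have "\<phi> (1 / (u - c)) \<in> ball 0 1" "\<phi> (1 / (u - c)) \<noteq> 0" using \<phi>(3) \<phi>n0 inD by blast+
      then show "w \<in> {w. (2 * norm b) powr (- 1 / real k) < norm w}"
        unfolding u(2) using \<kappa>\<rho> \<rho>0 by (simp add: f_def norm_divide field_simps \<rho>_def)
    next
      fix w :: complex assume "w \<in> {w. (2 * norm b) powr (- 1 / real k) < norm w}"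
      then have w: "\<rho> < norm w" by (simp add: \<rho>_def)
      then have "w \<noteq> 0" using \<rho>0 by auto
      have "\<kappa> / w \<in> ball 0 1" using w \<kappa>\<rho> \<rho>0 by (simp add: norm_divide divide_less_eq)
      then obtain v where v: "v \<in> D" "\<phi> v = \<kappa> / w" using \<phi>(3) by (metis imageE)
      have "v \<noteq> 0" using v \<phi>(4) \<kappa>0 \<open>w \<noteq> 0\<close> by auto
      then show "w \<in> f ` (- K)"
        using outD[OF v(1)] v(2) \<kappa>0 by (intro image_eqI[of _ _ "c + 1 / v"]) auto
    qed
    show "f u ^ k = (poly R u + joukowski_sqrt (poly R u)) / (2 * b)" if "u \<notin> K" for u
      using \<phi>(5)[OF inD(1)[OF that]] gx[OF inD(1,2)[OF that]] \<kappa>k that inD[OF that]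
      by (simp add: f_def power_divide)
    show "((\<lambda>u. f u - u) \<longlongrightarrow> deriv (\<lambda>v. \<kappa> / m v) 0 - c) at_infinity"
    proof -
      \<comment> \<open>f u - u is the difference quotient of \<open>?M\<close> at 0 minus c,
        because \<open>?M 0\<close> is 1 and u = c + 1/v.\<close>
      let ?M = "\<lambda>v. \<kappa> / m v"
      have "?M holomorphic_on D" using mhol \<phi>n0 \<kappa>0 by (intro holomorphic_intros) (auto simp: m_def)
      then have "(?M has_field_derivative deriv ?M 0) (at 0)" using D0 openD holomorphic_derivI by blast
      then have "((\<lambda>v. (?M v - ?M 0) / (v - 0)) \<longlongrightarrow> deriv ?M 0) (at 0)"
        by (simp add: has_field_derivative_iff)
      moreover have "filterlim (\<lambda>u. 1 / (u - c)) (at 0) at_infinity"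
      proof (rule filterlim_atI)
        have "filterlim (\<lambda>u. u - c) at_infinity at_infinity"
          using tendsto_add_filterlim_at_infinity'[OF filterlim_ident tendsto_const[of "-c"]] by simp
        then show "((\<lambda>u. 1 / (u - c)) \<longlongrightarrow> 0) at_infinity"
          using tendsto_inverse_0 filterlim_compose by (fastforce simp: inverse_eq_divide[symmetric])
        show "\<forall>\<^sub>F u in at_infinity. 1 / (u - c) \<noteq> 0"
          using eventually_not_equal_at_infinity[of c] by eventually_elim auto
      qed
      ultimately have "((\<lambda>u. (?M (1 / (u - c)) - ?M 0) / (1 / (u - c) - 0)) \<longlongrightarrow> deriv ?M 0) at_infinity"
        by (rule filterlim_compose)
      then have "((\<lambda>u. (?M (1 / (u - c)) - ?M 0) / (1 / (u - c) - 0) - c) \<longlongrightarrow> deriv ?M 0 - c) at_infinity"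
        by (intro tendsto_intros)
      moreover have "\<forall>\<^sub>F u in at_infinity. (?M (1 / (u - c)) - ?M 0) / (1 / (u - c) - 0) - c = f u - u"
        using eventually_not_equal_at_infinity[of c]
      proof eventually_elim
        case (elim u)
        define v where "v = 1 / (u - c)"
        have v: "v \<noteq> 0" "u = c + 1 / v" using elim by (simp_all add: v_def)
        have "(?M v - ?M 0) / (v - 0) - c = f u - u"
          using v \<kappa>0 by (simp add: m_def f_def diff_divide_distrib)
        then show ?case by (simp only: v_def)
      qed
      ultimately show ?thesis using tendsto_cong by force
    qed
  qed
qed

section \<open>Conformal maps onto the exterior of a disc\<close>

lemma bounded_imp_filterlim_at_infinity:
  fixes f :: "complex \<Rightarrow> complex"
  assumes "((\<lambda>u. f u - u) \<longlongrightarrow> \<gamma>) at_infinity"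
  shows filterlim_at_infinity_of_diff_tendsto: "filterlim f at_infinity at_infinity"
    and ratio_tendsto_1_of_diff_tendsto: "((\<lambda>u. f u / u) \<longlongrightarrow> 1) at_infinity"
proof -
  have "filterlim (\<lambda>u. (f u - u) + u) at_infinity at_infinity"
    by (rule tendsto_add_filterlim_at_infinity[OF assms filterlim_ident])
  then show "filterlim f at_infinity at_infinity" by simp
  have "((\<lambda>u. (f u - u) * inverse u + 1) \<longlongrightarrow> \<gamma> * 0 + 1) at_infinity"
    by (intro tendsto_intros assms tendsto_inverse_0)
  moreover have "\<forall>\<^sub>F u in at_infinity. (f u - u) * inverse u + 1 = f u / u"
    using eventually_not_equal_at_infinity[of 0] by eventually_elim (simp add: field_simps)
  ultimately show "((\<lambda>u. f u / u) \<longlongrightarrow> 1) at_infinity" using tendsto_cong by force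
qed

lemma eventually_notin_compact_at_infinity:
  fixes K :: "complex set"
  assumes "compact K"
  shows "\<forall>\<^sub>F u in at_infinity. u \<notin> K"
proof -
  obtain B where "\<And>u. u \<in> K \<Longrightarrow> norm u \<le> B"
    using compact_imp_bounded[OF assms] bounded_iff by metis
  then have "\<forall>u. B + 1 \<le> norm u \<longrightarrow> u \<notin> K" by force
  then show ?thesis unfolding eventually_at_infinity by blast
qed

lemma connected_exterior: "connected {w::complex. t < norm w}"
proof -
  have "{w::complex. t < norm w} = - cball 0 t" by auto
  then show ?thesis by (simp add: connected_complement_bounded_convex)
qed

text \<open>The exterior of a large circle is connected and is covered by the disjoint open images
  of the points outside and inside the circle of radius \<open>B'\<close>. It meets the first image,
  since f tends to infinity, and so misses the second.\<close>

lemma injective_holomorphic_large_values: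
  fixes f :: "complex \<Rightarrow> complex"
  assumes compact: "compact K" and hol: "f holomorphic_on - K" and inj: "inj_on f (- K)"
    and f_at_infinity: "filterlim f at_infinity at_infinity"
    and im: "{w. T0 < norm w} \<subseteq> f ` (- K)"
  shows "\<exists>T. \<forall>u. u \<notin> K \<longrightarrow> T < norm (f u) \<longrightarrow> B < norm u"
proof -
  have open_Compl_K: "open (- K)" using compact by (simp add: compact_imp_closed open_Compl)
  have continuous_f: "continuous_on (- K) f" using hol holomorphic_on_imp_continuous_on by blast
  obtain B0 where B0: "\<And>u. u \<in> K \<Longrightarrow> norm u \<le> B0"
    using compact_imp_bounded[OF compact] bounded_iff by metis
  define B' where "B' = max B (\<bar>B0\<bar> + 1)"
  have sub: "u \<notin> K" if "B' \<le> norm u" for u using B0[of u] that by (auto simp: B'_def)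
  have "compact (f ` sphere 0 B')"
    by (intro compact_continuous_image continuous_on_subset[OF continuous_f]) (use sub in auto)
  then obtain T1 where T1: "\<And>u. norm u = B' \<Longrightarrow> norm (f u) \<le> T1"
    using compact_imp_bounded bounded_iff by (metis (no_types, lifting) imageI mem_sphere_0)
  define T where "T = max T1 T0"
  define Y where "Y = {w::complex. T < norm w}"
  have op: "open (f ` S)" if "open S" "S \<subseteq> - K" for S
    by (rule open_mapping_thm3) (use that hol inj in \<open>auto elim: holomorphic_on_subset inj_on_subset\<close>)
  have o: "open (f ` {u. B' < norm u})" "open (f ` (- K \<inter> {u. norm u < B'}))"
    using sub by (auto intro!: op open_Int open_Compl_K open_Collect_less continuous_intros
        simp: compact_imp_closed[OF compact])
  have cover: "Y \<subseteq> f ` {u. B' < norm u} \<union> f ` (- K \<inter> {u. norm u < B'})"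
  proof
    fix w assume w: "w \<in> Y"
    then have "w \<in> f ` (- K)" using im by (auto simp: Y_def T_def)
    then obtain u where fw: "f u = w" "u \<notin> K" by auto
    have "norm u \<noteq> B'" using T1[of u] w fw by (auto simp: Y_def T_def)
    then consider "B' < norm u" | "norm u < B'" by linarith
    then show "w \<in> f ` {u. B' < norm u} \<union> f ` (- K \<inter> {u. norm u < B'})"
      by cases (use fw in auto)
  qed
  have disj: "f ` {u. B' < norm u} \<inter> f ` (- K \<inter> {u. norm u < B'}) = {}"
  proof (rule ccontr)
    assume "\<not> ?thesis"
    then obtain u v where "B' < norm u" "norm v < B'" "v \<notin> K" "f u = f v" by auto
    then show False using inj sub[of u] by (metis Compl_iff inj_onD less_eq_real_def less_le_not_le)
  qed
  have "\<forall>\<^sub>F u in at_infinity. T < norm (f u)"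
    using f_at_infinity by (simp add: filterlim_at_infinity_conv_norm_at_top filterlim_at_top_dense)
  moreover have "\<forall>\<^sub>F u in at_infinity. B' < norm (u::complex)"
    unfolding eventually_at_infinity by (rule exI[of _ "B' + 1"]) auto
  ultimately have "\<forall>\<^sub>F u in at_infinity. T < norm (f u) \<and> B' < norm u" by eventually_elim auto
  then obtain u where "T < norm (f u)" "B' < norm u"
    using eventually_happens[of _ at_infinity] trivial_limit_at_infinity by (metis (mono_tags, lifting))
  then have ne: "f ` {u. B' < norm u} \<inter> Y \<noteq> {}" by (auto simp: Y_def)
  have "connected Y" unfolding Y_def by (rule connected_exterior)
  then have emp: "f ` (- K \<inter> {u. norm u < B'}) \<inter> Y = {}"
    using connectedD[OF _ o _ cover] disj ne by blast
  have "B < norm u" if "u \<notin> K" "T < norm (f u)" for u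
  proof -
    have "f u \<in> Y" using that by (simp add: Y_def)
    then obtain v where v: "f u = f v" "B' < norm v" using cover emp by blast
    then have "u = v" using inj sub[of v] that by (auto dest: inj_onD)
    then show ?thesis using v by (simp add: B'_def)
  qed
  then show ?thesis by blast
qed

locale exterior_map =
  fixes K :: "complex set" and f :: "complex \<Rightarrow> complex" and \<rho> :: real and \<gamma> :: complex
  assumes compact: "compact K" and \<rho>: "\<rho> > 0"
    and hol: "f holomorphic_on - K" and inj: "inj_on f (- K)"
    and im: "f ` (- K) = {w. \<rho> < norm w}"
    and asymp: "((\<lambda>u. f u - u) \<longlongrightarrow> \<gamma>) at_infinity"
begin

definition inv_map ("\<psi>") where "\<psi> = the_inv_into (- K) f"

text \<open>The filled level sets of the Green function ln(|f| / \<rho>) of - K. The values of f on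
  K are arbitrary; adding K makes the set independent of them.\<close>

definition sublevel :: "real \<Rightarrow> complex set" where
  "sublevel t = K \<union> {u. norm (f u) \<le> t}"

lemma open_Compl_K: "open (- K)"
  using compact by (simp add: compact_imp_closed open_Compl)

lemma norm_f: "u \<notin> K \<Longrightarrow> \<rho> < norm (f u)"
  using im by blast

lemma f_nonzero: "u \<notin> K \<Longrightarrow> f u \<noteq> 0"
  using norm_f \<rho> by force

lemma \<psi>_f: "u \<notin> K \<Longrightarrow> \<psi> (f u) = u"
  using inj by (simp add: inv_map_def the_inv_into_f_f)

lemma f_\<psi>: "\<rho> < norm w \<Longrightarrow> f (\<psi> w) = w"
  using f_the_inv_into_f[OF inj, of w] im by (simp add: inv_map_def)

lemma \<psi>_notin: "\<rho> < norm w \<Longrightarrow> \<psi> w \<notin> K"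
  using the_inv_into_into[OF inj, of w "- K"] im by (simp add: inv_map_def)

lemma holomorphic_\<psi>: "\<psi> holomorphic_on {w. \<rho> < norm w}"
proof -
  obtain g where g: "g holomorphic_on (f ` (- K))" "\<And>z. z \<in> - K \<Longrightarrow> g (f z) = z"
    by (rule holomorphic_has_inverse[OF hol open_Compl_K inj]) (rule that)
  show ?thesis
    by (rule holomorphic_transform[OF g(1)[unfolded im]]) (metis ComplI \<psi>_notin f_\<psi> g(2) mem_Collect_eq)
qed

lemma continuous_\<psi>: "continuous_on {w. \<rho> < norm w} \<psi>"
  using holomorphic_\<psi> holomorphic_on_imp_continuous_on by blast

lemma continuous_f: "continuous_on (- K) f"
  using hol holomorphic_on_imp_continuous_on by blast

lemma \<psi>_image: "\<psi> ` {w. \<rho> < norm w} = - K"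
  using \<psi>_notin \<psi>_f norm_f by force

lemma connected_Compl_K: "connected (- K)"
  unfolding \<psi>_image[symmetric] by (intro connected_continuous_image continuous_\<psi> connected_exterior)

lemma f_at_infinity: "filterlim f at_infinity at_infinity"
  by (rule filterlim_at_infinity_of_diff_tendsto[OF asymp])

lemma \<psi>_large: "\<exists>T. \<forall>w. T < norm w \<longrightarrow> \<rho> < norm w \<and> B < norm (\<psi> w)"
proof -
  obtain T where T: "\<And>u. u \<notin> K \<Longrightarrow> T < norm (f u) \<Longrightarrow> B < norm u"
    using injective_holomorphic_large_values[OF compact hol inj f_at_infinity, of \<rho> B] im by auto
  have "\<rho> < norm w \<and> B < norm (\<psi> w)" if "max T \<rho> < norm w" for w
    using T[of "\<psi> w"] that \<psi>_notin f_\<psi> by simp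
  then show ?thesis by blast
qed

lemma \<psi>_at_infinity: "filterlim \<psi> at_infinity at_infinity"
  unfolding filterlim_at_infinity_conv_norm_at_top filterlim_at_top_dense
proof
  fix B
  obtain T where "\<forall>w. T < norm w \<longrightarrow> B < norm (\<psi> w)" using \<psi>_large by blast
  then have "\<forall>w. T + 1 \<le> norm w \<longrightarrow> B < norm (\<psi> w)" by force
  then show "\<forall>\<^sub>F x in at_infinity. B < norm (\<psi> x)" unfolding eventually_at_infinity by blast
qed

text \<open>Closed in the whole plane, not only in - K: within a bounded region the set is the image
  under \<psi> of a compact annulus, since large |f u| forces u to be large.\<close>

lemma closed_superlevel:
  assumes "\<rho> < t"
  shows "closed {u. u \<notin> K \<and> t \<le> norm (f u)}"
  unfolding closed_def
proof (subst open_subopen, rule ballI)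
  fix u assume "u \<in> - {u. u \<notin> K \<and> t \<le> norm (f u)}"
  then have u: "\<not> (u \<notin> K \<and> t \<le> norm (f u))" by simp
  obtain T where T: "\<And>w. T < norm w \<Longrightarrow> norm u + 1 < norm (\<psi> w)" using \<psi>_large by blast
  let ?A = "{w::complex. t \<le> norm w \<and> norm w \<le> T}"
  have "?A = cball 0 T - ball 0 t" by auto
  then have "compact ?A" by (simp add: compact_diff)
  then have "compact (\<psi> ` ?A)"
    using assms by (intro compact_continuous_image continuous_on_subset[OF continuous_\<psi>]) auto
  then have "open (ball 0 (norm u + 1) - \<psi> ` ?A)" by (simp add: compact_imp_closed open_Diff)
  moreover have "u \<notin> \<psi> ` ?A" using u assms \<psi>_notin f_\<psi> by force
  moreover have "ball 0 (norm u + 1) - \<psi> ` ?A \<subseteq> - {u. u \<notin> K \<and> t \<le> norm (f u)}"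
  proof (rule subsetI, rule ComplI)
    fix v assume v': "v \<in> ball 0 (norm u + 1) - \<psi> ` ?A" and "v \<in> {u. u \<notin> K \<and> t \<le> norm (f u)}"
    then have v: "v \<notin> K" "t \<le> norm (f v)" "norm v < norm u + 1" by auto
    then have "norm (f v) \<le> T" using T[of "f v"] \<psi>_f[of v] by force
    then have "v \<in> \<psi> ` ?A" using v \<psi>_f[of v] by (intro image_eqI[of _ _ "f v"]) auto
    then show False using v' by simp
  qed
  moreover have "u \<in> ball 0 (norm u + 1)" by simp
  ultimately show "\<exists>T. open T \<and> u \<in> T \<and> T \<subseteq> - {u. u \<notin> K \<and> t \<le> norm (f u)}" by blast
qed

lemma sublevel_eq:
  assumes "\<rho> < t"
  shows "- sublevel t = \<psi> ` {w. t < norm w}" "u \<in> sublevel t \<longleftrightarrow> u \<in> K \<or> norm (f u) \<le> t"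
    "\<psi> ` sphere 0 t = {u. u \<notin> K \<and> norm (f u) = t}" "\<psi> ` sphere 0 t \<subseteq> sublevel t"
    "K \<subseteq> sublevel t - \<psi> ` sphere 0 t"
proof -
  show "- sublevel t = \<psi> ` {w. t < norm w}"
  proof (intro equalityI subsetI)
    fix u assume "u \<in> - sublevel t"
    then show "u \<in> \<psi> ` {w. t < norm w}" using \<psi>_f[of u]
      by (intro image_eqI[of _ _ "f u"]) (auto simp: sublevel_def)
  qed (use assms \<psi>_notin f_\<psi> in \<open>auto simp: sublevel_def\<close>)
  show *: "\<psi> ` sphere 0 t = {u. u \<notin> K \<and> norm (f u) = t}"
  proof (intro equalityI subsetI)
    fix u assume "u \<in> {u. u \<notin> K \<and> norm (f u) = t}"
    then show "u \<in> \<psi> ` sphere 0 t" using \<psi>_f[of u]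
      by (intro image_eqI[of _ _ "f u"]) auto
  qed (use assms \<psi>_notin f_\<psi> in auto)
  show "\<psi> ` sphere 0 t \<subseteq> sublevel t" "K \<subseteq> sublevel t - \<psi> ` sphere 0 t"
    unfolding * by (auto simp: sublevel_def)
qed (auto simp: sublevel_def)

lemma open_interior_sublevel:
  assumes "\<rho> < t"
  shows "open (sublevel t - \<psi> ` sphere 0 t)"
proof -
  have "sublevel t - \<psi> ` sphere 0 t = - {u. u \<notin> K \<and> t \<le> norm (f u)}"
    unfolding sublevel_eq[OF assms] by (auto simp: sublevel_def)
  then show ?thesis using closed_superlevel[OF assms] by (simp add: open_Compl)
qed

lemma open_Compl_sublevel:
  assumes "\<rho> < t" shows "open (- sublevel t)"
proof -
  have "- sublevel t = - K \<inter> (\<lambda>u. norm (f u)) -` {t<..}" by (auto simp: sublevel_def)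
  also have "open \<dots>"
    by (intro continuous_open_preimage continuous_intros continuous_f) (auto simp: compact_imp_closed[OF compact])
  finally show ?thesis .
qed

lemma compact_sublevel:
  assumes "\<rho> < t" shows "compact (sublevel t)"
proof -
  have "\<forall>\<^sub>F u in at_infinity. t < norm (f u)"
    using f_at_infinity by (simp add: filterlim_at_infinity_conv_norm_at_top filterlim_at_top_dense)
  then have "\<forall>\<^sub>F u in at_infinity. u \<notin> sublevel t"
    using eventually_notin_compact_at_infinity[OF compact]
    by eventually_elim (auto simp: sublevel_def)
  then obtain B where B: "\<And>u. B \<le> norm u \<Longrightarrow> u \<notin> sublevel t" unfolding eventually_at_infinity by blast
  then have "bounded (sublevel t)" by (metis boundedI linear)
  then show ?thesis using open_Compl_sublevel[OF assms] by (simp add: compact_eq_bounded_closed closed_def)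
qed

lemma connected_Compl_sublevel:
  assumes "\<rho> < t" shows "connected (- sublevel t)"
  unfolding sublevel_eq(1)[OF assms]
  by (intro connected_continuous_image connected_exterior continuous_on_subset[OF continuous_\<psi>])
     (use assms in auto)

lemma connected_level:
  assumes "\<rho> < t" shows "connected (\<psi> ` sphere 0 t)" "compact (\<psi> ` sphere 0 t)" "\<psi> ` sphere 0 t \<noteq> {}"
proof -
  have sub: "sphere 0 t \<subseteq> {w. \<rho> < norm w}" using assms by auto
  show "connected (\<psi> ` sphere 0 t)" "compact (\<psi> ` sphere 0 t)"
    using continuous_on_subset[OF continuous_\<psi> sub]
    by (auto intro!: connected_continuous_image compact_continuous_image connected_sphere)
  show "\<psi> ` sphere 0 t \<noteq> {}" using assms \<rho> by simp
qed

text \<open>A clopen part of the sublevel set that misses the level curve would be a bounded clopen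
  subset of the plane.\<close>
lemma connected_sublevel:
  assumes t: "\<rho> < t" shows "connected (sublevel t)"
proof -
  have clop: False
    if AB: "closed A" "closed B" "A \<inter> B \<inter> sublevel t = {}" "sublevel t \<subseteq> A \<union> B"
      "B \<inter> sublevel t \<noteq> {}" "B \<inter> \<psi> ` sphere 0 t = {}" for A B
  proof -
    let ?U = "sublevel t - \<psi> ` sphere 0 t"
    have "B \<inter> sublevel t = ?U - A" using AB by blast
    then have "open (B \<inter> sublevel t)" using open_interior_sublevel[OF t] AB by auto
    moreover have "closed (B \<inter> sublevel t)" "bounded (B \<inter> sublevel t)"
      using compact_sublevel[OF t] AB by (auto simp: compact_eq_bounded_closed bounded_Int closed_Int)
    ultimately show False using AB(5) clopen[of "B \<inter> sublevel t"] not_bounded_UNIV by metis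
  qed
  show ?thesis
    unfolding connected_closed
  proof clarify
    fix A B assume AB: "closed A" "closed B" "A \<inter> B \<inter> sublevel t = {}" "sublevel t \<subseteq> A \<union> B"
      "A \<inter> sublevel t \<noteq> {}" "B \<inter> sublevel t \<noteq> {}"
    have "A \<inter> \<psi> ` sphere 0 t = {} \<or> B \<inter> \<psi> ` sphere 0 t = {}"
      by (rule connected_closedD[OF connected_level(1)[OF t]]) (use AB sublevel_eq(4)[OF t] in auto)
    then show False using clop[of A B] clop[of B A] AB by blast
  qed
qed

lemma K_eq_Inter_sublevel: "K = (\<Inter>n. sublevel (\<rho> + 1 / real (Suc n)))"
proof (intro equalityI subsetI)
  fix u assume u: "u \<in> (\<Inter>n. sublevel (\<rho> + 1 / real (Suc n)))"
  show "u \<in> K"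
  proof (rule ccontr)
    assume "u \<notin> K"
    then have "norm (f u) - \<rho> > 0" using norm_f by simp
    then obtain n where "inverse (real (Suc n)) < norm (f u) - \<rho>" using reals_Archimedean by blast
    then show False using u \<open>u \<notin> K\<close> by (auto simp: sublevel_def inverse_eq_divide dest: spec[of _ n])
  qed
qed (auto simp: sublevel_def)

lemma connected_K: "connected K"
proof -
  have "connected (\<Inter> (range (\<lambda>n. sublevel (\<rho> + 1 / real (Suc n)))))"
  proof (rule connected_nest)
    show "sublevel (\<rho> + 1 / real (Suc n)) \<subseteq> sublevel (\<rho> + 1 / real (Suc m))" if "m \<le> n" for m n
    proof -
      have "1 / real (Suc n) \<le> 1 / real (Suc m)" using that by (simp add: frac_le)
      then show ?thesis by (auto simp: sublevel_def)
    qed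
  qed (auto intro!: compact_sublevel connected_sublevel)
  then show ?thesis using K_eq_Inter_sublevel by simp
qed

lemma inverse_f_in_ball:
  assumes "u \<notin> K"
  shows "1 / f u \<in> ball 0 (1 / \<rho>)" "1 / f u \<noteq> 0"
  using norm_f[OF assms] f_nonzero[OF assms] \<rho> by (simp_all add: norm_divide field_simps)

text \<open>In the coordinate 1 / f the set - K, with infinity added as 0, is a disc and hence
  simply connected.\<close>

lemma holomorphic_log_in_ball:
  assumes m: "m holomorphic_on - K" "\<And>u. u \<notin> K \<Longrightarrow> m u \<noteq> 0" "(m \<longlongrightarrow> 1) at_infinity"
  obtains h where "h holomorphic_on ball 0 (1 / \<rho>)" "h 0 = 0" "\<And>u. u \<notin> K \<Longrightarrow> m u = exp (h (1 / f u))"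
proof -
  let ?B = "ball (0::complex) (1 / \<rho>)"
  define M where "M = (\<lambda>w. if w = 0 then 1 else m (\<psi> (1 / w)))"
  have ext: "\<rho> < norm (1 / w)" if "w \<in> ?B" "w \<noteq> 0" for w
    using that \<rho> by (simp add: norm_divide field_simps)
  have hol1: "M holomorphic_on ?B - {0}"
  proof -
    have "(\<lambda>w. \<psi> (1 / w)) holomorphic_on ?B - {0}"
      by (rule holomorphic_on_compose_gen[OF _ holomorphic_\<psi>, unfolded o_def])
         (use ext in \<open>auto intro!: holomorphic_intros\<close>)
    then have "(\<lambda>w. m (\<psi> (1 / w))) holomorphic_on ?B - {0}"
      by (rule holomorphic_on_compose_gen[OF _ m(1), unfolded o_def]) (use ext \<psi>_notin in auto)
    then show ?thesis by (rule holomorphic_transform) (auto simp: M_def)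
  qed
  have inf0: "filterlim (\<lambda>w::complex. 1 / w) at_infinity (at 0)"
  proof -
    have "(\<lambda>w::complex. 1 / w) = inverse" by (auto simp: inverse_eq_divide)
    then show ?thesis using filterlim_inverse_at_infinity by simp
  qed
  have "((\<lambda>w. m (\<psi> (1 / w))) \<longlongrightarrow> 1) (at 0)"
    using m(3) filterlim_compose[OF \<psi>_at_infinity inf0] by (rule filterlim_compose)
  moreover have "\<forall>\<^sub>F w in at 0. m (\<psi> (1 / w)) = M w"
    using eventually_neq_at_within[of 0] by eventually_elim (simp add: M_def)
  ultimately have "(M \<longlongrightarrow> 1) (at 0)" using tendsto_cong by fast
  then have M0: "(M \<longlongrightarrow> M 0) (at 0 within ?B)" by (simp add: M_def tendsto_within_subset[OF _ subset_UNIV])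
  have Mhol: "M holomorphic_on ?B"
    by (rule no_isolated_singularity'[OF _ hol1]) (use M0 in simp_all)
  have Mnz: "M w \<noteq> 0" if "w \<in> ?B" for w
  proof (cases "w = 0")
    case False
    then show ?thesis using m(2) ext[OF that] \<psi>_notin[of "1 / w"] by (simp add: M_def)
  qed (simp add: M_def)
  have contr: "contractible ?B" by (rule convex_imp_contractible) auto
  obtain h where h: "h holomorphic_on ?B" "\<And>w. w \<in> ?B \<Longrightarrow> M w = exp (h w)"
    using contractible_imp_holomorphic_log[OF Mhol contr Mnz] by metis
  have eh0: "exp (h 0) = 1" using h(2)[of 0] \<rho> by (simp add: M_def)
  show ?thesis
  proof (rule that[of "\<lambda>v. h v - h 0"])
    show "(\<lambda>v. h v - h 0) holomorphic_on ?B" by (intro holomorphic_intros h)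
    show "m u = exp (h (1 / f u) - h 0)" if "u \<notin> K" for u
    proof -
      have "m u = M (1 / f u)" using inverse_f_in_ball[OF that] f_nonzero[OF that] \<psi>_f[OF that] by (simp add: M_def)
      also have "\<dots> = exp (h (1 / f u))" using inverse_f_in_ball[OF that] h(2) by blast
      finally show ?thesis by (simp add: exp_diff eh0)
    qed
  qed simp
qed

text \<open>The last limit records that the logarithm decays like 1/u, which the normalization of
  the square root map at infinity needs.\<close>

lemma holomorphic_log:
  assumes m: "m holomorphic_on - K" "\<And>u. u \<notin> K \<Longrightarrow> m u \<noteq> 0" "(m \<longlongrightarrow> 1) at_infinity"
  obtains l L where "l holomorphic_on - K" "\<And>u. u \<notin> K \<Longrightarrow> m u = exp (l u)"
    "((\<lambda>u. u * l u) \<longlongrightarrow> L) at_infinity"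
proof -
  obtain h where h: "h holomorphic_on ball 0 (1 / \<rho>)" "h 0 = 0" "\<And>u. u \<notin> K \<Longrightarrow> m u = exp (h (1 / f u))"
    using holomorphic_log_in_ball[OF m] by metis
  define l where "l = (\<lambda>u. h (1 / f u))"
  show ?thesis
  proof (rule that[of l])
    show "l holomorphic_on - K" unfolding l_def
      by (rule holomorphic_on_compose_gen[OF _ h(1), unfolded o_def])
         (use inverse_f_in_ball f_nonzero in \<open>auto intro!: holomorphic_intros hol\<close>)
    show "m u = exp (l u)" if "u \<notin> K" for u using h(3)[OF that] by (simp add: l_def)
    have "(h has_field_derivative deriv h 0) (at 0)" using h(1) \<rho> by (intro holomorphic_derivI) auto
    then have "((\<lambda>v. (h v - h 0) / (v - 0)) \<longlongrightarrow> deriv h 0) (at 0)" by (simp add: has_field_derivative_iff)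
    moreover have "filterlim (\<lambda>u. 1 / f u) (at 0) at_infinity"
    proof (rule filterlim_atI)
      show "((\<lambda>u. 1 / f u) \<longlongrightarrow> 0) at_infinity"
        using filterlim_compose[OF tendsto_inverse_0 f_at_infinity] by (simp add: inverse_eq_divide)
      show "\<forall>\<^sub>F u in at_infinity. 1 / f u \<noteq> 0"
        using eventually_notin_compact_at_infinity[OF compact] by eventually_elim (use f_nonzero in auto)
    qed
    ultimately have "((\<lambda>u. (h (1 / f u) - h 0) / (1 / f u - 0)) \<longlongrightarrow> deriv h 0) at_infinity"
      by (rule filterlim_compose)
    moreover have "((\<lambda>u. inverse (f u / u)) \<longlongrightarrow> inverse 1) at_infinity"
      by (intro tendsto_inverse ratio_tendsto_1_of_diff_tendsto[OF asymp]) auto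
    ultimately have "((\<lambda>u. (h (1 / f u) - h 0) / (1 / f u - 0) * inverse (f u / u)) \<longlongrightarrow> deriv h 0 * inverse 1) at_infinity"
      by (rule tendsto_mult)
    moreover have "\<forall>\<^sub>F u in at_infinity. (h (1 / f u) - h 0) / (1 / f u - 0) * inverse (f u / u) = u * l u"
      using eventually_notin_compact_at_infinity[OF compact]
      by eventually_elim (use f_nonzero in \<open>simp add: l_def h(2) field_simps\<close>)
    ultimately show "((\<lambda>u. u * l u) \<longlongrightarrow> deriv h 0 * inverse 1) at_infinity" using tendsto_cong by force
  qed
qed

end

section \<open>Logarithmic capacity\<close>

text \<open>The sum is the leading coefficient of the Lagrange interpolant with nodes S, which
  reproduces polynomials of degree below \<open>card S\<close>.\<close>

lemma lagrange_leading_coefficient: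
  fixes T :: "'a::field poly"
  assumes S: "finite S" "S \<noteq> {}" and T: "degree T = card S - 1"
  shows "(\<Sum>x\<in>S. poly T x / (\<Prod>y\<in>S - {x}. x - y)) = lead_coeff T"
proof -
  define L where "L = (\<lambda>x. \<Prod>y\<in>S - {x}. [:- y, 1:])"
  have degL: "degree (L x) = card S - 1" if "x \<in> S" for x
    unfolding L_def using that S by (simp add: degree_prod_sum_eq card_Diff_singleton)
  have lcL: "lead_coeff (L x) = 1" for x
    unfolding L_def lead_coeff_prod by simp
  have polyL: "poly (L x) z = (\<Prod>y\<in>S - {x}. z - y)" for x z
    by (simp add: L_def poly_prod)
  define Q where "Q = (\<Sum>x\<in>S. smult (poly T x / (\<Prod>y\<in>S - {x}. x - y)) (L x))"
  have cpos: "card S > 0" using S by (simp add: card_gt_0_iff)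
  have "degree Q \<le> card S - 1"
    unfolding Q_def by (rule degree_sum_le) (use S degL in \<open>auto intro: order.trans[OF degree_smult_le]\<close>)
  moreover have "poly T z = poly Q z" if z: "z \<in> S" for z
  proof -
    have "poly Q z = (\<Sum>x\<in>S. if x = z then poly T z else 0)"
      unfolding Q_def poly_sum
    proof (rule sum.cong[OF refl])
      fix x assume x: "x \<in> S"
      show "poly (smult (poly T x / (\<Prod>y\<in>S - {x}. x - y)) (L x)) z = (if x = z then poly T z else 0)"
      proof (cases "x = z")
        case True
        then show ?thesis using S by (simp add: polyL)
      next
        case False
        then have "(\<Prod>y\<in>S - {x}. z - y) = 0" using z S by (simp add: prod_zero_iff)
        then show ?thesis using False by (simp add: polyL)
      qed
    qed
    then show ?thesis using z S by simp
  qed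
  ultimately have "T = Q"
    by (intro poly_eqI_degree[of S]) (use T cpos in auto)
  then have "lead_coeff T = coeff Q (card S - 1)" using T by metis
  also have "\<dots> = (\<Sum>x\<in>S. poly T x / (\<Prod>y\<in>S - {x}. x - y))"
    unfolding Q_def coeff_sum by (intro sum.cong) (use degL lcL in \<open>metis coeff_smult mult.right_neutral\<close>)+
  finally show ?thesis by simp
qed

text \<open>Expanding the Vandermonde determinant along its last column, with the last power replaced
  by a monic polynomial that is small on \<open>E\<close>.\<close>
lemma fekete_bound:
  fixes E :: "complex set" and c C :: real
  assumes c: "c > 0" and C: "C > 0"
    and T: "\<And>j. \<exists>t. degree t = j \<and> lead_coeff t = 1 \<and> (\<forall>z\<in>E. norm (poly t z) \<le> C * c ^ j)"
    and S: "finite S" "S \<subseteq> E"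
  shows "(\<Prod>x\<in>S. \<Prod>y\<in>S - {x}. dist x y) \<le> (\<Prod>j<card S. real (Suc j) * (C * c ^ j))\<^sup>2"
  using S
proof (induction "card S" arbitrary: S)
  case 0
  then show ?case by simp
next
  case (Suc N)
  define B where "B = (\<lambda>n. \<Prod>j<n. real (Suc j) * (C * c ^ j))"
  have B0: "B n > 0" for n using c C by (auto simp: B_def intro!: prod_pos)
  define W where "W = (\<lambda>S::complex set. \<Prod>x\<in>S. \<Prod>y\<in>S - {x}. dist x y)"
  have W0: "W X > 0" if "finite X" for X using that by (auto simp: W_def intro!: prod_pos)
  obtain t where t: "degree t = N" "lead_coeff t = 1" "\<And>z. z \<in> E \<Longrightarrow> norm (poly t z) \<le> C * c ^ N"
    using T by blast
  define d where "d = (\<lambda>x. \<Prod>y\<in>S - {x}. dist x y)"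
  have d0: "d x > 0" for x using Suc.prems by (auto simp: d_def intro!: prod_pos)
  \<comment> \<open>W runs over ordered pairs, so removing x costs the square of its distance
    product.\<close>
  have rem: "W S = W (S - {x}) * (d x)\<^sup>2" if x: "x \<in> S" for x
  proof -
    have "W S = d x * (\<Prod>z\<in>S - {x}. \<Prod>y\<in>S - {z}. dist z y)"
      using Suc.prems x by (simp add: W_def d_def prod.remove)
    also have "(\<Prod>z\<in>S - {x}. \<Prod>y\<in>S - {z}. dist z y) = (\<Prod>z\<in>S - {x}. dist z x * (\<Prod>y\<in>S - {x} - {z}. dist z y))"
    proof (rule prod.cong[OF refl])
      fix z assume z: "z \<in> S - {x}"
      have "S - {z} - {x} = S - {x} - {z}" by auto
      then show "(\<Prod>y\<in>S - {z}. dist z y) = dist z x * (\<Prod>y\<in>S - {x} - {z}. dist z y)"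
        using z x Suc.prems by (subst prod.remove[of _ x]) auto
    qed
    also have "\<dots> = d x * W (S - {x})" by (simp add: prod.distrib d_def W_def dist_commute)
    finally show ?thesis by (simp add: power2_eq_square)
  qed
  have Sne: "S \<noteq> {}" using Suc by auto
  have "(\<Sum>x\<in>S. poly t x / (\<Prod>y\<in>S - {x}. x - y)) = lead_coeff t"
    by (rule lagrange_leading_coefficient) (use Suc.prems Suc.hyps(2)[symmetric] Sne t(1) in auto)
  then have "1 = norm (\<Sum>x\<in>S. poly t x / (\<Prod>y\<in>S - {x}. x - y))" using t(2) by simp
  also have "\<dots> \<le> (\<Sum>x\<in>S. norm (poly t x / (\<Prod>y\<in>S - {x}. x - y)))" by (rule norm_sum)
  also have "\<dots> = (\<Sum>x\<in>S. norm (poly t x) / d x)"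
    by (simp add: norm_divide prod_norm[symmetric] d_def dist_norm)
  \<comment> \<open>The induction hypothesis for S without x bounds each 1 / d x by B N / sqrt(W S).
    The N + 1 equal terms supply the new factor \<open>Suc N\<close>.\<close>
  also have "\<dots> \<le> (\<Sum>x\<in>S. C * c ^ N * B N / sqrt (W S))"
  proof (rule sum_mono)
    fix x assume x: "x \<in> S"
    have "W (S - {x}) \<le> (B N)\<^sup>2"
    proof -
      have N: "N = card (S - {x})" using Suc.hyps(2) x by simp
      have "finite (S - {x})" "S - {x} \<subseteq> E" using Suc.prems by auto
      from Suc.hyps(1)[OF N this] show ?thesis unfolding W_def B_def by (simp only: N[symmetric])
    qed
    then have "sqrt (W (S - {x})) \<le> B N" using B0[of N] by (simp add: real_le_lsqrt W0 Suc.prems less_imp_le)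
    moreover have "sqrt (W S) = sqrt (W (S - {x})) * d x"
      using rem[OF x] d0[of x] by (simp add: real_sqrt_mult)
    ultimately have "sqrt (W S) \<le> B N * d x" using d0[of x] by simp
    moreover have "sqrt (W S) > 0" using W0 Suc.prems by simp
    ultimately have "1 / d x \<le> B N / sqrt (W S)" using d0[of x] by (simp add: field_simps)
    then have "norm (poly t x) * (1 / d x) \<le> (C * c ^ N) * (B N / sqrt (W S))"
      using t(3)[of x] x Suc.prems d0[of x] c C by (intro mult_mono) (auto simp: less_imp_le)
    then show "norm (poly t x) / d x \<le> C * c ^ N * B N / sqrt (W S)" by simp
  qed
  also have "\<dots> = B (Suc N) / sqrt (W S)"
    by (simp add: B_def Suc.hyps(2)[symmetric] algebra_simps)
  finally have "sqrt (W S) \<le> B (Suc N)" using W0[of S] Suc.prems by (simp add: field_simps)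
  then have "W S \<le> (B (Suc N))\<^sup>2" using W0[of S] Suc.prems by (simp add: sqrt_le_D)
  then show ?case using Suc.hyps by (simp add: W_def B_def)
qed

lemma distr_PiM_pair:
  assumes M: "prob_space M" and ij: "i \<noteq> j" "i \<in> I" "j \<in> I"
  shows "distr (PiM I (\<lambda>_. M)) (M \<Otimes>\<^sub>M M) (\<lambda>\<omega>. (\<omega> i, \<omega> j)) = M \<Otimes>\<^sub>M M"
proof -
  interpret prob_space M by fact
  let ?f = "case_bool i j"
  let ?Q = "PiM UNIV (\<lambda>_::bool. M)"
  have 1: "distr (PiM I (\<lambda>_. M)) ?Q (\<lambda>\<omega>. \<lambda>n\<in>UNIV. \<omega> (?f n)) = ?Q"
    using ij by (intro distr_PiM_reindex) (auto simp: M inj_on_def split: bool.splits)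
  have "case_bool M M = (\<lambda>_. M)" by (auto split: bool.splits)
  then have "M \<Otimes>\<^sub>M M = distr ?Q (M \<Otimes>\<^sub>M M) (\<lambda>x. (x True, x False))"
    using pair_measure_eq_distr_PiM[OF sigma_finite_measure_axioms sigma_finite_measure_axioms] by simp
  also have "\<dots> = distr (PiM I (\<lambda>_. M)) (M \<Otimes>\<^sub>M M) ((\<lambda>x. (x True, x False)) \<circ> (\<lambda>\<omega>. \<lambda>n\<in>UNIV. \<omega> (?f n)))"
    by (subst 1[symmetric], rule distr_distr)
       (use ij in \<open>auto intro!: measurable_Pair measurable_component_singleton measurable_restrict split: bool.splits\<close>)
  also have "(\<lambda>x. (x True, x False)) \<circ> (\<lambda>\<omega>. \<lambda>n\<in>UNIV. \<omega> (?f n)) = (\<lambda>\<omega>. (\<omega> i, \<omega> j))"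
    by (auto simp: fun_eq_iff)
  finally show ?thesis by simp
qed

text \<open>Fubini turns the absence of atoms into a null diagonal.\<close>

lemma AE_pair_distinct:
  fixes M :: "complex measure"
  assumes M: "prob_space M" "sets M = sets borel" and at: "\<And>z. emeasure M {z} = 0"
  shows "AE p in M \<Otimes>\<^sub>M M. fst p \<noteq> snd p"
proof -
  interpret prob_space M by fact
  interpret pair_prob_space M M ..
  have [measurable_cong]: "sets M = sets borel" by fact
  have sp: "space M = UNIV" using sets_eq_imp_space_eq[OF M(2)] by simp
  have "AE x in M. AE y in M. x \<noteq> y"
  proof (rule AE_I2)
    fix x
    show "AE y in M. x \<noteq> y" 
    proof (rule AE_I)
      show "{y \<in> space M. \<not> x \<noteq> y} \<subseteq> {x}" by blast
    qed (simp_all add: at M(2))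
  qed
  moreover have "{p \<in> space (M \<Otimes>\<^sub>M M). fst p \<noteq> snd p} \<in> sets (M \<Otimes>\<^sub>M M)"
  proof -
    have "open {p :: complex \<times> complex. fst p \<noteq> snd p}"
      by (intro open_Collect_neq continuous_intros)
    then have "{p. fst p \<noteq> snd p} \<in> sets (borel \<Otimes>\<^sub>M borel :: (complex \<times> complex) measure)"
      unfolding borel_prod by (rule borel_open)
    moreover have "sets (M \<Otimes>\<^sub>M M) = sets (borel \<Otimes>\<^sub>M borel)"
      by (rule sets_pair_measure_cong) (rule M(2))+
    ultimately show ?thesis by (simp add: space_pair_measure sp)
  qed
  ultimately show ?thesis by (intro AE_pair_measure) auto
qed

text \<open>Average the Fekete bound over N independent points with law M. Each of the N(N - 1) pair
  terms has the energy as its mean, and after division the constants C and j + 1 leave an error of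
  order ln N / N only.\<close>

lemma energy_le:
  fixes E :: "complex set" and M :: "complex measure"
  assumes c: "c > 0" and C: "C > 0"
    and T: "\<And>j. \<exists>t. degree t = j \<and> lead_coeff t = 1 \<and> (\<forall>z\<in>E. norm (poly t z) \<le> C * c ^ j)"
    and M: "prob_space M" "sets M = sets borel" "emeasure M E = 1" "\<And>z. emeasure M {z} = 0"
    and int: "integrable (M \<Otimes>\<^sub>M M) (\<lambda>p. ln (dist (fst p) (snd p)))"
  shows "(\<integral>p. ln (dist (fst p) (snd p)) \<partial>(M \<Otimes>\<^sub>M M)) \<le> ln c"
proof -
  interpret prob_space M by fact
  let ?I = "\<integral>p. ln (dist (fst p) (snd p)) \<partial>(M \<Otimes>\<^sub>M M)"
  have fin: "real N * (real N - 1) * ?I \<le> 2 * (\<Sum>j<N. ln (real (Suc j)) + (ln C + real j * ln c))" for N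
  proof -
    let ?P = "PiM {..<N} (\<lambda>_. M)"
    interpret P: prob_space ?P by (rule prob_space_PiM) (rule M)
    define B where "B = (\<Prod>j<N. real (Suc j) * (C * c ^ j))"
    have B0: "B > 0" using c C by (auto simp: B_def intro!: prod_pos)
    have meas: "(\<lambda>\<omega>. (\<omega> i, \<omega> j)) \<in> ?P \<rightarrow>\<^sub>M (M \<Otimes>\<^sub>M M)" if "i < N" "j < N" for i j
      using that by (auto intro!: measurable_Pair measurable_component_singleton)
    have pair: "integrable ?P (\<lambda>\<omega>. ln (dist (\<omega> i) (\<omega> j)))"
      "(\<integral>\<omega>. ln (dist (\<omega> i) (\<omega> j)) \<partial>?P) = ?I" "AE \<omega> in ?P. \<omega> i \<noteq> \<omega> j"
      if ij: "i < N" "j < N" "i \<noteq> j" for i j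
    proof -
      have d: "distr ?P (M \<Otimes>\<^sub>M M) (\<lambda>\<omega>. (\<omega> i, \<omega> j)) = M \<Otimes>\<^sub>M M"
        by (rule distr_PiM_pair[OF M(1)]) (use ij in auto)
      have bm: "(\<lambda>p. ln (dist (fst p) (snd p))) \<in> borel_measurable (M \<Otimes>\<^sub>M M)"
        using int by (rule borel_measurable_integrable)
      show "integrable ?P (\<lambda>\<omega>. ln (dist (\<omega> i) (\<omega> j)))"
        using int integrable_distr_eq[OF meas[OF ij(1,2)] bm] d by simp
      show "(\<integral>\<omega>. ln (dist (\<omega> i) (\<omega> j)) \<partial>?P) = ?I"
        using integral_distr[OF meas[OF ij(1,2)] bm] d by simp
      have [measurable_cong]: "sets M = sets borel" by fact
      have "AE p in distr ?P (M \<Otimes>\<^sub>M M) (\<lambda>\<omega>. (\<omega> i, \<omega> j)). fst p \<noteq> snd p"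
        unfolding d by (rule AE_pair_distinct[OF M(1,2,4)])
      then show "AE \<omega> in ?P. \<omega> i \<noteq> \<omega> j"
        using AE_distrD[OF meas[OF ij(1,2)]] by fastforce
    qed
    have inE: "AE \<omega> in ?P. \<omega> i \<in> E" if "i < N" for i
    proof -
      have "AE x in M. x \<in> E" using M(3) by (intro AE_prob_1) (simp add: measure_def)
      then have "AE x in distr ?P M (\<lambda>\<omega>. \<omega> i). x \<in> E"
        using that by (subst distr_PiM_component) (auto simp: M)
      then show ?thesis
        by (rule AE_distrD[rotated]) (use that in \<open>auto intro: measurable_component_singleton\<close>)
    qed
    define F where "F = (\<lambda>\<omega>::nat \<Rightarrow> complex. \<Sum>i<N. \<Sum>j\<in>{..<N} - {i}. ln (dist (\<omega> i) (\<omega> j)))"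
    \<comment> \<open>Distinctness matters because ln 0 = 0 by convention, which would break the
      passage from the product to the sum of logarithms.\<close>
    have "AE \<omega> in ?P. (\<forall>i\<in>{..<N}. \<omega> i \<in> E) \<and> (\<forall>i\<in>{..<N}. \<forall>j\<in>{..<N} - {i}. \<omega> i \<noteq> \<omega> j)"
    proof (intro AE_conjI)
      show "AE \<omega> in ?P. \<forall>i\<in>{..<N}. \<omega> i \<in> E" by (intro AE_finite_allI) (use inE in auto)
      show "AE \<omega> in ?P. \<forall>i\<in>{..<N}. \<forall>j\<in>{..<N} - {i}. \<omega> i \<noteq> \<omega> j"
        by (intro AE_finite_allI) (use pair(3) in auto)
    qed
    then have AE: "AE \<omega> in ?P. F \<omega> \<le> 2 * ln B"
    proof eventually_elim
      case (elim \<omega>)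
      have inj: "inj_on \<omega> {..<N}" using elim by (auto simp: inj_on_def)
      have "(\<Prod>i<N. \<Prod>j\<in>{..<N} - {i}. dist (\<omega> i) (\<omega> j)) = (\<Prod>x\<in>\<omega> ` {..<N}. \<Prod>y\<in>\<omega> ` {..<N} - {x}. dist x y)"
      proof (subst prod.reindex[OF inj], unfold o_def, rule prod.cong[OF refl])
        fix i assume i: "i \<in> {..<N}"
        have "\<omega> ` {..<N} - {\<omega> i} = \<omega> ` ({..<N} - {i})" using inj i by (auto simp: inj_on_def)
        then show "(\<Prod>j\<in>{..<N} - {i}. dist (\<omega> i) (\<omega> j)) = (\<Prod>y\<in>\<omega> ` {..<N} - {\<omega> i}. dist (\<omega> i) y)"
          using inj by (simp add: prod.reindex inj_on_diff)
      qed
      also have "\<dots> \<le> B\<^sup>2"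
        using fekete_bound[OF c C T, of "\<omega> ` {..<N}"] elim inj by (auto simp: B_def card_image image_subset_iff)
      finally have le: "(\<Prod>i<N. \<Prod>j\<in>{..<N} - {i}. dist (\<omega> i) (\<omega> j)) \<le> B\<^sup>2" .
      have pos: "(\<Prod>j\<in>{..<N} - {i}. dist (\<omega> i) (\<omega> j)) > 0" if "i < N" for i
        using elim that by (intro prod_pos) auto
      have "F \<omega> = ln (\<Prod>i<N. \<Prod>j\<in>{..<N} - {i}. dist (\<omega> i) (\<omega> j))"
        unfolding F_def using elim pos
        by (subst ln_prod) (auto intro!: sum.cong ln_prod[symmetric])
      also have "\<dots> \<le> ln (B\<^sup>2)"
      proof (intro ln_mono le)
        show "(\<Prod>i<N. \<Prod>j\<in>{..<N} - {i}. dist (\<omega> i) (\<omega> j)) > 0"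
          by (rule prod_pos) (use pos in blast)
      qed
      also have "\<dots> = 2 * ln B" using B0 by (simp add: ln_realpow)
      finally show ?case .
    qed
    have intF: "integrable ?P F" unfolding F_def by (intro Bochner_Integration.integrable_sum pair) auto
    have inner: "(\<integral>\<omega>. (\<Sum>j\<in>{..<N} - {i}. ln (dist (\<omega> i) (\<omega> j))) \<partial>?P) = (\<Sum>j\<in>{..<N} - {i}. ?I)"
      if "i < N" for i
    proof -
      have "(\<integral>\<omega>. (\<Sum>j\<in>{..<N} - {i}. ln (dist (\<omega> i) (\<omega> j))) \<partial>?P) =
          (\<Sum>j\<in>{..<N} - {i}. (\<integral>\<omega>. ln (dist (\<omega> i) (\<omega> j)) \<partial>?P))"
        by (rule Bochner_Integration.integral_sum) (use that in \<open>auto intro!: pair(1)\<close>)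
      also have "\<dots> = (\<Sum>j\<in>{..<N} - {i}. ?I)"
        by (rule sum.cong[OF refl]) (use that pair(2) in auto)
      finally show ?thesis .
    qed
    have "(\<integral>\<omega>. F \<omega> \<partial>?P) = (\<Sum>i<N. (\<integral>\<omega>. (\<Sum>j\<in>{..<N} - {i}. ln (dist (\<omega> i) (\<omega> j))) \<partial>?P))"
      unfolding F_def
      by (rule Bochner_Integration.integral_sum) (auto intro!: Bochner_Integration.integrable_sum pair)
    also have "\<dots> = (\<Sum>i<N. \<Sum>j\<in>{..<N} - {i}. ?I)" by (rule sum.cong[OF refl]) (use inner in auto)
    also have "\<dots> = real N * (real N - 1) * ?I"
      by (cases N) (auto simp: card_Diff_singleton)
    finally have "real N * (real N - 1) * ?I = (\<integral>\<omega>. F \<omega> \<partial>?P)" by simp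
    also have "\<dots> \<le> 2 * ln B" using P.integral_le_const[OF intF AE] .
    also have "ln B = (\<Sum>j<N. ln (real (Suc j)) + (ln C + real j * ln c))"
      unfolding B_def using c C by (subst ln_prod) (auto simp: ln_mult ln_realpow intro!: sum.cong)
    finally show ?thesis .
  qed
  have bound: "?I \<le> ln c + 2 * (ln (real m + 2) + ln C) / (real m + 1)" for m
  proof -
    \<comment> \<open>At least two points, so that N - 1 can be divided by.\<close>
    define N where "N = m + 2"
    have "(\<Sum>j<N. ln (real (Suc j)) + (ln C + real j * ln c)) \<le> (\<Sum>j<N. ln (real N) + (ln C + real j * ln c))"
      by (intro sum_mono) auto
    also have "\<dots> = real N * (ln (real N) + ln C) + (\<Sum>j<N. real j) * ln c"
      by (simp add: sum.distrib flip: sum_distrib_right) (simp add: algebra_simps)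
    also have "(\<Sum>j<N. real j) = real N * (real N - 1) / 2"
      by (induction N) (auto simp: field_simps)
    finally have "2 * (\<Sum>j<N. ln (real (Suc j)) + (ln C + real j * ln c)) \<le>
        2 * (real N * (ln (real N) + ln C) + real N * (real N - 1) / 2 * ln c)" by simp
    with fin[of N] have "real N * (real N - 1) * ?I \<le>
        2 * (real N * (ln (real N) + ln C) + real N * (real N - 1) / 2 * ln c)" by (rule order.trans)
    also have "\<dots> = real N * (real N - 1) * (ln c + 2 * (ln (real N) + ln C) / (real N - 1))"
      by (simp add: N_def field_simps)
    finally have "real N * (real N - 1) * ?I \<le> real N * (real N - 1) * (ln c + 2 * (ln (real N) + ln C) / (real N - 1))" .
    moreover have "real N * (real N - 1) > 0" by (simp add: N_def)
    ultimately have "?I \<le> ln c + 2 * (ln (real N) + ln C) / (real N - 1)"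
      by (meson mult_le_cancel_left_pos)
    then show ?thesis by (simp add: N_def add.commute)
  qed
  have "(\<lambda>m. ln c + 2 * (ln (real m + 2) + ln C) / (real m + 1)) \<longlonglongrightarrow> ln c + 0"
    by (intro tendsto_add tendsto_const) real_asymp
  then show ?thesis using bound by (intro LIMSEQ_le_const[where X="\<lambda>m. ln c + 2 * (ln (real m + 2) + ln C) / (real m + 1)"]) auto
qed

text \<open>The polynomials serve the second claim as well: \<open>Sup\<close> dominates its
  elements because c bounds the set of values above.\<close>

lemma log_capacity_le:
  fixes E :: "complex set"
  assumes c: "c > 0" and C: "C > 0"
    and T: "\<And>j. \<exists>t. degree t = j \<and> lead_coeff t = 1 \<and> (\<forall>z\<in>E. norm (poly t z) \<le> C * c ^ j)"
  shows "log_capacity E \<le> c"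
    and "prob_space M \<Longrightarrow> sets M = sets borel \<Longrightarrow> emeasure M E = 1 \<Longrightarrow> (\<And>z. emeasure M {z} = 0) \<Longrightarrow>
      integrable (M \<Otimes>\<^sub>M M) (\<lambda>p. ln (dist (fst p) (snd p))) \<Longrightarrow>
      exp (\<integral>p. ln (dist (fst p) (snd p)) \<partial>(M \<Otimes>\<^sub>M M)) \<le> log_capacity E"
proof -
  let ?S = "insert 0
     {exp (\<integral>x. ln (dist (fst x) (snd x)) \<partial>(M \<Otimes>\<^sub>M M)) | M :: complex measure.
        prob_space M \<and> sets M = sets borel \<and> emeasure M E = 1 \<and>
        (\<forall>z. emeasure M {z} = 0) \<and>
        integrable (M \<Otimes>\<^sub>M M) (\<lambda>x. ln (dist (fst x) (snd x)))}"
  have le: "x \<le> c" if x: "x \<in> ?S" for x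
  proof (cases "x = 0")
    case False
    then obtain M :: "complex measure" where M: "x = exp (\<integral>x. ln (dist (fst x) (snd x)) \<partial>(M \<Otimes>\<^sub>M M))"
        "prob_space M" "sets M = sets borel" "emeasure M E = 1" "\<forall>z. emeasure M {z} = 0"
        "integrable (M \<Otimes>\<^sub>M M) (\<lambda>x. ln (dist (fst x) (snd x)))"
      using x by blast
    have "(\<integral>x. ln (dist (fst x) (snd x)) \<partial>(M \<Otimes>\<^sub>M M)) \<le> ln c"
      by (rule energy_le[OF c C T M(2-4) _ M(6)]) (use M(5) in auto)
    then show ?thesis unfolding M(1) using c by (simp add: ln_ge_iff)
  qed (use c in simp)
  show "log_capacity E \<le> c" unfolding log_capacity_def by (rule cSup_least) (use le in auto)
  show "exp (\<integral>p. ln (dist (fst p) (snd p)) \<partial>(M \<Otimes>\<^sub>M M)) \<le> log_capacity E"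
    if "prob_space M" "sets M = sets borel" "emeasure M E = 1" "\<And>z. emeasure M {z} = 0"
      "integrable (M \<Otimes>\<^sub>M M) (\<lambda>p. ln (dist (fst p) (snd p)))"
    unfolding log_capacity_def
  proof (rule cSup_upper)
    show "bdd_above ?S" by (rule bdd_aboveI) (rule le)
    show "exp (\<integral>p. ln (dist (fst p) (snd p)) \<partial>(M \<Otimes>\<^sub>M M)) \<in> ?S"
      using that by (intro insertI2 CollectI exI[of _ M]) auto
  qed
qed

section \<open>Energy of a measure lifted through the square root\<close>

lemma borel_measurable_csqrt [measurable]: "csqrt \<in> borel_measurable borel"
  unfolding borel_measurable_complex_iff csqrt.simps complex.sel by measurable

text \<open>A fair coin chooses the sign of the square root of b x. Because ln|z - w| + ln|z + w| =
  ln|z^2 - w^2|, the potential at z of the resulting law is half the potential at z^2 of the law of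
  b. Integrals are taken of D minus the kernel, nonnegative for an upper bound D, as integrability
  is known only afterwards.\<close>

lemma energy_of_square_root_measure:
  fixes b :: "real \<Rightarrow> complex" and K :: "complex set"
  defines "U \<equiv> restrict_space lborel {0..1::real}"
  assumes bm: "b \<in> borel_measurable U" and bK: "\<And>x. b x \<in> K" and K: "compact K"
    and fin: "\<And>u. finite {x \<in> {0..1}. b x = u}"
    and pot: "\<And>z D. z \<in> K \<Longrightarrow> (\<And>u. u \<in> K \<Longrightarrow> ln (dist z u) \<le> D) \<Longrightarrow>
        (\<integral>\<^sup>+x. ennreal (D - ln (dist z (b x))) \<partial>U) \<le> ennreal (D - L)"
  obtains M where "prob_space M" "sets M = sets borel" "emeasure M {z. z\<^sup>2 \<in> K} = 1"
    "\<And>z. emeasure M {z} = 0" "integrable (M \<Otimes>\<^sub>M M) (\<lambda>p. ln (dist (fst p) (snd p)))"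
    "L / 2 \<le> (\<integral>p. ln (dist (fst p) (snd p)) \<partial>(M \<Otimes>\<^sub>M M))"
proof -
  define E where "E = {z. z\<^sup>2 \<in> K}"
  interpret U: prob_space U unfolding U_def by (rule prob_space_restrict_space) auto
  let ?coin = "measure_pmf (pmf_of_set (UNIV :: bool set))"
  let ?Q = "U \<Otimes>\<^sub>M ?coin"
  interpret Q: pair_prob_space U ?coin ..
  define Z where "Z = (\<lambda>p::real \<times> bool. (if snd p then 1 else -1) * csqrt (b (fst p)))"
  have Zm [measurable]: "Z \<in> borel_measurable ?Q"
    unfolding Z_def using bm by measurable
  define M where "M = distr ?Q borel Z"
  have M: "prob_space M" "sets M = sets borel" "space M = UNIV"
    unfolding M_def by (auto intro!: Q.prob_space_distr)
  interpret M: prob_space M by fact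
  have [measurable_cong]: "sets M = sets borel" by fact
  have Zsq: "(Z p)\<^sup>2 = b (fst p)" for p by (simp add: Z_def power_mult_distrib)
  have ZE: "Z p \<in> E" for p using bK by (simp add: E_def Zsq)
  have "closed E"
    unfolding E_def using continuous_closed_vimage[OF compact_imp_closed[OF K], of "\<lambda>z. z\<^sup>2"]
    by (simp add: vimage_def continuous_intros)
  then have Em [measurable]: "E \<in> sets borel" by auto
  have ME: "emeasure M E = 1"
  proof -
    have "emeasure M E = emeasure ?Q (Z -` E \<inter> space ?Q)"
      unfolding M_def by (rule emeasure_distr) auto
    also have "Z -` E \<inter> space ?Q = space ?Q" using ZE by auto
    finally show ?thesis by (simp add: Q.emeasure_space_1)
  qed
  have spU: "space U = {0..1}" by (simp add: U_def space_restrict_space)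
  have nullfin: "emeasure U A = 0" "A \<in> sets U" if "finite A" "A \<subseteq> {0..1}" for A
  proof -
    show "A \<in> sets U" using that by (auto simp: U_def sets_restrict_space_iff finite_imp_closed borel_closed)
    show "emeasure U A = 0"
      unfolding U_def using that by (subst emeasure_restrict_space) (auto simp: emeasure_lborel_countable countable_finite)
  qed
  have nullb: "emeasure U {x \<in> {0..1}. b x = u} = 0" "{x \<in> {0..1}. b x = u} \<in> sets U" for u
    by (rule nullfin[OF fin]; blast)+
  have aeU: "AE x in U. b x \<noteq> u" for u
    by (rule AE_I[OF _ nullb[of u]]) (auto simp: spU)
  have Mat: "emeasure M {z} = 0" for z
  proof -
    have "emeasure M {z} = emeasure ?Q (Z -` {z} \<inter> space ?Q)"
      unfolding M_def by (rule emeasure_distr) auto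
    also have "\<dots> \<le> emeasure ?Q ({x \<in> {0..1}. b x = z\<^sup>2} \<times> UNIV)"
    proof (rule emeasure_mono)
      show "Z -` {z} \<inter> space ?Q \<subseteq> {x \<in> {0..1}. b x = z\<^sup>2} \<times> UNIV"
        using Zsq by (fastforce simp: space_pair_measure spU)
      show "{x \<in> {0..1}. b x = z\<^sup>2} \<times> UNIV \<in> sets ?Q"
        by (intro pair_measureI nullb) auto
    qed
    also have "\<dots> = 0" using nullb by (subst measure_pmf.emeasure_pair_measure_Times) simp_all
    finally show ?thesis by simp
  qed
  \<comment> \<open>B \<ge> 1 makes |z|^2 \<le> B imply |z| \<le> B, so one bound D for the kernel
    serves both K and E.\<close>
  obtain B where B: "\<And>u. u \<in> K \<Longrightarrow> norm u \<le> B" "B \<ge> 1"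
  proof -
    obtain B0 where "\<And>u. u \<in> K \<Longrightarrow> norm u \<le> B0"
      using compact_imp_bounded[OF K] bounded_iff by metis
    then show ?thesis using that[of "max B0 1"] by force
  qed
  define D where "D = ln (2 * B)"
  have D0: "D \<ge> 0" using B(2) by (simp add: D_def)
  have nE: "norm z \<le> B" if "z \<in> E" for z
  proof -
    have "(norm z)\<^sup>2 \<le> B" using B(1)[of "z\<^sup>2"] that by (simp add: E_def norm_power)
    also have "\<dots> \<le> B\<^sup>2" using B(2) by (simp add: power2_eq_square)
    finally show ?thesis using B(2) by (simp add: power_mono_iff)
  qed
  have lnD: "ln (dist z w) \<le> D" if "norm z \<le> B" "norm w \<le> B" for z w :: complex
  proof (cases "z = w")
    case False
    have "dist z w \<le> 2 * B" using that norm_triangle_ineq4[of z w] by (simp add: dist_norm)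
    then show ?thesis using False unfolding D_def by (intro ln_mono) auto
  qed (use D0 in simp)
  have potM: "(\<integral>\<^sup>+w. ennreal (D - ln (dist z w)) \<partial>M) \<le> ennreal (D - L / 2)" if z: "z \<in> E" for z
  proof -
    have "(\<integral>\<^sup>+w. ennreal (D - ln (dist z w)) \<partial>M) = (\<integral>\<^sup>+p. ennreal (D - ln (dist z (Z p))) \<partial>?Q)"
      unfolding M_def by (rule nn_integral_distr) auto
    also have "\<dots> = (\<integral>\<^sup>+x. (\<integral>\<^sup>+s. ennreal (D - ln (dist z (Z (x, s)))) \<partial>?coin) \<partial>U)"
      by (rule measure_pmf.nn_integral_fst[symmetric]) measurable
    also have "\<dots> = (\<integral>\<^sup>+x. ennreal (1/2) * ennreal (2 * D - ln (dist (z\<^sup>2) (b x))) \<partial>U)"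
    proof (rule nn_integral_cong_AE, use aeU[of "z\<^sup>2"] in eventually_elim)
      case (elim x)
      have zz: "dist z (Z (x, True)) * dist z (Z (x, False)) = dist (z\<^sup>2) (b x)"
        by (simp add: Z_def dist_norm norm_mult[symmetric] algebra_simps power2_eq_square[symmetric])
      then have ne: "dist z (Z (x, True)) \<noteq> 0" "dist z (Z (x, False)) \<noteq> 0" using elim by auto
      have "norm (Z (x, s)) \<le> B" for s using nE[OF ZE] .
      then have le: "ln (dist z (Z (x, s))) \<le> D" for s using lnD[OF nE[OF z]] by blast
      have "(\<integral>\<^sup>+s. ennreal (D - ln (dist z (Z (x, s)))) \<partial>?coin) =
        (ennreal (D - ln (dist z (Z (x, True)))) + ennreal (D - ln (dist z (Z (x, False))))) / 2"
        by (subst nn_integral_pmf_of_set) (auto simp: UNIV_bool add.commute)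
      also have "\<dots> = ennreal ((2 * D - (ln (dist z (Z (x, True))) + ln (dist z (Z (x, False))))) / 2)"
      proof -
        have "0 \<le> 2 * D - (ln (dist z (Z (x, True))) + ln (dist z (Z (x, False))))"
          using le[of True] le[of False] by simp
        moreover have "ennreal (D - ln (dist z (Z (x, True)))) + ennreal (D - ln (dist z (Z (x, False)))) =
            ennreal (2 * D - (ln (dist z (Z (x, True))) + ln (dist z (Z (x, False)))))"
          using le by (subst ennreal_plus[symmetric]) (auto simp: algebra_simps)
        ultimately show ?thesis using divide_ennreal[of _ 2] by simp
      qed
      also have "ln (dist z (Z (x, True))) + ln (dist z (Z (x, False))) = ln (dist (z\<^sup>2) (b x))"
        using ne zz ln_mult[of "dist z (Z (x, True))" "dist z (Z (x, False))"] by simp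
      also have "ennreal ((2 * D - ln (dist (z\<^sup>2) (b x))) / 2) = ennreal (1/2) * ennreal (2 * D - ln (dist (z\<^sup>2) (b x)))"
        by (subst ennreal_mult'[symmetric]) auto
      finally show ?case .
    qed
    also have "\<dots> = ennreal (1/2) * (\<integral>\<^sup>+x. ennreal (2 * D - ln (dist (z\<^sup>2) (b x))) \<partial>U)"
      using bm by (intro nn_integral_cmult) measurable
    also have "\<dots> \<le> ennreal (1/2) * ennreal (2 * D - L)"
    proof (intro mult_left_mono pot)
      show "z\<^sup>2 \<in> K" using z by (simp add: E_def)
      fix u assume "u \<in> K"
      have "ln (dist (z\<^sup>2) u) \<le> D" using lnD[OF B(1) B(1)] \<open>z\<^sup>2 \<in> K\<close> \<open>u \<in> K\<close> .
      then show "ln (dist (z\<^sup>2) u) \<le> 2 * D" using D0 by simp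
    qed auto
    also have "\<dots> = ennreal (D - L / 2)" by (subst ennreal_mult'[symmetric]) (auto simp: field_simps)
    finally show ?thesis .
  qed
  define g where "g = (\<lambda>p::complex \<times> complex. D - ln (dist (fst p) (snd p)))"
  have gm [measurable]: "g \<in> borel_measurable (M \<Otimes>\<^sub>M M)" unfolding g_def by measurable
  interpret MM: pair_prob_space M M ..
  have aeE: "AE z in M. z \<in> E" using ME by (intro M.AE_prob_1) (simp add: measure_def)
  have "(\<integral>\<^sup>+p. ennreal (g p) \<partial>(M \<Otimes>\<^sub>M M)) = (\<integral>\<^sup>+z. (\<integral>\<^sup>+w. ennreal (D - ln (dist z w)) \<partial>M) \<partial>M)"
    unfolding g_def using M.nn_integral_fst[of "\<lambda>p. ennreal (D - ln (dist (fst p) (snd p)))" M] by simp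
  also have "\<dots> \<le> (\<integral>\<^sup>+z. ennreal (D - L / 2) \<partial>M)"
  proof (rule nn_integral_mono_AE)
    show "AE z in M. (\<integral>\<^sup>+w. ennreal (D - ln (dist z w)) \<partial>M) \<le> ennreal (D - L / 2)"
      using aeE by eventually_elim (rule potM)
  qed
  also have "\<dots> = ennreal (D - L / 2)" by (simp add: M.emeasure_space_1)
  finally have le: "(\<integral>\<^sup>+p. ennreal (g p) \<partial>(M \<Otimes>\<^sub>M M)) \<le> ennreal (D - L / 2)" .
  have g0: "AE p in M \<Otimes>\<^sub>M M. 0 \<le> g p"
  proof (rule MM.AE_pair_measure)
    show "{p \<in> space (M \<Otimes>\<^sub>M M). 0 \<le> g p} \<in> sets (M \<Otimes>\<^sub>M M)" by measurable
    show "AE x in M. AE y in M. 0 \<le> g (x, y)"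
      using aeE
    proof eventually_elim
      case (elim x)
      show ?case using aeE by eventually_elim (use elim lnD nE in \<open>auto simp: g_def\<close>)
    qed
  qed
  have gi: "integrable (M \<Otimes>\<^sub>M M) g"
    by (rule integrableI_nonneg) (use g0 le in \<open>auto intro: le_less_trans\<close>)
  have eqln: "(\<lambda>p. ln (dist (fst p) (snd p))) = (\<lambda>p. D - g p)" by (auto simp: g_def)
  have "ennreal (\<integral>p. g p \<partial>(M \<Otimes>\<^sub>M M)) \<le> ennreal (D - L / 2)"
    using le nn_integral_eq_integral[OF gi g0] by simp
  moreover have "(\<integral>p. g p \<partial>(M \<Otimes>\<^sub>M M)) \<ge> 0" using g0 by (rule integral_nonneg_AE)
  \<comment> \<open>\<open>ennreal\<close> cuts negative reals off at 0, so the estimate passes to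
    the reals only if its right side is nonnegative. Were it negative, the hypothesis on the
    potential would make the integral of a function that is at least \<open>?\<epsilon>\<close> > 0
    vanish.\<close>
  moreover have "0 \<le> D - L / 2"
  proof (rule ccontr)
    assume neg: "\<not> 0 \<le> D - L / 2"
    obtain z where "z \<in> K" using bK by blast
    have ub: "ln (dist z u) \<le> 2 * D" if "u \<in> K" for u
      using lnD[OF B(1)[OF \<open>z \<in> K\<close>] B(1)[OF that]] D0 by simp
    let ?\<epsilon> = "(L - 2 * D) / 2"
    have "?\<epsilon> > 0" using neg by simp
    have "(\<integral>\<^sup>+x. ennreal (2 * D + ?\<epsilon> - ln (dist z (b x))) \<partial>U) \<le> ennreal (2 * D + ?\<epsilon> - L)"
    proof (rule pot[OF \<open>z \<in> K\<close>])
      fix u assume "u \<in> K"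
      from ub[OF this] show "ln (dist z u) \<le> 2 * D + ?\<epsilon>" using \<open>?\<epsilon> > 0\<close> by linarith
    qed
    also have "\<dots> = 0" using \<open>?\<epsilon> > 0\<close> by (simp add: ennreal_neg field_simps)
    finally have "(\<integral>\<^sup>+x. ennreal (2 * D + ?\<epsilon> - ln (dist z (b x))) \<partial>U) = 0" by simp
    moreover have "(\<integral>\<^sup>+x. ennreal ?\<epsilon> \<partial>U) \<le> (\<integral>\<^sup>+x. ennreal (2 * D + ?\<epsilon> - ln (dist z (b x))) \<partial>U)"
    proof (intro nn_integral_mono ennreal_leI)
      show "?\<epsilon> \<le> 2 * D + ?\<epsilon> - ln (dist z (b x))" for x using ub[OF bK, of x] by linarith
    qed
    moreover have "(\<integral>\<^sup>+x. ennreal ?\<epsilon> \<partial>U) = ennreal ?\<epsilon>" by (simp add: U.emeasure_space_1)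
    ultimately show False using \<open>?\<epsilon> > 0\<close> by simp
  qed
  ultimately have "(\<integral>p. g p \<partial>(M \<Otimes>\<^sub>M M)) \<le> D - L / 2" by (simp add: ennreal_le_iff)
  moreover have "(\<integral>p. D - g p \<partial>(M \<Otimes>\<^sub>M M)) = D - (\<integral>p. g p \<partial>(M \<Otimes>\<^sub>M M))"
    using gi by (simp add: MM.P.prob_space)
  ultimately show ?thesis
    using M ME Mat gi unfolding E_def by (intro that[of M]) (auto simp: eqln)
qed

lemma holomorphic_mean_value_circle:
  assumes h: "h holomorphic_on cball 0 s" and s: "s > 0"
  shows "((\<lambda>x. h (s * exp (2 * of_real pi * \<i> * of_real x))) has_integral h 0) {0..1}"
proof -
  have "((\<lambda>u. h u / (u - 0)) has_contour_integral (2 * of_real pi * \<i> * h 0)) (circlepath 0 s)"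
    by (rule Cauchy_integral_circlepath_simple[OF h]) (use s in simp)
  then have "((\<lambda>x. h (circlepath 0 s x) / circlepath 0 s x * vector_derivative (circlepath 0 s) (at x))
      has_integral (2 * of_real pi * \<i> * h 0)) {0..1}"
    by (simp add: has_contour_integral)
  then have "((\<lambda>x. 2 * of_real pi * \<i> * h (s * exp (2 * of_real pi * \<i> * of_real x)))
      has_integral (2 * of_real pi * \<i> * h 0)) {0..1}"
    unfolding vector_derivative_circlepath unfolding circlepath
    by (rule has_integral_eq[rotated]) (use s in simp)
  then have "((\<lambda>x. (1 / (2 * of_real pi * \<i>)) * (2 * of_real pi * \<i> * h (s * exp (2 * of_real pi * \<i> * of_real x))))
      has_integral (1 / (2 * of_real pi * \<i>)) * (2 * of_real pi * \<i> * h 0)) {0..1}"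
    by (rule has_integral_mult_right)
  then show ?thesis by simp
qed

context exterior_map
begin

text \<open>The point of modulus \<open>t\<close> at angle \<open>-2 \<pi> x\<close>; the sign makes its inverse run through the
  circle of radius \<open>1 / t\<close> in the usual parametrization.\<close>
definition circ :: "real \<Rightarrow> real \<Rightarrow> complex" where
  "circ t x = of_real t / exp (2 * of_real pi * \<i> * of_real x)"

lemma norm_circ: "t \<ge> 0 \<Longrightarrow> norm (circ t x) = t"
proof -
  have "norm (exp (2 * of_real pi * \<i> * of_real x)) = 1" by simp
  then show "t \<ge> 0 \<Longrightarrow> norm (circ t x) = t" by (simp add: circ_def norm_divide)
qed

lemma continuous_circ: "continuous_on S (circ t)"
  unfolding circ_def by (intro continuous_intros) auto

text \<open>(u - z) / f u is zero-free on - K and tends to 1 at infinity, so ln|u - z| - ln|f u| is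
  the real part of a function holomorphic in 1 / f that vanishes at the origin. The mean value
  property over |f u| = t leaves ln t.\<close>

lemma has_integral_potential:
  assumes z: "z \<in> K" and t: "\<rho> < t"
  shows "((\<lambda>x. ln (dist z (\<psi> (circ t x)))) has_integral ln t) {0..1}"
proof -
  have t0: "t > 0" using t \<rho> by simp
  define m where "m = (\<lambda>u. (u - z) / f u)"
  have "m holomorphic_on - K" unfolding m_def using f_nonzero by (intro holomorphic_intros hol) auto
  moreover have "m u \<noteq> 0" if "u \<notin> K" for u using that z f_nonzero by (auto simp: m_def)
  moreover have "(m \<longlongrightarrow> 1) at_infinity"
  proof -
    have "((\<lambda>u. (1 - z * inverse u) * inverse (f u / u)) \<longlongrightarrow> (1 - z * 0) * inverse 1) at_infinity"
      by (intro tendsto_intros tendsto_inverse_0 ratio_tendsto_1_of_diff_tendsto[OF asymp]) auto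
    moreover have "\<forall>\<^sub>F u in at_infinity. (1 - z * inverse u) * inverse (f u / u) = m u"
      using eventually_not_equal_at_infinity[of 0] 
    proof eventually_elim
      case (elim u)
      then have "1 - z * inverse u = (u - z) / u" by (simp add: field_simps)
      then show ?case using elim by (simp add: m_def)
    qed
    ultimately show ?thesis using tendsto_cong by force
  qed
  ultimately obtain h where h: "h holomorphic_on ball 0 (1 / \<rho>)" "h 0 = 0"
      "\<And>u. u \<notin> K \<Longrightarrow> m u = exp (h (1 / f u))"
    using holomorphic_log_in_ball by metis
  have "cball 0 (1 / t) \<subseteq> ball (0::complex) (1 / \<rho>)" 
  proof -
    have "1 / t < 1 / \<rho>" using t \<rho> by (simp add: frac_less2)
    then show ?thesis by auto
  qed
  then have "h holomorphic_on cball 0 (1 / t)" using h(1) holomorphic_on_subset by blast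
  then have "((\<lambda>x. h (of_real (1 / t) * exp (2 * of_real pi * \<i> * of_real x))) has_integral h 0) {0..1}"
    by (rule holomorphic_mean_value_circle) (use t0 in simp)
  then have "((\<lambda>x. Re (h (of_real (1 / t) * exp (2 * of_real pi * \<i> * of_real x)))) has_integral Re (h 0)) {0..1}"
    by (rule has_integral_Re)
  then have "((\<lambda>x. Re (h (of_real (1 / t) * exp (2 * of_real pi * \<i> * of_real x))) + ln t)
      has_integral (Re (h 0) + (1 - 0) *\<^sub>R ln t)) {0..1}"
    using has_integral_const_real[of "ln t" 0 1] by (intro has_integral_add) auto
  then have "((\<lambda>x. Re (h (of_real (1 / t) * exp (2 * of_real pi * \<i> * of_real x))) + ln t)
      has_integral ln t) {0..1}" by (simp add: h(2))
  then show ?thesis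
  proof (rule has_integral_eq[rotated])
    fix x :: real
    let ?w = "circ t x"
    have w: "\<rho> < norm ?w" using t t0 norm_circ[of t x] by simp
    have "1 / ?w = of_real (1 / t) * exp (2 * of_real pi * \<i> * of_real x)" by (simp add: circ_def)
    then have "m (\<psi> ?w) = exp (h (of_real (1 / t) * exp (2 * of_real pi * \<i> * of_real x)))"
      using h(3)[OF \<psi>_notin[OF w]] f_\<psi>[OF w] by simp
    then have "norm (m (\<psi> ?w)) = exp (Re (h (of_real (1 / t) * exp (2 * of_real pi * \<i> * of_real x))))" by simp
    moreover have "norm (m (\<psi> ?w)) = dist z (\<psi> ?w) / t"
      using f_\<psi>[OF w] norm_circ[of t x] t0 by (simp add: m_def norm_divide dist_norm norm_minus_commute)
    moreover have "dist z (\<psi> ?w) > 0" using z \<psi>_notin[OF w] by auto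
    ultimately have "ln (dist z (\<psi> ?w) / t) = Re (h (of_real (1 / t) * exp (2 * of_real pi * \<i> * of_real x)))"
      by simp
    then show "Re (h (of_real (1 / t) * exp (2 * of_real pi * \<i> * of_real x))) + ln t = ln (dist z (\<psi> ?w))"
      using \<open>dist z (\<psi> ?w) > 0\<close> t0 by (simp add: ln_div)
  qed
qed

text \<open>Fatou's lemma for the mean values over the level curves gives the lower bound for the
  potential of the limit measure, together with its integrability.\<close>
lemma boundary_potential:
  fixes b :: "real \<Rightarrow> complex"
  defines "U \<equiv> restrict_space lborel {0..1::real}"
  assumes b: "\<And>x. b x \<in> K" "\<And>x. (\<lambda>n. \<psi> (circ (\<rho> + 1 / real (Suc n)) x)) \<longlonglongrightarrow> b x"
    and fin: "\<And>u. finite {x \<in> {0..1}. b x = u}"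
  shows "b \<in> borel_measurable U"
    and "z \<in> K \<Longrightarrow> (\<And>u. u \<in> K \<Longrightarrow> ln (dist z u) \<le> D) \<Longrightarrow>
        (\<integral>\<^sup>+x. ennreal (D - ln (dist z (b x))) \<partial>U) \<le> ennreal (D - ln \<rho>)"
proof -
  let ?t = "\<lambda>n. \<rho> + 1 / real (Suc n)"
  have t: "\<rho> < ?t n" for n by simp
  have "continuous_on UNIV (\<lambda>x. \<psi> (circ (?t n) x))" for n
    by (rule continuous_on_compose2[OF continuous_\<psi> continuous_circ]) (use t \<rho> norm_circ[of "?t n"] in auto)
  then have "(\<lambda>x. \<psi> (circ (?t n) x)) \<in> borel_measurable borel" for n
    by (rule borel_measurable_continuous_onI)
  then have bmU: "(\<lambda>x. \<psi> (circ (?t n) x)) \<in> borel_measurable U" for n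
    unfolding U_def by (intro measurable_restrict_space1) simp
  show bm: "b \<in> borel_measurable U"
    by (rule borel_measurable_LIMSEQ_metric[OF bmU b(2)])
  interpret U: prob_space U unfolding U_def by (rule prob_space_restrict_space) auto
  assume z: "z \<in> K" and D: "\<And>u. u \<in> K \<Longrightarrow> ln (dist z u) \<le> D"
  have spU: "space U = {0..1}" by (simp add: U_def space_restrict_space)
  have aeU: "AE x in U. b x \<noteq> u" for u
  proof (rule AE_I)
    let ?A = "{x \<in> {0..1}. b x = u}"
    show "{x \<in> space U. \<not> b x \<noteq> u} \<subseteq> ?A" by (auto simp: spU)
    show "?A \<in> sets U" using fin[of u]
      by (auto simp: U_def sets_restrict_space_iff finite_imp_closed borel_closed)
    show "emeasure U ?A = 0"
      unfolding U_def using fin[of u]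
      by (subst emeasure_restrict_space) (auto simp: emeasure_lborel_countable countable_finite)
  qed
  \<comment> \<open>Fatou needs nonnegative integrands, so \<open>D'\<close> has to dominate the
    kernel on the level curves as well, not only on K.\<close>
  have step: "(\<integral>\<^sup>+x. ennreal (D' - ln (dist z (b x))) \<partial>U) \<le> ennreal (D' - ln \<rho>)"
    if D': "\<And>x n. ln (dist z (\<psi> (circ (?t n) x))) \<le> D'" for D'
  proof -
    let ?F = "\<lambda>n x. ennreal (D' - ln (dist z (\<psi> (circ (?t n) x))))"
    have "(\<integral>\<^sup>+x. ennreal (D' - ln (dist z (b x))) \<partial>U) \<le> (\<integral>\<^sup>+x. liminf (\<lambda>n. ?F n x) \<partial>U)"
    proof (rule nn_integral_mono_AE, use aeU[of z] in eventually_elim)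
      case (elim x)
      then have "(\<lambda>n. ?F n x) \<longlonglongrightarrow> ennreal (D' - ln (dist z (b x)))"
        by (intro tendsto_ennrealI tendsto_intros b) auto
      then show ?case by (simp add: lim_imp_Liminf)
    qed
    also have "\<dots> \<le> liminf (\<lambda>n. \<integral>\<^sup>+x. ?F n x \<partial>U)"
      by (rule nn_integral_liminf) (use bmU in measurable)
    also have "(\<lambda>n. \<integral>\<^sup>+x. ?F n x \<partial>U) = (\<lambda>n. ennreal (D' - ln (?t n)))"
    proof
      fix n
      have "((\<lambda>x. D' - ln (dist z (\<psi> (circ (?t n) x)))) has_integral ((1 - 0) *\<^sub>R D' - ln (?t n))) {0..1}"
        using has_integral_const_real[of D' 0 1] by (intro has_integral_diff has_integral_potential z t) auto
      then have "((\<lambda>x. D' - ln (dist z (\<psi> (circ (?t n) x)))) has_integral (D' - ln (?t n))) {0..1}" by simp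
      then have "(\<integral>\<^sup>+x. indicator {0..1} x * ?F n x \<partial>lborel) = ennreal (D' - ln (?t n))"
        using nn_integral_has_integral_lebesgue[of "{0..1}" "\<lambda>x. D' - ln (dist z (\<psi> (circ (?t n) x)))"] D'
        by (simp add: indicator_mult_ennreal mult.commute)
      then show "(\<integral>\<^sup>+x. ?F n x \<partial>U) = ennreal (D' - ln (?t n))"
        unfolding U_def by (subst nn_integral_restrict_space) (auto simp: mult.commute)
    qed
    also have "liminf (\<lambda>n. ennreal (D' - ln (?t n))) = ennreal (D' - ln \<rho>)"
    proof (rule lim_imp_Liminf)
      have "?t \<longlonglongrightarrow> \<rho> + 0"
        by (intro tendsto_intros LIMSEQ_Suc[OF lim_1_over_n])
      then have "?t \<longlonglongrightarrow> \<rho>" by simp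
      then show "(\<lambda>n. ennreal (D' - ln (?t n))) \<longlonglongrightarrow> ennreal (D' - ln \<rho>)"
        by (intro tendsto_ennrealI tendsto_intros) (use \<rho> in auto)
    qed simp
    finally show ?thesis .
  qed
  \<comment> \<open>All these level curves lie in the compact set
    \<open>sublevel (\<rho> + 1)\<close>.\<close>
  obtain D' where D': "\<And>x n. ln (dist z (\<psi> (circ (?t n) x))) \<le> D'"
  proof -
    obtain B where B: "\<And>u. u \<in> sublevel (\<rho> + 1) \<Longrightarrow> norm u \<le> B"
      using compact_imp_bounded[OF compact_sublevel[of "\<rho> + 1"]] bounded_iff by (metis less_add_one)
    have "ln (dist z (\<psi> (circ (?t n) x))) \<le> ln (2 * B)" for n x
    proof -
      let ?w = "circ (?t n) x"
      have "norm ?w = ?t n" using \<rho> by (intro norm_circ) simp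
      moreover have "1 / real (Suc n) \<le> 1" by simp
      ultimately have w: "\<rho> < norm ?w" "norm ?w \<le> \<rho> + 1" using t[of n] by linarith+
      have "\<psi> ?w \<in> sublevel (\<rho> + 1)" using w f_\<psi>[OF w(1)] by (simp add: sublevel_def)
      then have "norm (\<psi> ?w) \<le> B" "norm z \<le> B" using B z by (auto simp: sublevel_def)
      then have "dist z (\<psi> ?w) \<le> 2 * B" using norm_triangle_ineq4[of z "\<psi> ?w"] by (simp add: dist_norm)
      moreover have "dist z (\<psi> ?w) > 0" using z \<psi>_notin[OF w(1)] by auto
      ultimately show ?thesis by (intro ln_mono)
    qed
    then show ?thesis using that by blast
  qed
  \<comment> \<open>Raising the constant from D to \<open>?m\<close> adds the same finite amount to
    both sides, which is cancelled at the end.\<close>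
  let ?m = "max D D'"
  have eq: "(\<integral>\<^sup>+x. ennreal (?m - ln (dist z (b x))) \<partial>U) = (\<integral>\<^sup>+x. ennreal (D - ln (dist z (b x))) \<partial>U) + ennreal (?m - D)"
  proof -
    have "(\<integral>\<^sup>+x. ennreal (?m - ln (dist z (b x))) \<partial>U) =
        (\<integral>\<^sup>+x. ennreal (D - ln (dist z (b x))) + ennreal (?m - D) \<partial>U)"
      using D[OF b(1)] by (intro nn_integral_cong) (simp flip: ennreal_plus)
    also have "\<dots> = (\<integral>\<^sup>+x. ennreal (D - ln (dist z (b x))) \<partial>U) + ennreal (?m - D)"
      using bm by (subst nn_integral_add) (auto simp: U.emeasure_space_1)
    finally show ?thesis .
  qed
  have le: "(\<integral>\<^sup>+x. ennreal (D - ln (dist z (b x))) \<partial>U) + ennreal (?m - D) \<le> ennreal (?m - ln \<rho>)"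
    unfolding eq[symmetric] by (rule step) (use D' in \<open>auto simp: le_max_iff_disj\<close>)
  show "(\<integral>\<^sup>+x. ennreal (D - ln (dist z (b x))) \<partial>U) \<le> ennreal (D - ln \<rho>)"
  proof -
    obtain r where r: "(\<integral>\<^sup>+x. ennreal (D - ln (dist z (b x))) \<partial>U) = ennreal r" "r \<ge> 0"
      using le by (cases "(\<integral>\<^sup>+x. ennreal (D - ln (dist z (b x))) \<partial>U)") (auto simp: top_unique)
    then have "ennreal (r + (?m - D)) \<le> ennreal (?m - ln \<rho>)" using le by (simp add: ennreal_plus)
    moreover have "r + (?m - D) \<ge> 0" using r by simp
    \<comment> \<open>The second alternative is the truncation of \<open>ennreal\<close> at 0; it
      forces r = 0, and then the claim is trivial.\<close>
    ultimately have "r + (?m - D) \<le> ?m - ln \<rho> \<or> r + (?m - D) = 0 \<and> ?m - ln \<rho> \<le> 0"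
      by (metis ennreal_le_iff2 antisym)
    then show ?thesis
    proof
      assume "r + (?m - D) \<le> ?m - ln \<rho>"
      then have "r \<le> D - ln \<rho>" by simp
      then show ?thesis unfolding r(1) by (rule ennreal_leI)
    next
      assume "r + (?m - D) = 0 \<and> ?m - ln \<rho> \<le> 0"
      then have "r = 0" using r(2) by linarith
      then show ?thesis using r(1) by simp
    qed
  qed
qed

end

text \<open>A continuous path along which a polynomial converges cannot oscillate between the finitely
  many roots of the limit equation.\<close>
lemma path_tendsto_of_poly_tendsto:
  fixes R :: "complex poly" and p :: "real \<Rightarrow> complex"
  assumes deg: "degree R > 0" and cont: "continuous_on {\<rho><..} p"
    and lim: "((\<lambda>t. poly R (p t)) \<longlongrightarrow> y) (at_right \<rho>)"
  obtains u where "poly R u = y" "(p \<longlongrightarrow> u) (at_right \<rho>)"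
proof -
  define Z where "Z = {u. poly R u = y}"
  have Zeq: "Z = {u. poly (R - [:y:]) u = 0}" by (auto simp: Z_def)
  have ne: "R - [:y:] \<noteq> 0" using deg by (metis degree_pCons_0 eq_iff_diff_eq_0 less_irrefl)
  then have finZ: "finite Z" unfolding Zeq by (rule poly_roots_finite)
  have near: "\<forall>\<^sub>F t in at_right \<rho>. \<exists>u\<in>Z. dist (p t) u < \<delta>" if "\<delta> > 0" for \<delta>
  proof -
    \<comment> \<open>On this compact set, away from all solutions of R u = y, the distance of R u
      from y has a positive minimum; so R(p t) close to y puts p t near a solution.\<close>
    define C where "C = {u. poly R u \<in> cball y 1} - (\<Union>u\<in>Z. ball u \<delta>)"
    have "compact C" unfolding C_def
      by (intro compact_diff polynomial_preimage_compact deg) auto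
    have "\<exists>\<eta>>0. \<forall>u\<in>C. \<eta> \<le> dist (poly R u) y"
    proof (cases "C = {}")
      case False
      obtain u where u: "u \<in> C" "\<And>v. v \<in> C \<Longrightarrow> dist (poly R u) y \<le> dist (poly R v) y"
      proof -
        have "continuous_on C (\<lambda>u. dist (poly R u) y)" by (intro continuous_intros)
        from continuous_attains_inf[OF \<open>compact C\<close> False this] show ?thesis using that by blast
      qed
      have "u \<notin> Z" using u(1) that by (auto simp: C_def)
      then have "dist (poly R u) y > 0" by (auto simp: Z_def)
      then show ?thesis using u by blast
    qed (auto intro: exI[of _ 1])
    then obtain \<eta> where \<eta>: "\<eta> > 0" "\<And>u. u \<in> C \<Longrightarrow> \<eta> \<le> dist (poly R u) y" by blast
    have "\<forall>\<^sub>F t in at_right \<rho>. dist (poly R (p t)) y < min \<eta> 1"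
      using lim \<eta>(1) by (intro tendstoD) auto
    then show ?thesis
    proof eventually_elim
      case (elim t)
      then have "p t \<notin> C" using \<eta>(2)[of "p t"] by force
      then show ?case using elim by (auto simp: C_def dist_commute)
    qed
  qed
  obtain \<delta>0 where \<delta>0: "\<delta>0 > 0" "\<And>u v. u \<in> Z \<Longrightarrow> v \<in> Z \<Longrightarrow> u \<noteq> v \<Longrightarrow> 2 * \<delta>0 \<le> dist u v"
  proof -
    define S where "S = (\<lambda>(u,v). dist u v / 2) ` {q \<in> Z \<times> Z. fst q \<noteq> snd q} \<union> {1}"
    have S: "finite S" "\<And>s. s \<in> S \<Longrightarrow> s > 0" using finZ by (auto simp: S_def)
    have "Min S > 0" using S by (subst Min_gr_iff) (auto simp: S_def)
    moreover have "2 * Min S \<le> dist u v" if "u \<in> Z" "v \<in> Z" "u \<noteq> v" for u v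
    proof -
      have "dist u v / 2 \<in> S" unfolding S_def
        using that by (intro UnI1 image_eqI[of _ _ "(u, v)"]) auto
      then have "Min S \<le> dist u v / 2" using S(1) by (rule Min_le[rotated])
      then show ?thesis by simp
    qed
    ultimately show ?thesis using that by blast
  qed
  obtain s where s: "s > \<rho>" "\<And>t. \<rho> < t \<Longrightarrow> t < s \<Longrightarrow> \<exists>u\<in>Z. dist (p t) u < \<delta>0"
    using near[OF \<delta>0(1)] unfolding eventually_at_right_field by blast
  have "connected (p ` {\<rho><..<s})"
    by (intro connected_continuous_image continuous_on_subset[OF cont]) auto
  obtain t0 where t0: "\<rho> < t0" "t0 < s" using dense s(1) by blast
  obtain u where u: "u \<in> Z" "dist (p t0) u < \<delta>0" using s(2)[OF t0] by blast
  \<comment> \<open>Balls of radius \<open>\<delta>0\<close> around distinct solutions are disjoint,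
    so the connected end of the path stays in one of them.\<close>
  have inu: "dist (p t) u < \<delta>0" if t: "\<rho> < t" "t < s" for t
  proof (rule ccontr)
    assume no: "\<not> dist (p t) u < \<delta>0"
    let ?A = "ball u \<delta>0" and ?B = "\<Union>v\<in>Z - {u}. ball v \<delta>0"
    have "?A \<inter> ball v \<delta>0 = {}" if "v \<in> Z - {u}" for v
      using \<delta>0(2)[of u v] that u by (intro disjoint_ballI) auto
    then have "?A \<inter> ?B = {}" by auto
    moreover have "p ` {\<rho><..<s} \<subseteq> ?A \<union> ?B" using s(2) by (fastforce simp: dist_commute)
    moreover have "p t0 \<in> ?A \<inter> p ` {\<rho><..<s}" using u t0 by (auto simp: dist_commute)
    moreover have "p t \<in> ?B \<inter> p ` {\<rho><..<s}" using s(2)[OF t] no t by (fastforce simp: dist_commute)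
    ultimately show False
      using connectedD[OF \<open>connected (p ` {\<rho><..<s})\<close>, of ?A ?B] by blast
  qed
  have "(p \<longlongrightarrow> u) (at_right \<rho>)"
  proof (rule tendstoI)
    fix e :: real assume "e > 0"
    have "\<forall>\<^sub>F t in at_right \<rho>. \<rho> < t \<and> t < s"
      using s(1) unfolding eventually_at_right_field by blast
    moreover have "min e \<delta>0 > 0" using \<open>e > 0\<close> \<delta>0 by simp
    then have "\<forall>\<^sub>F t in at_right \<rho>. \<exists>u\<in>Z. dist (p t) u < min e \<delta>0" by (rule near)
    ultimately show "\<forall>\<^sub>F t in at_right \<rho>. dist (p t) u < e"
    proof eventually_elim
      case (elim t)
      then obtain v where v: "v \<in> Z" "dist (p t) v < min e \<delta>0" by blast
      have "v = u"
      proof (rule ccontr)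
        assume "v \<noteq> u"
        then have "2 * \<delta>0 \<le> dist u v" using \<delta>0(2)[of u v] u v by auto
        moreover have "dist u v \<le> dist (p t) u + dist (p t) v" by (metis dist_commute dist_triangle)
        ultimately show False using inu[of t] elim v by auto
      qed
      then show ?case using v by simp
    qed
  qed
  then show ?thesis using that[of u] u by (simp add: Z_def)
qed

context exterior_map
begin

lemma finite_circ_vimage:
  assumes "finite S"
  shows "finite {x \<in> {0..1}. circ \<rho> x \<in> S}"
proof -
  have "inj_on (circ \<rho>) {0..<1}"
  proof (rule inj_onI)
    fix x y :: real assume xy: "x \<in> {0..<1}" "y \<in> {0..<1}" "circ \<rho> x = circ \<rho> y"
    then have "exp (2 * of_real pi * \<i> * complex_of_real x) = exp (2 * of_real pi * \<i> * complex_of_real y)"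
      using \<rho> by (simp add: circ_def field_simps)
    then obtain n :: int where "2 * of_real pi * \<i> * complex_of_real x = 2 * of_real pi * \<i> * complex_of_real y + (of_int (2 * n) * pi) * \<i>"
      using exp_eq by metis
    then have "2 * pi * \<i> * complex_of_real x = 2 * pi * \<i> * (complex_of_real y + of_int n)"
      by (simp add: algebra_simps)
    then have "complex_of_real x = complex_of_real (y + of_int n)" by simp
    then have "x = y + of_int n" using of_real_eq_iff by blast
    moreover have "n = 0" using calculation xy by auto
    ultimately show "x = y" by simp
  qed
  then have "finite (circ \<rho> -` S \<inter> {0..<1})" using assms by (rule finite_vimage_IntI[rotated])
  moreover have "{x \<in> {0..1}. circ \<rho> x \<in> S} \<subseteq> insert 1 (circ \<rho> -` S \<inter> {0..<1})" by auto
  ultimately show ?thesis by (meson finite.insertI finite_subset)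
qed

text \<open>With y = 2 c w^k one has R(\<psi> w) = (y + 1/y) / 2, which is continuous up to |w| =
  \<rho>, where |y| = 1. So R(\<psi>) has radial limits, and with it \<psi>. On the circle (y + 1/y)
  / 2 is the real part of y, hence the limits lie in K. A limit determines y up to two values, and y
  determines w up to a k-th root of unity, so fibres are finite.\<close>

lemma polynomial_boundary_values:
  fixes R :: "complex poly" and c :: complex
  assumes K: "K = {u. poly R u \<in> unit_segment}" and k: "degree R > 0" "k > 0" and c: "2 * norm c * \<rho> ^ k = 1"
    and fk: "\<And>u. u \<notin> K \<Longrightarrow> f u ^ k = (poly R u + joukowski_sqrt (poly R u)) / (2 * c)"
  obtains b where "\<And>x. b x \<in> K" "\<And>x. (\<lambda>n. \<psi> (circ (\<rho> + 1 / real (Suc n)) x)) \<longlonglongrightarrow> b x"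
    "\<And>u. finite {x \<in> {0..1}. b x = u}"
proof -
  have c0: "c \<noteq> 0" using c by auto
  define y where "y = (\<lambda>t x. 2 * c * circ t x ^ k)"
  have R\<psi>: "poly R (\<psi> w) = (2 * c * w ^ k + 1 / (2 * c * w ^ k)) / 2" if w: "\<rho> < norm w" for w
  proof -
    let ?x = "poly R (\<psi> w)"
    have notin: "?x \<notin> unit_segment" using \<psi>_notin[OF w] by (auto simp: K)
    have e: "2 * c * w ^ k = ?x + joukowski_sqrt ?x"
      using fk[OF \<psi>_notin[OF w]] f_\<psi>[OF w] c0 by (simp add: field_simps)
    have "1 / (?x + joukowski_sqrt ?x) = ?x - joukowski_sqrt ?x"
      using joukowski_sqrt_mult[OF notin] by (metis mult_eq_0_iff nonzero_eq_divide_eq mult.commute zero_neq_one)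
    then show ?thesis by (simp add: e)
  qed
  have y1: "norm (y \<rho> x) = 1" for x
    using norm_circ[of \<rho> x] \<rho> c by (simp add: y_def norm_mult norm_power)
  have "\<exists>u. poly R u = (y \<rho> x + 1 / y \<rho> x) / 2 \<and> ((\<lambda>t. \<psi> (circ t x)) \<longlongrightarrow> u) (at_right \<rho>)" for x
  proof -
    have gt: "\<rho> < norm (circ t x)" if "t \<in> {\<rho><..}" for t using that \<rho> norm_circ[of t x] by simp
    have cc: "continuous_on T (\<lambda>t. circ t x)" for T unfolding circ_def by (intro continuous_intros) auto
    have cont: "continuous_on {\<rho><..} (\<lambda>t. \<psi> (circ t x))"
      by (rule continuous_on_compose2[OF continuous_\<psi> cc]) (use gt in auto)
    have "isCont (\<lambda>t. circ t x) \<rho>" using cc[of UNIV] by (simp add: continuous_on_eq_continuous_at)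
    then have "((\<lambda>t. circ t x) \<longlongrightarrow> circ \<rho> x) (at_right \<rho>)"
      by (simp add: isCont_def filterlim_at_split)
    then have "((\<lambda>t. (y t x + 1 / y t x) / 2) \<longlongrightarrow> (y \<rho> x + 1 / y \<rho> x) / 2) (at_right \<rho>)"
      unfolding y_def using c0 norm_circ[of \<rho> x] \<rho> by (intro tendsto_intros) auto
    moreover have "\<forall>\<^sub>F t in at_right \<rho>. (y t x + 1 / y t x) / 2 = poly R (\<psi> (circ t x))"
      using eventually_at_right_less[of \<rho>] by eventually_elim (use R\<psi> gt in \<open>simp add: y_def\<close>)
    ultimately have "((\<lambda>t. poly R (\<psi> (circ t x))) \<longlongrightarrow> (y \<rho> x + 1 / y \<rho> x) / 2) (at_right \<rho>)"
      using tendsto_cong by fast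
    from path_tendsto_of_poly_tendsto[OF k(1) cont this] show ?thesis by metis
  qed
  then obtain b where b: "\<And>x. poly R (b x) = (y \<rho> x + 1 / y \<rho> x) / 2"
    "\<And>x. ((\<lambda>t. \<psi> (circ t x)) \<longlongrightarrow> b x) (at_right \<rho>)" by metis
  show ?thesis
  proof (rule that[of b])
    show "b x \<in> K" for x
    proof -
      have "1 / y \<rho> x = cnj (y \<rho> x)"
      proof -
        have "y \<rho> x \<noteq> 0" "y \<rho> x * cnj (y \<rho> x) = 1"
          using y1[of x] complex_norm_square[of "y \<rho> x"] by auto
        then show ?thesis by (simp add: divide_eq_eq mult.commute)
      qed
      then have "poly R (b x) = of_real (Re (y \<rho> x))" using b(1)[of x] by (simp add: complex_add_cnj)
      moreover have "Re (y \<rho> x) \<in> {-1..1}" using abs_Re_le_cmod[of "y \<rho> x"] y1[of x] by auto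
      ultimately show ?thesis unfolding K by blast
    qed
    show "(\<lambda>n. \<psi> (circ (\<rho> + 1 / real (Suc n)) x)) \<longlonglongrightarrow> b x" for x
    proof (rule filterlim_compose[OF b(2)])
      have "(\<lambda>n. \<rho> + 1 / real (Suc n)) \<longlonglongrightarrow> \<rho> + 0"
        by (intro tendsto_intros LIMSEQ_Suc[OF lim_1_over_n])
      then show "filterlim (\<lambda>n. \<rho> + 1 / real (Suc n)) (at_right \<rho>) sequentially"
        by (auto simp: filterlim_at)
    qed
    show "finite {x \<in> {0..1}. b x = u}" for u
    proof -
      let ?r = "poly R u"
      let ?Y = "{?r + csqrt (?r\<^sup>2 - 1), ?r - csqrt (?r\<^sup>2 - 1)}"
      let ?S = "\<Union>y\<in>?Y. {w. w ^ k = y / (2 * c)}"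
      have "circ \<rho> x \<in> ?S" if "b x = u" for x
      proof -
        have ne: "y \<rho> x \<noteq> 0" using y1[of x] by auto
        have "2 * ?r * y \<rho> x = (y \<rho> x)\<^sup>2 + 1"
          using b(1)[of x] that ne by (simp add: field_simps power2_eq_square)
        then have "(y \<rho> x - ?r)\<^sup>2 = (csqrt (?r\<^sup>2 - 1))\<^sup>2"
          unfolding power2_csqrt by (simp add: power2_eq_square algebra_simps)
        then have "y \<rho> x - ?r = csqrt (?r\<^sup>2 - 1) \<or> y \<rho> x - ?r = - csqrt (?r\<^sup>2 - 1)"
          unfolding power2_eq_iff .
        then have "y \<rho> x = ?r + csqrt (?r\<^sup>2 - 1) \<or> y \<rho> x = ?r - csqrt (?r\<^sup>2 - 1)"
          by (auto simp: algebra_simps eq_diff_eq)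
        then have "y \<rho> x \<in> ?Y" by blast
        moreover have "circ \<rho> x ^ k = y \<rho> x / (2 * c)" using c0 by (simp add: y_def)
        ultimately show ?thesis by blast
      qed
      then have "{x \<in> {0..1}. b x = u} \<subseteq> {x \<in> {0..1}. circ \<rho> x \<in> ?S}" by blast
      moreover have "finite ?S" using k by (intro finite_UN_I) auto
      ultimately show ?thesis using finite_circ_vimage finite_subset by blast
    qed
  qed
qed

end

section \<open>Monic polynomials that are small on the preimage of the segment\<close>

text \<open>These are the Chebyshev polynomials scaled to be monic: 2^(1-j) cos(j \<theta>) in the
  variable cos \<theta>.\<close>

lemma scaled_chebyshev_polys:
  "\<exists>\<tau> :: complex poly. degree \<tau> = j \<and> lead_coeff \<tau> = 1 \<and> (\<forall>x\<in>{-1..1}. norm (poly \<tau> (of_real x)) \<le> 2 * (1/2) ^ j)"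
proof -
  \<comment> \<open>The induction starts at degree 1: at degree 0 the formula would give the
    constant 2, which is not monic.\<close>
  have cosrec: "\<exists>\<tau> :: real poly. degree \<tau> = Suc j \<and> lead_coeff \<tau> = 1 \<and>
      (\<forall>\<theta>. poly \<tau> (cos \<theta>) = 2 * (1/2) ^ Suc j * cos (real (Suc j) * \<theta>))" for j
  proof (induction j rule: less_induct)
    case (less j)
    consider "j = 0" | "j = 1" | i where "j = Suc (Suc i)" by (metis One_nat_def not0_implies_Suc)
    then show ?case
    proof cases
      case 1
      then show ?thesis by (intro exI[of _ "[:0, 1:]"]) auto
    next
      case 2
      have "poly [:- (1/2), 0, 1:] (cos \<theta>) = 2 * (1/2) ^ Suc 1 * cos (real (Suc 1) * \<theta>)" for \<theta> :: real
        using cos_double_cos[of \<theta>] by (simp add: power2_eq_square algebra_simps)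
      then show ?thesis using 2 by (intro exI[of _ "[:- (1/2), 0, 1:]"]) auto
    next
      case 3
      obtain \<sigma> where \<sigma>: "degree \<sigma> = Suc (Suc i)" "lead_coeff \<sigma> = 1"
          "\<And>\<theta>. poly \<sigma> (cos \<theta>) = 2 * (1/2) ^ Suc (Suc i) * cos (real (Suc (Suc i)) * \<theta>)"
        using less.IH[of "Suc i"] 3 by auto
      obtain \<pi> where \<pi>: "degree \<pi> = Suc i" "\<And>\<theta>. poly \<pi> (cos \<theta>) = 2 * (1/2) ^ Suc i * cos (real (Suc i) * \<theta>)"
        using less.IH[of i] 3 by auto
      \<comment> \<open>Three-term recurrence of the scaled polynomials, from cos((j+1)\<theta>) +
        cos((j-1)\<theta>) = 2 cos \<theta> cos(j \<theta>); the scaling turns the coefficient of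
        the older one into 1/4.\<close>
      let ?\<tau> = "pCons 0 \<sigma> - smult (1/4) \<pi>"
      have s0: "\<sigma> \<noteq> 0" using \<sigma>(1) by auto
      have dlt: "degree (smult (1/4) \<pi>) < degree (pCons 0 \<sigma>)" using \<sigma>(1) \<pi>(1) s0 by simp
      have "degree ?\<tau> = Suc (Suc (Suc i))"
        using degree_add_eq_left[of "- smult (1/4) \<pi>" "pCons 0 \<sigma>"] dlt \<sigma>(1) s0 by simp
      moreover have "lead_coeff ?\<tau> = 1"
        unfolding calculation using \<sigma> \<pi>(1) by (simp add: coeff_eq_0)
      moreover have "poly ?\<tau> (cos \<theta>) = 2 * (1/2) ^ Suc (Suc (Suc i)) * cos (real (Suc (Suc (Suc i))) * \<theta>)" for \<theta>
      proof -
        have "cos (real (Suc (Suc (Suc i))) * \<theta>) + cos (real (Suc i) * \<theta>) = 2 * (cos \<theta> * cos (real (Suc (Suc i)) * \<theta>))"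
        proof -
          have "real (Suc (Suc (Suc i))) * \<theta> = real (Suc (Suc i)) * \<theta> + \<theta>"
            "real (Suc i) * \<theta> = real (Suc (Suc i)) * \<theta> - \<theta>" by (simp_all add: algebra_simps)
          then show ?thesis by (simp only: cos_add cos_diff) simp
        qed
        then have e: "cos \<theta> * cos (real (Suc (Suc i)) * \<theta>) = (cos (real (Suc (Suc (Suc i))) * \<theta>) + cos (real (Suc i) * \<theta>)) / 2"
          by simp
        have "poly ?\<tau> (cos \<theta>) = 2 * (1/2) ^ Suc (Suc i) * (cos \<theta> * cos (real (Suc (Suc i)) * \<theta>))
            - (1/4) * (2 * (1/2) ^ Suc i * cos (real (Suc i) * \<theta>))"
          by (simp only: poly_diff poly_pCons poly_smult \<sigma>(3) \<pi>(2)) simp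
        then show ?thesis unfolding e by (simp add: field_simps del: of_nat_Suc)
      qed
      ultimately show ?thesis using 3 by blast
    qed
  qed
  show ?thesis
  proof (cases j)
    case 0
    then show ?thesis by (intro exI[of _ 1]) auto
  next
    case (Suc i)
    obtain \<tau> :: "real poly" where \<tau>: "degree \<tau> = Suc i" "lead_coeff \<tau> = 1"
        "\<And>\<theta>. poly \<tau> (cos \<theta>) = 2 * (1/2) ^ Suc i * cos (real (Suc i) * \<theta>)"
      using cosrec[of i] by metis
    let ?t = "map_poly complex_of_real \<tau>"
    have "norm (poly ?t (of_real x)) \<le> 2 * (1/2) ^ j" if x: "x \<in> {-1..1}" for x
    proof -
      have "poly ?t (of_real x) = of_real (poly \<tau> x)" by (simp add: poly_altdef degree_map_poly coeff_map_poly)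
      also have "poly \<tau> x = 2 * (1/2) ^ j * cos (real (Suc i) * arccos x)"
        using \<tau>(3)[of "arccos x"] x Suc by (simp add: cos_arccos)
      finally have "norm (poly ?t (of_real x)) = 2 * (1/2) ^ j * \<bar>cos (real (Suc i) * arccos x)\<bar>"
        by (simp only: norm_of_real abs_mult) simp
      also have "\<dots> \<le> 2 * (1/2) ^ j * 1" by (intro mult_left_mono abs_cos_le_one) auto
      finally show ?thesis by simp
    qed
    moreover have "degree ?t = j" using \<tau>(1) Suc by (simp add: degree_map_poly)
    moreover have "lead_coeff ?t = 1" using \<tau> by (simp add: degree_map_poly coeff_map_poly)
    ultimately show ?thesis by blast
  qed
qed

text \<open>For j = n q + r take z^r times the monic Chebyshev polynomial of degree q in P, divided
  by the q-th power of the leading coefficient p. Since c^n = 1 / (2|p|), the factor (1/2)^q / |p|^q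
  is exactly c^(n q); the r < n spare powers of z affect only the constant.\<close>

lemma small_monic_polys_on_preimage:
  fixes P :: "complex poly"
  defines "n \<equiv> degree P" and "c \<equiv> (2 * norm (lead_coeff P)) powr (- 1 / real (degree P))"
  assumes n: "n > 0"
  obtains C where "C > 0" "\<And>j. \<exists>t. degree t = j \<and> lead_coeff t = 1 \<and>
     (\<forall>z\<in>{z. poly P z \<in> unit_segment}. norm (poly t z) \<le> C * c ^ j)"
proof -
  let ?E = "{z. poly P z \<in> unit_segment}"
  define p where "p = lead_coeff P"
  have p0: "p \<noteq> 0" using n by (auto simp: p_def n_def)
  have c0: "c > 0" using p0 by (simp add: c_def p_def)
  have cn: "c ^ n = 1 / (2 * norm p)"
  proof -
    have "c = (2 * norm p) powr (- 1 / real n)" by (simp add: c_def p_def n_def)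
    then have "c ^ n = (2 * norm p) powr (- 1 / real n * real n)"
      unfolding powr_powr[symmetric] using p0 by (subst powr_realpow) auto
    also have "\<dots> = (2 * norm p) powr (- 1)" using n by simp
    finally show ?thesis using p0 by (simp add: powr_minus inverse_eq_divide)
  qed
  have "compact ?E"
    by (intro polynomial_preimage_compact compact_continuous_image continuous_intros) (use n n_def in auto)
  then obtain B0 where B0: "\<And>z. z \<in> ?E \<Longrightarrow> norm z \<le> B0"
    using compact_imp_bounded bounded_iff by metis
  \<comment> \<open>B0 / c is included so that |z| \<le> c B on the set: the factor z^r must
    contribute its share c^r.\<close>
  define B where "B = max 1 (max B0 (B0 / c))"
  have B: "B \<ge> 1" "\<And>z. z \<in> ?E \<Longrightarrow> norm z \<le> c * B"
  proof -
    fix z assume "z \<in> ?E"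
    then have "norm z \<le> c * (B0 / c)" using B0 c0 by simp
    also have "\<dots> \<le> c * B" using c0 by (intro mult_left_mono) (auto simp: B_def)
    finally show "norm z \<le> c * B" .
  qed (simp add: B_def)
  show ?thesis
  proof (rule that[of "2 * B ^ n"])
    show "2 * B ^ n > 0" using B(1) by simp
    fix j
    define q r where "q = j div n" and "r = j mod n"
    have j: "j = n * q + r" "r < n" using n by (simp_all add: q_def r_def)
    obtain \<tau> :: "complex poly" where \<tau>: "degree \<tau> = q" "lead_coeff \<tau> = 1"
        "\<And>x. x \<in> {-1..1} \<Longrightarrow> norm (poly \<tau> (of_real x)) \<le> 2 * (1/2) ^ q"
      using scaled_chebyshev_polys[of q] by metis
    have deg: "degree (pcompose \<tau> P) = q * n" by (simp add: degree_pcompose \<tau>(1) n_def)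
    have lc: "lead_coeff (pcompose \<tau> P) = p ^ q"
      using lead_coeff_comp[of P \<tau>] n \<tau> by (simp add: n_def p_def)
    have ne: "pcompose \<tau> P \<noteq> 0" using lc p0 by auto
    define t where "t = monom 1 r * smult (1 / p ^ q) (pcompose \<tau> P)"
    have "degree t = j"
      unfolding t_def using ne p0 deg j by (subst degree_mult_eq) (auto simp: degree_monom_eq mult.commute)
    moreover have "lead_coeff t = 1"
      unfolding t_def lead_coeff_mult lead_coeff_smult lc using p0 by (simp add: degree_monom_eq)
    moreover have "norm (poly t z) \<le> 2 * B ^ n * c ^ j" if z: "z \<in> ?E" for z
    proof -
      obtain x where x: "x \<in> {-1..1}" "poly P z = of_real x" using z by auto
      have "norm (poly t z) = norm z ^ r * (norm (poly \<tau> (of_real x)) / norm p ^ q)"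
        by (simp add: t_def poly_monom poly_pcompose x norm_mult norm_power norm_divide)
      also have "\<dots> \<le> (c * B) ^ r * (2 * (1/2) ^ q / norm p ^ q)"
        using \<tau>(3)[OF x(1)] B(2)[OF z] c0 B(1)
        by (intro mult_mono power_mono divide_right_mono) auto
      also have "2 * (1/2) ^ q / norm p ^ q = 2 * (c ^ n) ^ q"
        unfolding cn by (simp add: power_divide power_mult_distrib)
      also have "(c * B) ^ r * (2 * (c ^ n) ^ q) = 2 * B ^ r * c ^ j"
        by (simp add: j(1) power_add power_mult power_mult_distrib)
      also have "\<dots> \<le> 2 * B ^ n * c ^ j"
        using B(1) j(2) c0 by (intro mult_right_mono mult_left_mono power_increasing) auto
      finally show ?thesis .
    qed
    ultimately show "\<exists>t. degree t = j \<and> lead_coeff t = 1 \<and> (\<forall>z\<in>?E. norm (poly t z) \<le> 2 * B ^ n * c ^ j)" by blast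
  qed
qed

section \<open>Branches of the square root\<close>

lemma components_Un_two:
  fixes F G :: "'a::topological_space set"
  assumes "closed F" "closed G" "connected F" "connected G" "F \<noteq> {}" "G \<noteq> {}" "F \<inter> G = {}"
  shows "components (F \<union> G) = {F, G}"
proof -
  have comp: "A \<in> components (A \<union> B)"
    if A: "closed A" "closed B" "connected A" "A \<noteq> {}" "A \<inter> B = {}" for A B :: "'a set"
    unfolding in_components_maximal
  proof (intro conjI allI impI)
    fix d assume d: "d \<noteq> {} \<and> A \<subseteq> d \<and> d \<subseteq> A \<union> B \<and> connected d"
    then have "A \<inter> d = {} \<or> B \<inter> d = {}"
      using A by (intro connected_closedD[of d]) auto
    then show "d = A" using A d by blast
  qed (use A in auto)
  have F: "F \<in> components (F \<union> G)" by (rule comp) (use assms in auto)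
  have "G \<in> components (G \<union> F)" by (rule comp) (use assms in auto)
  then have G: "G \<in> components (F \<union> G)" by (simp add: Un_commute)
  show ?thesis
  proof (intro equalityI subsetI)
    fix C assume C: "C \<in> components (F \<union> G)"
    then obtain x where x: "x \<in> C" "x \<in> F \<union> G"
      using in_components_nonempty in_components_subset by blast
    then have "C \<inter> F \<noteq> {} \<or> C \<inter> G \<noteq> {}" by blast
    then show "C \<in> {F, G}" using components_nonoverlap[OF C F] components_nonoverlap[OF C G] by blast
  qed (use F G in auto)
qed

text \<open>A - C and - A are disjoint open sets that make up the complement of C, so each of its
  components lies in one of them. The first set is bounded; the second is connected and
  unbounded.\<close>

lemma inside_outside_of_frontier:
  fixes A C :: "complex set"
  assumes A: "compact A" "connected (- A)" and C: "C \<subseteq> A" "open (A - C)"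
  shows "inside C = A - C" "outside C = - A"
proof -
  have open_A: "open (- A)" using A by (simp add: compact_imp_closed open_Compl)
  have unb: "\<not> bounded (- A)" using A(1) cobounded_imp_unbounded compact_imp_bounded by fastforce
  have out: "x \<in> outside C" if "x \<in> - A" for x
  proof -
    have "- A \<subseteq> connected_component_set (- C) x"
      using that C A by (intro connected_component_maximal) auto
    then have "\<not> bounded (connected_component_set (- C) x)" using unb bounded_subset by blast
    then show ?thesis using that C by (auto simp: outside_def)
  qed
  have ins: "x \<in> inside C" if x: "x \<in> A - C" for x
  proof -
    let ?D = "connected_component_set (- C) x"
    have "?D \<subseteq> (A - C) \<union> (- A)" using connected_component_subset[of "- C" x] by blast
    moreover have "x \<in> ?D" using x by simp
    ultimately have "- A \<inter> ?D = {}"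
      using connectedD[OF connected_connected_component C(2) open_A, of "- C" x] x by blast
    then have "?D \<subseteq> A" by blast
    then have "bounded ?D" using A(1) bounded_subset compact_imp_bounded by blast
    then show ?thesis using x by (auto simp: inside_def)
  qed
  have "inside C \<inter> outside C = {}" "inside C \<inter> C = {}" "outside C \<inter> C = {}"
    by (auto simp: inside_def outside_def)
  then show "inside C = A - C" "outside C = - A" using ins out C by blast+
qed

text \<open>A compact plane set with connected complement is Borsukian: zero-free continuous
  functions on it have continuous logarithms. Half of a logarithm of the identity gives the
  root.\<close>

lemma continuous_square_root:
  fixes K :: "complex set"
  assumes "compact K" "connected (- K)" "0 \<notin> K"
  obtains s where "continuous_on K s" "\<And>u. u \<in> K \<Longrightarrow> (s u)\<^sup>2 = u"
proof -
  have "Borsukian K" using assms by (simp add: Borsukian_separation_compact)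
  then obtain g :: "complex \<Rightarrow> complex" where g: "continuous_on K g" "\<And>u. u \<in> K \<Longrightarrow> u = exp (g u)"
    using assms unfolding Borsukian_continuous_logarithm
    by (metis (no_types, lifting) ComplI Pi_I continuous_on_id id_apply singletonD)
  show ?thesis
  proof (rule that[of "\<lambda>u. exp (g u / 2)"])
    show "continuous_on K (\<lambda>u. exp (g u / 2))" by (intro continuous_intros g) auto
    show "(exp (g u / 2))\<^sup>2 = u" if "u \<in> K" for u
      using g(2)[OF that] by (simp add: power2_eq_square flip: exp_add)
  qed
qed

locale square_root_branch =
  fixes K :: "complex set" and s :: "complex \<Rightarrow> complex"
  assumes compact: "compact K" and connected_Compl: "connected (- K)" and nonzero: "0 \<notin> K"
    and cont: "continuous_on K s" and sq: "\<And>u. u \<in> K \<Longrightarrow> (s u)\<^sup>2 = u"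
begin

lemma inj_s: "inj_on s K"
  by (metis inj_onI sq)

lemma s_nonzero: "u \<in> K \<Longrightarrow> s u \<noteq> 0"
  using sq nonzero by force

lemma compact_image: "compact (s ` K)"
  by (intro compact_continuous_image cont compact)

lemma disjoint: "s ` K \<inter> uminus ` s ` K = {}"
proof (rule ccontr)
  assume "\<not> ?thesis"
  then obtain u v where uv: "u \<in> K" "v \<in> K" "s u = - s v" by auto
  then have "u = v" using sq by (metis power2_minus)
  then show False using uv s_nonzero[of u] by simp
qed

lemma preimage_square: "A \<subseteq> K \<Longrightarrow> {z. z\<^sup>2 \<in> A} = s ` A \<union> uminus ` s ` A"
proof (intro equalityI subsetI)
  fix z assume A: "A \<subseteq> K" and z: "z \<in> {z. z\<^sup>2 \<in> A}"
  then have "(s (z\<^sup>2))\<^sup>2 = z\<^sup>2" using sq by auto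
  then have "z = s (z\<^sup>2) \<or> z = - s (z\<^sup>2)" by (metis power2_eq_iff)
  then show "z \<in> s ` A \<union> uminus ` s ` A" using z by blast
qed (use sq in \<open>auto simp: subset_iff\<close>)

text \<open>For compact plane sets, connectedness of the complement is equivalent to the Borsukian
  property, which is invariant under the homeomorphism s with inverse z^2.\<close>

lemma connected_Compl_image: "connected (- s ` K)"
proof -
  have "homeomorphism K (s ` K) s (\<lambda>z. z\<^sup>2)"
    using sq cont by (intro homeomorphismI) (auto intro!: continuous_intros)
  then have "K homeomorphic s ` K" using homeomorphic_def by blast
  moreover have "Borsukian K" using compact connected_Compl by (simp add: Borsukian_separation_compact)
  ultimately have "Borsukian (s ` K)" using homeomorphic_Borsukian by blast
  then show ?thesis using compact_image by (simp add: Borsukian_separation_compact)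
qed

lemma connected_Compl_minus_image: "connected (- uminus ` s ` K)"
proof -
  have "- uminus ` s ` K = uminus ` (- s ` K)" by (simp only: bij_image_Compl_eq[OF bij_uminus])
  then show ?thesis
    using connected_continuous_image[OF _ connected_Compl_image, of uminus] by (simp add: continuous_intros)
qed

lemma components_preimage:
  assumes "connected K" "K \<noteq> {}"
  shows "components {z. z\<^sup>2 \<in> K} = {s ` K, uminus ` s ` K}"
  unfolding preimage_square[OF subset_refl]
proof (rule components_Un_two)
  have "compact (uminus ` s ` K)" by (intro compact_continuous_image continuous_intros compact_image)
  then show "closed (s ` K)" "closed (uminus ` s ` K)" using compact_image by (auto simp: compact_imp_closed)
  show "connected (s ` K)" by (intro connected_continuous_image cont assms)
  then show "connected (uminus ` s ` K)" by (rule connected_continuous_image[rotated]) (intro continuous_intros)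
qed (use assms disjoint in auto)

text \<open>The lifted region is open because it is a preimage under squaring with the other,
  compact sheet removed; so the lift of C encloses it.\<close>

lemma inside_outside_image:
  assumes C: "C \<subseteq> K" "open (K - C)"
  shows "inside (s ` C) = s ` (K - C)" "outside (s ` C) = - s ` K"
proof -
  have e: "s ` K - s ` C = s ` (K - C)" using inj_on_image_set_diff[OF inj_s, of K C] C by auto
  have "s ` (K - C) = {z. z\<^sup>2 \<in> K - C} - uminus ` s ` K"
    using preimage_square[of "K - C"] disjoint by blast
  moreover have "open {z. z\<^sup>2 \<in> K - C}"
    using open_vimage[OF C(2), of "\<lambda>z. z\<^sup>2"] by (simp add: vimage_def continuous_intros)
  moreover have "closed (uminus ` s ` K)"
    by (intro compact_imp_closed compact_continuous_image continuous_intros compact_image)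
  ultimately have op: "open (s ` K - s ` C)" using e by (simp add: open_Diff)
  have "s ` C \<subseteq> s ` K" using C by auto
  from inside_outside_of_frontier[OF compact_image connected_Compl_image this op]
  show "inside (s ` C) = s ` (K - C)" "outside (s ` C) = - s ` K" using e by auto
qed

lemma minus_branch: "square_root_branch K (\<lambda>u. - s u)"
  by unfold_locales (use compact connected_Compl nonzero cont sq in \<open>auto intro!: continuous_intros\<close>)

lemma subset_branch:
  assumes "A \<subseteq> K" "compact A" "connected (- A)" shows "square_root_branch A s"
  by unfold_locales (use assms nonzero cont sq continuous_on_subset in auto)

text \<open>The quotient of two continuous square roots of a zero-free function takes only the
  values 1 and -1.\<close>

lemma branch_unique_on_connected:
  assumes g: "continuous_on A g" "connected A" "\<And>x. x \<in> A \<Longrightarrow> g x \<in> K"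
    and h: "continuous_on A h" "\<And>x. x \<in> A \<Longrightarrow> (h x)\<^sup>2 = g x"
  shows "(\<forall>x\<in>A. h x = s (g x)) \<or> (\<forall>x\<in>A. h x = - s (g x))"
proof -
  have cs: "continuous_on A (\<lambda>x. s (g x))" by (rule continuous_on_compose2[OF cont g(1)]) (use g(3) in auto)
  have nz: "s (g x) \<noteq> 0" if "x \<in> A" for x using s_nonzero g(3) that by blast
  have "continuous_on A (\<lambda>x. h x / s (g x))" using nz by (intro continuous_intros h cs) auto
  moreover have vals: "h x / s (g x) \<in> {1, -1}" if x: "x \<in> A" for x
  proof -
    have "(h x)\<^sup>2 = (s (g x))\<^sup>2" using h(2)[OF x] sq[OF g(3)[OF x]] by simp
    then have "h x = s (g x) \<or> h x = - s (g x)" by (simp add: power2_eq_iff)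
    then show ?thesis using nz[OF x] by auto
  qed
  then have "(\<lambda>x. h x / s (g x)) ` A \<subseteq> {1, -1}" by blast
  ultimately have "(\<lambda>x. h x / s (g x)) constant_on A"
    using g(2) by (intro continuous_finite_range_constant) (auto intro: finite_subset)
  then obtain c where c: "\<And>x. x \<in> A \<Longrightarrow> h x / s (g x) = c" by (auto simp: constant_on_def)
  show ?thesis
  proof (cases "A = {}")
    case False
    then obtain a where "a \<in> A" by blast
    then have "c = 1 \<or> c = -1" using c[of a] vals[of a] by simp
    then show ?thesis using c nz by (metis (no_types, lifting) divide_eq_minus_1_iff divide_eq_1_iff)
  qed auto
qed

end

section \<open>Existence of the Walsh map\<close>

locale walsh_setting = exterior_map +
  assumes zero_notin: "0 \<notin> K"
begin

definition E :: "complex set" where "E = {z. z\<^sup>2 \<in> K}"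

definition \<alpha> :: complex where "\<alpha> = - f 0"

lemma compact_K: "compact K"
  by (rule compact)

text \<open>For empty K the function f would be entire with |f| > \<rho>, so 1 / f would be constant
  by Liouville.\<close>

lemma K_nonempty: "K \<noteq> {}"
proof
  assume e: "K = {}"
  have "(\<lambda>x. inverse (f x)) holomorphic_on UNIV"
    using hol f_nonzero e by (intro holomorphic_intros) auto
  moreover have "norm (inverse (f x)) \<le> inverse \<rho>" for x
    using norm_f[of x] e \<rho> unfolding norm_inverse by (intro le_imp_inverse_le) auto
  then have "bounded (range (\<lambda>x. inverse (f x)))" by (intro boundedI) auto
  ultimately have "(\<lambda>x. inverse (f x)) constant_on UNIV" by (rule Liouville_theorem)
  then obtain c where c: "\<And>x. inverse (f x) = c" by (auto simp: constant_on_def)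
  have "f 0 = f 1" using c[of 0] c[of 1] inverse_eq_iff_eq by metis
  then show False using inj_onD[OF inj, of 0 1] e by simp
qed

lemma norm_\<alpha>: "\<rho> < norm \<alpha>"
  using norm_f[OF zero_notin] by (simp add: \<alpha>_def)

lemma Compl_E: "- E = {z. z\<^sup>2 \<in> - K}"
  by (auto simp: E_def)

lemma open_Compl_E: "open (- E)"
  using open_vimage[OF open_Compl_K, of "\<lambda>z. z\<^sup>2"] unfolding Compl_E
  by (simp add: vimage_def continuous_intros)

lemma zero_in_Compl_E: "0 \<in> - E"
  using zero_notin by (simp add: E_def)

text \<open>t < |\<alpha>| = |f 0| keeps 0 out of the sublevel set. The root is wanted on a
  neighbourhood of K, so that level curves around K can be lifted.\<close>

lemma sublevel_branch:
  assumes t: "\<rho> < t" "t < norm \<alpha>"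
  obtains s where "square_root_branch (sublevel t) s"
proof -
  have "0 \<notin> sublevel t" using zero_notin t by (simp add: sublevel_eq(2)[OF t(1)] \<alpha>_def)
  then show ?thesis
    using continuous_square_root[OF compact_sublevel connected_Compl_sublevel, of t] t that
      compact_sublevel[OF t(1)] connected_Compl_sublevel[OF t(1)]
    by (metis square_root_branch.intro)
qed

lemma ball_branch:
  assumes t: "t < norm \<alpha>"
  obtains \<sigma> where "square_root_branch (cball \<alpha> t) \<sigma>"
proof -
  have "0 \<notin> cball \<alpha> t" using t by simp
  moreover have "connected (- cball \<alpha> t)" by (intro connected_complement_bounded_convex) auto
  ultimately show ?thesis
    using continuous_square_root[OF compact_cball] that by (metis compact_cball square_root_branch.intro)
qed

lemma E_branch:
  obtains s where "square_root_branch K s" "components E = {s ` K, uminus ` s ` K}"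
proof -
  obtain t where t: "\<rho> < t" "t < norm \<alpha>" using dense norm_\<alpha> by blast
  obtain s where s: "square_root_branch (sublevel t) s" using sublevel_branch[OF t] .
  interpret square_root_branch "sublevel t" s by fact
  interpret K: square_root_branch K s
    by (rule subset_branch) (use compact_K connected_Compl_K sublevel_eq(5)[OF t(1)] in auto)
  have "components E = {s ` K, uminus ` s ` K}"
    unfolding E_def by (intro K.components_preimage connected_K K_nonempty)
  then show ?thesis using that K.square_root_branch_axioms by blast
qed

text \<open>Writing f u - f 0 = u exp(l u), the function z exp(l(z^2) / 2) is an odd square root
  that involves no choice of branch at 0. The right side of (\<Phi> - z)(\<Phi> + z) = \<alpha> +
  (f(z^2) - z^2) is bounded at infinity, which gives the decay O(1/z).\<close>

lemma square_root_map:
  obtains \<Phi> where "\<Phi> holomorphic_on - E" "\<And>z. z \<in> - E \<Longrightarrow> (\<Phi> z)\<^sup>2 = \<alpha> + f (z\<^sup>2)"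
    "\<And>z. \<Phi> (- z) = - \<Phi> z" "(\<lambda>z. \<Phi> z - z) \<in> O[at_infinity](\<lambda>z. 1 / z)"
proof -
  define m where "m = (\<lambda>u. if u = 0 then deriv f 0 else (f u - f 0) / (u - 0))"
  have "m holomorphic_on - K"
    unfolding m_def using open_Compl_K zero_notin by (intro pole_lemma hol) (simp add: interior_open)
  moreover have "m u \<noteq> 0" if "u \<notin> K" for u
  proof (cases "u = 0")
    case True
    then show ?thesis
      using holomorphic_injective_imp_regular[OF hol open_Compl_K inj] zero_notin by (simp add: m_def)
  next
    case False
    then have "f u \<noteq> f 0" using inj that zero_notin by (auto simp: inj_on_def)
    then show ?thesis using False by (simp add: m_def)
  qed
  moreover have "(m \<longlongrightarrow> 1) at_infinity"
  proof -
    have "((\<lambda>u. f u / u - f 0 * inverse u) \<longlongrightarrow> 1 - f 0 * 0) at_infinity"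
      by (intro tendsto_intros tendsto_inverse_0 ratio_tendsto_1_of_diff_tendsto[OF asymp])
    moreover have "\<forall>\<^sub>F u in at_infinity. f u / u - f 0 * inverse u = m u"
      using eventually_not_equal_at_infinity[of 0] by eventually_elim (simp add: m_def diff_divide_distrib inverse_eq_divide)
    ultimately show ?thesis using tendsto_cong by force
  qed
  ultimately obtain l L where l: "l holomorphic_on - K" "\<And>u. u \<notin> K \<Longrightarrow> m u = exp (l u)"
      "((\<lambda>u. u * l u) \<longlongrightarrow> L) at_infinity"
    using holomorphic_log by metis
  define \<Phi> where "\<Phi> = (\<lambda>z. z * exp (l (z\<^sup>2) / 2))"
  have hol\<Phi>: "\<Phi> holomorphic_on - E"
  proof -
    have "(\<lambda>z. l (z\<^sup>2)) holomorphic_on - E"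
      by (rule holomorphic_on_compose_gen[OF _ l(1), unfolded o_def])
         (auto intro!: holomorphic_intros simp: E_def)
    then show ?thesis unfolding \<Phi>_def by (intro holomorphic_intros) auto
  qed
  have sq: "(\<Phi> z)\<^sup>2 = \<alpha> + f (z\<^sup>2)" if "z \<in> - E" for z
  proof -
    have "(\<Phi> z)\<^sup>2 = z\<^sup>2 * exp (l (z\<^sup>2))"
      by (simp add: \<Phi>_def power_mult_distrib power2_eq_square flip: exp_add)
    also have "\<dots> = z\<^sup>2 * m (z\<^sup>2)" using l(2)[of "z\<^sup>2"] that by (simp add: E_def)
    also have "\<dots> = \<alpha> + f (z\<^sup>2)" by (simp add: m_def \<alpha>_def)
    finally show ?thesis .
  qed
  have inf2: "filterlim (\<lambda>z::complex. z\<^sup>2) at_infinity at_infinity"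
    by (rule filterlim_power_at_infinity) (auto intro: filterlim_ident)
  have notinE: "\<forall>\<^sub>F z in at_infinity. z \<notin> E"
    using filterlim_compose[OF _ inf2] eventually_notin_compact_at_infinity[OF compact]
      eventually_compose_filterlim[OF _ inf2, of "\<lambda>u. u \<notin> K"] by (simp add: E_def)
  have l0: "(l \<longlongrightarrow> 0) at_infinity"
  proof -
    have "((\<lambda>u. inverse u * (u * l u)) \<longlongrightarrow> 0 * L) at_infinity"
      by (intro tendsto_intros tendsto_inverse_0 l)
    moreover have "\<forall>\<^sub>F u in at_infinity. inverse u * (u * l u) = l u"
      using eventually_not_equal_at_infinity[of 0] by eventually_elim simp
    ultimately have "(l \<longlongrightarrow> 0 * L) at_infinity" by (rule Lim_transform_eventually)
    then show ?thesis by simp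
  qed
  have "((\<lambda>z. exp (l (z\<^sup>2) / 2)) \<longlongrightarrow> exp (0 / 2)) at_infinity"
    by (intro tendsto_intros filterlim_compose[OF l0 inf2]) auto
  then have q: "((\<lambda>z. exp (l (z\<^sup>2) / 2)) \<longlongrightarrow> 1) at_infinity" by simp
  have "((\<lambda>z. (\<alpha> + (f (z\<^sup>2) - z\<^sup>2)) / (exp (l (z\<^sup>2) / 2) + 1)) \<longlongrightarrow> (\<alpha> + \<gamma>) / (1 + 1)) at_infinity"
    by (intro tendsto_intros q filterlim_compose[OF asymp inf2]) auto
  moreover have "\<forall>\<^sub>F z in at_infinity. exp (l (z\<^sup>2) / 2) + 1 \<noteq> 0"
    using tendsto_imp_eventually_ne[OF tendsto_add[OF q tendsto_const[of 1]], of 0] by simp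
  then have "\<forall>\<^sub>F z in at_infinity. (\<alpha> + (f (z\<^sup>2) - z\<^sup>2)) / (exp (l (z\<^sup>2) / 2) + 1) = (\<Phi> z - z) / (1 / z)"
    using notinE
  proof eventually_elim
    case (elim z)
    let ?e = "exp (l (z\<^sup>2) / 2)"
    have "\<alpha> + (f (z\<^sup>2) - z\<^sup>2) = (z * ?e)\<^sup>2 - z\<^sup>2" using sq[of z] elim by (simp add: \<Phi>_def)
    also have "\<dots> = (?e + 1) * (z * (z * ?e - z))" by (simp add: power2_eq_square algebra_simps)
    finally show ?case using elim by (simp add: \<Phi>_def)
  qed
  ultimately have "((\<lambda>z. (\<Phi> z - z) / (1 / z)) \<longlongrightarrow> (\<alpha> + \<gamma>) / (1 + 1)) at_infinity"
    using tendsto_cong by fast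
  then have "(\<lambda>z. \<Phi> z - z) \<in> O[at_infinity](\<lambda>z. 1 / z)"
    by (rule bigoI_tendsto) (use eventually_not_equal_at_infinity[of 0] in eventually_elim, simp)
  then show ?thesis using that[OF hol\<Phi> sq] by (simp add: \<Phi>_def)
qed

lemma lemniscatic_set_eq:
  assumes "a 1 = - a 2" "(a 2)\<^sup>2 = \<alpha>" "m 1 = 1 / 2" "m 2 = 1 / 2"
  shows "lemniscatic_set 2 a m (sqrt \<rho>) = {w. w\<^sup>2 \<in> cball \<alpha> \<rho>}"
proof -
  have "{1..2::nat} = {1, 2}" by auto
  then have "(\<Prod>j\<in>{1..2}. cmod (w - a j) powr m j) = sqrt (dist \<alpha> (w\<^sup>2))" for w
  proof -
    have "(w + a 2) * (w - a 2) = w\<^sup>2 - \<alpha>"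
      unfolding assms(2)[symmetric] by (simp add: power2_eq_square algebra_simps)
    then have "cmod (w + a 2) * cmod (w - a 2) = dist \<alpha> (w\<^sup>2)"
      by (metis norm_mult dist_norm dist_commute)
    then have "sqrt (cmod (w + a 2)) * sqrt (cmod (w - a 2)) = sqrt (dist \<alpha> (w\<^sup>2))"
      by (metis real_sqrt_mult)
    note root = this
    have m1: "m (Suc 0) = 1 / 2" "a (Suc 0) = - a 2" using assms by auto
    show ?thesis
      unfolding \<open>{1..2::nat} = {1, 2}\<close> by (simp add: m1 assms(4) powr_half_sqrt root)
  qed
  then show ?thesis by (simp add: lemniscatic_set_def)
qed

context
  fixes \<Phi> s \<sigma> t
  assumes t: "\<rho> < t" "t < norm \<alpha>"
    and \<Phi>: "\<Phi> holomorphic_on - E" "inj_on \<Phi> (- E)"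
    and s: "square_root_branch (sublevel t) s" and \<sigma>: "square_root_branch (cball \<alpha> t) \<sigma>"
    and eq: "\<And>u. u \<in> \<psi> ` sphere 0 t \<Longrightarrow> \<Phi> (s u) = \<sigma> (\<alpha> + f u)"
begin

text \<open>Since t lies between \<rho> and |\<alpha>|, the level curve |f| = t encloses K but not
  0, and s lifts it to a closed curve around one component of E. Its image under \<Phi> is, by
  \<open>eq\<close>, the lift by \<open>\<sigma>\<close> of the circle of radius t around \<alpha>,
  where inside and outside are described in the same way.\<close>

lemma surrounding_curve:
  obtains g where "path_image g \<subseteq> - E" "simple_path g" "pathfinish g = pathstart g"
    "s ` K \<subseteq> inside (path_image g)" "uminus ` s ` K \<subseteq> outside (path_image g)"
    "simple_path (\<Phi> \<circ> g)" "pathfinish (\<Phi> \<circ> g) = pathstart (\<Phi> \<circ> g)"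
    "\<sigma> ` cball \<alpha> \<rho> \<subseteq> inside (path_image (\<Phi> \<circ> g))" "uminus ` \<sigma> ` cball \<alpha> \<rho> \<subseteq> outside (path_image (\<Phi> \<circ> g))"
proof -
  interpret s: square_root_branch "sublevel t" s by fact
  interpret \<sigma>: square_root_branch "cball \<alpha> t" \<sigma> by fact
  let ?C = "\<psi> ` sphere 0 t"
  have t0: "t > 0" using t \<rho> by simp
  have C: "?C \<subseteq> sublevel t" "open (sublevel t - ?C)" "K \<subseteq> sublevel t - ?C"
    using sublevel_eq(4,5)[OF t(1)] open_interior_sublevel[OF t(1)] by auto
  have sub: "sphere 0 t \<subseteq> {w. \<rho> < norm w}" using t by auto
  have inj\<psi>: "inj_on \<psi> {w. \<rho> < norm w}" by (rule inj_on_inverseI[of _ f]) (use f_\<psi> in auto)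
  define c where "c = (\<psi> \<circ> circlepath 0 t)"
  have pc: "path_image (circlepath 0 t) = sphere 0 t" using t0 by simp
  have c: "simple_path c" "path_image c = ?C"
  proof -
    show "simple_path c" unfolding c_def
    proof (rule simple_path_continuous_image)
      show "continuous_on (path_image (circlepath 0 t)) \<psi>"
        unfolding pc by (rule continuous_on_subset[OF continuous_\<psi> sub])
      show "inj_on \<psi> (path_image (circlepath 0 t))"
        unfolding pc by (rule inj_on_subset[OF inj\<psi> sub])
    qed (use t0 in \<open>simp add: simple_path_circlepath\<close>)
    show "path_image c = ?C" using t0 by (simp add: c_def path_image_compose)
  qed
  define g where "g = s \<circ> c"
  have g: "simple_path g" "path_image g = s ` ?C"
  proof -
    show "simple_path g" unfolding g_def
    proof (rule simple_path_continuous_image[OF c(1)])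
      show "continuous_on (path_image c) s" unfolding c(2) by (rule continuous_on_subset[OF s.cont C(1)])
      show "inj_on s (path_image c)" unfolding c(2) by (rule inj_on_subset[OF s.inj_s C(1)])
    qed
    show "path_image g = s ` ?C" by (simp add: g_def path_image_compose c(2))
  qed
  have gE: "path_image g \<subseteq> - E"
    unfolding g(2) E_def using s.sq C by auto
  have image\<Phi>: "path_image (\<Phi> \<circ> g) = \<sigma> ` sphere \<alpha> t"
  proof -
    have "(\<lambda>u. \<alpha> + f u) ` ?C = sphere \<alpha> t"
    proof -
      have "(\<lambda>u. \<alpha> + f u) ` ?C = (\<lambda>w. \<alpha> + w) ` sphere 0 t"
        unfolding image_image using f_\<psi> sub by (intro image_cong) auto
      then show ?thesis using sphere_translation[of \<alpha> 0 t] by simp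
    qed
    moreover have "path_image (\<Phi> \<circ> g) = \<sigma> ` (\<lambda>u. \<alpha> + f u) ` ?C"
      unfolding path_image_compose g(2) image_image by (intro image_cong refl) (use eq in blast)
    ultimately show ?thesis by simp
  qed
  have sph: "sphere \<alpha> t \<subseteq> cball \<alpha> t" "open (cball \<alpha> t - sphere \<alpha> t)" "cball \<alpha> \<rho> \<subseteq> cball \<alpha> t - sphere \<alpha> t"
  proof -
    have e: "cball \<alpha> t - sphere \<alpha> t = ball \<alpha> t" by auto
    show "sphere \<alpha> t \<subseteq> cball \<alpha> t" "open (cball \<alpha> t - sphere \<alpha> t)" unfolding e by auto
    show "cball \<alpha> \<rho> \<subseteq> cball \<alpha> t - sphere \<alpha> t" unfolding e using t by (auto intro: le_less_trans)
  qed
  show ?thesis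
  proof (rule that[OF gE g(1)])
    have "pathfinish c = pathstart c"
      by (simp add: c_def pathfinish_compose pathstart_compose)
    then show cl: "pathfinish g = pathstart g"
      by (simp add: g_def pathfinish_compose pathstart_compose)
    then show "pathfinish (\<Phi> \<circ> g) = pathstart (\<Phi> \<circ> g)"
      by (simp add: pathfinish_compose pathstart_compose)
    show "s ` K \<subseteq> inside (path_image g)"
      unfolding g(2) s.inside_outside_image[OF C(1,2)] using C(3) by (rule image_mono)
    show "uminus ` s ` K \<subseteq> outside (path_image g)"
      unfolding g(2) s.inside_outside_image[OF C(1,2)] using C(3) s.disjoint by blast
    show "simple_path (\<Phi> \<circ> g)"
      by (rule simple_path_continuous_image[OF g(1)])
         (use \<Phi> gE holomorphic_on_imp_continuous_on in \<open>blast intro: continuous_on_subset inj_on_subset\<close>)+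
    show "\<sigma> ` cball \<alpha> \<rho> \<subseteq> inside (path_image (\<Phi> \<circ> g))"
      unfolding image\<Phi> \<sigma>.inside_outside_image[OF sph(1,2)] using sph(3) by (rule image_mono)
    show "uminus ` \<sigma> ` cball \<alpha> \<rho> \<subseteq> outside (path_image (\<Phi> \<circ> g))"
      unfolding image\<Phi> \<sigma>.inside_outside_image[OF sph(1,2)] using sph(3) \<sigma>.disjoint by blast
  qed
qed

end

lemma walsh_map_exists:
  assumes cap: "log_capacity E = sqrt \<rho>" and F: "bij_betw F {1..2::nat} (components E)"
  shows "\<exists>a m \<Phi>. is_walsh_map 2 F a m \<Phi>"
proof -
  have I12: "{1..2::nat} = {1, 2}" by auto
  obtain \<Phi> where \<Phi>: "\<Phi> holomorphic_on - E" "\<And>z. z \<in> - E \<Longrightarrow> (\<Phi> z)\<^sup>2 = \<alpha> + f (z\<^sup>2)"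
    "\<And>z. \<Phi> (- z) = - \<Phi> z" "(\<lambda>z. \<Phi> z - z) \<in> O[at_infinity](\<lambda>z. 1 / z)"
    by (rule square_root_map) (rule that)
  have inj\<Phi>: "inj_on \<Phi> (- E)"
  proof (rule inj_onI)
    fix z z' assume z: "z \<in> - E" "z' \<in> - E" "\<Phi> z = \<Phi> z'"
    then have "f (z\<^sup>2) = f (z'\<^sup>2)" using \<Phi>(2) by (metis add_left_cancel)
    then have "z\<^sup>2 = z'\<^sup>2" using inj z unfolding Compl_E by (auto dest: inj_onD)
    then have "z = z' \<or> z = - z'" by (simp add: power2_eq_iff)
    then show "z = z'"
    proof
      \<comment> \<open>Oddness gives \<open>\<Phi> z' = 0\<close>, and the injectivity of f then
        leaves only z' = 0.\<close>
      assume "z = - z'"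
      then have "\<Phi> z' = 0" using z(3) \<Phi>(3)[of z'] by simp
      then have "f (z'\<^sup>2) = f 0" using \<Phi>(2)[OF z(2)] by (simp add: \<alpha>_def)
      then have "z'\<^sup>2 = 0" using inj z(2) zero_notin unfolding Compl_E by (auto dest: inj_onD)
      then show ?thesis using \<open>z = - z'\<close> by simp
    qed
  qed
  obtain t where t: "\<rho> < t" "t < norm \<alpha>" using dense norm_\<alpha> by blast
  \<comment> \<open>The branch is negated if necessary, so that s describes F 2.\<close>
  have "\<exists>s. square_root_branch (sublevel t) s \<and> F 2 = s ` K \<and> F 1 = uminus ` s ` K"
  proof -
    obtain s where s: "square_root_branch (sublevel t) s" using sublevel_branch[OF t] .
    interpret s: square_root_branch "sublevel t" s by fact
    interpret K: square_root_branch K s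
      by (rule s.subset_branch) (use compact_K connected_Compl_K sublevel_eq(5)[OF t(1)] in auto)
    have "components E = {s ` K, uminus ` s ` K}"
      unfolding E_def by (intro K.components_preimage connected_K K_nonempty)
    then have "{F 1, F 2} = {s ` K, uminus ` s ` K}" using F I12 by (auto simp: bij_betw_def)
    moreover have "F 1 \<noteq> F 2" using F I12 by (auto simp: bij_betw_def inj_on_def)
    ultimately have "F 2 = s ` K \<and> F 1 = uminus ` s ` K \<or> F 1 = s ` K \<and> F 2 = uminus ` s ` K"
      by (auto simp: doubleton_eq_iff)
    then show ?thesis
    proof
      assume "F 1 = s ` K \<and> F 2 = uminus ` s ` K"
      then show ?thesis using s.minus_branch by (intro exI[of _ "\<lambda>u. - s u"]) (auto simp: image_image)
    qed (use s in blast)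
  qed
  then obtain s where s: "square_root_branch (sublevel t) s" and F12: "F 2 = s ` K" "F 1 = uminus ` s ` K" by blast
  interpret s: square_root_branch "sublevel t" s by fact
  let ?C = "\<psi> ` sphere 0 t"
  \<comment> \<open>On the connected level curve the two square roots of \<alpha> + f u differ by a
    constant sign, which is absorbed in \<open>\<sigma>\<close>.\<close>
  have "\<exists>\<sigma>. square_root_branch (cball \<alpha> t) \<sigma> \<and> (\<forall>u\<in>?C. \<Phi> (s u) = \<sigma> (\<alpha> + f u))"
  proof -
    obtain \<sigma> where \<sigma>: "square_root_branch (cball \<alpha> t) \<sigma>" using ball_branch[OF t(2)] .
    interpret \<sigma>: square_root_branch "cball \<alpha> t" \<sigma> by fact
    have CK: "?C \<subseteq> - K" "?C \<subseteq> sublevel t" using sublevel_eq(4,5)[OF t(1)] by auto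
    have sC: "s u \<in> - E" "(s u)\<^sup>2 = u" if "u \<in> ?C" for u
      using that CK s.sq[of u] by (auto simp: E_def)
    have "(\<forall>u\<in>?C. \<Phi> (s u) = \<sigma> (\<alpha> + f u)) \<or> (\<forall>u\<in>?C. \<Phi> (s u) = - \<sigma> (\<alpha> + f u))"
    proof (rule \<sigma>.branch_unique_on_connected)
      show "continuous_on ?C (\<lambda>u. \<alpha> + f u)"
        by (intro continuous_intros continuous_on_subset[OF continuous_f CK(1)])
      show "connected ?C" by (rule connected_level[OF t(1)])
      show "\<alpha> + f u \<in> cball \<alpha> t" if "u \<in> ?C" for u
        using that unfolding sublevel_eq(3)[OF t(1)] by (simp add: dist_norm)
      show "continuous_on ?C (\<lambda>u. \<Phi> (s u))"
        by (rule continuous_on_compose2[OF holomorphic_on_imp_continuous_on[OF \<Phi>(1)] continuous_on_subset[OF s.cont CK(2)]])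
           (use sC in auto)
      show "(\<Phi> (s u))\<^sup>2 = \<alpha> + f u" if "u \<in> ?C" for u using \<Phi>(2) sC[OF that] by simp
    qed
    then show ?thesis using \<sigma> \<sigma>.minus_branch by blast
  qed
  then obtain \<sigma> where \<sigma>: "square_root_branch (cball \<alpha> t) \<sigma>" and \<sigma>eq: "\<And>u. u \<in> ?C \<Longrightarrow> \<Phi> (s u) = \<sigma> (\<alpha> + f u)" by blast
  interpret \<sigma>: square_root_branch "cball \<alpha> t" \<sigma> by fact
  have conn: "connected (- cball \<alpha> \<rho>)" by (intro connected_complement_bounded_convex) auto
  interpret \<rho>: square_root_branch "cball \<alpha> \<rho>" \<sigma>
    by (rule \<sigma>.subset_branch) (use t conn in auto)
  obtain g2 where g2: "path_image g2 \<subseteq> - E" "simple_path g2" "pathfinish g2 = pathstart g2"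
    "s ` K \<subseteq> inside (path_image g2)" "uminus ` s ` K \<subseteq> outside (path_image g2)"
    "simple_path (\<Phi> \<circ> g2)" "pathfinish (\<Phi> \<circ> g2) = pathstart (\<Phi> \<circ> g2)"
    "\<sigma> ` cball \<alpha> \<rho> \<subseteq> inside (path_image (\<Phi> \<circ> g2))" "uminus ` \<sigma> ` cball \<alpha> \<rho> \<subseteq> outside (path_image (\<Phi> \<circ> g2))"
    using surrounding_curve[OF t \<Phi>(1) inj\<Phi> s \<sigma> \<sigma>eq] by metis
  \<comment> \<open>\<Phi> is odd, so the negated branches match as well and give the curve around F
    1.\<close>
  have eq': "\<Phi> (- s u) = - \<sigma> (\<alpha> + f u)" if "u \<in> ?C" for u using \<Phi>(3) \<sigma>eq[OF that] by simp
  obtain g1 where g1: "path_image g1 \<subseteq> - E" "simple_path g1" "pathfinish g1 = pathstart g1"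
    "uminus ` s ` K \<subseteq> inside (path_image g1)" "s ` K \<subseteq> outside (path_image g1)"
    "simple_path (\<Phi> \<circ> g1)" "pathfinish (\<Phi> \<circ> g1) = pathstart (\<Phi> \<circ> g1)"
    "uminus ` \<sigma> ` cball \<alpha> \<rho> \<subseteq> inside (path_image (\<Phi> \<circ> g1))" "\<sigma> ` cball \<alpha> \<rho> \<subseteq> outside (path_image (\<Phi> \<circ> g1))"
    using surrounding_curve[OF t \<Phi>(1) inj\<Phi> s.minus_branch \<sigma>.minus_branch eq'] by (simp add: image_image) metis
  define a where "a = (\<lambda>j::nat. if j = 2 then \<sigma> \<alpha> else - \<sigma> \<alpha>)"
  define m where "m = (\<lambda>j::nat. 1 / 2 :: real)"
  have a2: "(a 2)\<^sup>2 = \<alpha>" "a 1 = - a 2" using \<rho>.sq[of \<alpha>] \<rho> by (simp_all add: a_def)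
  define L where "L = {w. w\<^sup>2 \<in> cball \<alpha> \<rho>}"
  have Lem: "lemniscatic_set 2 a m (log_capacity E) = L"
    unfolding cap L_def by (rule lemniscatic_set_eq) (use a2 in \<open>auto simp: m_def\<close>)
  have compL: "components L = {\<sigma> ` cball \<alpha> \<rho>, uminus ` \<sigma> ` cball \<alpha> \<rho>}"
    unfolding L_def by (rule \<rho>.components_preimage) (use \<rho> in auto)
  have cc: "connected_component_set L x = X" if "X \<in> components L" "x \<in> X" for x X
    using that by (metis components_iff connected_component_eq)
  have L2: "connected_component_set L (a 2) = \<sigma> ` cball \<alpha> \<rho>"
    by (rule cc) (use compL \<rho> in \<open>auto simp: a_def\<close>)
  have L1: "connected_component_set L (a 1) = uminus ` \<sigma> ` cball \<alpha> \<rho>"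
    by (rule cc) (use compL \<rho> in \<open>auto simp: a_def\<close>)
  have UF: "(\<Union>j\<in>{1..2}. F j) = E"
    using F Union_components[of E] by (simp add: bij_betw_def)
  have img: "\<Phi> ` (- E) = - L"
  proof (intro equalityI subsetI)
    fix w assume "w \<in> \<Phi> ` (- E)"
    then obtain z where z: "z \<in> - E" "w = \<Phi> z" by auto
    then show "w \<in> - L" using \<Phi>(2)[OF z(1)] norm_f[of "z\<^sup>2"] by (auto simp: L_def E_def dist_norm)
  next
    fix w assume w: "w \<in> - L"
    then have "\<rho> < norm (w\<^sup>2 - \<alpha>)" by (auto simp: L_def dist_norm norm_minus_commute)
    then have u: "f (\<psi> (w\<^sup>2 - \<alpha>)) = w\<^sup>2 - \<alpha>" "\<psi> (w\<^sup>2 - \<alpha>) \<notin> K" using f_\<psi> \<psi>_notin by auto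
    define z where "z = csqrt (\<psi> (w\<^sup>2 - \<alpha>))"
    have z2: "z\<^sup>2 = \<psi> (w\<^sup>2 - \<alpha>)" by (simp add: z_def)
    have zE: "z \<in> - E" "- z \<in> - E" using u z2 by (simp_all add: E_def)
    have "(\<Phi> z)\<^sup>2 = w\<^sup>2" using \<Phi>(2)[OF zE(1)] z2 u by simp
    then have "w = \<Phi> z \<or> w = \<Phi> (- z)" unfolding \<Phi>(3) by (metis power2_eq_iff)
    then show "w \<in> \<Phi> ` (- E)" using zE by blast
  qed
  have inja: "a 1 \<noteq> a 2" using \<rho>.s_nonzero[of \<alpha>] \<rho> by (simp add: a_def)
  have cptL: "compact (\<sigma> ` cball \<alpha> \<rho>)" "compact (uminus ` \<sigma> ` cball \<alpha> \<rho>)"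
    using \<rho>.compact_image by (auto intro!: compact_continuous_image continuous_intros)
  have ain: "\<sigma> \<alpha> \<in> \<sigma> ` cball \<alpha> \<rho>" using \<rho> by auto
  have bijL: "bij_betw (\<lambda>j. connected_component_set L (a j)) {1..2} (components L)"
  proof -
    have "\<sigma> ` cball \<alpha> \<rho> \<noteq> uminus ` \<sigma> ` cball \<alpha> \<rho>" using \<rho>.disjoint ain by blast
    then show ?thesis unfolding compL I12 bij_betw_def by (auto simp: L1[simplified] L2)
  qed
  have D1: "{1, 2} - {1} = {2::nat}" and D2: "{1, 2} - {2} = {1::nat}" by auto
  have J1: "\<exists>g. path_image g \<subseteq> - E \<and> jordan_surrounds g 2 F 1 \<and>
      jordan_surrounds (\<Phi> \<circ> g) 2 (\<lambda>j. connected_component_set L (a j)) 1"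
    unfolding jordan_surrounds_def I12 D1 by (rule exI[of _ g1]) (use g1 F12 L1 L2 in simp)
  have J2: "\<exists>g. path_image g \<subseteq> - E \<and> jordan_surrounds g 2 F 2 \<and>
      jordan_surrounds (\<Phi> \<circ> g) 2 (\<lambda>j. connected_component_set L (a j)) 2"
    unfolding jordan_surrounds_def I12 D2 by (rule exI[of _ g2]) (use g2 F12 L1 L2 in simp)
  have J: "compact (connected_component_set L (a j)) \<and> a j \<in> connected_component_set L (a j) \<and>
      (\<exists>g. path_image g \<subseteq> - E \<and> jordan_surrounds g 2 F j \<and>
        jordan_surrounds (\<Phi> \<circ> g) 2 (\<lambda>j. connected_component_set L (a j)) j)" if j: "j \<in> {1, 2}" for j
  proof -
    consider "j = 1" | "j = 2" using j by blast
    then show ?thesis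
    proof cases
      case 1
      have "a 1 \<in> connected_component_set L (a 1)" unfolding L1 using ain by (auto simp: a_def)
      moreover have "compact (connected_component_set L (a 1))" unfolding L1 by (rule cptL)
      ultimately show ?thesis unfolding 1 using J1 by blast
    next
      case 2
      have "a 2 \<in> connected_component_set L (a 2)" unfolding L2 using ain by (simp add: a_def)
      moreover have "compact (connected_component_set L (a 2))" unfolding L2 by (rule cptL)
      ultimately show ?thesis unfolding 2 using J2 by blast
    qed
  qed
  have "inj_on a {1..2}" using inja unfolding I12 by auto
  moreover have "(\<Sum>j\<in>{1..2}. m j) = 1" unfolding I12 by (simp add: m_def)
  ultimately have "is_walsh_map 2 F a m \<Phi>"
    unfolding is_walsh_map_def Let_def UF Lem
    using \<Phi>(1,4) inj\<Phi> img bijL J unfolding I12 by (simp add: m_def)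
  then show ?thesis by blast
qed

end

section \<open>Centers and exponents of a Walsh map\<close>

text \<open>A maximum principle for functions that are only locally moduli of holomorphic functions,
  as |U(\<Phi>)| is for real exponents. \<open>bdry\<close> controls the function near the boundary
  and near infinity, so a larger supremum would be attained, and the set where it is attained is
  open and closed in A.\<close>

lemma local_modulus_le_1:
  fixes H :: "complex \<Rightarrow> real"
  assumes A: "open A" "connected A" and cont: "continuous_on A H"
    and loc: "\<And>z. z \<in> A \<Longrightarrow> \<exists>r>0. \<exists>g. ball z r \<subseteq> A \<and> g holomorphic_on ball z r \<and> (\<forall>w\<in>ball z r. H w = norm (g w))"
    and bdry: "\<And>\<epsilon>. \<epsilon> > 0 \<Longrightarrow> \<exists>C. compact C \<and> C \<subseteq> A \<and> (\<forall>z\<in>A - C. H z < 1 + \<epsilon>)"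
    and z: "z \<in> A"
  shows "H z \<le> 1"
proof (rule ccontr)
  assume "\<not> H z \<le> 1"
  then obtain C where C: "compact C" "C \<subseteq> A" "\<And>w. w \<in> A - C \<Longrightarrow> H w < H z"
    using bdry[of "H z - 1"] by auto
  have "z \<in> C" using C(3)[of z] z by blast
  then obtain z1 where z1: "z1 \<in> C" "\<And>w. w \<in> C \<Longrightarrow> H w \<le> H z1"
    using continuous_attains_sup[OF C(1) _ continuous_on_subset[OF cont C(2)]] by blast
  have max: "H w \<le> H z1" if "w \<in> A" for w
    using z1(2)[of w] z1(2)[OF \<open>z \<in> C\<close>] C(3)[of w] that by fastforce
  let ?T = "A \<inter> H -` {H z1}"
  have "open ?T"
  proof (subst open_subopen, rule ballI)
    fix x assume x: "x \<in> ?T"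
    then obtain r g where r: "r > 0" "ball x r \<subseteq> A" "g holomorphic_on ball x r" "\<And>w. w \<in> ball x r \<Longrightarrow> H w = norm (g w)"
      using loc[of x] by blast
    have "g constant_on ball x r"
    proof (rule maximum_modulus_principle[OF r(3)])
      show "norm (g w) \<le> norm (g x)" if "w \<in> ball x r" for w
        using max[of w] r that x by (metis IntD2 centre_in_ball subsetD vimage_singleton_eq)
    qed (use r(1) in auto)
    then obtain c where "\<And>w. w \<in> ball x r \<Longrightarrow> g w = c" by (auto simp: constant_on_def)
    then have "H w = H x" if "w \<in> ball x r" for w using r(1,4) that by (metis centre_in_ball)
    then have "ball x r \<subseteq> ?T" using r(2) x by auto
    then show "\<exists>U. open U \<and> x \<in> U \<and> U \<subseteq> ?T" using r(1) by (metis centre_in_ball open_ball)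
  qed
  moreover have "open (A \<inter> H -` (- {H z1}))"
    by (rule continuous_open_preimage[OF cont A(1)]) auto
  moreover have "z1 \<in> ?T" using z1 C by auto
  ultimately have "A \<inter> H -` (- {H z1}) \<inter> A = {}"
    using connectedD[OF A(2), of ?T "A \<inter> H -` (- {H z1})"] by blast
  then have const: "H w = H z1" if "w \<in> A" for w using that by blast
  \<comment> \<open>If H were constant above 1, \<open>bdry\<close> would make A compact as well as
    open, hence empty or the whole plane.\<close>
  have "H z1 > 1" using const[OF z] \<open>\<not> H z \<le> 1\<close> by simp
  then obtain C' where C': "compact C'" "C' \<subseteq> A" "\<And>w. w \<in> A - C' \<Longrightarrow> H w < H z1"
    using bdry[of "H z1 - 1"] by auto
  have "A = C'" using C' const by force
  then have "open C'" "closed C'" using A C'(1) compact_imp_closed by auto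
  then have "C' = {} \<or> C' = UNIV" using clopen by blast
  then show False using C'(1) \<open>A = C'\<close> z not_compact_UNIV by blast
qed

lemma holomorphic_const_of_norm_1:
  assumes A: "open A" "connected A" and q: "q holomorphic_on A" "\<And>z. z \<in> A \<Longrightarrow> norm (q z) = 1"
  shows "q constant_on A"
proof (cases "A = {}")
  case False
  then obtain x where "x \<in> A" by blast
  then show ?thesis
    by (intro maximum_modulus_principle[OF q(1) A A(1) order.refl, of x]) (use q in auto)
qed (simp add: constant_on_def)

text \<open>Replacing a loop by a nearby smooth one turns all these winding numbers simultaneously into
  integrals of logarithmic derivatives.\<close>
lemma winding_number_log_derivative:
  assumes A: "open A" and g: "path g" "pathfinish g = pathstart g" "path_image g \<subseteq> A"
  obtains h where "valid_path h" "pathfinish h = pathstart h" "path_image h \<subseteq> A"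
    "\<And>q. q holomorphic_on A \<Longrightarrow> (\<And>z. z \<in> A \<Longrightarrow> q z \<noteq> 0) \<Longrightarrow>
       ((\<lambda>z. deriv q z / q z) has_contour_integral 2 * of_real pi * \<i> * winding_number (q \<circ> g) 0) h"
proof -
  obtain e where e: "e > 0" "\<And>x y. x \<in> path_image g \<Longrightarrow> y \<notin> A \<Longrightarrow> e \<le> dist x y"
  proof -
    have "\<exists>d>0. \<forall>x\<in>path_image g. \<forall>y\<in>- A. d \<le> dist x y"
      using A g by (intro separate_compact_closed compact_path_image) auto
    then show ?thesis using that by auto
  qed
  obtain h where h: "polynomial_function h" "pathstart h = pathstart g" "pathfinish h = pathfinish g"
      "\<And>t. t \<in> {0..1} \<Longrightarrow> norm (h t - g t) < e"
    using path_approx_polynomial_function[OF g(1) e(1)] by metis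
  have vh: "valid_path h" by (rule valid_path_polynomial_function[OF h(1)])
  have hom: "homotopic_loops A g h"
  proof (rule homotopic_loops_nearby_explicit)
    fix t x assume "t \<in> {0..1::real}" "x \<notin> A"
    then have "e \<le> norm (g t - x)" using e(2)[of "g t" x] by (auto simp: path_image_def dist_norm)
    then show "norm (h t - g t) < norm (g t - x)" using h(4) \<open>t \<in> {0..1}\<close> by fastforce
  qed (use g h vh valid_path_imp_path in auto)
  have hA: "path_image h \<subseteq> A" using homotopic_loops_imp_subset[OF hom] by blast
  have int: "((\<lambda>z. deriv q z / q z) has_contour_integral 2 * of_real pi * \<i> * winding_number (q \<circ> g) 0) h"
    if q: "q holomorphic_on A" "\<And>z. z \<in> A \<Longrightarrow> q z \<noteq> 0" for q
  proof -
    have "homotopic_loops (- {0}) (q \<circ> g) (q \<circ> h)"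
      by (rule homotopic_loops_continuous_image[OF hom])
         (use q holomorphic_on_imp_continuous_on in auto)
    then have "winding_number (q \<circ> g) 0 = winding_number (q \<circ> h) 0"
      by (rule winding_number_homotopic_loops)
    also have "\<dots> = 1 / (2 * of_real pi * \<i>) * contour_integral (q \<circ> h) (\<lambda>w. 1 / (w - 0))"
    proof -
      have "valid_path (q \<circ> h)" by (rule valid_path_compose_holomorphic[OF vh q(1) A hA])
      moreover have "0 \<notin> path_image (q \<circ> h)" using q(2) hA by (auto simp: path_image_compose)
      ultimately show ?thesis using winding_number_valid_path[of "q \<circ> h" 0] by simp
    qed
    also have "contour_integral (q \<circ> h) (\<lambda>w. 1 / (w - 0)) = contour_integral h (\<lambda>z. deriv q z / q z)"
      using contour_integral_comp_analyticW[of q A h "\<lambda>w. 1 / (w - 0)"] q(1) A vh hA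
      by (simp add: analytic_on_open)
    finally have eq: "2 * of_real pi * \<i> * winding_number (q \<circ> g) 0 = contour_integral h (\<lambda>z. deriv q z / q z)"
      by (simp add: o_def)
    have "(\<lambda>z. deriv q z / q z) contour_integrable_on h"
      by (rule contour_integrable_holomorphic_simple[OF _ A vh hA])
         (use q A in \<open>auto intro!: holomorphic_intros holomorphic_deriv\<close>)
    then show ?thesis unfolding eq by (rule has_contour_integral_integral)
  qed
  show ?thesis by (rule that[OF vh _ hA int]) (use h g in simp)
qed

section \<open>Green function comparison for an arbitrary Walsh map\<close>

locale walsh_map = walsh_setting +
  fixes F :: "nat \<Rightarrow> complex set" and a :: "nat \<Rightarrow> complex" and m :: "nat \<Rightarrow> real" and \<Phi> :: "complex \<Rightarrow> complex"
  assumes cap: "log_capacity E = sqrt \<rho>" and F: "bij_betw F {1..2::nat} (components E)"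
    and walsh: "is_walsh_map 2 F a m \<Phi>"
begin

definition L where "L = lemniscatic_set 2 a m (sqrt \<rho>)"

lemma I12: "{1..2::nat} = {1, 2}"
  by auto

lemma UF: "(\<Union>j\<in>{1..2}. F j) = E"
  using F Union_components[of E] by (simp add: bij_betw_def)

lemma walsh_facts:
  shows inj_a: "a 1 \<noteq> a 2" and m_pos: "m 1 > 0" "m 2 > 0" and m_sum: "m 1 + m 2 = 1"
    and hol_\<Phi>: "\<Phi> holomorphic_on - E" and inj_\<Phi>: "inj_on \<Phi> (- E)" and image_\<Phi>: "\<Phi> ` (- E) = - L"
    and asymp_\<Phi>: "(\<lambda>z. \<Phi> z - z) \<in> O[at_infinity](\<lambda>z. 1 / z)"
    and comps_L: "bij_betw (\<lambda>j. connected_component_set L (a j)) {1..2} (components L)"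
    and compact_Lc: "\<And>j. j \<in> {1, 2} \<Longrightarrow> compact (connected_component_set L (a j))"
    and a_in_Lc: "\<And>j. j \<in> {1, 2} \<Longrightarrow> a j \<in> connected_component_set L (a j)"
    and curve: "\<And>j. j \<in> {1, 2} \<Longrightarrow> \<exists>g. path_image g \<subseteq> - E \<and> jordan_surrounds g 2 F j \<and>
            jordan_surrounds (\<Phi> \<circ> g) 2 (\<lambda>j. connected_component_set L (a j)) j"
proof -
  note w = walsh[unfolded is_walsh_map_def Let_def UF cap, folded L_def, unfolded I12]
  show "a 1 \<noteq> a 2" "m 1 > 0" "m 2 > 0" "m 1 + m 2 = 1" using w by auto
  show "\<Phi> holomorphic_on - E" "inj_on \<Phi> (- E)" "\<Phi> ` (- E) = - L" "(\<lambda>z. \<Phi> z - z) \<in> O[at_infinity](\<lambda>z. 1 / z)"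
    using w by blast+
  show "bij_betw (\<lambda>j. connected_component_set L (a j)) {1..2} (components L)" using w unfolding I12 by blast
  fix j :: nat assume "j \<in> {1, 2}"
  then show "compact (connected_component_set L (a j))" "a j \<in> connected_component_set L (a j)"
    "\<exists>g. path_image g \<subseteq> - E \<and> jordan_surrounds g 2 F j \<and>
            jordan_surrounds (\<Phi> \<circ> g) 2 (\<lambda>j. connected_component_set L (a j)) j"
    using w by blast+
qed

lemma F_cases:
  obtains s where "square_root_branch K s" "F 2 = s ` K" "F 1 = uminus ` s ` K"
proof -
  obtain s where s: "square_root_branch K s" "components E = {s ` K, uminus ` s ` K}" by (rule E_branch)
  interpret s: square_root_branch K s by fact
  have "{F 1, F 2} = {s ` K, uminus ` s ` K}" using F s(2) I12 by (auto simp: bij_betw_def)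
  moreover have "F 1 \<noteq> F 2" using F I12 by (auto simp: bij_betw_def inj_on_def)
  ultimately consider "F 2 = s ` K" "F 1 = uminus ` s ` K" | "F 1 = s ` K" "F 2 = uminus ` s ` K"
    by (auto simp: doubleton_eq_iff)
  then show ?thesis
  proof cases
    case 2
    show ?thesis
      by (rule that[OF s.minus_branch]) (use 2 in \<open>auto simp: image_image\<close>)
  qed (use that s in blast)
qed

lemma F_facts:
  "compact (F 1)" "compact (F 2)" "connected (- F 1)" "connected (- F 2)" "F 1 \<inter> F 2 = {}" "E = F 1 \<union> F 2"
proof -
  obtain s where s: "square_root_branch K s" "F 2 = s ` K" "F 1 = uminus ` s ` K" by (rule F_cases)
  interpret square_root_branch K s by fact
  show "compact (F 1)" "compact (F 2)" unfolding s
    using compact_image by (auto intro!: compact_continuous_image continuous_intros)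
  show "connected (- F 1)" "connected (- F 2)" unfolding s
    by (rule connected_Compl_minus_image connected_Compl_image)+
  show "F 1 \<inter> F 2 = {}" using disjoint unfolding s by blast
  show "E = F 1 \<union> F 2" using UF I12 by auto
qed

lemma compact_E: "compact E"
  using F_facts by auto

lemma connected_Compl_E: "connected (- E)"
  unfolding F_facts(6) by (rule Janiszewski_connected) (use F_facts in \<open>auto simp: compact_imp_closed\<close>)

lemma L_eq: "L = connected_component_set L (a 1) \<union> connected_component_set L (a 2)"
proof -
  have c: "components L = {connected_component_set L (a 1), connected_component_set L (a 2)}"
    using comps_L unfolding I12 bij_betw_def by auto
  have "L = \<Union> (components L)" by simp
  then show ?thesis unfolding c by simp
qed

lemma compact_L: "compact L"
  by (subst L_eq) (use compact_Lc in auto)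

text \<open>The single-valued modulus of the multivalued U.\<close>

definition V where "V w = cmod (w - a 1) powr m 1 * cmod (w - a 2) powr m 2" for w

lemma L_V: "w \<in> L \<longleftrightarrow> V w \<le> sqrt \<rho>"
  unfolding L_def lemniscatic_set_def I12 V_def by simp

lemma continuous_V: "continuous_on S V"
  unfolding V_def using m_pos by (intro continuous_intros continuous_on_powr') auto

lemma a_in_L: "a 1 \<in> L" "a 2 \<in> L"
  using a_in_Lc connected_component_subset by blast+

lemma \<Phi>_ne: "z \<in> - E \<Longrightarrow> \<Phi> z \<noteq> a 1" "z \<in> - E \<Longrightarrow> \<Phi> z \<noteq> a 2"
  using image_\<Phi> a_in_L by force+

lemma \<Phi>_diff_tendsto: "((\<lambda>z. \<Phi> z - z) \<longlongrightarrow> 0) at_infinity"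
proof -
  obtain c where c: "\<forall>\<^sub>F z in at_infinity. norm (\<Phi> z - z) \<le> c * norm (1 / z)"
    using asymp_\<Phi> by (elim landau_o.bigE)
  have "((\<lambda>z::complex. c * norm (inverse z)) \<longlongrightarrow> c * norm (0::complex)) at_infinity"
    by (intro tendsto_intros tendsto_inverse_0)
  then have "((\<lambda>z::complex. c * norm (1 / z)) \<longlongrightarrow> 0) at_infinity" by (simp add: inverse_eq_divide)
  with c show ?thesis by (rule Lim_null_comparison)
qed

lemma \<Phi>_at_infinity: "filterlim \<Phi> at_infinity at_infinity"
  by (rule filterlim_at_infinity_of_diff_tendsto[OF \<Phi>_diff_tendsto])

lemma square_at_infinity: "filterlim (\<lambda>z::complex. z\<^sup>2) at_infinity at_infinity"
  by (rule filterlim_power_at_infinity) (auto intro: filterlim_ident)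

definition G where "G z = f (z\<^sup>2)" for z

lemma hol_G: "G holomorphic_on - E"
  unfolding G_def
  by (rule holomorphic_on_compose_gen[OF _ hol, unfolded o_def]) (auto intro!: holomorphic_intros simp: E_def)

lemma norm_G: "z \<in> - E \<Longrightarrow> \<rho> < norm (G z)"
  using norm_f by (simp add: G_def E_def)

lemma G_nz: "z \<in> - E \<Longrightarrow> G z \<noteq> 0"
  using norm_G \<rho> by fastforce

lemma G_asymp: "((\<lambda>z. G z - z\<^sup>2) \<longlongrightarrow> \<gamma>) at_infinity"
  unfolding G_def by (rule filterlim_compose[OF asymp square_at_infinity])

lemma G_ratio: "((\<lambda>z. G z / z\<^sup>2) \<longlongrightarrow> 1) at_infinity"
  unfolding G_def by (rule filterlim_compose[OF ratio_tendsto_1_of_diff_tendsto[OF asymp] square_at_infinity])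

text \<open>V(\<Phi> z) / sqrt \<rho> and sqrt(|G z| / \<rho>) are both exponentials of the Green
  function of - E, so H is expected to be 1.\<close>

definition H where "H z = V (\<Phi> z) / sqrt (norm (G z))" for z

lemma V_\<Phi>: "z \<in> - E \<Longrightarrow> sqrt \<rho> < V (\<Phi> z)"
  using image_\<Phi> L_V[of "\<Phi> z"] by force

lemma H_pos: "z \<in> - E \<Longrightarrow> H z > 0"
  using V_\<Phi>[of z] G_nz[of z] \<rho> by (simp add: H_def less_trans[of 0 "sqrt \<rho>"])

lemma continuous_\<Phi>: "continuous_on (- E) \<Phi>"
  using hol_\<Phi> holomorphic_on_imp_continuous_on by blast

lemma continuous_H: "continuous_on (- E) H"
  unfolding H_def using G_nz holomorphic_on_imp_continuous_on[OF hol_G]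
  by (intro continuous_intros continuous_on_compose2[OF continuous_V continuous_\<Phi>]) auto

text \<open>H is the modulus of exp g, with g built from local logarithms of the three factors. The
  derivative of g is single-valued on - E and is kept for the identity of logarithmic
  derivatives.\<close>

lemma H_local:
  assumes z: "z \<in> - E"
  obtains r g where "r > 0" "ball z r \<subseteq> - E" "g holomorphic_on ball z r"
    "\<And>w. w \<in> ball z r \<Longrightarrow> H w = norm (exp (g w))"
    "\<And>w. w \<in> ball z r \<Longrightarrow> (g has_field_derivative of_real (m 1) * (deriv \<Phi> w / (\<Phi> w - a 1))
        + of_real (m 2) * (deriv \<Phi> w / (\<Phi> w - a 2)) - deriv G w / G w / 2) (at w)"
proof -
  obtain r where r: "r > 0" "ball z r \<subseteq> - E" using open_Compl_E z open_contains_ball by blast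
  have ctr: "contractible (ball z r)" by (rule convex_imp_contractible) auto
  have hol: "(\<lambda>w. \<Phi> w - c) holomorphic_on ball z r" "G holomorphic_on ball z r" for c
    using hol_\<Phi> hol_G r(2) holomorphic_on_subset by (auto intro!: holomorphic_intros)
  have log: "\<exists>l. l holomorphic_on ball z r \<and> (\<forall>w\<in>ball z r. q w = exp (l w) \<and> (l has_field_derivative deriv q w / q w) (at w))"
    if q: "q holomorphic_on ball z r" "\<And>w. w \<in> ball z r \<Longrightarrow> q w \<noteq> 0" for q
  proof -
    obtain l where l: "l holomorphic_on ball z r" "\<And>w. w \<in> ball z r \<Longrightarrow> q w = exp (l w)"
      using contractible_imp_holomorphic_log[OF q(1) ctr q(2)] by metis
    have "(l has_field_derivative deriv q w / q w) (at w)" if w: "w \<in> ball z r" for w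
    proof -
      have dl: "(l has_field_derivative deriv l w) (at w)" by (rule holomorphic_derivI[OF l(1) open_ball w])
      then have "((\<lambda>x. exp (l x)) has_field_derivative exp (l w) * deriv l w) (at w)"
        by (auto intro!: derivative_eq_intros)
      moreover have "\<forall>\<^sub>F x in nhds w. x \<in> ball z r" using w by (intro eventually_nhds_in_open) auto
      then have "\<forall>\<^sub>F x in nhds w. exp (l x) = q x" by eventually_elim (use l(2) in auto)
      ultimately have "(q has_field_derivative exp (l w) * deriv l w) (at w)"
        by (subst DERIV_cong_ev[OF refl _ refl, of _ "\<lambda>x. exp (l x)"]) (auto elim: eventually_mono)
      then have "deriv q w = q w * deriv l w" using l(2)[OF w] by (simp add: DERIV_imp_deriv)
      then show ?thesis using dl q(2)[OF w] by simp
    qed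
    then show ?thesis using l by blast
  qed
  have nz: "\<Phi> w - a 1 \<noteq> 0" "\<Phi> w - a 2 \<noteq> 0" "G w \<noteq> 0" if "w \<in> ball z r" for w
    using \<Phi>_ne G_nz r(2) that by auto
  obtain l1 where l1: "l1 holomorphic_on ball z r" "\<And>w. w \<in> ball z r \<Longrightarrow> \<Phi> w - a 1 = exp (l1 w)"
     "\<And>w. w \<in> ball z r \<Longrightarrow> (l1 has_field_derivative deriv (\<lambda>w. \<Phi> w - a 1) w / (\<Phi> w - a 1)) (at w)"
    using log[OF hol(1) nz(1)] by blast
  obtain l2 where l2: "l2 holomorphic_on ball z r" "\<And>w. w \<in> ball z r \<Longrightarrow> \<Phi> w - a 2 = exp (l2 w)"
     "\<And>w. w \<in> ball z r \<Longrightarrow> (l2 has_field_derivative deriv (\<lambda>w. \<Phi> w - a 2) w / (\<Phi> w - a 2)) (at w)"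
    using log[OF hol(1) nz(2)] by blast
  obtain l3 where l3: "l3 holomorphic_on ball z r" "\<And>w. w \<in> ball z r \<Longrightarrow> G w = exp (l3 w)"
     "\<And>w. w \<in> ball z r \<Longrightarrow> (l3 has_field_derivative deriv G w / G w) (at w)"
    using log[OF hol(2) nz(3)] by blast
  have d\<Phi>: "deriv (\<lambda>w. \<Phi> w - c) w = deriv \<Phi> w" if "w \<in> ball z r" for w c
  proof -
    have "\<Phi> field_differentiable at w"
      using hol_\<Phi> open_Compl_E r(2) that by (meson holomorphic_on_imp_differentiable_at subsetD)
    then show ?thesis by simp
  qed
  define g where "g = (\<lambda>w. of_real (m 1) * l1 w + of_real (m 2) * l2 w - l3 w / 2)"
  show ?thesis
  proof (rule that[OF r, of g])
    show "g holomorphic_on ball z r" unfolding g_def by (intro holomorphic_intros l1 l2 l3) auto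
    show "H w = norm (exp (g w))" if w: "w \<in> ball z r" for w
    proof -
      have n: "cmod (\<Phi> w - a 1) = exp (Re (l1 w))" "cmod (\<Phi> w - a 2) = exp (Re (l2 w))" "cmod (G w) = exp (Re (l3 w))"
        using l1(2) l2(2) l3(2) w by simp_all
      have "sqrt (exp x) = exp (x / 2)" for x :: real
        by (rule real_sqrt_unique) (simp_all add: power2_eq_square flip: exp_add)
      then show ?thesis
        unfolding H_def V_def n g_def by (simp add: powr_def exp_add exp_diff norm_mult norm_divide)
    qed
    show "(g has_field_derivative of_real (m 1) * (deriv \<Phi> w / (\<Phi> w - a 1))
        + of_real (m 2) * (deriv \<Phi> w / (\<Phi> w - a 2)) - deriv G w / G w / 2) (at w)" if w: "w \<in> ball z r" for w
      unfolding g_def using l1(3)[OF w] l2(3)[OF w] l3(3)[OF w] unfolding d\<Phi>[OF w]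
      by (auto intro!: derivative_eq_intros simp: ac_simps)
  qed
qed

lemma H_at_infinity: "(H \<longlongrightarrow> 1) at_infinity"
proof -
  have r: "((\<lambda>z. cmod (\<Phi> z - c) / cmod z) \<longlongrightarrow> 1) at_infinity" for c
  proof -
    have "((\<lambda>z. (\<Phi> z - c) - z) \<longlongrightarrow> 0 - c) at_infinity"
      using tendsto_diff[OF \<Phi>_diff_tendsto tendsto_const[of c]] by (simp add: algebra_simps)
    then have "((\<lambda>z. norm ((\<Phi> z - c) / z)) \<longlongrightarrow> norm (1::complex)) at_infinity"
      by (intro tendsto_norm ratio_tendsto_1_of_diff_tendsto)
    then show ?thesis by (simp add: norm_divide)
  qed
  have "((\<lambda>z. (cmod (\<Phi> z - a 1) / cmod z) powr m 1 * (cmod (\<Phi> z - a 2) / cmod z) powr m 2 / sqrt (norm (G z / z\<^sup>2)))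
      \<longlongrightarrow> 1 powr m 1 * 1 powr m 2 / sqrt (norm (1::complex))) at_infinity"
    by (intro tendsto_intros r G_ratio) auto
  moreover have "\<forall>\<^sub>F z in at_infinity. (cmod (\<Phi> z - a 1) / cmod z) powr m 1 * (cmod (\<Phi> z - a 2) / cmod z) powr m 2 / sqrt (norm (G z / z\<^sup>2)) = H z"
    using eventually_not_equal_at_infinity[of 0]
  proof eventually_elim
    case (elim z)
    have "cmod z powr m 1 * cmod z powr m 2 = cmod z"
      using elim m_sum by (simp add: powr_add[symmetric])
    moreover have "sqrt (norm (G z / z\<^sup>2)) = sqrt (norm (G z)) / cmod z"
      by (simp add: norm_divide norm_power real_sqrt_divide)
    ultimately show ?case using elim
      by (simp add: H_def V_def powr_divide field_simps)
  qed
  ultimately show ?thesis using Lim_transform_eventually by fastforce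
qed

lemma compact_exhaustion:
  assumes "\<rho> < t" shows "compact {z. z \<in> - E \<and> t \<le> norm (G z) \<and> norm z \<le> B}"
proof -
  have "{z. z \<in> - E \<and> t \<le> norm (G z) \<and> norm z \<le> B} = ((\<lambda>z. z\<^sup>2) -` {u. u \<notin> K \<and> t \<le> norm (f u)}) \<inter> cball 0 B"
    by (auto simp: E_def G_def)
  moreover have "closed ((\<lambda>z::complex. z\<^sup>2) -` {u. u \<notin> K \<and> t \<le> norm (f u)})"
    by (intro closed_vimage closed_superlevel assms continuous_intros)
  ultimately show ?thesis by (simp add: closed_Int_compact)
qed

lemma H_near_infinity:
  assumes "\<epsilon> > 0"
  obtains B where "\<And>z. B \<le> norm z \<Longrightarrow> \<bar>H z - 1\<bar> < \<epsilon>"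
proof -
  have "\<forall>\<^sub>F z in at_infinity. dist (H z) 1 < \<epsilon>" using H_at_infinity assms by (rule tendstoD)
  then show ?thesis using that unfolding eventually_at_infinity by (auto simp: dist_real_def)
qed

text \<open>V(\<Phi> z) has to come down to sqrt \<rho> near E. In a bounded region the values with
  V at least (1 + \<epsilon>) sqrt \<rho> form a compact subset of - L. Its preimage is compact in -
  E, so |G| is at least some t > \<rho> there; points with |G| < t therefore have small V.\<close>

lemma H_le_1:
  assumes "z \<in> - E" shows "H z \<le> 1"
proof (rule local_modulus_le_1[OF open_Compl_E connected_Compl_E continuous_H _ _ assms])
  fix z assume "z \<in> - E"
  then obtain r g where "r > 0" "ball z r \<subseteq> - E" "g holomorphic_on ball z r"
    "\<And>w. w \<in> ball z r \<Longrightarrow> H w = norm (exp (g w))"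
    using H_local by metis
  then show "\<exists>r>0. \<exists>g. ball z r \<subseteq> - E \<and> g holomorphic_on ball z r \<and> (\<forall>w\<in>ball z r. H w = norm (g w))"
    by (intro exI[of _ r] conjI exI[of _ "\<lambda>w. exp (g w)"] holomorphic_intros) auto
next
  fix \<epsilon> :: real assume \<epsilon>: "\<epsilon> > 0"
  obtain B where B: "\<And>z. B \<le> norm z \<Longrightarrow> \<bar>H z - 1\<bar> < \<epsilon>" using H_near_infinity[OF \<epsilon>] by metis
  obtain T0 where T0: "{w. T0 < norm w} \<subseteq> \<Phi> ` (- E)"
  proof -
    obtain T0 where "\<And>w. w \<in> L \<Longrightarrow> norm w \<le> T0"
      using compact_imp_bounded[OF compact_L] bounded_iff by metis
    then show ?thesis using that[of T0] unfolding image_\<Phi> by fastforce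
  qed
  \<comment> \<open>This bounds \<Phi> by T on |z| < B, so that only the bounded part
    \<open>W\<close> of - L has to be considered.\<close>
  obtain T where T: "\<And>z. z \<notin> E \<Longrightarrow> T < norm (\<Phi> z) \<Longrightarrow> B < norm z"
    using injective_holomorphic_large_values[OF compact_E hol_\<Phi> inj_\<Phi> \<Phi>_at_infinity T0] by blast
  define W where "W = cball 0 T \<inter> {w. (1 + \<epsilon>) * sqrt \<rho> \<le> V w}"
  have "closed {w. (1 + \<epsilon>) * sqrt \<rho> \<le> V w}" by (intro closed_Collect_le continuous_intros continuous_V)
  then have cW: "compact W" unfolding W_def by (intro compact_Int_closed compact_cball)
  have WL: "W \<subseteq> - L"
  proof
    fix w assume "w \<in> W"
    then have "(1 + \<epsilon>) * sqrt \<rho> \<le> V w" by (simp add: W_def)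
    moreover have "sqrt \<rho> < (1 + \<epsilon>) * sqrt \<rho>" using \<epsilon> \<rho> by simp
    ultimately show "w \<in> - L" using L_V[of w] by simp
  qed
  obtain g where g: "g holomorphic_on (\<Phi> ` (- E))" "\<And>z. z \<in> - E \<Longrightarrow> g (\<Phi> z) = z"
    by (rule holomorphic_has_inverse[OF hol_\<Phi> open_Compl_E inj_\<Phi>]) (rule that)
  have "compact (g ` W)"
    by (intro compact_continuous_image[OF _ cW] continuous_on_subset[OF holomorphic_on_imp_continuous_on[OF g(1)]])
       (use WL image_\<Phi> in auto)
  have gE: "g ` W \<subseteq> - E"
  proof safe
    fix w assume "w \<in> W" "g w \<in> E"
    moreover obtain z where "z \<in> - E" "w = \<Phi> z" using \<open>w \<in> W\<close> WL image_\<Phi> by blast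
    ultimately show False using g(2)[of z] by simp
  qed
  have "\<exists>t>\<rho>. \<forall>x\<in>g ` W. t \<le> norm (G x)"
  proof (cases "W = {}")
    case False
    have "continuous_on (g ` W) (\<lambda>x. norm (G x))"
      using gE holomorphic_on_imp_continuous_on[OF hol_G] by (intro continuous_intros) (auto elim: continuous_on_subset)
    then obtain x where "x \<in> g ` W" "\<forall>y\<in>g ` W. norm (G x) \<le> norm (G y)"
      using continuous_attains_inf[OF \<open>compact (g ` W)\<close>] False by (metis image_is_empty)
    then show ?thesis using norm_G[of x] gE by blast
  qed (auto intro: exI[of _ "\<rho> + 1"])
  then obtain t where t: "t > \<rho>" "\<And>x. x \<in> g ` W \<Longrightarrow> t \<le> norm (G x)" by blast
  let ?C = "{z. z \<in> - E \<and> t \<le> norm (G z) \<and> norm z \<le> B}"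
  have "H z < 1 + \<epsilon>" if z: "z \<in> - E - ?C" for z
  proof (cases "B \<le> norm z")
    case True
    then show ?thesis using B[OF True] by linarith
  next
    case False
    then have Gt: "norm (G z) < t" using z by auto
    have "norm (\<Phi> z) \<le> T" using T[of z] False z by force
    have "\<Phi> z \<notin> W"
    proof
      assume "\<Phi> z \<in> W"
      moreover have "g (\<Phi> z) = z" using g(2) z by blast
      ultimately have "z \<in> g ` W" by (metis image_eqI)
      then show False using t(2)[of z] Gt by simp
    qed
    then have "V (\<Phi> z) < (1 + \<epsilon>) * sqrt \<rho>" using \<open>norm (\<Phi> z) \<le> T\<close> by (simp add: W_def)
    also have "\<dots> \<le> (1 + \<epsilon>) * sqrt (norm (G z))" using norm_G[of z] z \<epsilon> by (intro mult_left_mono) auto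
    finally show ?thesis using G_nz[of z] z by (simp add: H_def divide_less_eq)
  qed
  moreover have "compact ?C" by (rule compact_exhaustion[OF t(1)])
  ultimately show "\<exists>C. compact C \<and> C \<subseteq> - E \<and> (\<forall>z\<in>- E - C. H z < 1 + \<epsilon>)" by (intro exI[of _ ?C]) auto
qed

text \<open>For the reciprocal it suffices that V(\<Phi>) > sqrt \<rho> on all of - E, while |G| is
  barely above \<rho> near E.\<close>

lemma H_ge_1:
  assumes "z \<in> - E" shows "H z \<ge> 1"
proof -
  have "inverse (H z) \<le> 1"
  proof (rule local_modulus_le_1[OF open_Compl_E connected_Compl_E _ _ _ assms])
    show "continuous_on (- E) (\<lambda>z. inverse (H z))"
      using H_pos by (intro continuous_intros continuous_H) fastforce
  next
    fix z assume "z \<in> - E"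
    then obtain r g where "r > 0" "ball z r \<subseteq> - E" "g holomorphic_on ball z r"
      "\<And>w. w \<in> ball z r \<Longrightarrow> H w = norm (exp (g w))"
      using H_local by metis
    then show "\<exists>r>0. \<exists>g. ball z r \<subseteq> - E \<and> g holomorphic_on ball z r \<and> (\<forall>w\<in>ball z r. inverse (H w) = norm (g w))"
      by (intro exI[of _ r] conjI exI[of _ "\<lambda>w. exp (- g w)"] holomorphic_intros) (auto simp: exp_minus norm_inverse)
  next
    fix \<epsilon> :: real assume \<epsilon>: "\<epsilon> > 0"
    \<comment> \<open>Near infinity H > 1 - \<delta> = 1 / (1 + \<epsilon>), the lower bound that
      the reciprocal requires.\<close>
    define \<delta> where "\<delta> = \<epsilon> / (1 + \<epsilon>)"
    have \<delta>: "\<delta> > 0" "1 - \<delta> = 1 / (1 + \<epsilon>)" using \<epsilon> by (simp_all add: \<delta>_def field_simps)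
    obtain B where B: "\<And>z. B \<le> norm z \<Longrightarrow> \<bar>H z - 1\<bar> < \<delta>" using H_near_infinity[OF \<delta>(1)] by metis
    \<comment> \<open>Chosen so that |G| < t means sqrt |G| < (1 + \<epsilon>) sqrt \<rho>.\<close>
    define t where "t = \<rho> * (1 + \<epsilon>)\<^sup>2"
    have t: "\<rho> < t" using \<epsilon> \<rho> by (simp add: t_def)
    let ?C = "{z. z \<in> - E \<and> t \<le> norm (G z) \<and> norm z \<le> B}"
    have "inverse (H z) < 1 + \<epsilon>" if z: "z \<in> - E - ?C" for z
    proof -
      have "1 / (1 + \<epsilon>) < H z"
      proof (cases "B \<le> norm z")
        case True
        then show ?thesis using B[OF True] \<delta>(2) by linarith
      next
        case False
        then have "norm (G z) < t" using z by auto
        then have "sqrt (norm (G z)) < sqrt \<rho> * (1 + \<epsilon>)"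
          using \<epsilon> by (metis t_def real_sqrt_less_iff real_sqrt_mult real_sqrt_abs abs_of_pos add_pos_pos zero_less_one)
        moreover have "sqrt \<rho> < V (\<Phi> z)" using V_\<Phi> z by blast
        ultimately have "sqrt (norm (G z)) < V (\<Phi> z) * (1 + \<epsilon>)"
          using \<epsilon> by (smt (verit) mult_strict_right_mono)
        then show ?thesis using G_nz[of z] z \<epsilon> by (simp add: H_def field_simps)
      qed
      then show ?thesis using \<epsilon> H_pos[of z] z by (simp add: field_simps)
    qed
    moreover have "compact ?C" by (rule compact_exhaustion[OF t])
    ultimately show "\<exists>C. compact C \<and> C \<subseteq> - E \<and> (\<forall>z\<in>- E - C. inverse (H z) < 1 + \<epsilon>)" by (intro exI[of _ ?C]) auto
  qed
  then show ?thesis using H_pos[OF assms] by (simp add: inverse_le_1_iff)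
qed

lemma H_eq_1: "z \<in> - E \<Longrightarrow> H z = 1"
  using H_le_1 H_ge_1 by force

text \<open>Since H = 1, the local function exp g has modulus 1 and is constant, so g' = 0.\<close>

lemma log_derivative_identity:
  assumes z: "z \<in> - E"
  shows "of_real (m 1) * (deriv \<Phi> z / (\<Phi> z - a 1)) + of_real (m 2) * (deriv \<Phi> z / (\<Phi> z - a 2)) = deriv G z / G z / 2"
proof -
  obtain r g where r: "r > 0" "ball z r \<subseteq> - E" "g holomorphic_on ball z r"
    "\<And>w. w \<in> ball z r \<Longrightarrow> H w = norm (exp (g w))"
    "\<And>w. w \<in> ball z r \<Longrightarrow> (g has_field_derivative of_real (m 1) * (deriv \<Phi> w / (\<Phi> w - a 1))
        + of_real (m 2) * (deriv \<Phi> w / (\<Phi> w - a 2)) - deriv G w / G w / 2) (at w)"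
    using H_local[OF z] by metis
  have zr: "z \<in> ball z r" using r by simp
  have "(\<lambda>w. exp (g w)) constant_on ball z r"
  proof (rule holomorphic_const_of_norm_1)
    show "norm (exp (g w)) = 1" if "w \<in> ball z r" for w
      using r(4)[OF that] H_eq_1[of w] r(2) that by auto
  qed (use r(3) in \<open>auto intro!: holomorphic_intros\<close>)
  then obtain c where c: "\<And>w. w \<in> ball z r \<Longrightarrow> exp (g w) = c" by (auto simp: constant_on_def)
  let ?d = "of_real (m 1) * (deriv \<Phi> z / (\<Phi> z - a 1)) + of_real (m 2) * (deriv \<Phi> z / (\<Phi> z - a 2)) - deriv G z / G z / 2"
  have "((\<lambda>w. exp (g w)) has_field_derivative exp (g z) * ?d) (at z)"
    using r(5)[OF zr] by (rule DERIV_chain2[OF DERIV_exp])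
  moreover have "\<forall>\<^sub>F w in nhds z. exp (g w) = c"
  proof -
    have "\<forall>\<^sub>F x in nhds z. x \<in> ball z r" using zr by (intro eventually_nhds_in_open) auto
    then show ?thesis by eventually_elim (use c in auto)
  qed
  then have "((\<lambda>w. exp (g w)) has_field_derivative 0) (at z)"
    by (subst DERIV_cong_ev[OF refl _ refl, of _ "\<lambda>_. c"]) auto
  ultimately have "exp (g z) * ?d = 0" using DERIV_unique by blast
  then show ?thesis by simp
qed

section \<open>Exponents and centers\<close>

text \<open>Integrate the identity of logarithmic derivatives along the curve around F 2. The left
  side sees only a 2 and yields m 2 times a winding number. Of the two square roots of a point e of
  K the right side sees only the one in F 2, with the factor 1/2. Both winding numbers are
  \<plusminus>1, and the unknown orientations disappear in absolute values.\<close>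

lemma exponents: "m 1 = 1 / 2" "m 2 = 1 / 2"
proof -
  obtain g where g: "path_image g \<subseteq> - E" "jordan_surrounds g 2 F 2"
      "jordan_surrounds (\<Phi> \<circ> g) 2 (\<lambda>j. connected_component_set L (a j)) 2"
    using curve[of 2] by auto
  have D2: "{1, 2} - {2} = {1::nat}" by auto
  have sg: "simple_path g" "pathfinish g = pathstart g" "F 2 \<subseteq> inside (path_image g)" "F 1 \<subseteq> outside (path_image g)"
    using g(2) unfolding jordan_surrounds_def I12 D2 by auto
  have s\<Phi>: "simple_path (\<Phi> \<circ> g)" "connected_component_set L (a 2) \<subseteq> inside (path_image (\<Phi> \<circ> g))"
      "connected_component_set L (a 1) \<subseteq> outside (path_image (\<Phi> \<circ> g))"
    using g(3) unfolding jordan_surrounds_def I12 D2 by auto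
  have pg: "path g" "path (\<Phi> \<circ> g)" using sg(1) s\<Phi>(1) simple_path_imp_path by auto
  obtain s where s: "square_root_branch K s" "F 2 = s ` K" "F 1 = uminus ` s ` K" by (rule F_cases)
  interpret s: square_root_branch K s by fact
  obtain e where e: "e \<in> K" using K_nonempty by blast
  have seF: "s e \<in> F 2" "- s e \<in> F 1" using s e by auto
  have se2: "(s e)\<^sup>2 = e" using s.sq e by simp
  obtain h where h: "valid_path h" "pathfinish h = pathstart h" "path_image h \<subseteq> - E"
    "\<And>q. q holomorphic_on - E \<Longrightarrow> (\<And>z. z \<in> - E \<Longrightarrow> q z \<noteq> 0) \<Longrightarrow>
       ((\<lambda>z. deriv q z / q z) has_contour_integral 2 * of_real pi * \<i> * winding_number (q \<circ> g) 0) h"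
    using winding_number_log_derivative[OF open_Compl_E pg(1) sg(2) g(1)] by metis
  have d\<Phi>: "deriv (\<lambda>w. \<Phi> w - c) w = deriv \<Phi> w" if "w \<in> - E" for w c
  proof -
    have "\<Phi> field_differentiable at w"
      using hol_\<Phi> open_Compl_E that by (meson holomorphic_on_imp_differentiable_at)
    then show ?thesis by simp
  qed
  have hE: "z \<in> - E" if "z \<in> path_image h" for z using h(3) that by blast
  have iw: "((\<lambda>z. deriv \<Phi> z / (\<Phi> z - a j)) has_contour_integral 2 * of_real pi * \<i> * winding_number (\<Phi> \<circ> g) (a j)) h"
    if j: "j \<in> {1, 2}" for j
  proof -
    have "((\<lambda>z. deriv (\<lambda>w. \<Phi> w - a j) z / (\<Phi> z - a j)) has_contour_integral
        2 * of_real pi * \<i> * winding_number ((\<lambda>w. \<Phi> w - a j) \<circ> g) 0) h"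
      by (rule h(4)) (use j \<Phi>_ne in \<open>auto intro!: holomorphic_intros hol_\<Phi>\<close>)
    moreover have "winding_number ((\<lambda>w. \<Phi> w - a j) \<circ> g) 0 = winding_number (\<Phi> \<circ> g) (a j)"
      by (subst winding_number_offset[of "\<Phi> \<circ> g"]) (simp add: o_def)
    ultimately show ?thesis
      using has_contour_integral_eq[of "\<lambda>z. deriv (\<lambda>w. \<Phi> w - a j) z / (\<Phi> z - a j)" _ h "\<lambda>z. deriv \<Phi> z / (\<Phi> z - a j)"]
        d\<Phi> hE by auto
  qed
  have iz: "((\<lambda>z. 1 / (z - c)) has_contour_integral 2 * of_real pi * \<i> * winding_number g c) h"
    if c: "c \<in> E" for c
  proof -
    have "((\<lambda>z. deriv (\<lambda>w. w - c) z / (z - c)) has_contour_integral 2 * of_real pi * \<i> * winding_number ((\<lambda>w. w - c) \<circ> g) 0) h"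
      by (rule h(4)) (use c in \<open>auto intro!: holomorphic_intros\<close>)
    moreover have "winding_number ((\<lambda>w. w - c) \<circ> g) 0 = winding_number g c"
      by (subst winding_number_offset[of g]) (simp add: o_def)
    ultimately show ?thesis by simp
  qed
  \<comment> \<open>f u / (u - e) has a single-valued logarithm, so G z is (z - s e)(z + s e) times
    an exponential, which contributes nothing to the integral.\<close>
  obtain l Lim where l: "l holomorphic_on - K" "\<And>u. u \<notin> K \<Longrightarrow> f u / (u - e) = exp (l u)" "((\<lambda>u. u * l u) \<longlongrightarrow> Lim) at_infinity"
  proof (rule holomorphic_log[of "\<lambda>u. f u / (u - e)"])
    show "(\<lambda>u. f u / (u - e)) holomorphic_on - K" using e by (intro holomorphic_intros hol) auto
    show "f u / (u - e) \<noteq> 0" if "u \<notin> K" for u using f_nonzero[OF that] e that by auto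
    have "((\<lambda>u. (f u / u) * inverse (1 - e * inverse u)) \<longlongrightarrow> 1 * inverse (1 - e * 0)) at_infinity"
      by (intro tendsto_intros tendsto_inverse_0 ratio_tendsto_1_of_diff_tendsto[OF asymp]) auto
    moreover have "\<forall>\<^sub>F u in at_infinity. (f u / u) * inverse (1 - e * inverse u) = f u / (u - e)"
      using eventually_not_equal_at_infinity[of 0]
    proof eventually_elim
      case (elim u)
      then have "1 - e * inverse u = (u - e) / u" by (simp add: field_simps)
      then show ?case using elim by simp
    qed
    ultimately have "((\<lambda>u. f u / (u - e)) \<longlongrightarrow> 1 * inverse (1 - e * 0)) at_infinity" by (rule Lim_transform_eventually)
    then show "((\<lambda>u. f u / (u - e)) \<longlongrightarrow> 1) at_infinity" by simp
  qed (rule that)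
  define \<Lambda> where "\<Lambda> = (\<lambda>z. l (z\<^sup>2))"
  have hol\<Lambda>: "\<Lambda> holomorphic_on - E"
    unfolding \<Lambda>_def
    by (rule holomorphic_on_compose_gen[OF _ l(1), unfolded o_def]) (auto intro!: holomorphic_intros simp: E_def)
  have GL: "G z = (z - s e) * (z + s e) * exp (\<Lambda> z)" if z: "z \<in> - E" for z
  proof -
    have "z\<^sup>2 \<notin> K" "z\<^sup>2 \<noteq> e" using z e by (auto simp: E_def)
    then have "G z = (z\<^sup>2 - e) * exp (\<Lambda> z)" using l(2)[of "z\<^sup>2"] by (simp add: G_def \<Lambda>_def field_simps)
    then show ?thesis using se2 by (simp add: power2_eq_square algebra_simps)
  qed
  have GLd: "1 / (z - s e) + 1 / (z - (- s e)) + deriv \<Lambda> z = deriv G z / G z" if z: "z \<in> - E" for z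
  proof -
    have nz: "z - s e \<noteq> 0" "z + s e \<noteq> 0" using G_nz[OF z] GL[OF z] by auto
    have dL: "(\<Lambda> has_field_derivative deriv \<Lambda> z) (at z)" by (rule holomorphic_derivI[OF hol\<Lambda> open_Compl_E z])
    have "((\<lambda>z. (z - s e) * (z + s e) * exp (\<Lambda> z)) has_field_derivative
        (z + s e) * exp (\<Lambda> z) + (z - s e) * exp (\<Lambda> z) + (z - s e) * (z + s e) * (exp (\<Lambda> z) * deriv \<Lambda> z)) (at z)"
      by (auto intro!: derivative_eq_intros dL simp: algebra_simps)
    moreover have "\<forall>\<^sub>F w in nhds z. w \<in> - E" using z open_Compl_E by (intro eventually_nhds_in_open)
    then have "\<forall>\<^sub>F w in nhds z. G w = (w - s e) * (w + s e) * exp (\<Lambda> w)" by eventually_elim (rule GL)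
    ultimately have "(G has_field_derivative
        (z + s e) * exp (\<Lambda> z) + (z - s e) * exp (\<Lambda> z) + (z - s e) * (z + s e) * (exp (\<Lambda> z) * deriv \<Lambda> z)) (at z)"
      by (subst DERIV_cong_ev[OF refl _ refl])
    then have dG: "deriv G z = (z + s e) * exp (\<Lambda> z) + (z - s e) * exp (\<Lambda> z) + (z - s e) * (z + s e) * (exp (\<Lambda> z) * deriv \<Lambda> z)"
      by (rule DERIV_imp_deriv)
    have "(B * e + A * e + A * B * (e * d)) / (A * B * e) = 1 / A + 1 / B + d"
      if "A \<noteq> 0" "B \<noteq> 0" "e \<noteq> 0" for A B e d :: complex
      using that by (simp add: field_simps)
    from this[OF nz exp_not_eq_zero] show ?thesis unfolding dG GL[OF z] by simp
  qed
  have "(deriv \<Lambda> has_contour_integral 0) h"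
    by (rule Cauchy_theorem_primitive[OF _ h(1,3,2), of \<Lambda>])
       (use holomorphic_derivI[OF hol\<Lambda> open_Compl_E] in \<open>auto intro: has_field_derivative_at_within\<close>)
  moreover have "s e \<in> E" "- s e \<in> E" using seF F_facts(6) by auto
  ultimately have "((\<lambda>z. 1 / (z - s e) + 1 / (z - (- s e)) + deriv \<Lambda> z) has_contour_integral
      2 * of_real pi * \<i> * winding_number g (s e) + 2 * of_real pi * \<i> * winding_number g (- s e) + 0) h"
    by (intro has_contour_integral_add iz)
  moreover have "winding_number g (- s e) = 0"
    using seF sg pg by (intro winding_number_zero_in_outside) auto
  ultimately have iG: "((\<lambda>z. deriv G z / G z) has_contour_integral 2 * of_real pi * \<i> * winding_number g (s e)) h"
    using has_contour_integral_eq[of "\<lambda>z. 1 / (z - s e) + 1 / (z - (- s e)) + deriv \<Lambda> z" _ h "\<lambda>z. deriv G z / G z"]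
      GLd hE by auto
  have w\<Phi>0: "winding_number (\<Phi> \<circ> g) (a 1) = 0"
    using a_in_Lc[of 1] s\<Phi> pg sg by (intro winding_number_zero_in_outside) (auto simp: pathfinish_compose pathstart_compose)
  have "((\<lambda>z. of_real (m 1) * (deriv \<Phi> z / (\<Phi> z - a 1)) + of_real (m 2) * (deriv \<Phi> z / (\<Phi> z - a 2)))
      has_contour_integral of_real (m 1) * (2 * of_real pi * \<i> * winding_number (\<Phi> \<circ> g) (a 1))
        + of_real (m 2) * (2 * of_real pi * \<i> * winding_number (\<Phi> \<circ> g) (a 2))) h"
    by (intro has_contour_integral_add has_contour_integral_lmul iw) auto
  moreover have "((\<lambda>z. deriv G z / G z / 2) has_contour_integral (2 * of_real pi * \<i> * winding_number g (s e)) / 2) h"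
    by (intro has_contour_integral_div iG)
  moreover have "of_real (m 1) * (deriv \<Phi> z / (\<Phi> z - a 1)) + of_real (m 2) * (deriv \<Phi> z / (\<Phi> z - a 2)) = deriv G z / G z / 2"
    if "z \<in> path_image h" for z by (rule log_derivative_identity[OF hE[OF that]])
  ultimately have "of_real (m 1) * (2 * of_real pi * \<i> * winding_number (\<Phi> \<circ> g) (a 1))
        + of_real (m 2) * (2 * of_real pi * \<i> * winding_number (\<Phi> \<circ> g) (a 2)) = (2 * of_real pi * \<i> * winding_number g (s e)) / 2"
    by (metis (no_types, lifting) has_contour_integral_eq has_contour_integral_unique)
  then have "2 * of_real pi * \<i> * (of_real (m 2) * winding_number (\<Phi> \<circ> g) (a 2)) = 2 * of_real pi * \<i> * (winding_number g (s e) / 2)"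
    unfolding w\<Phi>0 by (simp add: algebra_simps)
  then have "of_real (m 2) * winding_number (\<Phi> \<circ> g) (a 2) = winding_number g (s e) / 2"
    by (auto simp: field_simps)
  then have "norm (of_real (m 2) * winding_number (\<Phi> \<circ> g) (a 2)) = norm (winding_number g (s e) / 2)" by (rule arg_cong)
  moreover have "norm (winding_number (\<Phi> \<circ> g) (a 2)) = 1"
    using a_in_Lc[of 2] s\<Phi> by (intro simple_closed_path_norm_winding_number_inside) auto
  moreover have "norm (winding_number g (s e)) = 1"
    using seF sg by (intro simple_closed_path_norm_winding_number_inside) auto
  ultimately show "m 2 = 1 / 2" using m_pos(2) by (simp add: norm_mult norm_divide)
  then show "m 1 = 1 / 2" using m_sum by simp
qed

text \<open>With both exponents 1/2 the square of U is a polynomial, H = 1 says that the holomorphic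
  quotient q has modulus 1, and the behaviour at infinity fixes the constant as 1.\<close>

lemma product_identity:
  assumes z: "z \<in> - E" shows "(\<Phi> z - a 1) * (\<Phi> z - a 2) = G z"
proof -
  define q where "q = (\<lambda>z. (\<Phi> z - a 1) * (\<Phi> z - a 2) / G z)"
  have "q constant_on - E"
  proof (rule holomorphic_const_of_norm_1[OF open_Compl_E connected_Compl_E])
    show "q holomorphic_on - E" unfolding q_def using G_nz by (intro holomorphic_intros hol_\<Phi> hol_G) auto
    fix w assume w: "w \<in> - E"
    have "sqrt (cmod (\<Phi> w - a 1)) * sqrt (cmod (\<Phi> w - a 2)) = sqrt (cmod (G w))"
      using H_eq_1[OF w] G_nz[OF w] by (simp add: H_def V_def exponents powr_half_sqrt divide_eq_1_iff del: One_nat_def)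
    then have "cmod (\<Phi> w - a 1) * cmod (\<Phi> w - a 2) = cmod (G w)"
      by (metis real_sqrt_eq_iff real_sqrt_mult)
    then show "norm (q w) = 1" using G_nz[OF w] by (simp add: q_def norm_mult norm_divide)
  qed
  then obtain c where c: "\<And>w. w \<in> - E \<Longrightarrow> q w = c" by (auto simp: constant_on_def)
  have r: "((\<lambda>z. (\<Phi> z - c) / z) \<longlongrightarrow> 1) at_infinity" for c
  proof (rule ratio_tendsto_1_of_diff_tendsto)
    show "((\<lambda>z. (\<Phi> z - c) - z) \<longlongrightarrow> 0 - c) at_infinity"
      using tendsto_diff[OF \<Phi>_diff_tendsto tendsto_const[of c]] by (simp add: algebra_simps)
  qed
  have "((\<lambda>z. ((\<Phi> z - a 1) / z) * ((\<Phi> z - a 2) / z) * inverse (G z / z\<^sup>2)) \<longlongrightarrow> 1 * 1 * inverse 1) at_infinity"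
    by (intro tendsto_intros r G_ratio) auto
  moreover have "\<forall>\<^sub>F z in at_infinity. ((\<Phi> z - a 1) / z) * ((\<Phi> z - a 2) / z) * inverse (G z / z\<^sup>2) = c"
    using eventually_not_equal_at_infinity[of 0] eventually_notin_compact_at_infinity[OF compact_E]
  proof eventually_elim
    case (elim z)
    then have "((\<Phi> z - a 1) / z) * ((\<Phi> z - a 2) / z) * inverse (G z / z\<^sup>2) = q z"
      by (simp add: q_def power2_eq_square)
    then show ?case using c elim by simp
  qed
  ultimately have "((\<lambda>_::complex. c) \<longlongrightarrow> 1 * 1 * inverse 1) at_infinity" by (rule Lim_transform_eventually)
  then have "c = 1" by (simp add: tendsto_const_iff trivial_limit_at_infinity)
  then show ?thesis using c[OF z] G_nz[OF z] by (simp add: q_def)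
qed

text \<open>The sum of the centers is read off from the terms of order z of the product identity at
  infinity. For their product the identity is used at 0: G is even, so the derivative 2 \<Phi>(0)
  \<Phi>'(0) of the left side vanishes, and injectivity of \<Phi> leaves \<Phi>(0) = 0.\<close>

lemma centers: "a 1 = - a 2" "(a 2)\<^sup>2 = \<alpha>"
proof -
  have e1: "((\<lambda>z. (\<Phi> z - z) * (\<Phi> z / z + 1) - (G z - z\<^sup>2) * inverse z + a 1 * a 2 * inverse z) \<longlongrightarrow> 0 * (1 + 1) - \<gamma> * 0 + a 1 * a 2 * 0) at_infinity"
    by (intro tendsto_intros tendsto_inverse_0 \<Phi>_diff_tendsto G_asymp ratio_tendsto_1_of_diff_tendsto[OF \<Phi>_diff_tendsto])
  have e2: "((\<lambda>z. (a 1 + a 2) * (\<Phi> z / z)) \<longlongrightarrow> (a 1 + a 2) * 1) at_infinity"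
    by (intro tendsto_intros ratio_tendsto_1_of_diff_tendsto[OF \<Phi>_diff_tendsto])
  have "\<forall>\<^sub>F z in at_infinity. (a 1 + a 2) * (\<Phi> z / z) = (\<Phi> z - z) * (\<Phi> z / z + 1) - (G z - z\<^sup>2) * inverse z + a 1 * a 2 * inverse z"
    using eventually_not_equal_at_infinity[of 0] eventually_notin_compact_at_infinity[OF compact_E]
  proof eventually_elim
    case (elim z)
    have "(\<Phi> z)\<^sup>2 - (a 1 + a 2) * \<Phi> z + a 1 * a 2 = G z"
      using product_identity[of z] elim by (simp add: power2_eq_square algebra_simps)
    then have "(a 1 + a 2) * \<Phi> z = (\<Phi> z)\<^sup>2 - G z + a 1 * a 2" by (simp add: algebra_simps)
    also have "\<dots> = ((\<Phi> z - z) * (\<Phi> z / z + 1) - (G z - z\<^sup>2) * inverse z + a 1 * a 2 * inverse z) * z"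
      using elim by (simp add: power2_eq_square field_simps)
    finally show ?case using elim by (simp add: field_simps)
  qed
  then have "((\<lambda>z. (\<Phi> z - z) * (\<Phi> z / z + 1) - (G z - z\<^sup>2) * inverse z + a 1 * a 2 * inverse z) \<longlongrightarrow> (a 1 + a 2) * 1) at_infinity"
    using e2 by (rule Lim_transform_eventually[rotated])
  from tendsto_unique[OF trivial_limit_at_infinity this e1] have "a 1 + a 2 = 0" by simp
  then show a1: "a 1 = - a 2" by (simp add: add_eq_0_iff)
  have d\<Phi>: "(\<Phi> has_field_derivative deriv \<Phi> 0) (at 0)"
    by (rule holomorphic_derivI[OF hol_\<Phi> open_Compl_E zero_in_Compl_E])
  have "((\<lambda>z. (\<Phi> z - a 1) * (\<Phi> z - a 2)) has_field_derivative deriv \<Phi> 0 * (\<Phi> 0 - a 2) + (\<Phi> 0 - a 1) * deriv \<Phi> 0) (at 0)"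
    by (auto intro!: derivative_eq_intros d\<Phi> simp: algebra_simps)
  then have d1: "((\<lambda>z. (\<Phi> z - a 1) * (\<Phi> z - a 2)) has_field_derivative 2 * \<Phi> 0 * deriv \<Phi> 0) (at 0)"
    unfolding a1 by (simp add: algebra_simps)
  have "(f has_field_derivative deriv f 0) (at (0\<^sup>2))"
    using holomorphic_derivI[OF hol open_Compl_K, of 0] zero_notin by simp
  then have "(G has_field_derivative deriv f 0 * (2 * 0)) (at 0)"
    unfolding G_def by (rule DERIV_chain2) (auto intro!: derivative_eq_intros)
  moreover have "\<forall>\<^sub>F w in nhds 0. w \<in> - E" using zero_in_Compl_E open_Compl_E by (intro eventually_nhds_in_open)
  then have "\<forall>\<^sub>F w in nhds 0. (\<Phi> w - a 1) * (\<Phi> w - a 2) = G w" by eventually_elim (rule product_identity)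
  ultimately have "((\<lambda>z. (\<Phi> z - a 1) * (\<Phi> z - a 2)) has_field_derivative deriv f 0 * (2 * 0)) (at 0)"
    by (subst DERIV_cong_ev[OF refl _ refl])
  with d1 have "2 * \<Phi> 0 * deriv \<Phi> 0 = 0" using DERIV_unique by fastforce
  moreover have "deriv \<Phi> 0 \<noteq> 0"
    by (rule holomorphic_injective_imp_regular[OF hol_\<Phi> open_Compl_E inj_\<Phi> zero_in_Compl_E])
  ultimately have "\<Phi> 0 = 0" by simp
  show "(a 2)\<^sup>2 = \<alpha>"
  proof -
    have "- ((a 2)\<^sup>2) = f 0"
      using product_identity[OF zero_in_Compl_E] a1 \<open>\<Phi> 0 = 0\<close> by (simp add: G_def power2_eq_square)
    then show ?thesis unfolding \<alpha>_def by (metis minus_minus)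
  qed
qed

lemma \<Phi>_square: "z \<in> - E \<Longrightarrow> (\<Phi> z)\<^sup>2 = \<alpha> + f (z\<^sup>2)"
  using product_identity[of z] centers by (simp add: G_def power2_eq_square algebra_simps)

lemma L_eq_preimage: "L = {w. w\<^sup>2 \<in> cball \<alpha> \<rho>}"
  unfolding L_def by (rule lemniscatic_set_eq) (use centers exponents in auto)

text \<open>The given curves only separate the components; which side of g is sent to which side of
  its image has to be derived. Inside minus F 2 and outside minus F 1 are connected, so each goes to
  one side. The outer one goes outside because \<Phi> tends to infinity, and the inner one cannot do
  so too.\<close>

lemma boundary_correspondence:
  assumes A: "A \<noteq> bot" and z: "(z \<longlongrightarrow> p) A" "p \<in> F 2" "\<forall>\<^sub>F x in A. z x \<in> - E"
    and w: "((\<lambda>x. \<Phi> (z x)) \<longlongrightarrow> w) A" "w \<in> L"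
  shows "w \<in> connected_component_set L (a 2)"
proof -
  obtain g where g: "path_image g \<subseteq> - E" "jordan_surrounds g 2 F 2"
      "jordan_surrounds (\<Phi> \<circ> g) 2 (\<lambda>j. connected_component_set L (a j)) 2"
    using curve[of 2] by auto
  have D2: "{1, 2} - {2} = {1::nat}" by auto
  have sg: "simple_path g" "pathfinish g = pathstart g" "F 2 \<subseteq> inside (path_image g)" "F 1 \<subseteq> outside (path_image g)"
    using g(2) unfolding jordan_surrounds_def I12 D2 by auto
  have s\<Phi>: "simple_path (\<Phi> \<circ> g)" "pathfinish (\<Phi> \<circ> g) = pathstart (\<Phi> \<circ> g)"
      "connected_component_set L (a 2) \<subseteq> inside (path_image (\<Phi> \<circ> g))"
      "connected_component_set L (a 1) \<subseteq> outside (path_image (\<Phi> \<circ> g))"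
    using g(3) unfolding jordan_surrounds_def I12 D2 by auto
  note J = Jordan_inside_outside[OF sg(1,2)] and J\<Phi> = Jordan_inside_outside[OF s\<Phi>(1,2)]
  let ?I = "inside (path_image g)" and ?O = "outside (path_image g)"
  let ?I' = "inside (path_image (\<Phi> \<circ> g))" and ?O' = "outside (path_image (\<Phi> \<circ> g))"
  have op: "open ?I" "open ?O" "open ?I'" "open ?O'"
    using J J\<Phi> by simp_all
  have disj: "?I \<inter> ?O = {}" "?I' \<inter> ?O' = {}" "?I \<inter> path_image g = {}" "?O \<inter> path_image g = {}"
      "?I' \<inter> path_image (\<Phi> \<circ> g) = {}" by (auto simp: inside_def outside_def)
  have un: "?I \<union> ?O = - path_image g" "?I' \<union> ?O' = - path_image (\<Phi> \<circ> g)"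
    using J J\<Phi> by simp_all
  \<comment> \<open>Janiszewski: F 2 and the complement of the inside are disjoint closed sets with
    connected complements.\<close>
  have cX: "connected (?I - F 2)"
  proof -
    have "connected (- (F 2 \<union> - ?I))"
    proof (rule Janiszewski_connected)
      have "F 2 \<inter> - ?I = {}" using sg(3) by blast
      then show "connected (F 2 \<inter> - ?I)" by simp
    qed (use F_facts J in \<open>simp_all add: closed_Compl\<close>)
    moreover have "- (F 2 \<union> - ?I) = ?I - F 2" by auto
    ultimately show ?thesis by simp
  qed
  have cY: "connected (?O - F 1)"
  proof -
    have "connected (- (F 1 \<union> - ?O))"
    proof (rule Janiszewski_connected)
      have "F 1 \<inter> - ?O = {}" using sg(4) by blast
      then show "connected (F 1 \<inter> - ?O)" by simp
    qed (use F_facts J in \<open>simp_all add: closed_Compl\<close>)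
    moreover have "- (F 1 \<union> - ?O) = ?O - F 1" by auto
    ultimately show ?thesis by simp
  qed
  have XE: "?I - F 2 \<subseteq> - E" and YE: "?O - F 1 \<subseteq> - E" using sg(3,4) disj(1) F_facts(6) by blast+
  have side: "\<Phi> ` X \<subseteq> ?I' \<or> \<Phi> ` X \<subseteq> ?O'"
    if X: "connected X" "X \<subseteq> - E" "X \<inter> path_image g = {}" for X
  proof -
    have "connected (\<Phi> ` X)" by (intro connected_continuous_image continuous_on_subset[OF continuous_\<Phi>] X)
    moreover have "\<Phi> ` X \<inter> path_image (\<Phi> \<circ> g) = {}"
    proof (rule ccontr)
      assume "\<not> ?thesis"
      then obtain x y where xy: "x \<in> X" "y \<in> path_image g" "\<Phi> x = \<Phi> y" by (auto simp: path_image_compose)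
      then have "x = y" using inj_\<Phi> X(2) g(1) by (meson inj_onD subsetD)
      then show False using xy X(3) by blast
    qed
    then have sub: "\<Phi> ` X \<subseteq> ?I' \<union> ?O'" unfolding un(2) by blast
    ultimately have "?I' \<inter> \<Phi> ` X = {} \<or> ?O' \<inter> \<Phi> ` X = {}"
      using disj(2) by (intro connectedD[OF _ op(3,4) _ sub]) auto
    then show ?thesis using sub by blast
  qed
  have Y: "\<Phi> ` (?O - F 1) \<subseteq> ?O'"
  proof -
    have "compact (- ?O')"
    proof -
      have "- ?O' = ?I' \<union> path_image (\<Phi> \<circ> g)" using disj(2) un(2) by (auto simp: outside_def)
      then have "bounded (- ?O')" using J\<Phi> s\<Phi>(1) by (simp add: bounded_simple_path_image)
      then show ?thesis using J\<Phi> by (simp add: compact_eq_bounded_closed closed_Compl)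
    qed
    moreover have "compact (- ?O)"
    proof -
      have "- ?O = ?I \<union> path_image g" using disj(1) un(1) by (auto simp: outside_def)
      then have "bounded (- ?O)" using J sg(1) by (simp add: bounded_simple_path_image)
      then show ?thesis using J by (simp add: compact_eq_bounded_closed closed_Compl)
    qed
    ultimately have c: "compact (- ?O')" "compact (- ?O)" by blast+
    have "\<forall>\<^sub>F x in at_infinity. \<Phi> x \<notin> - ?O'"
      by (rule eventually_compose_filterlim[OF eventually_notin_compact_at_infinity[OF c(1)] \<Phi>_at_infinity])
    moreover note eventually_notin_compact_at_infinity[OF c(2)]
      eventually_notin_compact_at_infinity[OF F_facts(1)]
    ultimately have "\<forall>\<^sub>F x in at_infinity. x \<in> ?O - F 1 \<and> \<Phi> x \<in> ?O'" by eventually_elim auto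
    then obtain x where "x \<in> ?O - F 1" "\<Phi> x \<in> ?O'"
      using eventually_happens'[OF trivial_limit_at_infinity] by blast
    moreover have "(?O - F 1) \<inter> path_image g = {}" using disj(4) by blast
    ultimately show ?thesis using side[OF cY YE] disj(2) by blast
  qed
  \<comment> \<open>Otherwise the inside of the image curve would be missed by \<Phi>, hence lie in
    L, and so would its boundary, the image curve, although that lies in - L.\<close>
  have X: "\<Phi> ` (?I - F 2) \<subseteq> ?I'"
  proof (rule ccontr)
    assume no: "\<not> ?thesis"
    have "(?I - F 2) \<inter> path_image g = {}" using disj(3) by blast
    then have "\<Phi> ` (?I - F 2) \<subseteq> ?O'" using side[OF cX XE] no by blast
    moreover have "- E \<subseteq> (?I - F 2) \<union> (?O - F 1) \<union> path_image g" using un(1) F_facts(6) by blast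
    ultimately have "\<Phi> ` (- E) \<subseteq> ?O' \<union> path_image (\<Phi> \<circ> g)" using Y unfolding path_image_compose by blast
    then have "- L \<subseteq> ?O' \<union> path_image (\<Phi> \<circ> g)" by (simp only: image_\<Phi>)
    moreover have "?I' \<inter> (?O' \<union> path_image (\<Phi> \<circ> g)) = {}" using disj(2,5) by blast
    ultimately have "?I' \<subseteq> L" by blast
    then have "closure ?I' \<subseteq> L" using compact_L by (simp add: closure_minimal compact_imp_closed)
    moreover have "frontier ?I' = path_image (\<Phi> \<circ> g)" using J\<Phi> by simp
    ultimately have "path_image (\<Phi> \<circ> g) \<subseteq> L" by (metis Diff_subset frontier_def order.trans)
    moreover have "path_image (\<Phi> \<circ> g) \<subseteq> - L" using g(1) image_\<Phi> by (auto simp: path_image_compose)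
    moreover have "path_image (\<Phi> \<circ> g) \<noteq> {}" by (simp add: path_image_nonempty)
    ultimately show False by blast
  qed
  have "open ?I" "p \<in> ?I" using op(1) z(2) sg(3) by auto
  then have "\<forall>\<^sub>F x in A. z x \<in> ?I" using z(1) topological_tendstoD by blast
  then have "\<forall>\<^sub>F x in A. \<Phi> (z x) \<in> closure ?I'"
    using z(3)
  proof eventually_elim
    case (elim x)
    then have "z x \<in> ?I - F 2" using F_facts(6) by blast
    then show ?case using X closure_subset by blast
  qed
  then have "w \<in> closure ?I'" using Lim_in_closed_set[OF closed_closure _ A w(1)] by blast
  moreover have "closure ?I' = ?I' \<union> path_image (\<Phi> \<circ> g)"
    using J\<Phi> closure_Un_frontier[of ?I'] by simp
  moreover have "path_image (\<Phi> \<circ> g) \<subseteq> - L" using g(1) image_\<Phi> by (auto simp: path_image_compose)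
  ultimately have "w \<in> ?I'" using w(2) by blast
  then have "w \<notin> connected_component_set L (a 1)" using s\<Phi>(4) disj(2) by blast
  then show ?thesis using w(2) L_eq by blast
qed

end

section \<open>Symmetry with respect to the real line\<close>

lemma connected_subset_side:
  fixes X :: "complex set"
  assumes X: "connected X" "x \<in> X" "Re (x * c) > 0" and no: "\<And>y. y \<in> X \<Longrightarrow> Re (y * c) \<noteq> 0"
    and y: "y \<in> X"
  shows "Re (y * c) > 0"
proof (rule ccontr)
  assume "\<not> Re (y * c) > 0"
  then have "y \<in> {y. Re (y * c) < 0}" using no[OF y] by simp
  moreover have "open {y. Re (y * c) < 0}" "open {y. Re (y * c) > 0}"
    by (intro open_Collect_less continuous_intros)+
  moreover have "X \<subseteq> {y. Re (y * c) < 0} \<union> {y. Re (y * c) > 0}" using no by (auto simp: neq_iff)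
  moreover have "{y. Re (y * c) < 0} \<inter> {y. Re (y * c) > 0} \<inter> X = {}" by auto
  ultimately have "{y. Re (y * c) < 0} \<inter> X = {} \<or> {y. Re (y * c) > 0} \<inter> X = {}"
    by (intro connectedD[OF X(1)])
  then show False using \<open>y \<in> {y. Re (y * c) < 0}\<close> X(2,3) y by blast
qed

lemma connected_conj_invariant_meets_Reals:
  fixes X :: "complex set"
  assumes X: "connected X" "X \<noteq> {}" "\<And>x. x \<in> X \<Longrightarrow> cnj x \<in> X"
  obtains x :: real where "of_real x \<in> X"
proof -
  have "\<exists>x\<in>X. Im x = 0"
  proof (rule ccontr)
    assume no: "\<not> ?thesis"
    obtain x where x: "x \<in> X" using X(2) by blast
    define y where "y = (if Im x > 0 then x else cnj x)"
    have y: "y \<in> X" "Im y > 0" using x X(3) no by (auto simp: y_def neq_iff)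
    have "Re (cnj y * (- \<i>)) > 0"
      by (rule connected_subset_side[OF X(1) y(1) _ _ X(3)[OF y(1)]]) (use y no in auto)
    then show False using y(2) by simp
  qed
  then obtain x where "x \<in> X" "Im x = 0" by blast
  moreover from this have "of_real (Re x) = x" by (simp add: complex_eq_iff)
  ultimately have "of_real (Re x) \<in> X" by simp
  then show ?thesis by (rule that)
qed

text \<open>The direction \<open>e\<close> of the axis that carries the real points of the components: \<open>e = 1\<close> in
  case 1 and \<open>e = \<i>\<close> in case 2.\<close>
locale symmetric_walsh_setting = walsh_setting +
  fixes \<epsilon> :: real and e :: complex
  assumes f_cnj: "\<And>u. u \<notin> K \<Longrightarrow> f (cnj u) = cnj (f u)"
    and K_cnj: "\<And>u. u \<in> K \<Longrightarrow> cnj u \<in> K"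
    and \<epsilon>: "\<epsilon> = 1 \<and> e = 1 \<or> \<epsilon> = -1 \<and> e = \<i>"
    and \<alpha>_\<epsilon>: "\<alpha> = of_real (\<epsilon> * norm \<alpha>)"
begin

lemma e_facts: "e\<^sup>2 = of_real \<epsilon>" "e * cnj e = 1" "\<epsilon> * \<epsilon> = 1" "e \<noteq> 0" "norm e = 1" "\<bar>\<epsilon>\<bar> = 1"
  using \<epsilon> by auto

lemma Re_axis: "Re (e * of_real x * cnj e) = x" "Re (- (e * of_real x) * cnj e) = - x"
  using \<epsilon> by auto

lemma f_Reals: "of_real x \<notin> K \<Longrightarrow> f (of_real x) = of_real (Re (f (of_real x)))"
  using f_cnj[of "of_real x"] by (simp add: complex_eq_iff)

lemma \<psi>_Reals:
  assumes "\<rho> < \<bar>x\<bar>" shows "\<psi> (of_real x) = of_real (Re (\<psi> (of_real x)))"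
proof -
  let ?u = "\<psi> (of_real x)"
  have u: "?u \<notin> K" "f ?u = of_real x" using assms \<psi>_notin f_\<psi> by auto
  have uc: "cnj ?u \<notin> K" using K_cnj[of "cnj ?u"] u by auto
  have "f (cnj ?u) = f ?u" using f_cnj[OF u(1)] u(2) by simp
  then have "cnj ?u = ?u" by (rule inj_onD[OF inj]) (use u uc in simp_all)
  then show ?thesis by (simp add: complex_eq_iff)
qed

text \<open>The image under \<open>\<psi>\<close> of the part of the axis between \<open>f 0\<close> and infinity is the ray that
  starts at \<open>0\<close>, which therefore misses \<open>K\<close>.\<close>
lemma ray_notin_K:
  assumes "x \<ge> 0" shows "of_real (- \<epsilon> * x) \<notin> K"
proof -
  \<comment> \<open>Real coordinate of \<psi> along the ray. It is 0 at |\<alpha>|, where the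
    argument of \<psi> is f 0, and tends to infinity with w; by the intermediate value theorem it
    takes every value x \<ge> 0.\<close>
  define h where "h = (\<lambda>w. - \<epsilon> * Re (\<psi> (of_real (- \<epsilon> * w))))"
  have real: "\<psi> (of_real (- \<epsilon> * w)) = of_real (- \<epsilon> * h w)" "\<rho> < norm (complex_of_real (- \<epsilon> * w))" if "w \<ge> norm \<alpha>" for w
  proof -
    have w: "\<rho> < \<bar>- \<epsilon> * w\<bar>" using that norm_\<alpha> \<rho> e_facts(6) by (simp add: abs_mult)
    then show "\<rho> < norm (complex_of_real (- \<epsilon> * w))" by (simp only: norm_of_real)
    have "- \<epsilon> * h w = Re (\<psi> (of_real (- \<epsilon> * w)))" using e_facts(3) by (simp add: h_def mult.assoc[symmetric])
    then show "\<psi> (of_real (- \<epsilon> * w)) = of_real (- \<epsilon> * h w)" using \<psi>_Reals[OF w] by simp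
  qed
  have h0: "h (norm \<alpha>) = 0"
  proof -
    have "f 0 = - \<alpha>" by (simp add: \<alpha>_def)
    also have "\<dots> = - complex_of_real (\<epsilon> * norm \<alpha>)" using \<alpha>_\<epsilon> by (rule arg_cong)
    also have "\<dots> = complex_of_real (- \<epsilon> * norm \<alpha>)" by simp
    finally have "complex_of_real (- \<epsilon> * norm \<alpha>) = f 0" ..
    then have "\<psi> (complex_of_real (- \<epsilon> * norm \<alpha>)) = 0" using \<psi>_f[OF zero_notin] by simp
    then show ?thesis by (simp add: h_def)
  qed
  have inf: "filterlim (\<lambda>w::real. complex_of_real (- \<epsilon> * w)) at_infinity at_top"
  proof -
    have "filterlim (\<lambda>w::real. norm (complex_of_real (- \<epsilon> * w))) at_top at_top"
    proof (rule filterlim_at_top_mono[OF filterlim_ident])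
      show "\<forall>\<^sub>F w in at_top. w \<le> norm (complex_of_real (- \<epsilon> * w))"
        using e_facts(6) by (intro always_eventually) (simp add: norm_mult abs_ge_self)
    qed
    then show ?thesis by (simp add: filterlim_at_infinity_conv_norm_at_top)
  qed
  have "((\<lambda>w. \<psi> w - w) \<longlongrightarrow> - \<gamma>) at_infinity"
  proof -
    have "((\<lambda>w. - (f (\<psi> w) - \<psi> w)) \<longlongrightarrow> - \<gamma>) at_infinity"
      by (intro tendsto_minus filterlim_compose[OF asymp \<psi>_at_infinity])
    moreover have "\<forall>\<^sub>F w in at_infinity. - (f (\<psi> w) - \<psi> w) = \<psi> w - w"
    proof -
      have "\<forall>\<^sub>F w in at_infinity. (w::complex) \<notin> cball 0 \<rho>"
        by (rule eventually_notin_compact_at_infinity) simp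
      then show ?thesis by eventually_elim (use f_\<psi> in auto)
    qed
    ultimately show ?thesis by (rule Lim_transform_eventually)
  qed
  from filterlim_compose[OF this inf]
  have "((\<lambda>w. \<psi> (of_real (- \<epsilon> * w)) - of_real (- \<epsilon> * w)) \<longlongrightarrow> - \<gamma>) at_top" .
  then have "((\<lambda>w. - \<epsilon> * Re (\<psi> (of_real (- \<epsilon> * w)) - of_real (- \<epsilon> * w))) \<longlongrightarrow> - \<epsilon> * Re (- \<gamma>)) at_top"
    by (intro tendsto_intros)
  moreover have "- \<epsilon> * Re (\<psi> (of_real (- \<epsilon> * w)) - of_real (- \<epsilon> * w)) = h w - w" for w
  proof -
    have "\<epsilon> * (\<epsilon> * w) = w" using e_facts(3) by (metis mult.assoc mult_1)
    moreover have "- \<epsilon> * Re (\<psi> (of_real (- \<epsilon> * w)) - of_real (- \<epsilon> * w)) = h w - \<epsilon> * (\<epsilon> * w)"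
      by (simp add: h_def distrib_left)
    ultimately show ?thesis by simp
  qed
  ultimately have "((\<lambda>w. h w - w) \<longlongrightarrow> - \<epsilon> * Re (- \<gamma>)) at_top" by (simp only:)
  then have "filterlim (\<lambda>w. (h w - w) + w) at_top at_top"
    by (rule filterlim_tendsto_add_at_top[OF _ filterlim_ident])
  then have "filterlim h at_top at_top" by simp
  then have "\<forall>\<^sub>F w in at_top. x \<le> h w" by (simp add: filterlim_at_top)
  then have "\<forall>\<^sub>F w in at_top. x \<le> h w \<and> norm \<alpha> \<le> w" using eventually_ge_at_top by (rule eventually_conj)
  then obtain W where W: "x \<le> h W" "norm \<alpha> \<le> W"
    using eventually_happens[of _ at_top] by (metis (mono_tags, lifting) trivial_limit_at_top_linorder)
  have "continuous_on {norm \<alpha>..W} h" unfolding h_def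
    by (intro continuous_intros continuous_on_compose2[OF continuous_\<psi>]) (use real(2) in auto)
  then obtain w where w: "norm \<alpha> \<le> w" "w \<le> W" "h w = x"
    using IVT'[of h "norm \<alpha>" x W] h0 assms W by auto
  then show ?thesis using real[OF w(1)] \<psi>_notin by metis
qed

text \<open>Points on the line perpendicular to e have their squares on the ray that misses
  K.\<close>

lemma E_axis: assumes "z \<in> E" shows "Re (z * cnj e) \<noteq> 0"
proof
  assume r: "Re (z * cnj e) = 0"
  let ?y = "Im (z * cnj e)"
  have "z = z * (e * cnj e)" by (simp add: e_facts)
  also have "\<dots> = e * (z * cnj e)" by (simp add: algebra_simps)
  also have "z * cnj e = \<i> * of_real ?y" using r by (simp add: complex_eq_iff)
  finally have "z\<^sup>2 = (e * (\<i> * of_real ?y))\<^sup>2" by simp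
  also have "\<dots> = of_real (- \<epsilon> * ?y\<^sup>2)" by (simp add: power_mult_distrib e_facts)
  finally show False using assms ray_notin_K[of "?y\<^sup>2"] by (simp add: E_def)
qed

text \<open>K is connected and symmetric, so it meets the real line; the ray leaves only points u
  with \<epsilon> u > 0.\<close>

lemma ex_axis_point: obtains x where "x > 0" "e * of_real x \<in> E"
proof -
  obtain u :: real where u: "of_real u \<in> K"
    using connected_conj_invariant_meets_Reals[OF connected_K K_nonempty K_cnj] by metis
  have "\<epsilon> * u > 0"
  proof (rule ccontr)
    assume "\<not> \<epsilon> * u > 0"
    then have "of_real (- \<epsilon> * (- \<epsilon> * u)) \<notin> K" by (intro ray_notin_K) simp
    moreover have "- \<epsilon> * (- \<epsilon> * u) = u" using e_facts(3) by (simp add: mult.assoc[symmetric])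
    ultimately show False using u by metis
  qed
  moreover have "(e * of_real (sqrt (\<epsilon> * u)))\<^sup>2 = of_real (\<epsilon> * (\<epsilon> * u))"
    using calculation by (simp add: power_mult_distrib e_facts flip: of_real_power)
  then have "(e * of_real (sqrt (\<epsilon> * u)))\<^sup>2 = of_real u" using e_facts(3) by (simp add: mult.assoc[symmetric])
  ultimately show ?thesis using u by (intro that[of "sqrt (\<epsilon> * u)"]) (auto simp: E_def)
qed

lemma E_uminus: "z \<in> E \<Longrightarrow> - z \<in> E" and E_cnj: "z \<in> E \<Longrightarrow> cnj z \<in> E"
  using K_cnj by (auto simp: E_def simp flip: complex_cnj_power)

text \<open>E avoids the line perpendicular to e, so each of the two opposite components lies on one
  side of it.\<close>

lemma component_sides:
  obtains C where "components E = {C, uminus ` C}" "connected C" "C \<noteq> {}" "C \<inter> uminus ` C = {}"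
    "\<And>z. z \<in> C \<Longrightarrow> Re (z * cnj e) > 0"
proof -
  obtain s where s: "square_root_branch K s" "components E = {s ` K, uminus ` s ` K}" by (rule E_branch)
  interpret square_root_branch K s by fact
  obtain x where x: "x > 0" "e * of_real x \<in> E" by (rule ex_axis_point)
  have sub: "s ` K \<subseteq> E" "uminus ` s ` K \<subseteq> E" using in_components_subset[of _ E] s(2) by auto
  have cs: "connected (s ` K)" by (rule connected_continuous_image[OF cont connected_K])
  have cm: "connected (uminus ` s ` K)" by (rule connected_continuous_image[OF _ cs]) (intro continuous_intros)
  have pos: "Re (e * of_real x * cnj e) > 0" unfolding Re_axis by (rule x(1))
  have mm: "uminus ` uminus ` s ` K = s ` K" by (simp add: image_image)
  have "e * of_real x \<in> s ` K \<or> e * of_real x \<in> uminus ` s ` K"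
    using x(2) s(2) Union_components[of E] by auto
  then show ?thesis
  proof
    assume "e * of_real x \<in> s ` K"
    then have "Re (z * cnj e) > 0" if "z \<in> s ` K" for z
      using connected_subset_side[OF cs _ pos _ that] E_axis sub by blast
    then show ?thesis using that[of "s ` K"] s(2) cs K_nonempty disjoint by auto
  next
    assume "e * of_real x \<in> uminus ` s ` K"
    then have "Re (z * cnj e) > 0" if "z \<in> uminus ` s ` K" for z
      using connected_subset_side[OF cm _ pos _ that] E_axis sub by blast
    then show ?thesis
    proof (intro that[of "uminus ` s ` K"])
      show "components E = {uminus ` s ` K, uminus ` uminus ` s ` K}"
        unfolding mm s(2) by (rule insert_commute)
      show "uminus ` s ` K \<inter> uminus ` uminus ` s ` K = {}" unfolding mm using disjoint by blast
    qed (use cm K_nonempty in auto)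
  qed
qed

lemma labeled_components:
  obtains F where "bij_betw F {1..2::nat} (components E)" "labeled_case1 F \<or> labeled_case2 F"
proof -
  obtain C where C: "components E = {C, uminus ` C}" "connected C" "C \<noteq> {}" "C \<inter> uminus ` C = {}"
    "\<And>z. z \<in> C \<Longrightarrow> Re (z * cnj e) > 0" by (rule component_sides) blast
  have "E = \<Union> (components E)" by simp
  then have EC: "E = C \<union> uminus ` C" unfolding C(1) by simp
  define F where "F = (\<lambda>j::nat. if j = 2 then C else uminus ` C)"
  have F12: "F 1 = uminus ` C" "F 2 = C" by (simp_all add: F_def)
  have "{1..2::nat} = {1, 2}" by auto
  moreover have "C \<noteq> uminus ` C" using C(3,4) by auto
  ultimately have bij: "bij_betw F {1..2::nat} (components E)"
    unfolding C(1) bij_betw_def by (auto simp: F_def)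
  have inC: "z \<in> C" if "z \<in> E" "Re (z * cnj e) > 0" for z
  proof (rule ccontr)
    assume "z \<notin> C"
    then have "- z \<in> C" using that(1) EC by auto
    then show False using C(5)[of "- z"] that(2) by simp
  qed
  show ?thesis
  proof (cases "\<epsilon> = 1")
    case True
    then have e1: "e = 1" using \<epsilon> by auto
    have cC: "cnj z \<in> C" if "z \<in> C" for z
    proof -
      have "z \<in> E" using EC that by blast
      then show ?thesis using C(5)[OF that] e1 by (intro inC E_cnj) auto
    qed
    have "cnj ` C = C"
    proof (intro equalityI subsetI)
      fix z assume "z \<in> C"
      then show "z \<in> cnj ` C" using cC by (intro image_eqI[of _ _ "cnj z"]) auto
    qed (use cC in auto)
    moreover have "cnj ` uminus ` C = uminus ` cnj ` C" by (simp add: image_image)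
    moreover have "x < y" if x: "complex_of_real x \<in> uminus ` C" and y: "complex_of_real y \<in> C" for x y
    proof -
      obtain c where c: "c \<in> C" "complex_of_real x = - c" using x by blast
      have "x = - Re c" using arg_cong[OF c(2), of Re] by simp
      then show ?thesis using C(5)[OF c(1)] C(5)[OF y] e1 by simp
    qed
    ultimately have "labeled_case1 F"
      unfolding labeled_case1_def F12 by simp
    then show ?thesis using bij that by blast
  next
    case False
    then have e1: "e = \<i>" using \<epsilon> by auto
    \<comment> \<open>Conjugation followed by negation preserves the imaginary part and so keeps the
      upper component; hence conjugation exchanges the two.\<close>
    have 1: "- cnj z \<in> C" if "z \<in> C" for z
    proof -
      have "z \<in> E" using EC that by blast
      then show ?thesis
        using C(5)[OF that] e1 by (intro inC E_uminus E_cnj) auto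
    qed
    have "cnj ` uminus ` C = C"
    proof (intro equalityI subsetI)
      fix z assume "z \<in> C"
      then have "- (- cnj z) \<in> uminus ` C" by (intro imageI 1)
      then have "cnj z \<in> uminus ` C" by simp
      then have "cnj (cnj z) \<in> cnj ` uminus ` C" by (rule imageI)
      then show "z \<in> cnj ` uminus ` C" by simp
    next
      fix z assume "z \<in> cnj ` uminus ` C"
      then obtain c where "c \<in> C" "z = cnj (- c)" by blast
      then show "z \<in> C" using 1[of c] by simp
    qed
    moreover have "C \<subseteq> {z. Im z > 0}" using C(5) e1 by auto
    ultimately have "labeled_case2 F" unfolding labeled_case2_def F12 by blast
    then show ?thesis using bij that by blast
  qed
qed

lemma components_of_labeling:
  assumes "bij_betw F {1..2::nat} (components E)"
  shows "E = F 1 \<union> F 2" "F 1 = uminus ` F 2" "F 1 \<inter> F 2 = {}" "connected (F 2)" "F 2 \<noteq> {}"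
    "simply_connected_compact (F 1)" "simply_connected_compact (F 2)"
    "bij_betw (\<lambda>z. z\<^sup>2) (F 1) K" "bij_betw (\<lambda>z. z\<^sup>2) (F 2) K"
proof -
  have I12: "{1..2::nat} = {1, 2}" by auto
  obtain s where s: "square_root_branch K s" "components E = {s ` K, uminus ` s ` K}" by (rule E_branch)
  interpret square_root_branch K s by fact
  have "{F 1, F 2} = {s ` K, uminus ` s ` K}" using assms s(2) I12 by (auto simp: bij_betw_def)
  moreover have "F 1 \<noteq> F 2" using assms I12 by (auto simp: bij_betw_def inj_on_def)
  ultimately have c: "F 2 = s ` K \<and> F 1 = uminus ` s ` K \<or> F 1 = s ` K \<and> F 2 = uminus ` s ` K"
    by (auto simp: doubleton_eq_iff)
  have comp: "F 1 \<in> components E" "F 2 \<in> components E" using assms I12 by (auto simp: bij_betw_def)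
  have "components E = {F 1, F 2}" using assms unfolding I12 bij_betw_def by auto
  moreover have "E = \<Union> (components E)" by simp
  ultimately show "E = F 1 \<union> F 2" by simp
  show "F 1 = uminus ` F 2" using c by (auto simp: image_image)
  show "F 1 \<inter> F 2 = {}" using c disjoint by auto
  show "connected (F 2)" "F 2 \<noteq> {}" using comp in_components_connected in_components_nonempty by auto
  have "compact (s ` K)" "compact (uminus ` s ` K)"
    using compact_image by (auto intro!: compact_continuous_image continuous_intros)
  then show "simply_connected_compact (F 1)" "simply_connected_compact (F 2)"
    using comp in_components_connected c connected_Compl_image connected_Compl_minus_image
    by (auto simp: simply_connected_compact_def)
  have "bij_betw (\<lambda>z. z\<^sup>2) (s ` K) K" "bij_betw (\<lambda>z. z\<^sup>2) (uminus ` s ` K) K"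
    by (rule bij_betw_byWitness[where f'=s] bij_betw_byWitness[where f'="\<lambda>u. - s u"]; use sq in auto)+
  then show "bij_betw (\<lambda>z. z\<^sup>2) (F 1) K" "bij_betw (\<lambda>z. z\<^sup>2) (F 2) K" using c by auto
qed

text \<open>A labeling of the first kind gives F 2 a real point, which for \<epsilon> = -1 would lie
  on the line that E avoids. One of the second kind excludes the real points that E has for
  \<epsilon> = 1.\<close>

lemma labeling_direction:
  assumes F: "bij_betw F {1..2::nat} (components E)" and lab: "labeled_case1 F \<or> labeled_case2 F"
  shows "labeled_case1 F \<longleftrightarrow> \<epsilon> = 1" "labeled_case2 F \<longleftrightarrow> \<epsilon> = -1"
    "\<And>z. z \<in> F 2 \<Longrightarrow> Re (z * cnj e) > 0"
proof -
  note c = components_of_labeling[OF F]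
  have 1: "\<epsilon> = 1 \<and> (\<forall>z\<in>F 2. Re (z * cnj e) > 0)" if "labeled_case1 F"
  proof -
    have cn: "cnj z \<in> F 2" if "z \<in> F 2" for z using \<open>labeled_case1 F\<close> that unfolding labeled_case1_def by blast
    obtain x :: real where x: "of_real x \<in> F 2"
      using connected_conj_invariant_meets_Reals[OF c(4,5) cn] by metis
    have "of_real (- x) \<in> F 1" unfolding c(2) using x by (intro image_eqI[of _ _ "of_real x"]) auto
    then have "- x < x" using \<open>labeled_case1 F\<close> x unfolding labeled_case1_def by blast
    then have "x > 0" by simp
    have "e = 1 \<and> \<epsilon> = 1"
    proof (rule ccontr)
      assume "\<not> ?thesis"
      then have "e = \<i>" using \<epsilon> by auto
      then show False using E_axis[of "of_real x"] x c(1) by simp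
    qed
    moreover have "Re (z * cnj 1) > 0" if "z \<in> F 2" for z
      by (rule connected_subset_side[OF c(4) x _ _ that]) (use \<open>x > 0\<close> E_axis calculation c(1) in auto)
    ultimately show ?thesis by simp
  qed
  have 2: "\<epsilon> = -1 \<and> (\<forall>z\<in>F 2. Re (z * cnj e) > 0)" if l: "labeled_case2 F"
  proof -
    have im: "Im z > 0" if "z \<in> F 2" for z using l that unfolding labeled_case2_def by blast
    have "e = \<i> \<and> \<epsilon> = -1"
    proof (rule ccontr)
      assume "\<not> ?thesis"
      then have e1: "e = 1" using \<epsilon> by auto
      obtain x where x: "x > 0" "e * of_real x \<in> E" by (rule ex_axis_point)
      then have "of_real x \<in> F 2 \<or> - of_real x \<in> F 2" using e1 c(1,2) by auto
      then show False using im by fastforce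
    qed
    then show ?thesis using im by auto
  qed
  show "labeled_case1 F \<longleftrightarrow> \<epsilon> = 1" "labeled_case2 F \<longleftrightarrow> \<epsilon> = -1" using 1 2 lab by auto
  show "Re (z * cnj e) > 0" if "z \<in> F 2" for z using 1 2 lab that by blast
qed

end

section \<open>Sign of the second center\<close>

locale symmetric_walsh_map = symmetric_walsh_setting + walsh_map +
  assumes lab: "labeled_case1 F \<or> labeled_case2 F"
begin

lemma axis_identity:
  assumes "of_real (\<epsilon> * y) \<notin> K" shows "f (of_real (\<epsilon> * y)) = of_real (\<epsilon> * (\<epsilon> * Re (f (of_real (\<epsilon> * y)))))"
  using f_Reals[OF assms] e_facts(3) by (simp add: mult.assoc[symmetric])

text \<open>(a 2)^2 = \<alpha> leaves the sign open. On the ray in direction e beyond the outermost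
  point of E, \<Phi> is e times a positive square root. Its limit at that point belongs to L and, by
  the boundary correspondence, to the component of a 2. As L misses the line perpendicular to e, a 2
  is on the same side as this limit.\<close>

lemma center_eq: "a 2 = e * of_real (sqrt (norm \<alpha>))"
proof -
  define X where "X = {x::real. x \<ge> 0 \<and> e * of_real x \<in> E}"
  have clX: "compact X"
  proof -
    have "closed X"
    proof -
      have "X = {0..} \<inter> (\<lambda>x. e * of_real x) -` E" by (auto simp: X_def)
      then show ?thesis using compact_E
        by (auto intro!: closed_Int closed_vimage continuous_intros simp: compact_imp_closed)
    qed
    moreover have "bounded X"
    proof -
      obtain B where "\<And>z. z \<in> E \<Longrightarrow> norm z \<le> B" using compact_imp_bounded[OF compact_E] bounded_iff by metis
      then have "\<bar>x\<bar> \<le> B" if "x \<in> X" for x using that e_facts(5) by (fastforce simp: X_def norm_mult)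
      then show ?thesis by (auto simp: bounded_iff)
    qed
    ultimately show ?thesis by (simp add: compact_eq_bounded_closed)
  qed
  obtain x0 where x0: "x0 > 0" "e * of_real x0 \<in> E" by (rule ex_axis_point)
  then have "x0 \<in> X" by (simp add: X_def)
  then obtain y where y: "y \<in> X" "\<And>x. x \<in> X \<Longrightarrow> x \<le> y"
    using continuous_attains_sup[OF clX _ continuous_on_id] by auto
  have ypos: "y > 0" using y(2)[OF \<open>x0 \<in> X\<close>] x0 by simp
  have ee: "e * of_real x * cnj e = of_real x" for x
    using e_facts(2) by (metis mult.assoc mult.commute mult_1)
  have yF: "e * of_real y \<in> F 2"
  proof (rule ccontr)
    assume "e * of_real y \<notin> F 2"
    then have "- (e * of_real y) \<in> F 2" using y(1) components_of_labeling(1,2)[OF F] by (auto simp: X_def)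
    then have "Re (- (e * of_real y) * cnj e) > 0" using labeling_direction(3)[OF F lab] by blast
    then show False using ypos ee[of y] by simp
  qed
  have xE: "e * of_real x \<in> - E" if "x > y" for x
    using y(2)[of x] that ypos by (force simp: X_def)
  have sqe: "(e * of_real x)\<^sup>2 = of_real (\<epsilon> * x\<^sup>2)" for x by (simp add: power_mult_distrib e_facts)
  have xK: "of_real (\<epsilon> * x\<^sup>2) \<notin> K" if "x > y" for x
  proof -
    have "(e * of_real x)\<^sup>2 \<notin> K" using xE[OF that] by (simp add: E_def)
    then show ?thesis unfolding sqe .
  qed
  \<comment> \<open>Real coordinate of f along the ray; it will stay above \<rho> and tend to \<rho>
    at y.\<close>
  define g where "g = (\<lambda>x. \<epsilon> * Re (f (of_real (\<epsilon> * x\<^sup>2))))"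
  have fg: "f (of_real (\<epsilon> * x\<^sup>2)) = of_real (\<epsilon> * g x)" if "x > y" for x
    using axis_identity[OF xK[OF that]] by (simp add: g_def)
  have ng: "\<rho> < \<bar>g x\<bar>" if "x > y" for x
    using norm_f[OF xK[OF that]] unfolding fg[OF that] by (simp only: norm_of_real abs_mult e_facts mult_1)
  have contg: "continuous_on {y<..} g"
    unfolding g_def
    by (intro continuous_intros continuous_on_compose2[OF continuous_f]) (use xK in auto)
  have inf: "filterlim (\<lambda>x::real. e * of_real x) at_infinity at_top"
  proof -
    have "filterlim (\<lambda>x::real. norm (e * of_real x)) at_top at_top"
    proof (rule filterlim_at_top_mono[OF filterlim_ident])
      show "\<forall>\<^sub>F x in at_top. x \<le> norm (e * of_real x)"
        using e_facts(5) by (intro always_eventually) (simp add: norm_mult abs_ge_self)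
    qed
    then show ?thesis by (simp add: filterlim_at_infinity_conv_norm_at_top)
  qed
  \<comment> \<open>A continuous real function without zeros on the ray keeps the sign that it has
    near infinity; this serves both g and the coordinate of \<Phi>.\<close>
  have pos_of_eventually: "h x > 0"
    if h: "continuous_on {y<..} h" "\<And>x. x > y \<Longrightarrow> h x \<noteq> 0" "\<forall>\<^sub>F x in at_top. h x > 0" "x > y" for h :: "real \<Rightarrow> real" and x
  proof (rule ccontr)
    assume "\<not> h x > 0"
    then have neg: "h x < 0" using h(2,4) by force
    have "\<forall>\<^sub>F x' in at_top. h x' > 0 \<and> x < x'" using h(3) eventually_gt_at_top by (rule eventually_conj)
    then obtain x' where x': "h x' > 0" "x < x'"
      using eventually_happens[of _ at_top] by (metis (mono_tags, lifting) trivial_limit_at_top_linorder)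
    have "continuous_on {x..x'} h" by (rule continuous_on_subset[OF h(1)]) (use h(4) in auto)
    then obtain z where "x \<le> z" "h z = 0" using IVT'[of h x 0 x'] neg x' by auto
    then show False using h(2)[of z] h(4) by simp
  qed
  have gpos: "g x > \<rho>" if x: "x > y" for x
  proof -
    have "g x > 0"
    proof (rule pos_of_eventually[OF contg _ _ x])
      show "g x \<noteq> 0" if "x > y" for x using ng[OF that] \<rho> by auto
      have "((\<lambda>x. G (e * of_real x) / (e * of_real x)\<^sup>2) \<longlongrightarrow> 1) at_top"
        by (rule filterlim_compose[OF G_ratio inf])
      then have "((\<lambda>x. Re (G (e * of_real x) / (e * of_real x)\<^sup>2)) \<longlongrightarrow> Re 1) at_top" by (rule tendsto_Re)
      then have "\<forall>\<^sub>F x in at_top. Re (G (e * of_real x) / (e * of_real x)\<^sup>2) > 0"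
        by (rule order_tendstoD) simp
      then show "\<forall>\<^sub>F x in at_top. g x > 0"
        using eventually_gt_at_top[of y]
      proof eventually_elim
        case (elim x)
        have "G (e * of_real x) / (e * of_real x)\<^sup>2 = of_real (g x / x\<^sup>2)"
          unfolding G_def sqe fg[OF elim(2)] using \<epsilon> by auto
        then show ?case using elim(1) by (simp add: zero_less_divide_iff)
      qed
    qed
    then show ?thesis using ng[OF x] by simp
  qed
  define h where "h = (\<lambda>x. Re (\<Phi> (e * of_real x) * cnj e))"
  have \<Phi>h: "\<Phi> (e * of_real x) = e * of_real (sqrt (norm \<alpha> + g x))" if x: "x > y" for x
  proof -
    have sq: "(\<Phi> (e * of_real x))\<^sup>2 = (e * of_real (sqrt (norm \<alpha> + g x)))\<^sup>2" if "x > y" for x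
    proof -
      have "(\<Phi> (e * of_real x))\<^sup>2 = \<alpha> + of_real (\<epsilon> * g x)"
        using \<Phi>_square[OF xE[OF that]] unfolding sqe fg[OF that] .
      also have "\<dots> = of_real (\<epsilon> * (norm \<alpha> + g x))" by (subst \<alpha>_\<epsilon>) (simp add: distrib_left)
      also have "norm \<alpha> + g x = (sqrt (norm \<alpha> + g x))\<^sup>2" using gpos[OF that] \<rho> by simp
      also have "of_real (\<epsilon> * (sqrt (norm \<alpha> + g x))\<^sup>2) = (e * of_real (sqrt (norm \<alpha> + g x)))\<^sup>2" by (rule sqe[symmetric])
      finally show ?thesis .
    qed
    have pm: "\<Phi> (e * of_real x) = e * of_real (sqrt (norm \<alpha> + g x)) \<or> \<Phi> (e * of_real x) = - (e * of_real (sqrt (norm \<alpha> + g x)))"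
      if "x > y" for x using sq[OF that] by (metis power2_eq_iff)
    have hx: "h x = sqrt (norm \<alpha> + g x) \<or> h x = - sqrt (norm \<alpha> + g x)" if "x > y" for x
      using pm[OF that] unfolding h_def by (metis Re_axis)
    have spos: "sqrt (norm \<alpha> + g x) > 0" if "x > y" for x
      using gpos[OF that] \<rho> by (simp add: add_nonneg_pos)
    have "h x > 0"
    proof (rule pos_of_eventually[OF _ _ _ x])
      show "continuous_on {y<..} h" unfolding h_def
        by (intro continuous_intros continuous_on_compose2[OF continuous_\<Phi>]) (use xE in auto)
      show "h x \<noteq> 0" if "x > y" for x using hx[OF that] spos[OF that] by auto
      have "((\<lambda>x. \<Phi> (e * of_real x) / (e * of_real x)) \<longlongrightarrow> 1) at_top"
        by (rule filterlim_compose[OF ratio_tendsto_1_of_diff_tendsto[OF \<Phi>_diff_tendsto] inf])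
      then have "((\<lambda>x. Re (\<Phi> (e * of_real x) / (e * of_real x))) \<longlongrightarrow> Re 1) at_top" by (rule tendsto_Re)
      then have "\<forall>\<^sub>F x in at_top. Re (\<Phi> (e * of_real x) / (e * of_real x)) > 0"
        by (rule order_tendstoD) simp
      then show "\<forall>\<^sub>F x in at_top. h x > 0"
        using eventually_gt_at_top[of 0]
      proof eventually_elim
        case (elim x)
        have "\<Phi> (e * of_real x) / (e * of_real x) = \<Phi> (e * of_real x) * cnj e / of_real x"
          using elim(2) e_facts(2,4) by (simp add: field_simps)
        then show ?case using elim by (simp add: h_def zero_less_divide_iff)
      qed
    qed
    moreover have "h x = - sqrt (norm \<alpha> + g x)" if "\<Phi> (e * of_real x) = - (e * of_real (sqrt (norm \<alpha> + g x)))"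
      unfolding h_def that by (rule Re_axis)
    ultimately show ?thesis using pm[OF x] spos[OF x] by fastforce
  qed
  \<comment> \<open>The superlevel set |f| \<ge> \<rho> + d is closed in the plane and does not
    contain the square of the point y e, which lies in K; so |f| < \<rho> + d close to it.\<close>
  have glim: "(g \<longlongrightarrow> \<rho>) (at_right y)"
  proof (rule tendstoI)
    fix d :: real assume d: "d > 0"
    have "open (- {u. u \<notin> K \<and> \<rho> + d \<le> norm (f u)})" using closed_superlevel[of "\<rho> + d"] d by (simp add: open_Compl)
    moreover have "complex_of_real (\<epsilon> * y\<^sup>2) \<in> - {u. u \<notin> K \<and> \<rho> + d \<le> norm (f u)}"
    proof -
      have "(e * of_real y)\<^sup>2 \<in> K" using y(1) by (simp add: X_def E_def)
      then have "complex_of_real (\<epsilon> * y\<^sup>2) \<in> K" unfolding sqe .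
      then show ?thesis by blast
    qed
    moreover have "((\<lambda>x. complex_of_real (\<epsilon> * x\<^sup>2)) \<longlongrightarrow> complex_of_real (\<epsilon> * y\<^sup>2)) (at_right y)"
      by (intro tendsto_intros)
    ultimately have "\<forall>\<^sub>F x in at_right y. complex_of_real (\<epsilon> * x\<^sup>2) \<in> - {u. u \<notin> K \<and> \<rho> + d \<le> norm (f u)}"
      using topological_tendstoD by blast
    then show "\<forall>\<^sub>F x in at_right y. dist (g x) \<rho> < d"
      using eventually_at_right_less[of y]
    proof eventually_elim
      case (elim x)
      then have "norm (f (of_real (\<epsilon> * x\<^sup>2))) < \<rho> + d" using xK[OF elim(2)] by auto
      then have "\<bar>g x\<bar> < \<rho> + d" unfolding fg[OF elim(2)] by (simp only: norm_of_real abs_mult e_facts mult_1)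
      then show ?case using gpos[OF elim(2)] by (simp add: dist_real_def)
    qed
  qed
  define w where "w = e * of_real (sqrt (norm \<alpha> + \<rho>))"
  have wlim: "((\<lambda>x. \<Phi> (e * of_real x)) \<longlongrightarrow> w) (at_right y)"
  proof -
    have "((\<lambda>x. e * of_real (sqrt (norm \<alpha> + g x))) \<longlongrightarrow> w) (at_right y)"
      unfolding w_def by (intro tendsto_intros glim)
    moreover have "\<forall>\<^sub>F x in at_right y. e * of_real (sqrt (norm \<alpha> + g x)) = \<Phi> (e * of_real x)"
      using eventually_at_right_less[of y] by eventually_elim (simp add: \<Phi>h)
    ultimately show ?thesis by (rule Lim_transform_eventually)
  qed
  have wL: "w \<in> L"
  proof -
    have "w\<^sup>2 = \<alpha> + of_real (\<epsilon> * \<rho>)"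
      unfolding w_def sqe using \<rho> by (subst (2) \<alpha>_\<epsilon>) (simp add: distrib_left)
    then show ?thesis using \<rho> e_facts(6) by (simp add: L_eq_preimage dist_norm norm_mult)
  qed
  have wc: "w \<in> connected_component_set L (a 2)"
  proof (rule boundary_correspondence[OF _ _ yF _ wlim wL])
    show "((\<lambda>x. e * of_real x) \<longlongrightarrow> e * of_real y) (at_right y)" by (intro tendsto_intros)
    show "\<forall>\<^sub>F x in at_right y. e * of_real x \<in> - E"
      using eventually_at_right_less[of y] by eventually_elim (rule xE)
  qed simp
  \<comment> \<open>On the perpendicular line v^2 - \<alpha> has modulus at least |\<alpha>| >
    \<rho>.\<close>
  have Laxis: "Re (v * cnj e) \<noteq> 0" if v: "v \<in> L" for v
  proof
    assume r: "Re (v * cnj e) = 0"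
    let ?y = "Im (v * cnj e)"
    have "v = v * (e * cnj e)" by (simp add: e_facts)
    also have "\<dots> = e * (v * cnj e)" by (simp add: algebra_simps)
    also have "v * cnj e = \<i> * of_real ?y" using r by (simp add: complex_eq_iff)
    finally have "v\<^sup>2 = (e * (\<i> * of_real ?y))\<^sup>2" by simp
    also have "\<dots> = of_real (- \<epsilon> * ?y\<^sup>2)" by (simp add: power_mult_distrib e_facts)
    finally have "v\<^sup>2 - \<alpha> = of_real (- \<epsilon> * (?y\<^sup>2 + norm \<alpha>))" by (subst \<alpha>_\<epsilon>) (simp add: algebra_simps)
    then have "norm (v\<^sup>2 - \<alpha>) = \<bar>- \<epsilon> * (?y\<^sup>2 + norm \<alpha>)\<bar>" by (simp only: norm_of_real)
    also have "\<dots> = ?y\<^sup>2 + norm \<alpha>" by (simp add: abs_mult e_facts abs_of_nonneg)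
    finally show False using v norm_\<alpha> by (simp add: L_eq_preimage dist_norm norm_minus_commute) (smt (verit) zero_le_power2)
  qed
  have "Re (a 2 * cnj e) > 0"
  proof (rule connected_subset_side[OF _ wc])
    show "connected (connected_component_set L (a 2))" by simp
    show "Re (w * cnj e) > 0" unfolding w_def ee using \<rho> by (simp add: add_nonneg_pos)
    show "Re (v * cnj e) \<noteq> 0" if "v \<in> connected_component_set L (a 2)" for v
      using Laxis that connected_component_subset by blast
    show "a 2 \<in> connected_component_set L (a 2)" by (rule a_in_Lc) simp
  qed
  moreover have "(a 2)\<^sup>2 = (e * of_real (sqrt (norm \<alpha>)))\<^sup>2"
    unfolding centers(2) sqe using \<alpha>_\<epsilon> by simp
  then have "a 2 = e * of_real (sqrt (norm \<alpha>)) \<or> a 2 = - (e * of_real (sqrt (norm \<alpha>)))" by (metis power2_eq_iff)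
  moreover have "Re (a 2 * cnj e) = - sqrt (norm \<alpha>)" if "a 2 = - (e * of_real (sqrt (norm \<alpha>)))"
    unfolding that by (rule Re_axis)
  moreover have "0 \<le> sqrt (norm \<alpha>)" by simp
  ultimately show ?thesis by linarith
qed

lemma eventually_positive: "\<forall>\<^sub>F x in at_top. \<Phi> (complex_of_real x) \<in> \<real> \<and> Re (\<Phi> (complex_of_real x)) > 0"
proof -
  have inf: "filterlim complex_of_real at_infinity at_top"
    by (simp add: filterlim_at_infinity_conv_norm_at_top filterlim_abs_real)
  have "((\<lambda>x. \<Phi> (complex_of_real x) / of_real x) \<longlongrightarrow> 1) at_top"
    by (rule filterlim_compose[OF ratio_tendsto_1_of_diff_tendsto[OF \<Phi>_diff_tendsto] inf])
  then have "((\<lambda>x. Re (\<Phi> (complex_of_real x) / of_real x)) \<longlongrightarrow> Re 1) at_top" by (rule tendsto_Re)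
  then have 1: "\<forall>\<^sub>F x in at_top. Re (\<Phi> (complex_of_real x) / of_real x) > 0" by (rule order_tendstoD) simp
  have 2: "\<forall>\<^sub>F x in at_top. complex_of_real x \<in> - E"
    using eventually_compose_filterlim[OF eventually_notin_compact_at_infinity[OF compact_E] inf] by simp
  show ?thesis
    using 1 2 eventually_gt_at_top[of 0]
  proof eventually_elim
    case (elim x)
    let ?v = "\<Phi> (complex_of_real x)"
    have pos: "Re ?v > 0" using elim by (simp add: zero_less_divide_iff)
    have "complex_of_real (x\<^sup>2) \<notin> K" using elim(2) by (simp add: E_def)
    then have "?v\<^sup>2 = of_real (\<epsilon> * norm \<alpha> + Re (f (of_real (x\<^sup>2))))"
      using \<Phi>_square[OF elim(2)] f_Reals[of "x\<^sup>2"] \<alpha>_\<epsilon> by simp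
    then have "Im (?v\<^sup>2) = 0" by simp
    then have "Re ?v * Im ?v = 0" by (auto simp: power2_eq_square)
    then have "Im ?v = 0" using pos by simp
    then show ?case using pos by (simp add: complex_is_Real_iff)
  qed
qed

end

section \<open>Even real polynomials\<close>

lemma even_polynomial_decomposition:
  fixes P :: "'a :: {idom, ring_char_0} poly"
  assumes "\<And>z. poly P (- z) = poly P z"
  obtains R where "P = pcompose R [:0, 0, 1:]"
proof -
  have "\<exists>R. P = pcompose R [:0, 0, 1:]"
    using assms
  proof (induction "degree P" arbitrary: P rule: less_induct)
    case less
    show ?case
    proof (cases "degree P = 0")
      case True
      then obtain c where "P = [:c:]" by (rule degree_eq_zeroE)
      then have "P = pcompose [:c:] [:0, 0, 1:]" by (simp add: pcompose_pCons)
      then show ?thesis ..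
    next
      case False
      obtain c1 P1 where P1: "P = pCons c1 P1" by (rule pCons_cases)
      obtain c2 Q where P1Q: "P1 = pCons c2 Q" by (rule pCons_cases)
      note PQ = P1[unfolded P1Q]
      \<comment> \<open>With P = c1 + c2 z + z^2 Q the difference P(z) - P(-z) is z D(z). So D = 0,
        which gives c2 = 0 and Q even.\<close>
      define D where "D = [:2 * c2:] + [:0, 1:] * (Q - pcompose Q [:0, -1:])"
      have "poly D z = 0" if "z \<noteq> 0" for z
      proof -
        have "poly P z - poly P (- z) = z * poly D z"
          unfolding PQ D_def by (simp add: poly_pcompose algebra_simps)
        then show ?thesis using less.prems[of z] that by simp
      qed
      then have "- {0} \<subseteq> {z. poly D z = 0}" by auto
      moreover have "infinite (- {0::'a})" by (simp add: infinite_UNIV_char_0 Compl_eq_Diff_UNIV)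
      ultimately have "infinite {z. poly D z = 0}" using finite_subset by blast
      then have D: "D = 0" using poly_roots_finite by blast
      then have "poly D 0 = 0" by simp
      then have c2: "c2 = 0" by (simp add: D_def)
      then have "[:0, 1:] * (Q - pcompose Q [:0, -1:]) = 0" using D by (simp add: D_def)
      then have Q: "Q = pcompose Q [:0, -1:]" by simp
      have "poly Q (- z) = poly Q z" for z using arg_cong[OF Q, of "\<lambda>q. poly q z"] by (simp add: poly_pcompose)
      moreover have "degree Q < degree P" using False by (auto simp: PQ degree_pCons_eq_if split: if_splits)
      ultimately obtain R where "Q = pcompose R [:0, 0, 1:]" using less.hyps by blast
      then have "P = pcompose (pCons c1 R) [:0, 0, 1:]" unfolding PQ c2 by (simp add: pcompose_pCons)
      then show ?thesis ..
    qed
  qed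
  then show ?thesis using that by blast
qed

text \<open>The even polynomial \<open>P z = R (z\<^sup>2)\<close> has the critical point \<open>0\<close>, and its other critical points are
  the square roots of those of \<open>R\<close>. As critical points come in pairs \<open>\<plusminus>z\<close>, the exceptional one is \<open>0\<close>.\<close>
lemma critical_points_of_square_composition:
  fixes R :: "complex poly" and A :: "complex set"
  defines "P \<equiv> pcompose R [:0, 0, 1:]"
  assumes crit: "{z. poly (pderiv P) z = 0 \<and> poly P z \<notin> A} = {z1}" and ord: "order z1 (pderiv P) = 1"
  shows "degree R > 0" "poly R 0 \<notin> A" "poly R u \<notin> A \<Longrightarrow> poly (pderiv R) u \<noteq> 0"
proof -
  have P: "poly P z = poly R (z\<^sup>2)" for z by (simp add: P_def poly_pcompose power2_eq_square)
  have dP: "pderiv P = pcompose (pderiv R) [:0, 0, 1:] * [:0, 2:]"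
    unfolding P_def pderiv_pcompose by (simp add: pderiv_pCons)
  have dPz: "poly (pderiv P) z = poly (pderiv R) (z\<^sup>2) * (2 * z)" for z
    unfolding dP by (simp add: poly_pcompose power2_eq_square)
  show R: "degree R > 0"
  proof (rule ccontr)
    assume "\<not> ?thesis"
    then obtain c where "R = [:c:]" using degree_eq_zeroE[of R] by auto
    then have "{z. poly (pderiv P) z = 0 \<and> poly P z \<notin> A} = {z. c \<notin> A}" unfolding dPz P by simp
    then have "z1 + 1 \<in> {z1}" using crit by blast
    then show False by simp
  qed
  have z1: "poly (pderiv P) z1 = 0" "poly P z1 \<notin> A" using crit by blast+
  have "poly (pderiv P) (- z1) = 0" "poly P (- z1) \<notin> A" using z1 unfolding dPz P by simp_all
  then have "- z1 = z1" using crit by blast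
  then have z10: "z1 = 0" by simp
  show R0: "poly R 0 \<notin> A" using z1(2) unfolding z10 P by simp
  show "poly (pderiv R) u \<noteq> 0" if u: "poly R u \<notin> A"
  proof
    assume d: "poly (pderiv R) u = 0"
    show False
    proof (cases "u = 0")
      case True
      \<comment> \<open>R'(0) = 0 would give P'(z) = 2 z R'(z^2) a multiple zero at 0, against the
        simplicity of the exceptional critical point.\<close>
      have "[:-0, 1:] dvd pderiv R" using d True by (simp only: poly_eq_0_iff_dvd)
      then obtain q where q: "pderiv R = [:0, 1:] * q" by (auto elim: dvdE)
      have "pderiv P = [:-0, 1:] ^ 2 * (pcompose q [:0, 0, 1:] * [:0, 2:])"
        unfolding dP q pcompose_mult by (simp add: pcompose_pCons power2_eq_square)
      then have "[:-0, 1:] ^ 2 dvd pderiv P" by (rule dvdI)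
      moreover have "pderiv P \<noteq> 0"
      proof -
        have "degree P > 0" unfolding P_def degree_pcompose using R by simp
        then show ?thesis by (simp add: pderiv_eq_0_iff)
      qed
      ultimately show False using ord unfolding z10 order_divides by simp
    next
      case False
      have "poly (pderiv P) (csqrt u) = 0" "poly P (csqrt u) \<notin> A" using u d unfolding dPz P by simp_all
      then have "csqrt u = 0" using crit z10 by blast
      then show False using False by simp
    qed
  qed
qed

lemma cnj_joukowski_sqrt:
  assumes "x \<notin> unit_segment" shows "joukowski_sqrt (cnj x) = cnj (joukowski_sqrt x)"
  unfolding joukowski_sqrt_def using cnj_csqrt[OF csqrt_arg_notin_nonpos_Reals(1)[OF assms]] by simp

text \<open>1 - 1/x^2 is a positive real here, so the sign of the branch is that of the factor
  x.\<close>

lemma joukowski_sqrt_of_real: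
  assumes "1 < \<bar>x\<bar>" shows "joukowski_sqrt (of_real x) = of_real (signed_sqrt x)"
proof -
  have x: "1 \<le> x\<^sup>2" using assms by (metis less_imp_le one_le_power power2_abs)
  then have "0 \<le> 1 - 1 / x\<^sup>2" by (simp add: divide_le_eq_1 field_simps)
  then have "csqrt (of_real (1 - 1 / x\<^sup>2)) = of_real (sqrt (1 - 1 / x\<^sup>2))" by (subst csqrt_of_real_nonneg) auto
  then have 1: "joukowski_sqrt (of_real x) = of_real (x * sqrt (1 - 1 / x\<^sup>2))"
    unfolding joukowski_sqrt_def by simp
  have "\<bar>x\<bar> * sqrt (1 - 1 / x\<^sup>2) = sqrt (x\<^sup>2 * (1 - 1 / x\<^sup>2))" unfolding real_sqrt_mult by simp
  also have "x\<^sup>2 * (1 - 1 / x\<^sup>2) = x\<^sup>2 - 1" using assms by (auto simp: field_simps)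
  finally have "x * sqrt (1 - 1 / x\<^sup>2) = signed_sqrt x"
    using assms by (auto simp: signed_sqrt_def abs_if split: if_splits)
  then show ?thesis unfolding 1 by (simp only:)
qed

section \<open>The preimage of the segment under an even real polynomial\<close>

locale polynomial_walsh_setting = walsh_setting +
  fixes R :: "complex poly" and b p0 :: real
  assumes degree_R: "degree R > 0" and lead_R: "lead_coeff R = of_real b" and R_0: "poly R 0 = of_real p0"
    and R_cnj: "\<And>u. poly R (cnj u) = cnj (poly R u)"
    and K_eq: "K = {u. poly R u \<in> unit_segment}"
    and \<rho>_eq: "\<rho> = (2 * \<bar>b\<bar>) powr (- 1 / real (degree R))"
    and f_power: "\<And>u. u \<notin> K \<Longrightarrow> f u ^ degree R = (poly R u + joukowski_sqrt (poly R u)) / (2 * of_real b)"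
begin

lemma K_iff: "u \<in> K \<longleftrightarrow> poly R u \<in> unit_segment"
  using K_eq by blast

lemma b_nonzero: "b \<noteq> 0"
  using degree_R lead_R by force

lemma \<rho>_power: "2 * \<bar>b\<bar> * \<rho> ^ degree R = 1"
proof -
  have "\<rho> ^ degree R = (2 * \<bar>b\<bar>) powr (- 1 / real (degree R) * real (degree R))"
    unfolding \<rho>_eq using b_nonzero by (subst powr_realpow[symmetric]) (simp_all add: powr_powr)
  also have "- 1 / real (degree R) * real (degree R) = - 1" using degree_R by simp
  finally show ?thesis using b_nonzero by (simp add: powr_minus_divide)
qed

lemma sqrt_\<rho>: "sqrt \<rho> = (2 * \<bar>b\<bar>) powr (- 1 / real (2 * degree R))"
proof -
  have "sqrt \<rho> = ((2 * \<bar>b\<bar>) powr (- 1 / real (degree R))) powr (1 / 2)"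
    unfolding \<rho>_eq by (rule powr_half_sqrt[symmetric]) simp
  then show ?thesis by (simp add: powr_powr mult.commute)
qed

text \<open>Above: R(z^2) has degree 2k and leading coefficient b, so its small monic polynomials
  decay at the rate sqrt \<rho>. Below: the boundary law on K has potential at least ln \<rho> on K,
  and the lift to E halves this bound.\<close>

lemma log_capacity_E: "log_capacity E = sqrt \<rho>"
proof -
  define P where "P = pcompose R [:0, 0, 1:]"
  have dP: "degree P = 2 * degree R" unfolding P_def degree_pcompose by simp
  have lP: "lead_coeff P = of_real b" unfolding P_def by (subst lead_coeff_comp) (simp_all add: lead_R)
  have EP: "{z. poly P z \<in> unit_segment} = E"
    by (simp add: P_def poly_pcompose E_def K_iff power2_eq_square)
  have cP: "(2 * norm (lead_coeff P)) powr (- 1 / real (degree P)) = sqrt \<rho>"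
    by (simp only: lP) (simp add: dP sqrt_\<rho>)
  obtain C where C: "C > 0" "\<And>j. \<exists>t. degree t = j \<and> lead_coeff t = 1 \<and> (\<forall>z\<in>E. norm (poly t z) \<le> C * sqrt \<rho> ^ j)"
    by (rule small_monic_polys_on_preimage[of P, unfolded cP EP]) (use dP degree_R that in auto)
  have s: "sqrt \<rho> > 0" using \<rho> by simp
  note cap = log_capacity_le[OF s C]
  obtain bv where bv: "\<And>x. bv x \<in> K" "\<And>x. (\<lambda>n. \<psi> (circ (\<rho> + 1 / real (Suc n)) x)) \<longlonglongrightarrow> bv x"
    "\<And>u. finite {x \<in> {0..1}. bv x = u}"
    using polynomial_boundary_values[OF K_eq degree_R degree_R, of "of_real b"] \<rho>_power f_power by auto
  note pot = boundary_potential[OF bv]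
  obtain M where M: "prob_space M" "sets M = sets borel" "emeasure M {z. z\<^sup>2 \<in> K} = 1"
    "\<And>z. emeasure M {z} = 0" "integrable (M \<Otimes>\<^sub>M M) (\<lambda>p. ln (dist (fst p) (snd p)))"
    "ln \<rho> / 2 \<le> (\<integral>p. ln (dist (fst p) (snd p)) \<partial>(M \<Otimes>\<^sub>M M))"
    by (rule energy_of_square_root_measure[OF pot(1) bv(1) compact_K bv(3) pot(2)]) (assumption | rule that | blast)+
  have "sqrt \<rho> = exp (ln \<rho> / 2)"
    using \<rho> by (simp add: powr_half_sqrt[symmetric] powr_def)
  also have "\<dots> \<le> exp (\<integral>p. ln (dist (fst p) (snd p)) \<partial>(M \<Otimes>\<^sub>M M))" using M(6) by simp
  also have "\<dots> \<le> log_capacity E"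
    by (rule cap(2)[OF M(1,2) _ M(4,5)]) (use M(3) in \<open>simp add: E_def\<close>)
  finally show ?thesis using cap(1) by simp
qed

lemma cnj_notin_K: "u \<notin> K \<Longrightarrow> cnj u \<notin> K"
proof
  assume u: "u \<notin> K" and "cnj u \<in> K"
  then obtain x where "x \<in> {-1..1}" "cnj (poly R u) = of_real x" by (auto simp: K_iff R_cnj)
  then have "poly R u = of_real x" by (metis complex_cnj_cnj complex_cnj_complex_of_real)
  then show False using u \<open>x \<in> {-1..1}\<close> by (auto simp: K_iff)
qed

text \<open>Both sides are \<open>k\<close>-th roots of the same function, so their quotient is constant; the constant is read
  off at infinity.\<close>
lemma f_cnj:
  assumes "u \<notin> K" shows "f (cnj u) = cnj (f u)"
proof -
  define q where "q = (\<lambda>u. cnj (f (cnj u)) / f u)"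
  have qk: "q u ^ degree R = 1" if u: "u \<notin> K" for u
  proof -
    have notin: "poly R u \<notin> unit_segment" using u by (simp add: K_iff)
    have "f (cnj u) ^ degree R = cnj (f u ^ degree R)"
      unfolding f_power[OF u] f_power[OF cnj_notin_K[OF u]] R_cnj cnj_joukowski_sqrt[OF notin] by simp
    then have "cnj (f (cnj u)) ^ degree R = f u ^ degree R" by (metis complex_cnj_cnj complex_cnj_power)
    then show ?thesis using f_nonzero[OF u] by (simp add: q_def power_divide)
  qed
  have "continuous_on (- K) (\<lambda>u. f (cnj u))"
    by (rule continuous_on_compose2[OF continuous_f]) (use cnj_notin_K in \<open>auto intro!: continuous_intros\<close>)
  then have "continuous_on (- K) q"
    unfolding q_def by (intro continuous_intros continuous_f) (use f_nonzero in auto)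
  moreover have "finite (q ` (- K))"
    by (rule finite_subset[OF _ finite_nth_roots[OF degree_R, of 1]]) (use qk in auto)
  ultimately have "q constant_on (- K)" using connected_Compl_K by (intro continuous_finite_range_constant)
  then obtain c where c: "\<And>u. u \<notin> K \<Longrightarrow> q u = c" by (auto simp: constant_on_def)
  have r: "((\<lambda>u. f u / u) \<longlongrightarrow> 1) at_infinity" by (rule ratio_tendsto_1_of_diff_tendsto[OF asymp])
  have "filterlim cnj at_infinity at_infinity"
    by (simp add: filterlim_at_infinity_conv_norm_at_top filterlim_norm_at_top)
  then have "((\<lambda>u. cnj (f (cnj u) / cnj u)) \<longlongrightarrow> cnj 1) at_infinity"
    by (intro tendsto_cnj filterlim_compose[OF r])
  then have "((\<lambda>u. cnj (f (cnj u) / cnj u) / (f u / u)) \<longlongrightarrow> cnj 1 / 1) at_infinity"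
    by (intro tendsto_divide r) auto
  moreover have "\<forall>\<^sub>F u in at_infinity. cnj (f (cnj u) / cnj u) / (f u / u) = c"
    using eventually_notin_compact_at_infinity[OF compact_K] eventually_not_equal_at_infinity[of 0]
  proof eventually_elim
    case (elim u)
    then show ?case using c[OF elim(1)] by (simp add: q_def)
  qed
  ultimately have "((\<lambda>u::complex. c) \<longlongrightarrow> cnj 1 / 1) at_infinity" by (rule Lim_transform_eventually)
  then have "c = 1" by (simp add: tendsto_const_iff trivial_limit_at_infinity)
  then have "cnj (f (cnj u)) = f u" using c[OF assms] f_nonzero[OF assms] by (simp add: q_def)
  then show ?thesis by (metis complex_cnj_cnj)
qed

lemma \<alpha>_real: "\<alpha> = of_real (Re \<alpha>)"
  using f_cnj[OF zero_notin] by (simp add: \<alpha>_def complex_eq_iff)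

lemma Re_\<alpha>_nonzero: "Re \<alpha> \<noteq> 0"
  using norm_\<alpha> \<rho> by (subst (asm) \<alpha>_real) auto

definition \<sigma> :: real where "\<sigma> = sgn (Re \<alpha>)"

definition axis :: complex where "axis = (if Re \<alpha> > 0 then 1 else \<i>)"

sublocale symmetric_walsh_setting K f \<rho> \<gamma> \<sigma> axis
proof
  show "cnj u \<in> K" if "u \<in> K" for u using that cnj_notin_K[of "cnj u"] by auto
  show "\<sigma> = 1 \<and> axis = 1 \<or> \<sigma> = -1 \<and> axis = \<i>" using Re_\<alpha>_nonzero by (auto simp: \<sigma>_def axis_def)
  have "norm \<alpha> = \<bar>Re \<alpha>\<bar>" by (subst \<alpha>_real) (simp only: norm_of_real)
  then show "\<alpha> = of_real (\<sigma> * norm \<alpha>)" using \<alpha>_real by (simp add: \<sigma>_def sgn_mult_abs)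
qed (rule f_cnj)

text \<open>Evaluate f^k at 0, where f 0 = -\<sigma> |\<alpha>|; the sign (-\<sigma>)^k changes
  sides because its square is 1. It becomes (-1)^(n/2) in case 1 and 1 in case 2.\<close>

lemma norm_\<alpha>_power:
  "norm \<alpha> ^ degree R = (- \<sigma>) ^ degree R / (2 * b) * (p0 + signed_sqrt p0)"
proof -
  have "of_real p0 \<notin> unit_segment" using zero_notin by (simp add: K_iff R_0)
  then have "p0 \<notin> {-1..1}" by blast
  then have p0: "1 < \<bar>p0\<bar>" by auto
  have "f 0 = - \<alpha>" by (simp add: \<alpha>_def)
  also have "\<dots> = - complex_of_real (\<sigma> * norm \<alpha>)" using \<alpha>_\<epsilon> by (rule arg_cong)
  finally have "f 0 = complex_of_real (- \<sigma> * norm \<alpha>)" by simp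
  then have "complex_of_real ((- \<sigma> * norm \<alpha>) ^ degree R) = f 0 ^ degree R" by simp
  also have "\<dots> = complex_of_real ((p0 + signed_sqrt p0) / (2 * b))"
    unfolding f_power[OF zero_notin] R_0 joukowski_sqrt_of_real[OF p0] by simp
  finally have "(- \<sigma> * norm \<alpha>) ^ degree R = (p0 + signed_sqrt p0) / (2 * b)" by (simp only: of_real_eq_iff)
  then have "(- \<sigma>) ^ degree R * norm \<alpha> ^ degree R = (p0 + signed_sqrt p0) / (2 * b)"
    by (simp only: power_mult_distrib)
  then have "(- \<sigma>) ^ degree R * ((- \<sigma>) ^ degree R * norm \<alpha> ^ degree R) = (- \<sigma>) ^ degree R * ((p0 + signed_sqrt p0) / (2 * b))"
    by (rule arg_cong)
  moreover have "(- \<sigma>) ^ degree R * (- \<sigma>) ^ degree R = 1"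
    unfolding power_mult_distrib[symmetric] using e_facts(3) by simp
  ultimately show ?thesis by (simp add: mult.assoc[symmetric])
qed

lemma root_norm_\<alpha>_power: "root (2 * degree R) (norm \<alpha> ^ degree R) = sqrt (norm \<alpha>)"
proof (rule real_root_pos_unique)
  show "sqrt (norm \<alpha>) ^ (2 * degree R) = norm \<alpha> ^ degree R" by (simp add: power_mult)
qed (use degree_R in auto)

lemma norm_\<alpha>_pos: "0 < norm \<alpha>"
  using norm_\<alpha> \<rho> by linarith

text \<open>R maps K onto the whole segment.\<close>

lemma infinite_K: "infinite K"
proof
  assume "finite K"
  then have "finite (poly R ` K)" by simp
  moreover have "unit_segment \<subseteq> poly R ` K"
  proof
    fix x assume x: "x \<in> unit_segment"
    have "degree (R + - [:x:]) = degree R" using degree_R by (intro degree_add_eq_left) simp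
    then have "degree (R - [:x:]) > 0" using degree_R by (simp only: diff_conv_add_uminus)
    then have "\<not> constant (poly (R - [:x:]))" by (simp add: constant_degree)
    then obtain u where "poly (R - [:x:]) u = 0" using fundamental_theorem_of_algebra by blast
    then have "poly R u = x" by simp
    then show "x \<in> poly R ` K" using x by (auto simp: K_iff)
  qed
  ultimately have "finite unit_segment" by (rule rev_finite_subset)
  then have "finite {-1..1::real}" by (rule finite_imageD) (simp add: inj_on_def)
  then show False using infinite_Icc[of "-1" "1::real"] by simp
qed

lemma labeling:
  obtains F where "bij_betw F {1..2::nat} (components E)" "E = F 1 \<union> F 2" "F 1 \<inter> F 2 = {}"
    "\<And>j. j \<in> {1..2} \<Longrightarrow> simply_connected_compact (F j) \<and> infinite (F j)" "F 1 = uminus ` F 2"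
    "labeled_case1 F \<or> labeled_case2 F"
proof -
  obtain F where F: "bij_betw F {1..2::nat} (components E)" "labeled_case1 F \<or> labeled_case2 F"
    by (rule labeled_components)
  note c = components_of_labeling[OF F(1)]
  have inf: "infinite (F 1)" "infinite (F 2)" using c(8,9) infinite_K bij_betw_finite by blast+
  have "simply_connected_compact (F j) \<and> infinite (F j)" if "j \<in> {1..2}" for j
  proof -
    have "j = 1 \<or> j = 2" using that by auto
    then show ?thesis using c(6,7) inf by blast
  qed
  then show ?thesis using that[OF F(1) c(1,3) _ c(2) F(2)] by blast
qed

lemma walsh_map_formulas:
  assumes F: "bij_betw F {1..2::nat} (components E)" and lab: "labeled_case1 F \<or> labeled_case2 F"
    and walsh: "is_walsh_map 2 F a m \<Phi>"
  shows "labeled_case1 F \<Longrightarrow> 0 < (-1) ^ degree R / (2 * b) * (p0 + signed_sqrt p0) \<and>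
      a 2 = of_real (root (2 * degree R) ((-1) ^ degree R / (2 * b) * (p0 + signed_sqrt p0))) \<and> a 2 \<in> \<real> \<and> 0 < Re (a 2)"
    and "labeled_case2 F \<Longrightarrow> 0 < 1 / (2 * b) * (p0 + signed_sqrt p0) \<and>
      a 2 = \<i> * of_real (root (2 * degree R) (1 / (2 * b) * (p0 + signed_sqrt p0)))"
    and "a 1 = - a 2"
    and "lemniscatic_set 2 a m (log_capacity E) = {w. sqrt (cmod (w\<^sup>2 - (a 2)\<^sup>2)) \<le> log_capacity E}"
    and "walsh_root_formula E (2 * degree R) (\<lambda>z. poly R (z\<^sup>2)) b ((a 2)\<^sup>2) \<Phi>"
proof -
  interpret w: symmetric_walsh_map K f \<rho> \<gamma> \<sigma> axis F a m \<Phi>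
    by unfold_locales (rule log_capacity_E F walsh lab)+
  have pos: "0 < norm \<alpha> ^ degree R" using norm_\<alpha>_pos by simp
  note dir = labeling_direction(1,2)[OF F lab]
  show "0 < (-1) ^ degree R / (2 * b) * (p0 + signed_sqrt p0) \<and>
      a 2 = of_real (root (2 * degree R) ((-1) ^ degree R / (2 * b) * (p0 + signed_sqrt p0))) \<and> a 2 \<in> \<real> \<and> 0 < Re (a 2)"
    if "labeled_case1 F"
  proof -
    have \<sigma>: "\<sigma> = 1" using that dir by simp
    then have "axis = 1" using \<epsilon> by auto
    then have "a 2 = of_real (sqrt (norm \<alpha>))" using w.center_eq by simp
    moreover have "norm \<alpha> ^ degree R = (-1) ^ degree R / (2 * b) * (p0 + signed_sqrt p0)"
      using norm_\<alpha>_power unfolding \<sigma> .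
    ultimately show ?thesis using pos root_norm_\<alpha>_power norm_\<alpha>_pos by (metis Re_complex_of_real Reals_of_real real_sqrt_gt_zero)
  qed
  show "0 < 1 / (2 * b) * (p0 + signed_sqrt p0) \<and>
      a 2 = \<i> * of_real (root (2 * degree R) (1 / (2 * b) * (p0 + signed_sqrt p0)))"
    if "labeled_case2 F"
  proof -
    have \<sigma>: "\<sigma> = -1" using that dir by simp
    then have "axis = \<i>" using \<epsilon> by auto
    then have "a 2 = \<i> * of_real (sqrt (norm \<alpha>))" using w.center_eq by simp
    moreover have "norm \<alpha> ^ degree R = 1 / (2 * b) * (p0 + signed_sqrt p0)"
      using norm_\<alpha>_power unfolding \<sigma> by simp
    ultimately show ?thesis using pos root_norm_\<alpha>_power by metis
  qed
  show "a 1 = - a 2" by (rule w.centers(1))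
  show "lemniscatic_set 2 a m (log_capacity E) = {w. sqrt (cmod (w\<^sup>2 - (a 2)\<^sup>2)) \<le> log_capacity E}"
    using w.L_eq_preimage unfolding w.L_def log_capacity_E w.centers(2)
    by (auto simp: dist_norm norm_minus_commute)
  define Q where "Q = (\<lambda>z. poly R (z\<^sup>2) / (2 * complex_of_real b))"
  \<comment> \<open>Dividing by 2 b turns the root of R^2 - 1 into the root of Q^2 - 1 / (4
    b^2).\<close>
  define S where "S = (\<lambda>z. joukowski_sqrt (poly R (z\<^sup>2)) / (2 * complex_of_real b))"
  have b0: "complex_of_real b \<noteq> 0" using b_nonzero by simp
  have notin: "poly R (z\<^sup>2) \<notin> unit_segment" if "z \<in> - E" for z using that by (simp add: E_def K_iff)
  have holS: "S holomorphic_on - E"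
    unfolding S_def by (intro holomorphic_intros holomorphic_on_compose[unfolded o_def]) (use notin b0 in auto)
  have sq: "(S z)\<^sup>2 = (Q z)\<^sup>2 - 1 / (4 * (complex_of_real b)\<^sup>2)" if "z \<in> - E" for z
    unfolding S_def Q_def power_divide joukowski_sqrt_sq[OF notin[OF that]]
    by (simp add: diff_divide_distrib power_mult_distrib)
  have lim: "((\<lambda>z. S z / Q z) \<longlongrightarrow> 1) at_infinity"
  proof -
    have "filterlim (\<lambda>z. poly R (z\<^sup>2)) at_infinity at_infinity"
      by (rule filterlim_compose[OF filterlim_poly_at_infinity w.square_at_infinity]) (rule degree_R)
    then have "((\<lambda>z. joukowski_sqrt (poly R (z\<^sup>2)) / poly R (z\<^sup>2)) \<longlongrightarrow> 1) at_infinity"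
      by (rule filterlim_compose[OF joukowski_sqrt_asymp])
    then show ?thesis using b0 by (simp add: S_def Q_def)
  qed
  \<comment> \<open>f(z^2) is the single-valued power with exponent 2/n: its k-th power, k = n/2, is
    Q + S.\<close>
  have G: "w.G z ^ degree R = Q z + S z" if "z \<in> - E" for z
    using f_power[of "z\<^sup>2"] that by (simp add: w.G_def Q_def S_def E_def add_divide_distrib)
  have \<Phi>: "(\<Phi> z)\<^sup>2 = (a 2)\<^sup>2 + w.G z" if "z \<in> - E" for z
    using w.\<Phi>_square[OF that] by (simp add: w.G_def w.centers(2))
  have "2 * degree R div 2 = degree R" by simp
  then show "walsh_root_formula E (2 * degree R) (\<lambda>z. poly R (z\<^sup>2)) b ((a 2)\<^sup>2) \<Phi>"
    unfolding walsh_root_formula_def Let_def Q_def[symmetric]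
    using holS w.hol_G w.hol_\<Phi> sq lim G \<Phi> w.eventually_positive by (intro exI[of _ S] exI[of _ w.G]) simp
qed

end

theorem theorem3p3:
  fixes p :: "real poly" and P :: "complex poly" and n :: nat
    and E :: "complex set" and z1 :: complex
  assumes "degree p = n" and "coeff p n \<noteq> 0"
    and "P = map_poly complex_of_real p"
    and "\<forall>z. poly P (- z) = poly P z"
    and "E = {z. poly P z \<in> complex_of_real ` {-1..1}}"
    and "{z. poly (pderiv P) z = 0 \<and> poly P z \<notin> complex_of_real ` {-1..1}} = {z1}"
    and "order z1 (pderiv P) = 1"
  shows
    "(\<exists>F :: nat \<Rightarrow> complex set.
        bij_betw F {1..2} (components E) \<and>
        E = F 1 \<union> F 2 \<and> F 1 \<inter> F 2 = {} \<and>
        (\<forall>j\<in>{1..2}. simply_connected_compact (F j) \<and> infinite (F j)) \<and>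
        F 1 = uminus ` F 2 \<and>
        (labeled_case1 F \<or> labeled_case2 F)) \<and>
     E = uminus ` E \<and> cnj ` E = E \<and> 0 \<notin> E \<and>
     (\<forall>F :: nat \<Rightarrow> complex set.
        bij_betw F {1..2} (components E) \<and> (labeled_case1 F \<or> labeled_case2 F) \<longrightarrow>
        (\<exists>a m \<Phi>. is_walsh_map 2 F a m \<Phi>) \<and>
        (\<forall>a m \<Phi>. is_walsh_map 2 F a m \<Phi> \<longrightarrow>
           (labeled_case1 F \<longrightarrow>
              0 < (-1) ^ (n div 2) / (2 * coeff p n) * (coeff p 0 + signed_sqrt (coeff p 0)) \<and>
              a 2 = complex_of_real (root n
                ((-1) ^ (n div 2) / (2 * coeff p n) * (coeff p 0 + signed_sqrt (coeff p 0)))) \<and>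
              a 2 \<in> \<real> \<and> 0 < Re (a 2)) \<and>
           (labeled_case2 F \<longrightarrow>
              0 < 1 / (2 * coeff p n) * (coeff p 0 + signed_sqrt (coeff p 0)) \<and>
              a 2 = \<i> * complex_of_real (root n
                (1 / (2 * coeff p n) * (coeff p 0 + signed_sqrt (coeff p 0))))) \<and>
           a 1 = - a 2 \<and>
           lemniscatic_set 2 a m (log_capacity E)
             = {w. sqrt (cmod (w\<^sup>2 - (a 2)\<^sup>2)) \<le> log_capacity E} \<and>
           log_capacity E = (2 * \<bar>coeff p n\<bar>) powr (- 1 / real n) \<and>
           walsh_root_formula E n (poly P) (coeff p n) ((a 2)\<^sup>2) \<Phi>))"
proof -
  have P_even: "\<And>z. poly P (- z) = poly P z" using assms(4) by blast
  obtain R where PR: "P = pcompose R [:0, 0, 1:]" using even_polynomial_decomposition[OF P_even] .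
  have Pz: "poly P z = poly R (z\<^sup>2)" for z by (simp add: PR poly_pcompose power2_eq_square)
  note crit = critical_points_of_square_composition[OF assms(6)[unfolded PR] assms(7)[unfolded PR]]
  have "degree P = n" using assms(1,3) by (simp add: degree_map_poly)
  then have n: "n = 2 * degree R" unfolding PR degree_pcompose by simp
  have lead: "lead_coeff R = of_real (coeff p n)"
  proof -
    have "lead_coeff R = lead_coeff P" unfolding PR by (subst lead_coeff_comp) simp_all
    also have "\<dots> = of_real (coeff p n)" using \<open>degree P = n\<close> by (simp add: assms(3) coeff_map_poly)
    finally show ?thesis .
  qed
  have R0: "poly R 0 = of_real (coeff p 0)"
    using Pz[of 0] by (simp add: assms(3) poly_0_coeff_0 coeff_map_poly)
  \<comment> \<open>R(u) is P at a square root of u, so the symmetry of R follows from the real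
    coefficients of P.\<close>
  have R_cnj: "poly R (cnj u) = cnj (poly R u)" for u
  proof -
    have "coeff P i \<in> \<real>" for i by (simp add: assms(3) coeff_map_poly)
    then have "cnj (poly P (csqrt u)) = poly P (cnj (csqrt u))" by (rule poly_cnj_real)
    then show ?thesis unfolding Pz by (simp flip: complex_cnj_power)
  qed
  define K where "K = {u. poly R u \<in> unit_segment}"
  have crit': "poly (pderiv R) u \<noteq> 0" if "u \<notin> {u. poly R u \<in> unit_segment}" for u
    using crit(3) that by simp
  obtain f \<gamma> where f: "f holomorphic_on - K" "inj_on f (- K)"
    "f ` (- K) = {w. (2 * norm (lead_coeff R)) powr (- 1 / real (degree R)) < norm w}"
    "\<And>u. u \<notin> K \<Longrightarrow> f u ^ degree R = (poly R u + joukowski_sqrt (poly R u)) / (2 * lead_coeff R)"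
    "((\<lambda>u. f u - u) \<longlongrightarrow> \<gamma>) at_infinity"
    unfolding K_def by (rule polynomial_preimage_exterior_map[OF crit(1) crit']) blast+
  define \<rho> where "\<rho> = (2 * \<bar>coeff p n\<bar>) powr (- 1 / real (degree R))"
  interpret polynomial_walsh_setting K f \<rho> \<gamma> R "coeff p n" "coeff p 0"
  proof
    show "compact K" unfolding K_def
      by (intro polynomial_preimage_compact crit(1) compact_continuous_image continuous_intros) auto
    show "0 < \<rho>" using assms(2) by (simp add: \<rho>_def)
    show "f ` (- K) = {w. \<rho> < norm w}" using f(3) unfolding \<rho>_def lead by simp
    show "f u ^ degree R = (poly R u + joukowski_sqrt (poly R u)) / (2 * of_real (coeff p n))" if "u \<notin> K" for u
      using f(4)[OF that] unfolding lead .
    show "0 \<notin> K" using crit(2) by (simp add: K_def)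
  qed (fact f crit(1) lead R0 R_cnj K_def \<rho>_def)+
  have EE: "E = walsh_setting.E K" unfolding assms(5) E_def by (simp add: K_def Pz)
  obtain F0 where F0: "bij_betw F0 {1..2::nat} (components E)" "E = F0 1 \<union> F0 2" "F0 1 \<inter> F0 2 = {}"
    "\<And>j. j \<in> {1..2} \<Longrightarrow> simply_connected_compact (F0 j) \<and> infinite (F0 j)" "F0 1 = uminus ` F0 2"
    "labeled_case1 F0 \<or> labeled_case2 F0"
    using labeling unfolding EE by blast
  have sym: "E = uminus ` E" "cnj ` E = E"
  proof -
    show "E = uminus ` E"
    proof (intro equalityI subsetI)
      fix z assume "z \<in> E"
      then have "- z \<in> E" unfolding EE by (rule E_uminus)
      then show "z \<in> uminus ` E" by (intro image_eqI[of _ _ "- z"]) auto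
    qed (use E_uminus EE in auto)
    show "cnj ` E = E"
    proof (intro equalityI subsetI)
      fix z assume "z \<in> E"
      then have "cnj z \<in> E" unfolding EE by (rule E_cnj)
      then show "z \<in> cnj ` E" by (intro image_eqI[of _ _ "cnj z"]) auto
    qed (use E_cnj EE in auto)
  qed
  have zero: "0 \<notin> E" using zero_notin by (simp add: EE E_def)
  have cap: "log_capacity E = (2 * \<bar>coeff p n\<bar>) powr (- 1 / real n)"
    unfolding EE log_capacity_E sqrt_\<rho> n ..
  have ex: "\<exists>a m \<Phi>. is_walsh_map 2 F a m \<Phi>" if "bij_betw F {1..2::nat} (components E)" for F
    using walsh_map_exists[OF log_capacity_E] that unfolding EE by blast
  have nd: "n div 2 = degree R" by (simp add: n)
  have polyP: "poly P = (\<lambda>z. poly R (z\<^sup>2))" by (rule ext) (rule Pz)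
  show ?thesis
  proof (intro conjI allI impI)
    show "\<exists>F. bij_betw F {1..2::nat} (components E) \<and> E = F 1 \<union> F 2 \<and> F 1 \<inter> F 2 = {} \<and>
        (\<forall>j\<in>{1..2}. simply_connected_compact (F j) \<and> infinite (F j)) \<and>
        F 1 = uminus ` F 2 \<and> (labeled_case1 F \<or> labeled_case2 F)"
      using F0 by (intro exI[of _ F0]) blast
  next
    fix F :: "nat \<Rightarrow> complex set"
    assume "bij_betw F {1..2} (components E) \<and> (labeled_case1 F \<or> labeled_case2 F)"
    then show "\<exists>a m \<Phi>. is_walsh_map 2 F a m \<Phi>" using ex by blast
  next
    fix F :: "nat \<Rightarrow> complex set" and a m \<Phi>
    assume F: "bij_betw F {1..2} (components E) \<and> (labeled_case1 F \<or> labeled_case2 F)" "is_walsh_map 2 F a m \<Phi>"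
    note W = walsh_map_formulas[OF conjunct1[OF F(1)[unfolded EE]] conjunct2[OF F(1)] F(2), folded EE]
    show "a 1 = - a 2" by (rule W(3))
    show "lemniscatic_set 2 a m (log_capacity E) = {w. sqrt (cmod (w\<^sup>2 - (a 2)\<^sup>2)) \<le> log_capacity E}"
      by (rule W(4))
    show "walsh_root_formula E n (poly P) (coeff p n) ((a 2)\<^sup>2) \<Phi>"
      using W(5) unfolding n[symmetric] polyP .
    { assume "labeled_case1 F"
      note W1 = W(1)[OF this, folded n nd]
      show "0 < (-1) ^ (n div 2) / (2 * coeff p n) * (coeff p 0 + signed_sqrt (coeff p 0))" "a 2 \<in> \<real>" "0 < Re (a 2)"
        "a 2 = complex_of_real (root n ((-1) ^ (n div 2) / (2 * coeff p n) * (coeff p 0 + signed_sqrt (coeff p 0))))"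
        using W1 by blast+ }
    { assume "labeled_case2 F"
      note W2 = W(2)[OF this, folded n]
      show "0 < 1 / (2 * coeff p n) * (coeff p 0 + signed_sqrt (coeff p 0))"
        "a 2 = \<i> * complex_of_real (root n (1 / (2 * coeff p n) * (coeff p 0 + signed_sqrt (coeff p 0))))"
        using W2 by blast+ }
  qed (rule sym zero cap)+
qed

end
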